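(* Let $d\ge 3$ and let $V:\mathbb Z^d\to\mathbb R$ be a real potential with $V\in\ell^p(\mathbb Z^d)$, where $1\le p<\frac65$ if $d=3$ and $1\le p<\frac43$ if $d\ge4$. Then $$\frac{\sigma(\mathbb T)}{2\pi}-B_0\le\frac{C_*^2}2\|V\|_p^2,$$ $$\Big|\sum_{j=1}^N\varkappa_j\Big|\le d\,C_*^2\|V\|_p^2,$$ $$\sum_{j=1}^N\varkappa_j\lambda_j\le\frac12\operatorname{Tr}V^2+\frac{d^2}{4\pi}C_*^2\|V\|_p^2,$$ where $B_0=\log B(0)=\log\big(\prod_{j=1}^N|z_j|\big)\le0$ and $\varkappa_j=|\lambda_j^2-d^2|^{1/2}\operatorname{sign}\lambda_j$.
   Context: The discrete Laplacian on $\ell^2(\mathbb Z^d)$ is $(\Delta f)(n)=\frac12\sum_{|n-m|=1}f_m$; its spectrum is $[-d,d]$. $V$ acts as multiplication, $(Vf)(n)=V_nf_n$, and $H=\Delta+V$. $\|V\|_p$ is the $\ell^p(\mathbb Z^d)$ norm. Let $\Lambda=\mathbb C\setminus[-d,d]$, $\mathbb D=\{|z|<1\}$, $\mathbb T=\mathbb R/2\pi\mathbb Z$. The map $\lambda(z)=\frac d2\left(z+\frac1z\right)$ is a conformal bijection $\mathbb D\to\Lambda$ (with $0\mapsto\infty$). With $R_0(\lambda)=(\Delta-\lambda)^{-1}$, set $\mathcal D(\lambda)=\det\big[(I+VR_0(\lambda))e^{-VR_0(\lambda)}\big]$ for $\lambda\in\Lambda$ (regularized determinant; $VR_0(\lambda)$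 is Hilbert–Schmidt), and $D(z)=\mathcal D(\lambda(z))$, $z\in\mathbb D$, with $D(0)=1$. $D$ is bounded and analytic in $\mathbb D$ and extends continuously to $\overline{\mathbb D}$. Let $\{z_j\}_{j=1}^N$, $N\le\infty$, be its zeros in $\mathbb D$ counted with multiplicity; $\lambda_j=\lambda(z_j)$ are the eigenvalues of $H$ outside $[-d,d]$. For real $V$ all $z_j,\lambda_j$ are real. The Blaschke product is $B=1$ if $N=0$, and $B(z)=\prod_{j=1}^N\frac{|z_j|}{z_j}\frac{z_j-z}{1-\overline{z_j}z}$ if $N\ge1$. The measure $\sigma\ge0$ is the singular measure on $[-\pi,\pi]$ (viewed on $\mathbb T$) in the canonical factorization $$D(z)=B(z)\exp\Big(-\frac1{2\pi}\int_{-\pi}^\pi\frac{e^{it}+z}{e^{it}-z}d\sigma(t)\Big)\exp\Big(\frac1{2\pi}\int_{-\pi}^\pi\frac{e^{it}+z}{e^{it}-z}\log|D(e^{it})|dt\Big),\quad |z|<1,$$ with $\log|D(e^{it})|\in L^1(-\pi,\pi)$. The constant $C_*$ is $C_*=C_{p,d}+C_d^0\,\Gamma(p,d)$, where $C_{1,d}=1$, $C_{p,d}=p^{\frac{d(p-1)}{2p}}$, $\Gamma(p,d)=(3+2\kappa)^{\frac{d(p-1)}{p}}$; $C_d^0=16$ if $d=3$, $C_d^0=4$ if $d=4$, $C_d^0=\frac{14\cdot2^{d/4}}{d-4}$ if $d\ge5$; and $\kappa=\frac{6(p-1)}{6-5p}$ if $d=3$, $\kappa=\left(\frac{5p-1}{4-3p}\right)^{\frac{5p-4}{4(p-1)}}$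 if $d=4$, $\kappa=\frac{3d(p-1)}{3d-(2d+1)p}$ if $d\ge5$. (For $d=4$, $p=1$, where $\kappa$ is undefined, $\Gamma(1,4)$ is understood as the limit of $\Gamma(p,4)$ as $p\to1^+$.) *)

theory Defs
  imports
    "HOL-Complex_Analysis.Complex_Analysis"
    "HOL-Probability.Probability"
    "HOL-Combinatorics.Permutations"
begin

text \<open>
  The lattice \<open>\<int>\<^sup>d\<close> is the type \<open>int ^ 'n\<close> with \<open>d = CARD('n)\<close>. Operators on \<open>\<ell>\<^sup>2(\<int>\<^sup>d)\<close> are
  plain maps on functions \<open>int ^ 'n \<Rightarrow> complex\<close>; only their values on \<open>l2\<close> are relevant.
\<close>

type_synonym 'n seq = "int ^ 'n \<Rightarrow> complex"

definition l2 :: "('n::finite) seq set" where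
  "l2 = {f. (\<lambda>n. (cmod (f n))\<^sup>2) summable_on UNIV}"

definition lp :: "real \<Rightarrow> (int ^ ('n::finite) \<Rightarrow> real) set" where
  "lp p = {V. (\<lambda>n. \<bar>V n\<bar> powr p) summable_on UNIV}"

definition lp_norm :: "real \<Rightarrow> (int ^ ('n::finite) \<Rightarrow> real) \<Rightarrow> real" where
  "lp_norm p V = (\<Sum>\<^sub>\<infinity>n. \<bar>V n\<bar> powr p) powr (1 / p)"

definition unit_seq :: "int ^ ('n::finite) \<Rightarrow> 'n seq" where
  "unit_seq m = (\<lambda>n. if n = m then 1 else 0)"

definition neighbours :: "int ^ ('n::finite) \<Rightarrow> (int ^ 'n) set" where
  "neighbours n = {m. norm (\<chi> i. real_of_int (n $ i - m $ i)) = 1}"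

definition laplacian :: "('n::finite) seq \<Rightarrow> 'n seq" where
  "laplacian f = (\<lambda>n. (1 / 2) * (\<Sum>m\<in>neighbours n. f m))"

definition mult_op :: "(int ^ ('n::finite) \<Rightarrow> real) \<Rightarrow> 'n seq \<Rightarrow> 'n seq" where
  "mult_op V f = (\<lambda>n. complex_of_real (V n) * f n)"

text \<open>The free resolvent \<open>(\<Delta> - \<lambda>)\<^sup>-\<^sup>1\<close> on \<open>\<ell>\<^sup>2\<close>, for \<open>\<lambda>\<close> off the spectrum \<open>[-d, d]\<close>.\<close>

definition free_resolvent :: "complex \<Rightarrow> ('n::finite) seq \<Rightarrow> 'n seq" where
  "free_resolvent lam f = (THE g. g \<in> l2 \<and> (\<lambda>n. laplacian g n - lam * g n) = f)"

text \<open>For a bounded operator \<open>T\<close> the exponential series converges in operator norm, hence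
  pointwise on the lattice when applied to an element of \<open>\<ell>\<^sup>2\<close>.\<close>

definition op_exp :: "(('n::finite) seq \<Rightarrow> 'n seq) \<Rightarrow> 'n seq \<Rightarrow> 'n seq" where
  "op_exp T f = (\<lambda>n. \<Sum>k. (T ^^ k) f n / fact k)"

definition op_trace :: "(('n::finite) seq \<Rightarrow> 'n seq) \<Rightarrow> complex" where
  "op_trace T = (\<Sum>\<^sub>\<infinity>n. T (unit_seq n) n)"

text \<open>The determinant of the matrix \<open>\<langle>\<delta>\<^sub>i, T \<delta>\<^sub>j\<rangle>\<close>, \<open>i, j \<in> S\<close>.\<close>

definition principal_minor :: "(('n::finite) seq \<Rightarrow> 'n seq) \<Rightarrow> (int ^ 'n) set \<Rightarrow> complex" where
  "principal_minor T S =
     (\<Sum>\<pi> | \<pi> permutes S. of_int (sign \<pi>) * (\<Prod>i\<in>S. T (unit_seq (\<pi> i)) i))"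

text \<open>The Fredholm determinant \<open>det (I + T) = \<Sum>\<^sub>k Tr (\<Lambda>\<^sup>k T)\<close> of a trace class operator \<open>T\<close>; the
  trace of the \<open>k\<close>-th exterior power is evaluated in the orthonormal basis of wedge products of
  the \<open>\<delta>\<^sub>n\<close>, which is indexed by the \<open>k\<close>-element sets of lattice points.\<close>

definition fredholm_det_I_plus :: "(('n::finite) seq \<Rightarrow> 'n seq) \<Rightarrow> complex" where
  "fredholm_det_I_plus T =
     (\<Sum>k. \<Sum>\<^sub>\<infinity>S\<in>{S. finite S \<and> card S = k}. principal_minor T S)"

text \<open>\<open>det [(I + A) e\<^sup>-\<^sup>A]\<close> for a Hilbert-Schmidt operator \<open>A\<close>; the operator \<open>(I + A) e\<^sup>-\<^sup>A - I\<close> is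
  trace class.\<close>

definition regularized_det :: "(('n::finite) seq \<Rightarrow> 'n seq) \<Rightarrow> complex" where
  "regularized_det A = fredholm_det_I_plus
     (\<lambda>f n. let g = op_exp (\<lambda>h m. - A h m) f in g n + A g n - f n)"

definition joukowski :: "nat \<Rightarrow> complex \<Rightarrow> complex" where
  "joukowski d z = of_nat d / 2 * (z + 1 / z)"

definition pert_det :: "(int ^ ('n::finite) \<Rightarrow> real) \<Rightarrow> complex \<Rightarrow> complex" where
  "pert_det V z =
     (if z = 0 then 1
      else regularized_det (mult_op V \<circ> free_resolvent (joukowski CARD('n) z)))"

text \<open>\<open>z 0, z 1, \<dots>\<close> (indices \<open>j < N\<close>, \<open>N \<le> \<infinity>\<close>) lists the zeros of \<open>D\<close> in the open unit disc, each
  one as often as its multiplicity.\<close>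

definition enumerates_disc_zeros :: "(complex \<Rightarrow> complex) \<Rightarrow> enat \<Rightarrow> (nat \<Rightarrow> complex) \<Rightarrow> bool" where
  "enumerates_disc_zeros D N z \<longleftrightarrow>
     (\<forall>j. enat j < N \<longrightarrow> cmod (z j) < 1 \<and> D (z j) = 0) \<and>
     (\<forall>w. cmod w < 1 \<and> D w = 0 \<longrightarrow>
        finite {j. enat j < N \<and> z j = w} \<and>
        int (card {j. enat j < N \<and> z j = w}) = zorder D w)"

definition blaschke :: "enat \<Rightarrow> (nat \<Rightarrow> complex) \<Rightarrow> complex \<Rightarrow> complex" where
  "blaschke N z w =
     prodinf (\<lambda>j. if enat j < N
                  then of_real (cmod (z j)) / z j * ((z j - w) / (1 - cnj (z j) * w)) else 1)"

text \<open>The value at a point of the closed disc of the continuous extension of \<open>D\<close> from the open disc.\<close>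

definition boundary_value :: "(complex \<Rightarrow> complex) \<Rightarrow> complex \<Rightarrow> complex" where
  "boundary_value D w = Lim (at w within ball 0 1) D"

text \<open>\<open>\<sigma>\<close> is the singular measure in the canonical factorization of \<open>D\<close>. It lives on the closed
  interval \<open>[-\<pi>, \<pi>]\<close>; identifying the end points does not affect the total mass \<open>\<sigma>(\<T>)\<close>.\<close>

definition canonical_singular_measure ::
  "(complex \<Rightarrow> complex) \<Rightarrow> enat \<Rightarrow> (nat \<Rightarrow> complex) \<Rightarrow> real measure \<Rightarrow> bool" where
  "canonical_singular_measure D N z \<sigma> \<longleftrightarrow>
     finite_measure \<sigma> \<and>
     sets \<sigma> = sets (restrict_space borel {-pi..pi}) \<and>
     (\<exists>S\<in>null_sets lborel. emeasure \<sigma> ({-pi..pi} - S) = 0) \<and>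
     set_integrable lborel {-pi..pi} (\<lambda>t. ln (cmod (boundary_value D (cis t)))) \<and>
     (\<forall>w. cmod w < 1 \<longrightarrow>
        D w = blaschke N z w
          * exp (- (1 / (2 * of_real pi)) * (LINT t|\<sigma>. (cis t + w) / (cis t - w)))
          * exp (1 / (2 * of_real pi) *
              (LBINT t:{-pi..pi}. (cis t + w) / (cis t - w)
                  * of_real (ln (cmod (boundary_value D (cis t)))))))"

text \<open>For real potentials the zeros \<open>z\<^sub>j\<close>, and hence the \<open>\<lambda>\<^sub>j = \<lambda>(z\<^sub>j)\<close>, are real.\<close>

definition eigenvalue_of_zero :: "nat \<Rightarrow> complex \<Rightarrow> real" where
  "eigenvalue_of_zero d w = Re (joukowski d w)"

definition varkappa :: "nat \<Rightarrow> real \<Rightarrow> real" where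
  "varkappa d lam = sqrt \<bar>lam\<^sup>2 - (real d)\<^sup>2\<bar> * sgn lam"

definition kappa_const :: "real \<Rightarrow> nat \<Rightarrow> real" where
  "kappa_const p d =
     (if d = 3 then 6 * (p - 1) / (6 - 5 * p)
      else if d = 4 then ((5 * p - 1) / (4 - 3 * p)) powr ((5 * p - 4) / (4 * (p - 1)))
      else 3 * real d * (p - 1) / (3 * real d - (2 * real d + 1) * p))"

definition Gamma_const :: "real \<Rightarrow> nat \<Rightarrow> real" where
  "Gamma_const p d =
     (let G = (\<lambda>q. (3 + 2 * kappa_const q d) powr (real d * (q - 1) / q))
      in if d = 4 \<and> p = 1 then Lim (at_right 1) G else G p)"

definition C_const :: "real \<Rightarrow> nat \<Rightarrow> real" where
  "C_const p d = (if p = 1 then 1 else p powr (real d * (p - 1) / (2 * p)))"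

definition C0_const :: "nat \<Rightarrow> real" where
  "C0_const d =
     (if d = 3 then 16 else if d = 4 then 4 else 14 * 2 powr (real d / 4) / (real d - 4))"

definition C_star :: "real \<Rightarrow> nat \<Rightarrow> real" where
  "C_star p d = C_const p d + C0_const d * Gamma_const p d"

end

theory Submission
  imports
    Defs
    "HOL-Real_Asymp.Real_Asymp"
    "Jordan_Normal_Form.Schur_Decomposition"
begin

text \<open>
  Let \<open>G\<^sub>\<lambda>\<close> be the Green's function of \<open>\<Delta>\<close>. If \<open>V\<close> is cut off to a finite set \<open>K\<close>, then \<open>D\<close> becomes the
  finite determinant of \<open>\<delta>\<^sub>i\<^sub>j + V i G\<^sub>\<lambda> (i - j)\<close>, \<open>i, j \<in> K\<close>, times \<open>exp (- \<Sum>\<^sub>i V i G\<^sub>\<lambda> 0)\<close>, and \<open>D\<close> is the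
  uniform limit of these truncations; its zeros are real by Hurwitz, since those of the truncations
  come from eigenvalues of a self-adjoint operator. In the upper half plane \<open>G\<^sub>\<lambda> n\<close> is, up to a
  phase, the integral of \<open>exp (\<i> \<lambda> t)\<close> times a product of Bessel functions \<open>J\<^bsub>n\<^sub>i\<^esub> t\<close>. The bounds
  \<open>\<bar>J\<^sub>n t\<bar> \<le> 3 t\<^bsup>-1/3\<^esup>\<close> and \<open>(J\<^sub>n t)\<^sup>2 \<le> 1/t\<close> for \<open>t \<ge> 2 \<bar>n\<bar>\<close> make \<open>G\<^sub>\<lambda>\<close> Hoelder continuous in \<open>\<lambda>\<close>, and
  together with \<open>\<Sum>\<^sub>n \<bar>G\<^sub>\<lambda> n\<bar>\<^sup>2 \<le> 3 / Im \<lambda>\<close> they bound \<open>\<Sum>\<^sub>n \<bar>G\<^sub>\<lambda> n\<bar>\<^bsup>r\<^esup>\<close> uniformly up to the spectrum, with \<open>r = 6\<close> for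
  \<open>d = 3\<close> and \<open>r = 4\<close> for \<open>d \<ge> 4\<close>. Young's inequality turns this into a Hilbert-Schmidt bound for
  \<open>\<bar>V\<bar>\<^bsup>1/2\<^esup> G \<bar>V\<bar>\<^bsup>1/2\<^esup>\<close> and hence into \<open>\<bar>D\<bar> \<le> exp M\<close> with \<open>M = (C\<^sub>*\<^sup>2 / 2\<pi> - 1 / d\<^sup>2) \<parallel>V\<parallel>\<^sub>p\<^sup>2 / 2\<close>.

  Write \<open>\<Lambda> \<phi>\<close> for the integral of \<open>\<phi>\<close> against \<open>log \<bar>D\<bar> dt - d\<sigma>\<close>, so that \<open>\<Lambda> \<phi> \<le> M \<integral>\<phi> dt\<close> for \<open>\<phi> \<ge> 0\<close>.
  The canonical factorization at \<open>0\<close> says \<open>\<Lambda> 1 = - 2\<pi> B\<^sub>0\<close>. As \<open>w = \<plusminus>s \<rightarrow> 0\<close>, the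
  bound \<open>log \<bar>D w\<bar> \<le> O(\<bar>w\<bar>\<^sup>2)\<close> gives \<open>\<Sum> (1 / x\<^sub>j - x\<^sub>j) = \<Lambda> cos / \<pi>\<close> for the zeros \<open>x\<^sub>j\<close>. As \<open>w = \<plusminus>\<i>s \<rightarrow> 0\<close>,
  the bound \<open>log \<bar>D w\<bar> \<le> (2 \<Sum>V\<^sup>2 / d\<^sup>2) \<bar>w\<bar>\<^sup>2 (1 + o(1))\<close> gives
  \<open>\<Sum> (1 / x\<^sub>j\<^sup>2 - x\<^sub>j\<^sup>2) \<le> 4 \<Sum>V\<^sup>2 / d\<^sup>2 + 2 \<Lambda> (cos 2t) / \<pi>\<close>. Testing \<open>\<Lambda>\<close> on the nonnegative functions
  \<open>1\<close>, \<open>1 \<plusminus> cos t\<close> and \<open>1 + cos 2t\<close> yields the three inequalities.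
\<close>

section \<open>Bessel functions\<close>

text \<open>The last inequality fixes the numerology. The argument at the origin of the disc yields
  Q + d^2 M with Q = Tr V^2, although only half of Q is allowed on the right. Since Q is at most the
  squared l^p norm, the other half can be charged to M: this is the term - 1 / d^2 in M, and its 2
  pi comes from the 4 pi of that inequality. Green's function therefore has to be bounded with
  explicit constants that beat \<open>C_star\<close> by more than sqrt (2 pi); hence the concrete 3
  for Bessel products and the concrete power sums, all obtained by elementary real analysis uniform
  in the order of the Bessel function. Near the origin only upper bounds for log |D| are available.
  Approaching from both sides turns the first-order bound into an equality; at second order a single
  inequality is obtained, with the sign that is claimed. Two obstacles come from the encoding:
  \<open>boundary_value\<close> is a \<open>Lim\<close> and \<open>prodinf\<close> a definite
  description. Existence of radial limits away from 1 and -1, and the Blaschke condition for the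
  zeros, have to be derived before either can be used.\<close>

definition bessel :: "int \<Rightarrow> real \<Rightarrow> real" where
  "bessel n t = integral {0..pi} (\<lambda>x. cos (of_int n * x - t * sin x)) / pi"

lemma bessel_integrable: "(\<lambda>x::real. cos (of_int n * x - t * sin x)) integrable_on {a..b}"
  by (intro integrable_continuous_real continuous_intros)

lemma bessel_has_field_derivative:
  "(bessel n has_real_derivative (bessel (n - 1) t - bessel (n + 1) t) / 2) (at t)"
proof -
  let ?f = "\<lambda>t x. cos (of_int n * x - t * sin x)"
  let ?f' = "\<lambda>t x. sin x * sin (of_int n * x - t * sin x)"
  have "((\<lambda>t. integral (cbox 0 pi) (?f t)) has_real_derivative integral (cbox 0 pi) (?f' t)) (at t within UNIV)"
  proof (rule leibniz_rule_field_derivative)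
    show "continuous_on (UNIV \<times> cbox 0 pi) (\<lambda>(t, x). ?f' t x)"
      by (auto intro!: continuous_intros simp: case_prod_unfold)
  qed (auto intro!: derivative_eq_intros bessel_integrable)
  moreover have "integral {0..pi} (?f' t) = pi * (bessel (n - 1) t - bessel (n + 1) t) / 2"
  proof -
    have "((\<lambda>x. (1 / 2) * (cos (of_int (n - 1) * x - t * sin x) - cos (of_int (n + 1) * x - t * sin x))) has_integral
       (1 / 2) * (pi * bessel (n - 1) t - pi * bessel (n + 1) t)) {0..pi}"
      unfolding bessel_def
      by (intro has_integral_mult_right has_integral_diff)
         (use bessel_integrable in \<open>auto intro!: integrable_integral simp del: of_int_add of_int_diff\<close>)
    moreover have "(1 / 2) * (cos (of_int (n - 1) * x - t * sin x) - cos (of_int (n + 1) * x - t * sin x)) = ?f' t x" for x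
      using cos_diff[of "of_int n * x - t * sin x" x] cos_add[of "of_int n * x - t * sin x" x]
      by (simp add: algebra_simps)
    ultimately have "(?f' t has_integral (1 / 2) * (pi * bessel (n - 1) t - pi * bessel (n + 1) t)) {0..pi}"
      by (simp only:)
    then show ?thesis by (simp add: integral_unique algebra_simps)
  qed
  ultimately have "((\<lambda>t. integral {0..pi} (?f t)) has_real_derivative pi * (bessel (n - 1) t - bessel (n + 1) t) / 2) (at t)"
    by simp
  from DERIV_cdivide[OF this, of pi] show ?thesis
    by (simp add: bessel_def[abs_def])
qed

lemmas bessel_deriv [derivative_intros] = DERIV_chain2[OF bessel_has_field_derivative]

lemma continuous_on_bessel: "continuous_on A (bessel n)"
  by (meson DERIV_continuous_on bessel_has_field_derivative has_field_derivative_at_within)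

lemma continuous_on_bessel' [continuous_intros]:
  "continuous_on A f \<Longrightarrow> continuous_on A (\<lambda>x. bessel n (f x))"
  using continuous_on_compose2[OF continuous_on_bessel[of UNIV n]] by blast

text \<open>The derivative of sin (n x - t sin x) integrates to 0 over [0, pi], since both end
  values are sines of integer multiples of pi; expanding that derivative gives the three-term
  relation.\<close>

lemma bessel_recurrence: "t * (bessel (n - 1) t + bessel (n + 1) t) = 2 * of_int n * bessel n t"
proof -
  let ?c = "\<lambda>n x. cos (of_int n * x - t * sin x)"
  have "((\<lambda>x. (of_int n - t * cos x) * ?c n x) has_integral
      (sin (of_int n * pi - t * sin pi) - sin (of_int n * 0 - t * sin 0))) {0..pi}"
    by (intro fundamental_theorem_of_calculus)
       (auto intro!: derivative_eq_intros simp: has_real_derivative_iff_has_vector_derivative[symmetric] algebra_simps)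
  then have "((\<lambda>x. (of_int n - t * cos x) * ?c n x) has_integral 0) {0..pi}"
    by (simp add: sin_integer_2pi sin_npi_int mult.commute)
  moreover have "(of_int n - t * cos x) * ?c n x = of_int n * ?c n x - t / 2 * (?c (n - 1) x + ?c (n + 1) x)" for x
  proof -
    have "?c (n - 1) x + ?c (n + 1) x = 2 * (cos x * ?c n x)"
      using cos_diff[of "of_int n * x - t * sin x" x] cos_add[of "of_int n * x - t * sin x" x]
      by (simp add: algebra_simps)
    then show ?thesis by (simp only:) (simp add: algebra_simps)
  qed
  ultimately have "((\<lambda>x. of_int n * ?c n x - t / 2 * (?c (n - 1) x + ?c (n + 1) x)) has_integral 0) {0..pi}"
    by (simp only:)
  moreover have "((\<lambda>x. of_int n * ?c n x - t / 2 * (?c (n - 1) x + ?c (n + 1) x)) has_integral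
     (of_int n * integral {0..pi} (?c n) - t / 2 * (integral {0..pi} (?c (n - 1)) + integral {0..pi} (?c (n + 1))))) {0..pi}"
    by (intro has_integral_diff has_integral_mult_right has_integral_add integrable_integral bessel_integrable)
  ultimately have "of_int n * integral {0..pi} (?c n) - t / 2 * (integral {0..pi} (?c (n - 1)) + integral {0..pi} (?c (n + 1))) = 0"
    using has_integral_unique by blast
  then show ?thesis by (simp add: bessel_def field_simps)
qed

lemma abs_bessel_le_1: "\<bar>bessel n t\<bar> \<le> 1"
proof -
  have "norm (integral {0..pi} (\<lambda>x. cos (of_int n * x - t * sin x))) \<le> 1 * (pi - 0)"
    by (rule integral_bound) (auto intro!: continuous_intros)
  then show ?thesis by (simp add: bessel_def)
qed

lemma bessel_at_0: "bessel n 0 = (if n = 0 then 1 else 0)"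
proof (cases "n = 0")
  case False
  with bessel_recurrence[of 0 n] show ?thesis by simp
qed (simp add: bessel_def)

lemma bessel_minus: "bessel (- n) t = (if even n then 1 else - 1) * bessel n t"
proof -
  have c: "cos (of_int n * (pi - x) - t * sin (pi - x)) = (if even n then 1 else - 1) * cos (of_int (- n) * x - t * sin x)" for x
  proof -
    have "cos (of_int n * (pi - x) - t * sin (pi - x)) = cos (of_int n * pi + (of_int (- n) * x - t * sin x))"
      by (simp add: algebra_simps)
    also have "\<dots> = (if even n then 1 else - 1) * cos (of_int (- n) * x - t * sin x)"
      by (simp add: cos_add sin_npi_int cos_npi_int mult.commute)
    finally show ?thesis .
  qed
  have "((\<lambda>x. cos (of_int n * x - t * sin x)) has_integral integral {0..pi} (\<lambda>x. cos (of_int n * x - t * sin x))) {0..pi}"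
    by (intro integrable_integral bessel_integrable)
  from has_integral_affinity[OF this[unfolded cbox_interval[symmetric]], of "-1" pi]
  have "((\<lambda>x. cos (of_int n * (pi - x) - t * sin (pi - x))) has_integral integral {0..pi} (\<lambda>x. cos (of_int n * x - t * sin x))) {0..pi}"
    by (simp add: image_affinity_atLeastAtMost)
  then have "integral {0..pi} (\<lambda>x. cos (of_int n * x - t * sin x)) = (if even n then 1 else - 1) * integral {0..pi} (\<lambda>x. cos (of_int (- n) * x - t * sin x))"
    unfolding c by (metis integral_mult_right integral_unique)
  then show ?thesis by (simp add: bessel_def)
qed

lemma abs_bessel_nat_abs: "\<bar>bessel n t\<bar> = \<bar>bessel (int (nat \<bar>n\<bar>)) t\<bar>"
  using bessel_minus[of n t] by (cases "n \<ge> 0") (auto simp: abs_mult)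

text \<open>For k > 0 this is 1 minus the sum of J_m^2 over |m| < k, minus only one of the two end
  terms m = k and m = -k. Halving the end terms makes the derivative collapse to the single product
  \<open>bessel_tail_deriv\<close>; the case distinction keeps m = 0 from being counted
  twice.\<close>

primrec bessel_tail :: "nat \<Rightarrow> real \<Rightarrow> real" where
  "bessel_tail 0 t = 1 - (bessel 0 t)\<^sup>2"
| "bessel_tail (Suc k) t = bessel_tail k t - (if k = 0 then 0 else (bessel (int k) t)\<^sup>2) - (bessel (int (Suc k)) t)\<^sup>2"

definition bessel_tail_deriv :: "nat \<Rightarrow> real \<Rightarrow> real" where
  "bessel_tail_deriv k t = bessel (int k) t * (bessel (int k - 1) t + bessel (int k + 1) t)"

lemma has_field_derivative_bessel_tail:
  "k > 0 \<Longrightarrow> (bessel_tail k has_real_derivative bessel_tail_deriv k t) (at t)"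
proof (induction k)
  case (Suc k)
  show ?case
  proof (cases "k = 0")
    case True
    have "bessel (-1) t = - bessel 1 t" using bessel_minus[of 1 t] by simp
    then show ?thesis unfolding True bessel_tail.simps if_True
      by (auto intro!: derivative_eq_intros simp: bessel_tail_deriv_def field_simps)
  next
    case False
    with Suc have "(bessel_tail k has_real_derivative bessel_tail_deriv k t) (at t)" by simp
    from False this show ?thesis
      by (auto intro!: derivative_eq_intros simp: bessel_tail_deriv_def field_simps)
  qed
qed simp

lemma mult_bessel_tail_deriv: "t * bessel_tail_deriv k t = 2 * real k * (bessel (int k) t)\<^sup>2"
  using arg_cong[OF bessel_recurrence[of t "int k"], of "\<lambda>x. bessel (int k) t * x"]
  by (simp add: bessel_tail_deriv_def power2_eq_square algebra_simps)

lemma bessel_tail_deriv_nonneg: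
  assumes "t \<ge> 0" "k > 0" shows "bessel_tail_deriv k t \<ge> 0"
proof (cases "t = 0")
  case True with assms show ?thesis by (simp add: bessel_tail_deriv_def bessel_at_0)
next
  case False
  with assms have "t > 0" by simp
  moreover have "t * bessel_tail_deriv k t \<ge> 0" unfolding mult_bessel_tail_deriv by simp
  ultimately show ?thesis by (simp add: zero_le_mult_iff)
qed

lemma bessel_tail_at_0: "bessel_tail k 0 = 0"
  by (induction k) (auto simp: bessel_at_0)

text \<open>It vanishes at t = 0 and is nondecreasing, because the recurrence turns its derivative
  into 2 k J_k^2 / t. This yields the Parseval-type inequality below without Fourier series.\<close>

lemma bessel_tail_nonneg:
  assumes "t \<ge> 0" "k > 0" shows "bessel_tail k t \<ge> 0"
proof -
  have "bessel_tail k 0 \<le> bessel_tail k t"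
    by (rule DERIV_nonneg_imp_nondecreasing[OF assms(1)])
       (use has_field_derivative_bessel_tail bessel_tail_deriv_nonneg assms in blast)
  then show ?thesis by (simp add: bessel_tail_at_0)
qed

lemma bessel_tail_le_1: "bessel_tail k t \<le> 1"
proof (induction k)
  case (Suc k)
  then show ?case by simp (smt (verit) zero_le_power2)
qed simp

lemma bessel_tail_sum:
  "bessel_tail (Suc k) t = 1 - (\<Sum>m\<in>{- int k..int k}. (bessel m t)\<^sup>2) - (bessel (int (Suc k)) t)\<^sup>2"
proof (induction k)
  case (Suc k)
  have "{- int (Suc k)..int (Suc k)} = insert (- int (Suc k)) (insert (int (Suc k)) {- int k..int k})"
    by auto
  then have "(\<Sum>m\<in>{- int (Suc k)..int (Suc k)}. (bessel m t)\<^sup>2)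
    = (bessel (- int (Suc k)) t)\<^sup>2 + ((bessel (int (Suc k)) t)\<^sup>2 + (\<Sum>m\<in>{- int k..int k}. (bessel m t)\<^sup>2))"
    by (simp del: of_nat_Suc)
  moreover have "(bessel (- int (Suc k)) t)\<^sup>2 = (bessel (int (Suc k)) t)\<^sup>2"
    by (subst bessel_minus) auto
  ultimately show ?case using Suc bessel_tail.simps(2)[of "Suc k" t] by simp
qed simp

lemma sum_bessel_squares_le_1:
  assumes "t \<ge> 0" "finite F" shows "(\<Sum>m\<in>F. (bessel m t)\<^sup>2) \<le> 1"
proof -
  obtain k where k: "F \<subseteq> {- int k..int k}"
  proof -
    let ?M = "Max (insert 0 (abs ` F))"
    have "F \<subseteq> {- int (nat ?M)..int (nat ?M)}"
    proof
      fix x assume "x \<in> F"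
      then have "\<bar>x\<bar> \<le> ?M" using assms(2) by (intro Max_ge) auto
      then show "x \<in> {- int (nat ?M)..int (nat ?M)}" by auto
    qed
    then show ?thesis by (rule that)
  qed
  then have "(\<Sum>m\<in>F. (bessel m t)\<^sup>2) \<le> (\<Sum>m\<in>{- int k..int k}. (bessel m t)\<^sup>2)"
    by (intro sum_mono2) auto
  also have "\<dots> \<le> 1"
    using bessel_tail_nonneg[of t "Suc k"] assms(1) unfolding bessel_tail_sum
    by (smt (verit) zero_le_power2 zero_less_Suc)
  finally show ?thesis .
qed

section \<open>Pointwise bounds: Landau's t^(-1/3), and decay beyond the turning point by an energy
  method\<close>

lemma van_der_corput_first:
  fixes n t \<mu> a b s :: real
  assumes "0 \<le> a" "a \<le> b" "b \<le> pi" "t > 0" "\<mu> > 0" and s: "s = 1 \<or> s = -1"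
    and phase: "\<And>x. a \<le> x \<Longrightarrow> x \<le> b \<Longrightarrow> s * (n - t * cos x) \<ge> \<mu>"
  shows "\<bar>integral {a..b} (\<lambda>x. cos (n * x - t * sin x))\<bar> \<le> 2 / \<mu>"
proof -
  let ?\<phi> = "\<lambda>x. n * x - t * sin x"
  let ?d = "\<lambda>x. n - t * cos x"
  have ss: "s * s = 1" using s by auto
  have nz: "?d x \<noteq> 0" if "a \<le> x" "x \<le> b" for x using phase[OF that] assms(5) by auto
  \<comment> \<open>With phase phi, \<open>?r\<close> is phi'' / phi'^2, and (sin phi / phi')' = cos
    phi - sin phi times \<open>?r\<close>. Since phi'' = t sin x is nonnegative on [0, pi], the last
    term is dominated by \<open>?r\<close>, which is itself the derivative of - 1 / phi'.\<close>
  let ?r = "\<lambda>x. t * sin x / (?d x)\<^sup>2"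
  have c1: "continuous_on {a..b} ?r"
    using nz by (intro continuous_intros) auto
  have c2: "continuous_on {a..b} (\<lambda>x. sin (?\<phi> x) * ?r x)"
    using nz by (intro continuous_intros) auto
  have i1: "((\<lambda>x. cos (?\<phi> x) - sin (?\<phi> x) * ?r x) has_integral (sin (?\<phi> b) / ?d b - sin (?\<phi> a) / ?d a)) {a..b}"
  proof (intro fundamental_theorem_of_calculus)
    fix x assume x: "x \<in> {a..b}"
    have "((\<lambda>x. sin (?\<phi> x) / ?d x) has_real_derivative (cos (?\<phi> x) * ?d x * ?d x - sin (?\<phi> x) * (t * sin x)) / (?d x * ?d x)) (at x within {a..b})"
      by (rule DERIV_divide) (use nz x in \<open>auto intro!: derivative_eq_intros\<close>)
    moreover have "(cos (?\<phi> x) * ?d x * ?d x - sin (?\<phi> x) * (t * sin x)) / (?d x * ?d x) = cos (?\<phi> x) - sin (?\<phi> x) * ?r x"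
    proof -
      have "(u * v * v - w * y) / (v * v) = u - w * (y / v\<^sup>2)" if "v \<noteq> 0" for u v w y :: real
        using that by (simp add: field_simps power2_eq_square)
      then show ?thesis using nz x by simp
    qed
    ultimately show "((\<lambda>x. sin (?\<phi> x) / ?d x) has_vector_derivative (cos (?\<phi> x) - sin (?\<phi> x) * ?r x)) (at x within {a..b})"
      by (simp add: has_real_derivative_iff_has_vector_derivative[symmetric])
  qed (use assms in simp)
  have i2: "(?r has_integral (- (1 / ?d b) - - (1 / ?d a))) {a..b}"
    using nz assms(2)
    by (intro fundamental_theorem_of_calculus)
       (auto intro!: derivative_eq_intros simp: has_real_derivative_iff_has_vector_derivative[symmetric] field_simps power2_eq_square)
  have i3: "\<bar>integral {a..b} (\<lambda>x. sin (?\<phi> x) * ?r x)\<bar> \<le> integral {a..b} ?r"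
  proof -
    have "norm (integral {a..b} (\<lambda>x. sin (?\<phi> x) * ?r x)) \<le> integral {a..b} ?r"
    proof (rule integral_norm_bound_integral)
      fix x assume x: "x \<in> {a..b}"
      have "?r x \<ge> 0" using x assms by (intro divide_nonneg_nonneg mult_nonneg_nonneg sin_ge_zero) auto
      then show "norm (sin (?\<phi> x) * ?r x) \<le> ?r x"
        using mult_right_mono[OF abs_sin_le_one, of "?r x"] by (simp only: real_norm_def abs_mult abs_of_nonneg mult_1)
    qed (use c1 c2 in \<open>auto intro: integrable_continuous_interval\<close>)
    then show ?thesis by simp
  qed
  have "integral {a..b} (\<lambda>x. cos (?\<phi> x)) - integral {a..b} (\<lambda>x. sin (?\<phi> x) * ?r x) = sin (?\<phi> b) / ?d b - sin (?\<phi> a) / ?d a"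
    using integral_unique[OF i1]
    by (subst integral_diff[symmetric]) (use c2 in \<open>auto intro!: integrable_continuous_interval continuous_intros\<close>)
  moreover have "\<bar>sin (?\<phi> b) / ?d b\<bar> \<le> 1 / (s * ?d b)" "\<bar>sin (?\<phi> a) / ?d a\<bar> \<le> 1 / (s * ?d a)"
    using s phase[of a] phase[of b] assms(2,5) by (auto simp: abs_divide intro!: frac_le)
  moreover have "integral {a..b} ?r = 1 / ?d a - 1 / ?d b" using integral_unique[OF i2] by simp
  ultimately have *: "\<bar>integral {a..b} (\<lambda>x. cos (?\<phi> x))\<bar> \<le> 1 / (s * ?d b) + 1 / (s * ?d a) + (1 / ?d a - 1 / ?d b)"
    using i3 by linarith
  \<comment> \<open>The end-point terms combine with the telescoped integral of \<open>?r\<close>: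
    only twice the value at the end where |phi'| is smallest survives.\<close>
  have "1 / (s * ?d b) + 1 / (s * ?d a) + (1 / ?d a - 1 / ?d b) \<le> 2 / \<mu>"
    using s
  proof
    assume "s = 1"
    then have "1 / (s * ?d b) + 1 / (s * ?d a) + (1 / ?d a - 1 / ?d b) = 2 / ?d a" by simp
    also have "\<dots> \<le> 2 / \<mu>" using phase[of a] assms \<open>s = 1\<close> by (intro frac_le) auto
    finally show ?thesis .
  next
    assume "s = -1"
    then have "1 / (s * ?d b) + 1 / (s * ?d a) + (1 / ?d a - 1 / ?d b) = 2 / (s * ?d b)"
      by (simp only: mult_minus1 divide_minus_right)
    also have "\<dots> \<le> 2 / \<mu>" using phase[of b] assms by (intro frac_le) auto
    finally show ?thesis .
  qed
  with * show ?thesis by linarith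
qed

text \<open>For y = (b - a) / 2, u - v = cos a - cos b = 2 sin ((a + b) / 2) sin y \<ge> 2 sin^2 y,
  because (a + b) / 2 lies between y and pi - y; and sin y \<ge> y / 2 on [0, pi / 2]. The square
  root is the source of the exponent 1/3 at a turning point.\<close>

lemma arccos_diff_le:
  assumes "-1 \<le> v" "v \<le> u" "u \<le> 1"
  shows "arccos v - arccos u \<le> 4 * sqrt ((u - v) / 2)"
proof -
  define a b where "a = arccos u" and "b = arccos v"
  have ab: "0 \<le> a" "a \<le> b" "b \<le> pi"
    using assms by (auto simp: a_def b_def arccos_lbound arccos_ubound intro!: arccos_le_mono[THEN iffD2])
  let ?y = "(b - a) / 2"
  have y: "0 \<le> ?y" "?y \<le> pi / 2" using ab by auto
  have s1: "?y / 2 \<le> sin ?y"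
  proof -
    have "\<bar>sin ?y - ?y\<bar> \<le> ?y ^ 3 / 6"
      using Maclaurin_sin_bound[of ?y 3] y by (simp add: eval_nat_numeral sin_coeff_def fact_numeral)
    moreover have "?y ^ 2 \<le> (16 / 10) ^ 2" using y pi_less_4 pi_approx by (intro power_mono) auto
    then have "?y * ?y ^ 2 \<le> ?y * 3" using y by (intro mult_left_mono) (auto simp: power2_eq_square)
    then have "?y ^ 3 \<le> ?y * 3" by (simp add: eval_nat_numeral)
    ultimately show ?thesis by linarith
  qed
  have "sin ?y \<le> sin ((a + b) / 2)"
  proof (cases "(a + b) / 2 \<le> pi / 2")
    case True then show ?thesis using ab by (intro sin_monotone_2pi_le) auto
  next
    case False
    have "?y \<le> pi - (a + b) / 2" using ab by (simp add: field_simps)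
    then have "sin ?y \<le> sin (pi - (a + b) / 2)" using ab False y by (intro sin_monotone_2pi_le) auto
    then show ?thesis by (simp add: sin_diff)
  qed
  then have "2 * (sin ?y * sin ?y) \<le> 2 * (sin ((a + b) / 2) * sin ?y)"
    using y by (intro mult_left_mono mult_right_mono sin_ge_zero) auto
  also have "\<dots> = cos a - cos b" by (simp add: cos_diff_cos)
  also have "\<dots> = u - v" using assms by (simp add: a_def b_def)
  finally have "(sin ?y)\<^sup>2 \<le> (u - v) / 2" by (simp add: power2_eq_square)
  moreover have "(?y / 2)\<^sup>2 \<le> (sin ?y)\<^sup>2" using s1 y by (intro power_mono) auto
  ultimately have "?y / 2 \<le> sqrt ((u - v) / 2)" by (intro real_le_rsqrt) linarith
  then show ?thesis by (simp add: a_def b_def field_simps)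
qed

text \<open>Two regions are balanced: where |n - t cos x| \<ge> \<mu>, the first-derivative test
  gives 2 / \<mu> on either side, and for \<mu> = t^(1/3) the exceptional middle interval has length
  at most 4 / \<mu>. The total 8 / (pi \<mu>) is below 3 / \<mu> because pi > 3.\<close>

lemma bessel_landau:
  assumes "t > 0" shows "\<bar>bessel n t\<bar> \<le> 3 * t powr (-1/3)"
proof -
  define \<mu> where "\<mu> = t powr (1/3)"
  have \<mu>: "\<mu> > 0" using assms by (simp add: \<mu>_def)
  have t\<mu>: "t = \<mu> ^ 3" using assms by (simp add: \<mu>_def powr_power)
  let ?f = "\<lambda>x. cos (of_int n * x - t * sin x)"
  \<comment> \<open>Clamping to [-1, 1] lets an interval degenerate when its end would lie outside
    the range of the cosine.\<close>
  let ?cl = "\<lambda>x::real. max (-1) (min 1 x)"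
  define u v where "u = (of_int n + \<mu>) / t" and "v = (of_int n - \<mu>) / t"
  have uv: "v \<le> u" using \<mu> assms by (simp add: u_def v_def divide_right_mono)
  have cuv: "-1 \<le> ?cl v" "?cl v \<le> ?cl u" "?cl u \<le> 1" using uv by auto
  define a b where "a = arccos (?cl u)" and "b = arccos (?cl v)"
  have ab: "0 \<le> a" "a \<le> b" "b \<le> pi"
    using cuv unfolding a_def b_def by (auto intro!: arccos_lbound arccos_ubound arccos_le_arccos)
  have "b - a \<le> 4 * sqrt ((?cl u - ?cl v) / 2)"
    unfolding a_def b_def by (rule arccos_diff_le) (use cuv in auto)
  also have "\<dots> \<le> 4 * sqrt ((u - v) / 2)" using uv by (intro mult_left_mono real_sqrt_le_mono) (auto simp: max_def min_def)
  also have "(u - v) / 2 = (1 / \<mu>)\<^sup>2" using \<mu> unfolding u_def v_def t\<mu> by (simp add: field_simps eval_nat_numeral)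
  finally have ba: "b - a \<le> 4 / \<mu>" using \<mu> by (simp del: power_divide power_one_over)
  have I1: "\<bar>integral {0..a} ?f\<bar> \<le> 2 / \<mu>"
  proof (cases "a = 0")
    case False
    then have "u < 1" using ab by (auto simp: a_def max_def min_def split: if_splits)
    show ?thesis
    proof (rule van_der_corput_first[where s = "-1"])
      fix x assume x: "0 \<le> x" "x \<le> a"
      then have "cos x \<ge> cos a" using ab by (intro cos_monotone_0_pi_le) auto
      then have "cos x \<ge> u" using \<open>u < 1\<close> cuv by (simp add: a_def)
      then have "t * cos x \<ge> t * u" using assms by (intro mult_left_mono) auto
      then show "- 1 * (of_int n - t * cos x) \<ge> \<mu>" using assms by (simp add: u_def)
    qed (use ab assms \<mu> in auto)
  qed (use \<mu> in simp)
  have I2: "\<bar>integral {b..pi} ?f\<bar> \<le> 2 / \<mu>"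
  proof (cases "b = pi")
    case False
    then have "v > -1" using ab by (cases "v = -1") (auto simp: b_def max_def min_def split: if_splits)
    show ?thesis
    proof (rule van_der_corput_first[where s = "1"])
      fix x assume x: "b \<le> x" "x \<le> pi"
      then have "cos x \<le> cos b" using ab by (intro cos_monotone_0_pi_le) auto
      then have "cos x \<le> v" using \<open>v > -1\<close> cuv by (simp add: b_def)
      then have "t * cos x \<le> t * v" using assms by (intro mult_left_mono) auto
      then show "1 * (of_int n - t * cos x) \<ge> \<mu>" using assms by (simp add: v_def)
    qed (use ab assms \<mu> in auto)
  qed (use \<mu> in simp)
  have I3: "\<bar>integral {a..b} ?f\<bar> \<le> 4 / \<mu>"
  proof -
    have "norm (integral {a..b} ?f) \<le> 1 * (b - a)"
      by (rule integral_bound) (use ab in \<open>auto intro!: continuous_intros\<close>)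
    then show ?thesis using ba by simp
  qed
  have "integral {0..pi} ?f = integral {0..a} ?f + integral {a..b} ?f + integral {b..pi} ?f"
    using ab by (simp add: Henstock_Kurzweil_Integration.integral_combine bessel_integrable)
  then have "\<bar>integral {0..pi} ?f\<bar> \<le> 8 / \<mu>" using I1 I2 I3 by (simp add: abs_le_iff)
  also have "\<dots> \<le> 3 * pi / \<mu>" using \<mu> pi_gt3 by (intro divide_right_mono) auto
  finally have "\<bar>bessel n t\<bar> \<le> 3 / \<mu>" by (simp add: bessel_def field_simps)
  then show ?thesis using powr_minus_divide[of t "1/3"] by (simp add: \<mu>_def)
qed

text \<open>With u = sqrt t J_n, Bessel's equation reads u'' + (1 - (n^2 - 1/4) / t^2) u = 0. The
  expression is u'^2 + (1 - (n^2 - 1/4) / t^2) u^2, whose derivative has the sign of n^2 -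
  1/4.\<close>

definition bessel_energy :: "nat \<Rightarrow> real \<Rightarrow> real" where
  "bessel_energy n t = (let J = bessel (int n) t; D = (bessel (int n - 1) t - bessel (int n + 1) t) / 2 in
     t * (J\<^sup>2 + D\<^sup>2) + J * D - ((real n)\<^sup>2 - 1 / 2) * J\<^sup>2 / t)"

lemma bessel_second_derivative:
  assumes "t \<noteq> 0"
  shows "((\<lambda>t. (bessel (n - 1) t - bessel (n + 1) t) / 2) has_real_derivative
    ((of_int n)\<^sup>2 * bessel n t / t\<^sup>2 - ((bessel (n - 1) t - bessel (n + 1) t) / 2) / t - bessel n t)) (at t)"
proof -
  have d: "((\<lambda>t. (bessel (n - 1) t - bessel (n + 1) t) / 2) has_real_derivative
    (bessel (n - 2) t - 2 * bessel n t + bessel (n + 2) t) / 4) (at t)"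
    by (auto intro!: derivative_eq_intros simp: field_simps)
  have r: "bessel (n - 2) t = 2 * of_int (n - 1) * bessel (n - 1) t / t - bessel n t"
     "bessel (n + 2) t = 2 * of_int (n + 1) * bessel (n + 1) t / t - bessel n t"
     "bessel n t * of_int n = t * (bessel (n - 1) t + bessel (n + 1) t) / 2"
    using bessel_recurrence[of t "n - 1"] bessel_recurrence[of t "n + 1"] bessel_recurrence[of t n] assms
    by (simp_all add: field_simps)
  have "(of_int n)\<^sup>2 * bessel n t / t\<^sup>2 = of_int n * (bessel n t * of_int n) / t\<^sup>2"
    by (simp add: power2_eq_square)
  also have "\<dots> = of_int n * (bessel (n - 1) t + bessel (n + 1) t) / (2 * t)"
    unfolding r(3) using assms by (simp add: field_simps power2_eq_square)
  finally have "(of_int n)\<^sup>2 * bessel n t / t\<^sup>2 - ((bessel (n - 1) t - bessel (n + 1) t) / 2) / t - bessel n t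
     = (bessel (n - 2) t - 2 * bessel n t + bessel (n + 2) t) / 4"
    unfolding r(1,2) using assms by (simp add: field_simps)
  then show ?thesis using d by (simp only:)
qed

lemma bessel_energy_deriv:
  assumes "t > 0"
  shows "(bessel_energy n has_real_derivative 2 * ((real n)\<^sup>2 - 1 / 4) * (bessel (int n) t)\<^sup>2 / t\<^sup>2) (at t)"
proof -
  let ?J = "bessel (int n)" and ?D = "\<lambda>t. (bessel (int n - 1) t - bessel (int n + 1) t) / 2"
  let ?D' = "(real n)\<^sup>2 * ?J t / t\<^sup>2 - ?D t / t - ?J t"
  have J: "(?J has_real_derivative ?D t) (at t)" by (rule bessel_has_field_derivative)
  have D: "(?D has_real_derivative ?D') (at t)"
    using bessel_second_derivative[of t "int n"] assms by simp
  have "((\<lambda>t. t * ((?J t)\<^sup>2 + (?D t)\<^sup>2) + ?J t * ?D t - ((real n)\<^sup>2 - 1 / 2) * (?J t)\<^sup>2 / t) has_real_derivative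
     ((?J t)\<^sup>2 + (?D t)\<^sup>2) + t * (2 * ?J t * ?D t + 2 * ?D t * ?D') + (?D t * ?D t + ?J t * ?D')
      - ((real n)\<^sup>2 - 1 / 2) * (2 * ?J t * ?D t * t - (?J t)\<^sup>2) / (t * t)) (at t)"
  proof -
    have "((\<lambda>t. t * ((f t)\<^sup>2 + (g t)\<^sup>2) + f t * g t - c * (f t)\<^sup>2 / t) has_real_derivative
       ((f t)\<^sup>2 + (g t)\<^sup>2) + t * (2 * f t * d + 2 * g t * e) + (d * g t + f t * e)
       - c * (2 * f t * d * t - (f t)\<^sup>2) / (t * t)) (at t)"
      if "(f has_real_derivative d) (at t)" "(g has_real_derivative e) (at t)" for f g d e c
      using that assms by (auto intro!: derivative_eq_intros simp: power2_eq_square algebra_simps)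
    from this[OF J D] show ?thesis .
  qed
  moreover have "(j\<^sup>2 + d\<^sup>2) + t * (2 * j * d + 2 * d * (m * j / t\<^sup>2 - d / t - j)) + (d * d + j * (m * j / t\<^sup>2 - d / t - j))
      - (m - 1 / 2) * (2 * j * d * t - j\<^sup>2) / (t * t) = 2 * (m - 1 / 4) * j\<^sup>2 / t\<^sup>2" for j d m :: real
  proof -
    define u where "u = 1 / t"
    have u: "t * u = 1" "x / t = x * u" "x / t\<^sup>2 = x * u * u" "x / (t * t) = x * u * u" for x
      using assms by (simp_all add: u_def power2_eq_square)
    show ?thesis unfolding u using u(1) by Groebner_Basis.algebra
  qed
  ultimately show ?thesis by (simp only: bessel_energy_def[abs_def] Let_def)
qed

lemma bessel_tendsto_0: "(bessel n \<longlongrightarrow> 0) at_top"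
proof (rule Lim_null_comparison)
  show "\<forall>\<^sub>F t in at_top. norm (bessel n t) \<le> 3 * t powr (-1/3)"
    using eventually_gt_at_top[of 0] by eventually_elim (simp add: bessel_landau[simplified])
  show "((\<lambda>t. 3 * t powr (-1/3)) \<longlongrightarrow> (0::real)) at_top" by real_asymp
qed

text \<open>By the recurrence the difference is - (n + 1/2) (J_n^2 + J_(n+1)^2) / t. Hence all
  energies behave alike at infinity, and a bound for order 0 propagates to every order without
  asymptotics of J_n.\<close>

lemma bessel_energy_diff_tendsto_0:
  "((\<lambda>t. bessel_energy (Suc n) t - bessel_energy n t) \<longlongrightarrow> 0) at_top"
proof -
  let ?J = "bessel (int n)" and ?K = "bessel (int n + 1)"
  let ?a = "real n"
  let ?R = "\<lambda>t. - (?a + 1 / 2) * ((?J t)\<^sup>2 + (?K t)\<^sup>2) / t"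
  have eq: "bessel_energy (Suc n) t - bessel_energy n t = ?R t" if "t > 0" for t
  proof -
    have r1: "bessel (int n - 1) t = 2 * ?a * ?J t / t - ?K t"
      using bessel_recurrence[of t "int n"] that by (simp add: field_simps)
    have r2: "bessel (int n + 2) t = 2 * (?a + 1) * ?K t / t - ?J t"
      using bessel_recurrence[of t "int n + 1"] that by (simp add: field_simps)
    have "(t * (k\<^sup>2 + ((j - (2 * (a + 1) * k / t - j)) / 2)\<^sup>2) + k * ((j - (2 * (a + 1) * k / t - j)) / 2) - ((a + 1)\<^sup>2 - 1 / 2) * k\<^sup>2 / t)
      - (t * (j\<^sup>2 + (((2 * a * j / t - k) - k) / 2)\<^sup>2) + j * (((2 * a * j / t - k) - k) / 2) - (a\<^sup>2 - 1 / 2) * j\<^sup>2 / t)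
      = - (a + 1 / 2) * (j\<^sup>2 + k\<^sup>2) / t" for j k a :: real
    proof -
      define u where "u = 1 / t"
      have u: "t * u = 1" "x / t = x * u" for x using that by (simp_all add: u_def)
      have h: "(j - (2 * (a + 1) * k * u - j)) / 2 = j - (a + 1) * k * u" "((2 * a * j * u - k) - k) / 2 = a * j * u - k"
        by (simp_all add: field_simps)
      show ?thesis unfolding u h using u(1) by Groebner_Basis.algebra
    qed
    moreover have e: "int (Suc n) - 1 = int n" "int (Suc n) + 1 = int n + 2" "int (Suc n) = int n + 1" "real (Suc n) = ?a + 1"
      and e2: "int n + 1 - 1 = int n" "int n + 1 + 1 = int n + 2" by auto
    ultimately show ?thesis
      unfolding bessel_energy_def Let_def e e2 r1 r2 by blast
  qed
  have "(?R \<longlongrightarrow> - (?a + 1 / 2) * (0\<^sup>2 + 0\<^sup>2) * 0) at_top"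
    unfolding divide_inverse
    by (intro tendsto_intros bessel_tendsto_0 tendsto_inverse_0_at_top filterlim_ident)
  then have "(?R \<longlongrightarrow> 0) at_top" by simp
  then show ?thesis
    by (rule Lim_transform_eventually)
       (use eventually_gt_at_top[of 0] in \<open>eventually_elim, simp only: eq\<close>)
qed

lemma integral_sin_squared: "((\<lambda>x. (sin x)\<^sup>2) has_integral pi / 2) {0..pi}"
proof -
  have "((\<lambda>x. (sin x)\<^sup>2) has_integral ((pi - sin pi * cos pi) / 2 - (0 - sin 0 * cos 0) / 2)) {0..pi}"
  proof (rule fundamental_theorem_of_calculus)
    fix x :: real
    have "((\<lambda>x. (x - sin x * cos x) / 2) has_real_derivative (1 - (cos x * cos x - sin x * sin x)) / 2) (at x within {0..pi})"
      by (auto intro!: derivative_eq_intros)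
    also have "(1 - (cos x * cos x - sin x * sin x)) / 2 = (sin x)\<^sup>2"
      using sin_cos_squared_add[of x] by (simp add: power2_eq_square field_simps)
    finally show "((\<lambda>x. (x - sin x * cos x) / 2) has_vector_derivative (sin x)\<^sup>2) (at x within {0..pi})"
      by (simp add: has_real_derivative_iff_has_vector_derivative)
  qed simp
  then show ?thesis by simp
qed

lemma integral_sin_fourth: "((\<lambda>x. (sin x) ^ 4) has_integral 3 * pi / 8) {0..pi}"
proof -
  have "((\<lambda>x. 3 / 4 * (sin x)\<^sup>2 - (sin x) ^ 4) has_integral ((sin pi ^ 3 * cos pi) / 4 - (sin 0 ^ 3 * cos 0) / 4)) {0..pi}"
  proof (rule fundamental_theorem_of_calculus)
    fix x :: real
    have "((\<lambda>x. (sin x ^ 3 * cos x) / 4) has_real_derivative (3 * sin x ^ 2 * cos x * cos x - sin x ^ 3 * sin x) / 4) (at x within {0..pi})"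
      by (auto intro!: derivative_eq_intros simp: eval_nat_numeral)
    also have "(3 * sin x ^ 2 * cos x * cos x - sin x ^ 3 * sin x) / 4 = 3 / 4 * (sin x)\<^sup>2 - (sin x) ^ 4"
      using sin_cos_squared_add[of x] by Groebner_Basis.algebra
    finally show "((\<lambda>x. (sin x ^ 3 * cos x) / 4) has_vector_derivative 3 / 4 * (sin x)\<^sup>2 - (sin x) ^ 4) (at x within {0..pi})"
      by (simp add: has_real_derivative_iff_has_vector_derivative)
  qed simp
  from has_integral_diff[OF has_integral_mult_right[OF integral_sin_squared, of "3/4"] this]
  show ?thesis by simp
qed

lemma cos_taylor_bounds:
  fixes x :: real
  shows "1 - x\<^sup>2 / 2 \<le> cos x" "cos x \<le> 1 - x\<^sup>2 / 2 + x ^ 4 / 24"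
proof -
  obtain t where "cos x = (\<Sum>m<4. cos_coeff m * x ^ m) + (cos (t + 1 / 2 * real 4 * pi) / fact 4) * x ^ 4"
    using Maclaurin_cos_expansion[of x 4] by blast
  moreover have "(\<Sum>m<4. f m) = f 0 + f 1 + f 2 + f (3 :: nat)" for f :: "nat \<Rightarrow> real"
    by (simp add: eval_nat_numeral)
  ultimately have "cos x = 1 - x\<^sup>2 / 2 + cos t * (x ^ 4 / 24)"
    by (simp add: cos_coeff_def fact_numeral)
  moreover have "cos t * (x ^ 4 / 24) \<le> 1 * (x ^ 4 / 24)" by (intro mult_right_mono) auto
  ultimately show "cos x \<le> 1 - x\<^sup>2 / 2 + x ^ 4 / 24" by simp
  obtain t where "cos x = (\<Sum>m<2. cos_coeff m * x ^ m) + (cos (t + 1 / 2 * real 2 * pi) / fact 2) * x ^ 2"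
    using Maclaurin_cos_expansion[of x 2] by blast
  then have "cos x = 1 - cos t * (x\<^sup>2 / 2)"
    by (simp add: eval_nat_numeral cos_coeff_def fact_numeral)
  moreover have "cos t * (x\<^sup>2 / 2) \<le> 1 * (x\<^sup>2 / 2)" by (intro mult_right_mono) auto
  ultimately show "1 - x\<^sup>2 / 2 \<le> cos x" by simp
qed

lemma bessel_0_at_1: "3 / 4 \<le> bessel 0 1" "bessel 0 1 \<le> 49 / 64"
proof -
  have c: "((\<lambda>x. cos (sin x)) has_integral pi * bessel 0 1) {0..pi}"
    using integrable_integral[OF bessel_integrable[of 0 1 0 pi]] by (simp add: bessel_def)
  have one: "((\<lambda>x::real. 1) has_integral pi) {0..pi}" using has_integral_const_real[of "1::real" 0 pi] by simp
  have "((\<lambda>x. 1 - 1 / 2 * (sin x)\<^sup>2) has_integral pi - 1 / 2 * (pi / 2)) {0..pi}"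
    by (intro has_integral_diff has_integral_mult_right one integral_sin_squared)
  from has_integral_le[OF this c] cos_taylor_bounds(1)[of "sin _"]
  have "pi - 1 / 2 * (pi / 2) \<le> pi * bessel 0 1" by simp
  then have "pi * (3 / 4) \<le> pi * bessel 0 1" by simp
  then show "3 / 4 \<le> bessel 0 1" by (rule mult_left_le_imp_le) simp
  have "((\<lambda>x. 1 - 1 / 2 * (sin x)\<^sup>2 + 1 / 24 * sin x ^ 4) has_integral pi - 1 / 2 * (pi / 2) + 1 / 24 * (3 * pi / 8)) {0..pi}"
    by (intro has_integral_diff has_integral_add has_integral_mult_right one integral_sin_squared integral_sin_fourth)
  from has_integral_le[OF c this] cos_taylor_bounds(2)[of "sin _"]
  have "pi * bessel 0 1 \<le> pi - 1 / 2 * (pi / 2) + 1 / 24 * (3 * pi / 8)" by simp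
  then have "pi * bessel 0 1 \<le> pi * (49 / 64)" by simp
  then show "bessel 0 1 \<le> 49 / 64" by (rule mult_left_le_imp_le) simp
qed

lemma bessel_1_at_1: "43 / 100 \<le> bessel 1 1" "bessel 1 1 \<le> 1 / 2"
proof -
  have c: "((\<lambda>x. sin x * sin (sin x)) has_integral pi * bessel 1 1) {0..pi}"
  proof -
    have 1: "((\<lambda>x. cos (x - sin x)) has_integral pi * bessel 1 1) {0..pi}"
      using integrable_integral[OF bessel_integrable[of 1 1 0 pi]] by (simp add: bessel_def)
    have 2: "((\<lambda>x. cos x * cos (sin x)) has_integral (sin (sin pi) - sin (sin 0))) {0..pi}"
      by (intro fundamental_theorem_of_calculus)
         (auto intro!: derivative_eq_intros simp: has_real_derivative_iff_has_vector_derivative[symmetric])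
    show ?thesis using has_integral_diff[OF 1 2] by (simp add: cos_diff)
  qed
  have b: "sin x * sin (sin x) \<le> (sin x)\<^sup>2" "(sin x)\<^sup>2 - 7 / 40 * sin x ^ 4 \<le> sin x * sin (sin x)" if "x \<in> {0..pi}" for x
  proof -
    define s where "s = sin x"
    have s: "0 \<le> s" "s \<le> 1" using that sin_ge_zero[of x] by (auto simp: s_def)
    have "sin s \<le> s" using s by (intro sin_x_le_x) auto
    then have "s * sin s \<le> s * s" using s by (intro mult_left_mono) auto
    then show "sin x * sin (sin x) \<le> (sin x)\<^sup>2" by (simp add: s_def power2_eq_square)
    have "(\<Sum>m<5. f m) = f 0 + f 1 + f 2 + f 3 + f (4 :: nat)" for f :: "nat \<Rightarrow> real"
      by (simp add: eval_nat_numeral)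
    then have "\<bar>sin s - (s - s ^ 3 / 6)\<bar> \<le> s ^ 5 / 120"
      using Maclaurin_sin_bound[of s 5] s by (simp add: sin_coeff_def fact_numeral)
    moreover have "s ^ 5 \<le> s ^ 3" using s by (intro power_decreasing) auto
    ultimately have "s - 7 / 40 * s ^ 3 \<le> sin s" by linarith
    then have "s * (s - 7 / 40 * s ^ 3) \<le> s * sin s" using s by (intro mult_left_mono) auto
    then show "(sin x)\<^sup>2 - 7 / 40 * sin x ^ 4 \<le> sin x * sin (sin x)"
      by (simp add: s_def eval_nat_numeral algebra_simps)
  qed
  from has_integral_le[OF c integral_sin_squared] b(1) have "pi * bessel 1 1 \<le> pi * (1 / 2)" by simp
  then show "bessel 1 1 \<le> 1 / 2" by (rule mult_left_le_imp_le) simp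
  from has_integral_le[OF has_integral_diff[OF integral_sin_squared has_integral_mult_right[OF integral_sin_fourth, of "7/40"]] c] b(2)
  have "pi * (43 / 100) \<le> pi * bessel 1 1" by simp
  then show "43 / 100 \<le> bessel 1 1" by (rule mult_left_le_imp_le) simp
qed

lemma bessel_energy_0_at_1: "bessel_energy 0 1 \<le> 3 / 4"
proof -
  define j k where "j = bessel 0 1" and "k = bessel 1 1"
  have jk: "3 / 4 \<le> j" "j \<le> 49 / 64" "43 / 100 \<le> k" "k \<le> 1 / 2"
    using bessel_0_at_1 bessel_1_at_1 by (auto simp: j_def k_def)
  have "bessel (- 1) 1 = - k" using bessel_minus[of 1 1] by (simp add: k_def)
  then have "bessel_energy 0 1 = 3 / 2 * j\<^sup>2 - j * k + k\<^sup>2"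
    by (simp add: bessel_energy_def Let_def j_def k_def power2_eq_square)
  \<comment> \<open>The form increases with j on the given range, so j is replaced by 49/64; the
    convex quadratic in k is then bounded by its chord between 43/100 and 1/2.\<close>
  also have "\<dots> = 3 / 2 * (49 / 64)\<^sup>2 - 49 / 64 * k + k\<^sup>2 - (49 / 64 - j) * (3 / 2 * (49 / 64 + j) - k)"
    by Groebner_Basis.algebra
  also have "\<dots> \<le> 3 / 2 * (49 / 64)\<^sup>2 - 49 / 64 * k + k\<^sup>2"
    using jk by simp
  also have "\<dots> = 3 / 2 * (49 / 64)\<^sup>2 - 43 / 200 - (49 / 64 - 93 / 100) * k - (k - 43 / 100) * (1 / 2 - k)"
    by Groebner_Basis.algebra
  also have "\<dots> \<le> 3 / 2 * (49 / 64)\<^sup>2 - 43 / 200 - (49 / 64 - 93 / 100) * k"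
    using jk by simp
  also have "\<dots> \<le> 3 / 4" using jk by (simp add: power2_eq_square)
  finally show ?thesis .
qed

text \<open>For n = 0 the energy decreases from its value at 1, which is at most 3/4. For n > 0 it
  increases towards its behaviour at infinity, which is that of order 0, so it cannot exceed 3/4
  either.\<close>

lemma bessel_energy_le:
  assumes "n > 0 \<and> t > 0 \<or> t \<ge> 1"
  shows "bessel_energy n t \<le> 3 / 4"
proof -
  have E0: "bessel_energy 0 s \<le> 3 / 4" if "s \<ge> 1" for s
  proof -
    have "bessel_energy 0 s \<le> bessel_energy 0 1"
    proof (rule DERIV_nonpos_imp_nonincreasing[OF that])
      fix x :: real assume "1 \<le> x" "x \<le> s"
      then show "\<exists>y. (bessel_energy 0 has_real_derivative y) (at x) \<and> y \<le> 0"
        using bessel_energy_deriv[of x 0] by (intro exI conjI) auto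
    qed
    then show ?thesis using bessel_energy_0_at_1 by simp
  qed
  have lim: "eventually (\<lambda>t. bessel_energy n t \<le> 3 / 4 + \<eta>) at_top" if "\<eta> > 0" for \<eta>
    using that
  proof (induction n arbitrary: \<eta>)
    case 0
    show ?case by (rule eventually_mono[OF eventually_ge_at_top[of 1]]) (use E0 0 in fastforce)
  next
    case (Suc n)
    have "eventually (\<lambda>t. bessel_energy n t \<le> 3 / 4 + \<eta> / 2) at_top" using Suc by simp
    moreover have "eventually (\<lambda>t. bessel_energy (Suc n) t - bessel_energy n t < \<eta> / 2) at_top"
      by (rule order_tendstoD(2)[OF bessel_energy_diff_tendsto_0]) (use Suc.prems in simp)
    ultimately show ?case by eventually_elim linarith
  qed
  show ?thesis
  proof (cases "n = 0")
    case True then show ?thesis using E0 assms by simp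
  next
    case False
    then have t: "t > 0" using assms by auto
    have "bessel_energy n t \<le> 3 / 4 + \<eta>" if eta: "\<eta> > 0" for \<eta>
    proof -
      have "eventually (\<lambda>s. bessel_energy n s \<le> 3 / 4 + \<eta> \<and> s \<ge> t) at_top"
        by (intro eventually_conj lim eta eventually_ge_at_top)
      then obtain s where s: "s \<ge> t" "bessel_energy n s \<le> 3 / 4 + \<eta>"
        using eventually_happens'[OF trivial_limit_at_top_linorder] by blast
      have "bessel_energy n t \<le> bessel_energy n s"
      proof (rule DERIV_nonneg_imp_nondecreasing[OF s(1)])
        fix x assume x: "t \<le> x" "x \<le> s"
        have "(real n)\<^sup>2 \<ge> 1" using False by simp
        then have "2 * ((real n)\<^sup>2 - 1 / 4) * (bessel (int n) x)\<^sup>2 / x\<^sup>2 \<ge> 0" by simp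
        then show "\<exists>y. (bessel_energy n has_real_derivative y) (at x) \<and> y \<ge> 0"
          using bessel_energy_deriv[of x n] x t by (intro exI conjI) auto
      qed
      with s show ?thesis by simp
    qed
    then show ?thesis by (rule field_le_epsilon)
  qed
qed

text \<open>Completing the square, the difference of the two sides is t (J' + J / (2 t))^2.\<close>

lemma bessel_energy_ge:
  assumes "t > 0"
  shows "t * (bessel (int n) t)\<^sup>2 - ((real n)\<^sup>2 - 1 / 4) * (bessel (int n) t)\<^sup>2 / t \<le> bessel_energy n t"
proof -
  have eq: "t * (j\<^sup>2 + d\<^sup>2) + j * d - (m - 1 / 2) * j\<^sup>2 / t - (t * j\<^sup>2 - (m - 1 / 4) * j\<^sup>2 / t) = t * (d + j / (2 * t))\<^sup>2" for j d m :: real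
  proof -
    define u where "u = 1 / t"
    have u: "t * u = 1" "x / t = x * u" "x / (2 * t) = x * u * (1 / 2)" for x using assms by (simp_all add: u_def)
    show ?thesis unfolding u using u(1) by Groebner_Basis.algebra
  qed
  have "t * j\<^sup>2 - (m - 1 / 4) * j\<^sup>2 / t \<le> t * (j\<^sup>2 + d\<^sup>2) + j * d - (m - 1 / 2) * j\<^sup>2 / t" for j d m :: real
    by (subst diff_ge_0_iff_ge[symmetric], subst eq) (use assms in simp)
  then show ?thesis
    unfolding bessel_energy_def Let_def by blast
qed

text \<open>For t \<ge> 2 |n| the centrifugal term (n^2 - 1/4) / t^2 is at most 1/4, so at least 3/4
  of t J^2 is left in the energy; the bound 3/4 for the energy then gives t J^2 \<le> 1.\<close>

lemma bessel_decay:
  assumes "t > 0" "t \<ge> 2 * \<bar>of_int n\<bar>"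
  shows "(bessel n t)\<^sup>2 \<le> 1 / t"
proof -
  have nat: "(bessel (int n) t)\<^sup>2 \<le> 1 / t" if "t \<ge> 2 * real n" for n
  proof (cases "n = 0 \<and> t < 1")
    case True
    have "(bessel (int n) t)\<^sup>2 \<le> 1" using abs_bessel_le_1[of n t] by (simp add: abs_square_le_1)
    also have "1 \<le> 1 / t" using True assms by simp
    finally show ?thesis .
  next
    case False
    define b where "b = (bessel (int n) t)\<^sup>2"
    have E: "t * b - ((real n)\<^sup>2 - 1 / 4) * b / t \<le> 3 / 4"
    proof -
      have "bessel_energy n t \<le> 3 / 4" by (rule bessel_energy_le) (use assms False in auto)
      with bessel_energy_ge[OF assms(1), of n] show ?thesis unfolding b_def by linarith
    qed
    have "(2 * real n)\<^sup>2 \<le> t\<^sup>2" using that by (intro power_mono) auto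
    then have "((real n)\<^sup>2 - 1 / 4) * b \<le> t\<^sup>2 / 4 * b" by (intro mult_right_mono) (auto simp: b_def)
    then have "((real n)\<^sup>2 - 1 / 4) * b / t \<le> t\<^sup>2 / 4 * b / t" using assms by (intro divide_right_mono) auto
    also have "\<dots> = t * b / 4" using assms by (simp add: power2_eq_square)
    finally have "t * b \<le> 1" using E by simp
    then have "b \<le> 1 / t" using assms by (simp add: pos_le_divide_eq mult.commute)
    then show ?thesis by (simp only: b_def)
  qed
  obtain m where m: "n = int m \<or> n = - int m" by (meson int_cases2)
  then have "(bessel n t)\<^sup>2 = (bessel (int m) t)\<^sup>2"
    using bessel_minus[of "int m" t] by (auto simp: power2_eq_square)
  moreover have "(bessel (int m) t)\<^sup>2 \<le> 1 / t" by (rule nat) (use assms(2) m in auto)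
  ultimately show ?thesis by (simp only:)
qed

section \<open>Integrals of products of Bessel functions, uniform in the orders\<close>

lemma continuous_on_bessel_tail_deriv [continuous_intros]: "continuous_on A (bessel_tail_deriv k)"
  unfolding bessel_tail_deriv_def by (intro continuous_intros)

text \<open>J_n^2 is t / (2 |n|) times the derivative of the tail, and this factor is at most 1 up
  to t = 2 |n|. As the tail stays below 1, J_n^2 has integral at most 1 over [0, 2 |n|], whatever n
  is.\<close>

lemma bessel_sq_le_tail_deriv:
  assumes "n \<noteq> 0" "0 \<le> t" "t \<le> 2 * \<bar>of_int n\<bar>"
  shows "(bessel n t)\<^sup>2 \<le> bessel_tail_deriv (nat \<bar>n\<bar>) t"
proof -
  define k where "k = nat \<bar>n\<bar>"
  have k: "real k > 0" "t \<le> 2 * real k" using assms by (auto simp: k_def)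
  have b: "(bessel n t)\<^sup>2 = (bessel (int k) t)\<^sup>2"
    using arg_cong[OF abs_bessel_nat_abs[of n t], of "\<lambda>x. x\<^sup>2"] by (simp only: k_def power2_abs)
  have nn: "bessel_tail_deriv k t \<ge> 0" using bessel_tail_deriv_nonneg assms(2) k(1) by auto
  have "2 * real k * (bessel (int k) t)\<^sup>2 = t * bessel_tail_deriv k t" by (rule mult_bessel_tail_deriv[symmetric])
  also have "\<dots> \<le> 2 * real k * bessel_tail_deriv k t" using k nn by (intro mult_right_mono) auto
  finally have "(bessel (int k) t)\<^sup>2 \<le> bessel_tail_deriv k t" using k(1) by (simp add: mult_le_cancel_left)
  then show ?thesis by (simp only: b k_def)
qed

lemma integral_powr_tail_le:
  assumes "1 \<le> m" "m \<le> X" "s > 1"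
  shows "integral {m..X} (\<lambda>t::real. t powr (- s)) \<le> 1 / (s - 1)"
proof -
  define r where "r = s - 1"
  have r: "r > 0" "- r - 1 = - s" using assms by (auto simp: r_def)
  have "((\<lambda>t::real. t powr (- s)) has_integral (- (1 / r) * X powr (- r) - - (1 / r) * m powr (- r))) {m..X}"
  proof (rule fundamental_theorem_of_calculus)
    fix x assume x: "x \<in> {m..X}"
    have "((\<lambda>t. - (1 / r) * t powr (- r)) has_real_derivative - (1 / r) * (- r * x powr (- r - 1))) (at x within {m..X})"
      by (rule has_field_derivative_at_within, intro DERIV_cmult has_real_derivative_powr) (use x assms in auto)
    also have "- (1 / r) * (- r * x powr (- r - 1)) = x powr (- s)" using r(1) unfolding r(2) by simp
    finally show "((\<lambda>t. - (1 / r) * t powr (- r)) has_vector_derivative x powr - s) (at x within {m..X})"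
      by (simp only: has_real_derivative_iff_has_vector_derivative)
  qed (use assms in simp)
  from integral_unique[OF this] have "integral {m..X} (\<lambda>t::real. t powr (- s)) = (1 / r) * (m powr (- r) - X powr (- r))"
    by (simp only: right_diff_distrib)
  also have "\<dots> \<le> (1 / r) * 1"
  proof (rule mult_left_mono)
    have "m powr (- r) \<le> 1" using powr_mono2'[of "- r" 1 m] assms r by simp
    then show "m powr (- r) - X powr (- r) \<le> 1" using powr_ge_zero[of X "- r"] by linarith
  qed (use r in simp)
  finally show ?thesis by (simp only: r_def mult_1_right)
qed

text \<open>The split point is max 1 (2 |n|). Before it F is compared with the derivative of
  \<open>bessel_tail\<close>, whose total increase is at most 1; after it the decay of J_n takes
  over. For n = 0 the first region is [0, 1], where \<open>F2\<close> bounds F by a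
  constant.\<close>

lemma bessel_moment_bound:
  fixes F :: "real \<Rightarrow> real"
  assumes "0 \<le> X" "continuous_on {0..X} F" "A \<ge> 0" "c \<ge> 0" "s > 1"
    and F1: "\<And>t. 0 \<le> t \<Longrightarrow> t \<le> 2 * \<bar>of_int n\<bar> \<Longrightarrow> F t \<le> A * (bessel n t)\<^sup>2"
    and F2: "\<And>t. n = 0 \<Longrightarrow> 0 \<le> t \<Longrightarrow> t \<le> 1 \<Longrightarrow> F t \<le> A"
    and F3: "\<And>t. 1 \<le> t \<Longrightarrow> 2 * \<bar>of_int n\<bar> \<le> t \<Longrightarrow> F t \<le> c * t powr (- s)"
  shows "integral {0..X} F \<le> A + c / (s - 1)"
proof -
  define m where "m = max 1 (2 * \<bar>real_of_int n\<bar>)"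
  have m1: "m \<ge> 1" by (simp add: m_def)
  have int: "F integrable_on {a..b}" if "0 \<le> a" "b \<le> X" for a b
    by (rule integrable_continuous_interval) (use that in \<open>auto intro: continuous_on_subset[OF assms(2)]\<close>)
  have head: "integral {0..x} F \<le> A" if x: "0 \<le> x" "x \<le> m" "x \<le> X" for x
  proof (cases "n = 0")
    case True
    have "integral {0..x} F \<le> integral {0..x} (\<lambda>_. A)"
      by (rule integral_le) (use int F2 x True in \<open>auto simp: m_def\<close>)
    also have "\<dots> = x * A" using x by simp
    also have "\<dots> \<le> 1 * A" using x assms True by (intro mult_right_mono) (auto simp: m_def)
    finally show ?thesis by simp
  next
    case False
    define k where "k = nat \<bar>n\<bar>"
    have k: "k > 0" "real k = \<bar>real_of_int n\<bar>" using False by (auto simp: k_def)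
    have mk: "m = 2 * \<bar>real_of_int n\<bar>" using False by (simp add: m_def)
    have tail: "(bessel_tail_deriv k has_integral (bessel_tail k x - bessel_tail k 0)) {0..x}"
      using has_field_derivative_bessel_tail[OF k(1)] x
      by (intro fundamental_theorem_of_calculus)
         (auto simp: has_real_derivative_iff_has_vector_derivative[symmetric] intro: has_field_derivative_at_within)
    have "integral {0..x} F \<le> integral {0..x} (\<lambda>t. A * bessel_tail_deriv k t)"
    proof (rule integral_le)
      show "(\<lambda>t. A * bessel_tail_deriv k t) integrable_on {0..x}"
        by (intro integrable_continuous_interval continuous_intros)
      fix t assume t: "t \<in> {0..x}"
      have "F t \<le> A * (bessel n t)\<^sup>2" using F1[of t] t x mk by auto
      also have "\<dots> \<le> A * bessel_tail_deriv k t" using bessel_sq_le_tail_deriv[OF False, of t] t x mk assms(3)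
        by (intro mult_left_mono) (auto simp: k_def)
      finally show "F t \<le> A * bessel_tail_deriv k t" .
    qed (use int x in auto)
    also have "\<dots> = A * bessel_tail k x" using integral_unique[OF tail] by (simp add: bessel_tail_at_0)
    also have "\<dots> \<le> A * 1" using bessel_tail_le_1 assms(3) by (intro mult_left_mono) auto
    finally show ?thesis by simp
  qed
  show ?thesis
  proof (cases "X \<le> m")
    case True
    have "c / (s - 1) \<ge> 0" using assms by simp
    moreover have "integral {0..X} F \<le> A" by (rule head) (use True assms in auto)
    ultimately show ?thesis by linarith
  next
    case False
    then have mX: "m \<le> X" by simp
    have pc: "continuous_on {m..X} (\<lambda>t. c * t powr (- s))" using m1 by (intro continuous_intros) auto
    have "integral {m..X} F \<le> integral {m..X} (\<lambda>t. c * t powr (- s))"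
      by (rule integral_le) (use int F3 m1 mX pc in \<open>auto simp: m_def intro!: integrable_continuous_interval\<close>)
    also have "\<dots> = c * integral {m..X} (\<lambda>t. t powr (- s))" by simp
    also have "\<dots> \<le> c * (1 / (s - 1))" using integral_powr_tail_le[OF m1 mX assms(5)] assms(4) by (rule mult_left_mono)
    finally have "integral {m..X} F \<le> c / (s - 1)" by simp
    moreover have "integral {0..X} F = integral {0..m} F + integral {m..X} F"
      using m1 mX int[of 0 X] assms(1) by (intro Henstock_Kurzweil_Integration.integral_combine[symmetric]) auto
    ultimately show ?thesis using head[of m] m1 mX by simp
  qed
qed

lemma min_one_le_powr: "0 \<le> (x::real) \<Longrightarrow> 0 \<le> a \<Longrightarrow> a \<le> 1 \<Longrightarrow> min 1 x \<le> x powr a"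
proof (cases "x \<ge> 1")
  case True
  assume "0 \<le> a"
  then have "1 \<le> x powr a" using True by (simp add: ge_one_powr_ge_zero)
  then show ?thesis by simp
next
  case False
  assume a: "0 \<le> x" "a \<le> 1" "0 \<le> a"
  have "x powr 1 \<le> x powr a" using a False by (intro powr_mono') auto
  then show ?thesis using a(1) by simp
qed

lemma abs_bessel_power_decay:
  assumes "t \<ge> 1" "2 * \<bar>of_int n\<bar> \<le> t"
  shows "\<bar>bessel n t\<bar> ^ k \<le> t powr (- (real k / 2))"
proof -
  have t: "t > 0" using assms by simp
  have "\<bar>bessel n t\<bar> \<le> sqrt (1 / t)" using bessel_decay[OF t assms(2)] by (intro real_le_rsqrt) simp
  also have "\<dots> = t powr (- (1 / 2))" using assms by (simp add: powr_minus_divide powr_half_sqrt real_sqrt_divide)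
  finally have "\<bar>bessel n t\<bar> ^ k \<le> (t powr (- (1 / 2))) ^ k" by (intro power_mono) auto
  also have "\<dots> = t powr (- (real k / 2))" using t by (simp add: powr_power)
  finally show ?thesis .
qed

lemma integral_bessel_cubed_le:
  assumes "0 \<le> X" shows "integral {0..X} (\<lambda>t. \<bar>bessel n t\<bar> ^ 3) \<le> 3"
proof -
  have "integral {0..X} (\<lambda>t. \<bar>bessel n t\<bar> ^ 3) \<le> 1 + 1 / (3 / 2 - 1)"
  proof (rule bessel_moment_bound[where n = n])
    fix t :: real
    have "\<bar>bessel n t\<bar> ^ 3 \<le> \<bar>bessel n t\<bar> ^ 2" using abs_bessel_le_1[of n t] by (intro power_decreasing) auto
    then show "\<bar>bessel n t\<bar> ^ 3 \<le> 1 * (bessel n t)\<^sup>2" by simp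
    show "\<bar>bessel n t\<bar> ^ 3 \<le> 1" using abs_bessel_le_1[of n t] by (intro power_le_one) auto
    show "1 \<le> t \<Longrightarrow> 2 * \<bar>of_int n\<bar> \<le> t \<Longrightarrow> \<bar>bessel n t\<bar> ^ 3 \<le> 1 * t powr - (3 / 2)"
      using abs_bessel_power_decay[of t n 3] by simp
  qed (use assms in \<open>auto intro!: continuous_intros\<close>)
  then show ?thesis by simp
qed

lemma integral_min_bessel_power_le:
  assumes "0 \<le> X" "\<epsilon> > 0" "r > 0" "r \<le> 3"
  shows "integral {0..X} (\<lambda>t. min 1 (\<epsilon> * t) * \<bar>bessel n t\<bar> ^ (2 + r)) \<le> (3 ^ r + 6 / real r) * \<epsilon> powr (real r / 3)"
proof -
  let ?F = "\<lambda>t. min 1 (\<epsilon> * t) * \<bar>bessel n t\<bar> ^ (2 + r)"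
  \<comment> \<open>The exponent r/3 is chosen so that t^(r/3) cancels Landau's t^(-r/3) in the
    first region; in the second it leaves t^(-1 - r/6), which is still integrable.\<close>
  have min: "min 1 (\<epsilon> * t) \<le> \<epsilon> powr (real r / 3) * t powr (real r / 3)" if "t \<ge> 0" for t
    using min_one_le_powr[of "\<epsilon> * t" "real r / 3"] that assms by (simp add: powr_mult)
  have "integral {0..X} ?F \<le> 3 ^ r * \<epsilon> powr (real r / 3) + \<epsilon> powr (real r / 3) / ((1 + real r / 6) - 1)"
  proof (rule bessel_moment_bound[where n = n])
    fix t :: real
    assume t: "0 \<le> t" "t \<le> 2 * \<bar>of_int n\<bar>"
    show "?F t \<le> 3 ^ r * \<epsilon> powr (real r / 3) * (bessel n t)\<^sup>2"
    proof (cases "t = 0")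
      case False
      then have t0: "t > 0" using t by simp
      have "\<bar>bessel n t\<bar> ^ r \<le> (3 * t powr (-1/3)) ^ r" using bessel_landau[OF t0] by (intro power_mono) auto
      also have "\<dots> = 3 ^ r * t powr (- (real r / 3))" using t0 by (simp add: power_mult_distrib powr_power)
      finally have 1: "\<bar>bessel n t\<bar> ^ r \<le> 3 ^ r * t powr (- (real r / 3))" .
      have "?F t = (min 1 (\<epsilon> * t) * \<bar>bessel n t\<bar> ^ r) * (bessel n t)\<^sup>2" by (simp add: power_add power2_eq_square abs_mult)
      also have "\<dots> \<le> ((\<epsilon> powr (real r / 3) * t powr (real r / 3)) * (3 ^ r * t powr (- (real r / 3)))) * (bessel n t)\<^sup>2"
        using 1 min[of t] t assms by (intro mult_right_mono mult_mono) auto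
      also have "\<dots> = 3 ^ r * \<epsilon> powr (real r / 3) * (t powr (real r / 3) * t powr (- (real r / 3))) * (bessel n t)\<^sup>2" by simp
      also have "t powr (real r / 3) * t powr (- (real r / 3)) = 1" using t0 by (simp add: powr_add[symmetric])
      finally show ?thesis by simp
    qed (use assms in simp)
  next
    fix t :: real assume t: "0 \<le> t" "t \<le> 1"
    have "?F t \<le> (\<epsilon> powr (real r / 3) * t powr (real r / 3)) * 1"
      using min[of t] t assms abs_bessel_le_1[of n t] by (intro mult_mono power_le_one) auto
    also have "\<dots> \<le> \<epsilon> powr (real r / 3)"
      using mult_left_mono[OF powr_le1[of "real r / 3" t], of "\<epsilon> powr (real r / 3)"] t by simp
    also have "\<dots> \<le> 3 ^ r * \<epsilon> powr (real r / 3)"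
      using mult_right_mono[OF one_le_power[of "3::real" r], of "\<epsilon> powr (real r / 3)"] by simp
    finally show "?F t \<le> 3 ^ r * \<epsilon> powr (real r / 3)" .
  next
    fix t :: real assume t: "1 \<le> t" "2 * \<bar>of_int n\<bar> \<le> t"
    have "?F t \<le> (\<epsilon> powr (real r / 3) * t powr (real r / 3)) * t powr (- (real (2 + r) / 2))"
      using min[of t] t abs_bessel_power_decay[of t n "2 + r"] by (intro mult_mono) auto
    also have "\<dots> = \<epsilon> powr (real r / 3) * (t powr (real r / 3) * t powr (- (real (2 + r) / 2)))" by simp
    also have "t powr (real r / 3) * t powr (- (real (2 + r) / 2)) = t powr (- (1 + real r / 6))"
    proof -
      have e: "real r / 3 + - (real (2 + r) / 2) = - (1 + real r / 6)" by (simp add: field_simps)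
      show ?thesis unfolding powr_add[symmetric] e ..
    qed
    finally show "?F t \<le> \<epsilon> powr (real r / 3) * t powr - (1 + real r / 6)" .
  qed (use assms in \<open>auto intro!: continuous_intros\<close>)
  then show ?thesis by (simp add: algebra_simps)
qed

text \<open>Arithmetic-geometric mean for the powers with exponent card I, which are then increased
  to exponent k as each factor is at most 1. It reduces products of Bessel functions of different
  orders to powers of a single one.\<close>

lemma prod_le_mean_power:
  fixes a :: "'a \<Rightarrow> real"
  assumes "finite I" "k \<le> card I" "k > 0" "\<And>i. i \<in> I \<Longrightarrow> 0 \<le> a i" "\<And>i. i \<in> I \<Longrightarrow> a i \<le> 1"
  shows "(\<Prod>i\<in>I. a i) \<le> (\<Sum>i\<in>I. a i ^ k) / card I"
proof -
  have ne: "I \<noteq> {}" and c: "card I > 0" using assms by auto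
  define P where "P = (\<Prod>i\<in>I. a i)"
  have "P \<ge> 0" unfolding P_def by (intro prod_nonneg) (use assms in auto)
  have "P = (P ^ card I) powr (1 / card I)"
  proof (cases "P = 0")
    case False
    with \<open>P \<ge> 0\<close> have "P > 0" by simp
    then have "P ^ card I = P powr real (card I)" by (rule powr_realpow[symmetric])
    then have "(P ^ card I) powr (1 / card I) = P powr (real (card I) * (1 / card I))" by (simp only: powr_powr)
    then show ?thesis using c \<open>P > 0\<close> by simp
  qed (use c in simp)
  also have "\<dots> = (\<Prod>i\<in>I. a i ^ card I) powr (1 / card I)" by (simp only: P_def prod_power_distrib)
  also have "\<dots> \<le> (\<Sum>i\<in>I. a i ^ card I / card I)"
    by (rule arith_geom_mean) (use assms ne in auto)
  also have "\<dots> \<le> (\<Sum>i\<in>I. a i ^ k / card I)"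
    using assms by (intro sum_mono divide_right_mono power_decreasing) auto
  finally show ?thesis by (simp add: P_def sum_divide_distrib)
qed

definition bessel_prod :: "int ^ 'n \<Rightarrow> real \<Rightarrow> real" where
  "bessel_prod n t = (\<Prod>i\<in>UNIV. bessel (n $ i) t)"

lemma continuous_on_bessel_prod [continuous_intros]: "continuous_on A (bessel_prod n)"
  unfolding bessel_prod_def by (intro continuous_intros)

lemma abs_bessel_prod_le:
  assumes "0 < k" "k \<le> CARD('n)"
  shows "\<bar>bessel_prod (n :: int ^ ('n::finite)) t\<bar> \<le> (\<Sum>i\<in>UNIV. \<bar>bessel (n $ i) t\<bar> ^ k) / CARD('n)"
proof -
  have "\<bar>bessel_prod n t\<bar> = (\<Prod>i\<in>UNIV. \<bar>bessel (n $ i) t\<bar>)" by (simp add: bessel_prod_def abs_prod)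
  also have "\<dots> \<le> (\<Sum>i\<in>UNIV. \<bar>bessel (n $ i) t\<bar> ^ k) / CARD('n)"
    by (rule prod_le_mean_power) (use assms abs_bessel_le_1 in auto)
  finally show ?thesis .
qed

lemma integral_weighted_bessel_prod_le:
  fixes n :: "int ^ ('n::finite)"
  assumes "0 < k" "k \<le> CARD('n)" "continuous_on {0..X} w" "\<And>t. t \<in> {0..X} \<Longrightarrow> w t \<ge> 0"
    and "\<And>m. integral {0..X} (\<lambda>t. w t * \<bar>bessel m t\<bar> ^ k) \<le> B"
  shows "integral {0..X} (\<lambda>t. w t * \<bar>bessel_prod n t\<bar>) \<le> B"
proof -
  have "integral {0..X} (\<lambda>t. w t * \<bar>bessel_prod n t\<bar>)
      \<le> integral {0..X} (\<lambda>t. (\<Sum>i\<in>UNIV. w t * \<bar>bessel (n $ i) t\<bar> ^ k) / CARD('n))"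
  proof (rule integral_le)
    fix t assume "t \<in> {0..X}"
    then show "w t * \<bar>bessel_prod n t\<bar> \<le> (\<Sum>i\<in>UNIV. w t * \<bar>bessel (n $ i) t\<bar> ^ k) / CARD('n)"
      using mult_left_mono[OF abs_bessel_prod_le[OF assms(1,2), of n t] assms(4)[of t]]
      by (simp add: sum_distrib_left)
  qed (use assms(3) in \<open>auto intro!: integrable_continuous_interval continuous_intros\<close>)
  also have "\<dots> = (\<Sum>i\<in>UNIV. integral {0..X} (\<lambda>t. w t * \<bar>bessel (n $ i) t\<bar> ^ k)) / CARD('n)"
    using assms(3) by (simp add: integral_sum integrable_continuous_interval continuous_intros)
  also have "\<dots> \<le> (\<Sum>i\<in>(UNIV::'n set). B) / CARD('n)"
    using assms(5) by (intro divide_right_mono sum_mono) auto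
  also have "\<dots> = B" by simp
  finally show ?thesis .
qed

lemma integral_bessel_prod_le:
  assumes "0 \<le> X" "3 \<le> CARD('n)"
  shows "integral {0..X} (\<lambda>t. \<bar>bessel_prod (n :: int ^ ('n::finite)) t\<bar>) \<le> 3"
proof -
  have "integral {0..X} (\<lambda>t. 1 * \<bar>bessel_prod n t\<bar>) \<le> 3"
  proof (rule integral_weighted_bessel_prod_le[OF _ assms(2)])
    show "integral {0..X} (\<lambda>t. 1 * \<bar>bessel m t\<bar> ^ 3) \<le> 3" for m
      using integral_bessel_cubed_le[OF assms(1), of m] by simp
  qed auto
  then show ?thesis by simp
qed

lemma integral_min_bessel_prod_le:
  assumes "0 \<le> X" "\<epsilon> > 0" "0 < r" "r \<le> 3" "2 + r \<le> CARD('n)"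
  shows "integral {0..X} (\<lambda>t. min 1 (\<epsilon> * t) * \<bar>bessel_prod (n :: int ^ ('n::finite)) t\<bar>) \<le> (3 ^ r + 6 / real r) * \<epsilon> powr (real r / 3)"
proof (rule integral_weighted_bessel_prod_le[OF _ assms(5)])
  show "continuous_on {0..X} (\<lambda>t. min 1 (\<epsilon> * t))" by (intro continuous_intros)
  show "min 1 (\<epsilon> * t) \<ge> 0" if "t \<in> {0..X}" for t using that assms(2) by simp
  show "integral {0..X} (\<lambda>t. min 1 (\<epsilon> * t) * \<bar>bessel m t\<bar> ^ (2 + r)) \<le> (3 ^ r + 6 / real r) * \<epsilon> powr (real r / 3)" for m
    by (rule integral_min_bessel_power_le[OF assms(1-4)])
qed simp

section \<open>Square-summable sequences and the Laplacian\<close>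

definition sq_norm :: "('n::finite) seq \<Rightarrow> real" where
  "sq_norm f = (\<Sum>\<^sub>\<infinity>n. (cmod (f n))\<^sup>2)"

lemma sum_le_sq_norm: "f \<in> l2 \<Longrightarrow> finite F \<Longrightarrow> (\<Sum>n\<in>F. (cmod (f n))\<^sup>2) \<le> sq_norm f"
  unfolding sq_norm_def l2_def by (intro finite_sum_le_infsum) auto

lemma sq_norm_nonneg: "sq_norm f \<ge> 0"
  unfolding sq_norm_def by (intro infsum_nonneg) auto

lemma cmod_le_sq_norm: "f \<in> l2 \<Longrightarrow> (cmod (f n))\<^sup>2 \<le> sq_norm f"
  using sum_le_sq_norm[of f "{n}"] by simp

lemma l2I:
  assumes "\<And>F. finite F \<Longrightarrow> (\<Sum>n\<in>F. (cmod (f n))\<^sup>2) \<le> C"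
  shows "f \<in> l2" "sq_norm f \<le> C"
proof -
  have s: "(\<lambda>n. (cmod (f n))\<^sup>2) summable_on UNIV"
    by (rule nonneg_bdd_above_summable_on) (use assms in \<open>auto simp: bdd_above_def\<close>)
  then show "f \<in> l2" by (simp add: l2_def)
  show "sq_norm f \<le> C" unfolding sq_norm_def by (rule infsum_le_finite_sums[OF s]) (use assms in auto)
qed

lemma sq_norm_eq_0: "f \<in> l2 \<Longrightarrow> sq_norm f = 0 \<Longrightarrow> f n = 0"
  using cmod_le_sq_norm[of f n] by simp

lemma l2_reindex:
  assumes "bij h" "f \<in> l2"
  shows "(\<lambda>n. f (h n)) \<in> l2" "sq_norm (\<lambda>n. f (h n)) = sq_norm f"
  using summable_on_reindex_bij_betw[OF assms(1), of "\<lambda>n. (cmod (f n))\<^sup>2"]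
    infsum_reindex_bij_betw[OF assms(1), of "\<lambda>n. (cmod (f n))\<^sup>2"] assms(2)
  by (auto simp: l2_def sq_norm_def)

lemma bij_translate: "bij (\<lambda>n::int ^ ('n::finite). n + a)" "bij (\<lambda>n::int ^ 'n. a - n)" "bij (\<lambda>n::int ^ 'n. n - a)"
  by (intro bij_betw_byWitness[where f' = "\<lambda>n. n - a"] bij_betw_byWitness[where f' = "\<lambda>n. a - n"]
      bij_betw_byWitness[where f' = "\<lambda>n. n + a"]; auto)+

lemma l2_cmult: "f \<in> l2 \<Longrightarrow> (\<lambda>n. c * f n) \<in> l2"
  by (auto simp: l2_def norm_mult power_mult_distrib intro: summable_on_cmult_right)

lemma l2_cnj: "f \<in> l2 \<Longrightarrow> (\<lambda>n. cnj (f n)) \<in> l2"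
  by (simp add: l2_def)

lemma sq_norm_cnj: "sq_norm (\<lambda>n. cnj (f n)) = sq_norm f"
  by (simp add: sq_norm_def)

lemma l2_add:
  assumes "f \<in> l2" "g \<in> l2"
  shows "(\<lambda>n. f n + g n) \<in> l2"
proof (rule l2I(1))
  fix F :: "(int ^ 'a) set" assume F: "finite F"
  have "(cmod (f n + g n))\<^sup>2 \<le> 2 * (cmod (f n))\<^sup>2 + 2 * (cmod (g n))\<^sup>2" for n
  proof -
    have "(cmod (f n + g n))\<^sup>2 \<le> (cmod (f n) + cmod (g n))\<^sup>2" by (intro power_mono norm_triangle_ineq) auto
    also have "\<dots> \<le> 2 * (cmod (f n))\<^sup>2 + 2 * (cmod (g n))\<^sup>2"
      using sum_squares_bound[of "cmod (f n)" "cmod (g n)"] by (simp add: power2_sum)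
    finally show ?thesis .
  qed
  then have "(\<Sum>n\<in>F. (cmod (f n + g n))\<^sup>2) \<le> (\<Sum>n\<in>F. 2 * (cmod (f n))\<^sup>2 + 2 * (cmod (g n))\<^sup>2)"
    by (rule sum_mono)
  also have "\<dots> = 2 * (\<Sum>n\<in>F. (cmod (f n))\<^sup>2) + 2 * (\<Sum>n\<in>F. (cmod (g n))\<^sup>2)"
    by (simp add: sum.distrib sum_distrib_left)
  also have "\<dots> \<le> 2 * sq_norm f + 2 * sq_norm g"
    using sum_le_sq_norm[OF assms(1) F] sum_le_sq_norm[OF assms(2) F] by simp
  finally show "(\<Sum>n\<in>F. (cmod (f n + g n))\<^sup>2) \<le> 2 * sq_norm f + 2 * sq_norm g" .
qed

lemma l2_diff: "f \<in> l2 \<Longrightarrow> g \<in> l2 \<Longrightarrow> (\<lambda>n. f n - g n) \<in> l2"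
  using l2_add[of f "\<lambda>n. (-1) * g n"] l2_cmult[of g "-1"] by simp

lemma l2_sum: "finite I \<Longrightarrow> (\<And>i. i \<in> I \<Longrightarrow> f i \<in> l2) \<Longrightarrow> (\<lambda>n. \<Sum>i\<in>I. f i n) \<in> l2"
proof (induction I rule: finite_induct)
  case empty
  then show ?case by (simp add: l2_def)
qed (auto intro: l2_add)

lemma infsum_nonneg_cauchy_schwarz:
  fixes a b :: "'a \<Rightarrow> real"
  assumes "(\<lambda>n. (a n)\<^sup>2) summable_on A" "(\<lambda>n. (b n)\<^sup>2) summable_on A" "\<And>n. a n \<ge> 0" "\<And>n. b n \<ge> 0"
  shows "(\<lambda>n. a n * b n) summable_on A"
    "(\<Sum>\<^sub>\<infinity>n\<in>A. a n * b n) \<le> sqrt (\<Sum>\<^sub>\<infinity>n\<in>A. (a n)\<^sup>2) * sqrt (\<Sum>\<^sub>\<infinity>n\<in>A. (b n)\<^sup>2)"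
proof -
  have *: "(\<Sum>n\<in>F. a n * b n) \<le> sqrt (\<Sum>\<^sub>\<infinity>n\<in>A. (a n)\<^sup>2) * sqrt (\<Sum>\<^sub>\<infinity>n\<in>A. (b n)\<^sup>2)" if F: "finite F" "F \<subseteq> A" for F
  proof -
    have "(\<Sum>n\<in>F. a n * b n) \<le> L2_set a F * L2_set b F"
      using L2_set_mult_ineq[of a b F] assms by (simp add: abs_of_nonneg)
    also have "\<dots> \<le> sqrt (\<Sum>\<^sub>\<infinity>n\<in>A. (a n)\<^sup>2) * sqrt (\<Sum>\<^sub>\<infinity>n\<in>A. (b n)\<^sup>2)"
      unfolding L2_set_def using assms F
      by (intro mult_mono real_sqrt_le_mono finite_sum_le_infsum) (auto intro!: sum_nonneg infsum_nonneg)
    finally show ?thesis .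
  qed
  show s: "(\<lambda>n. a n * b n) summable_on A"
    by (rule nonneg_bdd_above_summable_on) (use assms * in \<open>auto simp: bdd_above_def intro!: exI\<close>)
  show "(\<Sum>\<^sub>\<infinity>n\<in>A. a n * b n) \<le> sqrt (\<Sum>\<^sub>\<infinity>n\<in>A. (a n)\<^sup>2) * sqrt (\<Sum>\<^sub>\<infinity>n\<in>A. (b n)\<^sup>2)"
    by (rule infsum_le_finite_sums[OF s]) (use * in auto)
qed

lemma l2_mult_summable:
  assumes "f \<in> l2" "g \<in> l2"
  shows "(\<lambda>n. cmod (f n * g n)) summable_on UNIV" "(\<lambda>n. f n * g n) summable_on UNIV"
    "(\<Sum>\<^sub>\<infinity>n. cmod (f n * g n)) \<le> sqrt (sq_norm f) * sqrt (sq_norm g)"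
    "cmod (\<Sum>\<^sub>\<infinity>n. f n * g n) \<le> sqrt (sq_norm f) * sqrt (sq_norm g)"
proof -
  note cs = infsum_nonneg_cauchy_schwarz[of "\<lambda>n. cmod (f n)" UNIV "\<lambda>n. cmod (g n)", folded norm_mult]
  show 1: "(\<lambda>n. cmod (f n * g n)) summable_on UNIV" by (rule cs(1)) (use assms in \<open>auto simp: l2_def\<close>)
  then show "(\<lambda>n. f n * g n) summable_on UNIV" by (rule abs_summable_summable)
  show 2: "(\<Sum>\<^sub>\<infinity>n. cmod (f n * g n)) \<le> sqrt (sq_norm f) * sqrt (sq_norm g)"
    unfolding sq_norm_def by (rule cs(2)) (use assms in \<open>auto simp: l2_def\<close>)
  show "cmod (\<Sum>\<^sub>\<infinity>n. f n * g n) \<le> sqrt (sq_norm f) * sqrt (sq_norm g)"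
    using norm_infsum_bound[OF 1] 2 by linarith
qed

lemma has_sum_finite_sum:
  fixes f :: "'i \<Rightarrow> 'a \<Rightarrow> 'b :: {topological_comm_monoid_add, t2_space}"
  assumes "finite I" "\<And>i. i \<in> I \<Longrightarrow> f i summable_on A"
  shows "((\<lambda>n. \<Sum>i\<in>I. f i n) has_sum (\<Sum>i\<in>I. infsum (f i) A)) A"
  using assms by (induction I rule: finite_induct) (auto intro!: has_sum_add)

lemmas infsum_finite_sum = has_sum_finite_sum[THEN infsumI]
  and summable_on_finite_sum = has_sum_finite_sum[THEN has_sum_imp_summable]

section \<open>Lattice neighbours and the symmetry of the Laplacian\<close>

definition steps :: "(int ^ ('n::finite)) set" where
  "steps = (\<lambda>(i, s). axis i s) ` (UNIV \<times> {1, -1})"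

lemma finite_steps: "finite (steps :: (int ^ ('n::finite)) set)"
  by (simp add: steps_def)

lemma card_steps_le: "card (steps :: (int ^ ('n::finite)) set) \<le> 2 * CARD('n)"
proof -
  have "card (steps :: (int ^ 'n) set) \<le> card ((UNIV :: 'n set) \<times> {1, -1 :: int})"
    unfolding steps_def by (rule card_image_le) simp
  then show ?thesis by (simp add: card_cartesian_product)
qed

lemma uminus_axis: "- axis i (s :: int) = axis i (- s)"
  by (simp add: Finite_Cartesian_Product.vec_eq_iff axis_def)

lemma uminus_steps: "uminus ` steps = (steps :: (int ^ ('n::finite)) set)"
proof -
  have "e \<in> steps \<Longrightarrow> - e \<in> steps" for e :: "int ^ 'n"
    by (auto simp: steps_def uminus_axis image_iff)
  then show ?thesis by (metis (mono_tags, lifting) image_subsetI minus_minus rev_image_eqI subset_antisym subsetI)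
qed

text \<open>A nonzero integer coordinate already contributes at least 1, so it is the only one and
  equals 1 or -1.\<close>

lemma int_squares_sum_eq_1:
  fixes k :: "int ^ ('n::finite)"
  assumes "(\<Sum>i\<in>UNIV. (k $ i)\<^sup>2) = 1"
  shows "k \<in> steps"
proof -
  have "\<exists>i. k $ i \<noteq> 0"
  proof (rule ccontr)
    assume "\<not> ?thesis"
    then show False using assms by simp
  qed
  then obtain i where i: "k $ i \<noteq> 0" by blast
  have *: "(k $ i)\<^sup>2 + (\<Sum>j\<in>UNIV - {i}. (k $ j)\<^sup>2) = 1"
    using assms by (simp add: sum.remove[of UNIV i])
  have nn: "(\<Sum>j\<in>UNIV - {i}. (k $ j)\<^sup>2) \<ge> 0" by (intro sum_nonneg) auto
  moreover have "(k $ i)\<^sup>2 \<ge> 1" using i by (simp add: int_one_le_iff_zero_less)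
  ultimately have 1: "(k $ i)\<^sup>2 = 1" "(\<Sum>j\<in>UNIV - {i}. (k $ j)\<^sup>2) = 0" using * by linarith+
  then have "\<forall>j\<in>UNIV - {i}. (k $ j)\<^sup>2 = 0" by (subst (asm) sum_nonneg_eq_0_iff) auto
  then have "k = axis i (k $ i)" by (auto simp: Finite_Cartesian_Product.vec_eq_iff axis_def)
  moreover have "k $ i = 1 \<or> k $ i = -1" using 1(1) by (simp add: power2_eq_1_iff)
  ultimately show ?thesis unfolding steps_def by (metis (mono_tags, lifting) SigmaI UNIV_I case_prod_conv imageI insert_iff)
qed

lemma neighbours_eq: "neighbours n = (\<lambda>e. n + e) ` (steps :: (int ^ ('n::finite)) set)"
proof -
  have "norm (\<chi> i. real_of_int (n $ i - m $ i)) = 1 \<longleftrightarrow> m - n \<in> steps" for m :: "int ^ 'n"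
  proof -
    have "norm (\<chi> i. real_of_int (n $ i - m $ i)) = 1 \<longleftrightarrow> (\<Sum>i\<in>UNIV. (real_of_int (n $ i - m $ i))\<^sup>2) = 1"
      by (simp add: norm_vec_def L2_set_def)
    also have "\<dots> \<longleftrightarrow> (\<Sum>i\<in>UNIV. ((m - n) $ i)\<^sup>2) = 1"
    proof -
      have "(\<Sum>i\<in>UNIV. (real_of_int (n $ i - m $ i))\<^sup>2) = real_of_int (\<Sum>i\<in>UNIV. ((m - n) $ i)\<^sup>2)"
        by (simp add: power2_commute)
      then show ?thesis by (metis of_int_eq_1_iff)
    qed
    also have "\<dots> \<longleftrightarrow> m - n \<in> steps"
    proof
      assume "m - n \<in> steps"
      then obtain i s where e: "m - n = axis i s" "s = 1 \<or> s = -1" by (auto simp: steps_def)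
      have "(\<Sum>j\<in>UNIV. (axis i s $ j)\<^sup>2) = (\<Sum>j\<in>UNIV. if j = i then s\<^sup>2 else 0)"
        by (intro sum.cong) (auto simp: axis_def)
      then show "(\<Sum>i\<in>UNIV. ((m - n) $ i)\<^sup>2) = 1" unfolding e(1) using e(2) by auto
    qed (rule int_squares_sum_eq_1)
    finally show ?thesis .
  qed
  moreover have "m - n \<in> steps \<longleftrightarrow> m \<in> (\<lambda>e. n + e) ` steps" for m :: "int ^ 'n"
    by (auto simp: image_iff intro: bexI[of _ "m - n"])
  ultimately show ?thesis unfolding neighbours_def by blast
qed

lemma laplacian_eq: "laplacian f n = (\<Sum>e\<in>steps. f (n + e)) / 2"
  unfolding laplacian_def neighbours_eq by (simp add: sum.reindex)

lemma l2_laplacian: "f \<in> l2 \<Longrightarrow> laplacian f \<in> l2"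
proof -
  assume "f \<in> l2"
  then have "(\<lambda>n. \<Sum>e\<in>steps. f (n + e)) \<in> l2"
    by (intro l2_sum finite_steps l2_reindex(1)[OF bij_translate(1)])
  from l2_cmult[OF this, of "1/2"] show ?thesis by (simp add: laplacian_eq[abs_def])
qed

lemma laplacian_diff: "laplacian (\<lambda>n. f n - g n) n = laplacian f n - laplacian g n"
  by (simp add: laplacian_eq sum_subtractf diff_divide_distrib)

lemma laplacian_cnj: "laplacian (\<lambda>n. cnj (f n)) n = cnj (laplacian f n)"
  by (simp add: laplacian_eq)

lemma sum_uminus_steps: "(\<Sum>e\<in>steps. f (- e)) = (\<Sum>e\<in>steps. f (e :: int ^ ('n::finite)))"
  using sum.reindex[of uminus steps f] by (simp add: uminus_steps o_def)

lemma laplacian_symmetric: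
  assumes "f \<in> l2" "g \<in> l2"
  shows "(\<Sum>\<^sub>\<infinity>n. laplacian f n * g n) = (\<Sum>\<^sub>\<infinity>n. f n * laplacian g n)"
proof -
  have s: "(\<lambda>n. f (n + e) * g n) summable_on UNIV" "(\<lambda>n. f n * g (n + e)) summable_on UNIV" for e
    using l2_mult_summable(2) l2_reindex(1)[OF bij_translate(1)] assms by blast+
  have sh: "(\<Sum>\<^sub>\<infinity>n. f (n + e) * g n) = (\<Sum>\<^sub>\<infinity>n. f n * g (n + - e))" for e
    using infsum_reindex_bij_betw[OF bij_translate(1)[of e], of "\<lambda>n. f n * g (n + - e)"] by simp
  have "(\<Sum>\<^sub>\<infinity>n. laplacian f n * g n) = (\<Sum>\<^sub>\<infinity>n. (1/2) * (\<Sum>e\<in>steps. f (n + e) * g n))"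
    by (simp add: laplacian_eq sum_distrib_right)
  also have "\<dots> = (1/2) * (\<Sum>e\<in>steps. \<Sum>\<^sub>\<infinity>n. f (n + e) * g n)"
    by (simp only: infsum_cmult_right' infsum_finite_sum[OF finite_steps s(1)])
  also have "(\<Sum>e\<in>steps. \<Sum>\<^sub>\<infinity>n. f (n + e) * g n) = (\<Sum>e\<in>steps. \<Sum>\<^sub>\<infinity>n. f n * g (n + - e))"
    by (simp only: sh)
  also have "\<dots> = (\<Sum>e\<in>steps. \<Sum>\<^sub>\<infinity>n. f n * g (n + e))" by (rule sum_uminus_steps)
  also have "(1/2) * \<dots> = (\<Sum>\<^sub>\<infinity>n. (1/2) * (\<Sum>e\<in>steps. f n * g (n + e)))"
    by (simp only: infsum_cmult_right' infsum_finite_sum[OF finite_steps s(2)])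
  also have "\<dots> = (\<Sum>\<^sub>\<infinity>n. f n * laplacian g n)"
    by (simp add: laplacian_eq sum_distrib_left[symmetric])
  finally show ?thesis .
qed

section \<open>Uniqueness of Green's functions; the free resolvent as a convolution\<close>

definition off_spectrum :: "'n::finite itself \<Rightarrow> complex set" where
  "off_spectrum _ = - (complex_of_real ` {- real CARD('n)..real CARD('n)})"

definition is_green :: "complex \<Rightarrow> ('n::finite) seq \<Rightarrow> bool" where
  "is_green lam g \<longleftrightarrow> g \<in> l2 \<and> (\<forall>n. laplacian g n - lam * g n = (if n = 0 then 1 else 0))"

lemma infsum_mult_cnj: "f \<in> l2 \<Longrightarrow> (\<Sum>\<^sub>\<infinity>n. f n * cnj (f n)) = of_real (sq_norm f)"
  unfolding sq_norm_def complex_norm_square[symmetric] l2_def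
  by (intro infsumI has_sum_of_real has_sum_infsum) simp

lemma infsum_diff:
  fixes f g :: "'a \<Rightarrow> 'b :: {topological_ab_group_add, t2_space}"
  assumes "f summable_on A" "g summable_on A"
  shows "(\<Sum>\<^sub>\<infinity>x\<in>A. f x - g x) = infsum f A - infsum g A"
  using infsum_add[OF assms(1) summable_on_uminus[THEN iffD2, OF assms(2)]] by (simp add: infsum_uminus)

lemma cnj_form_laplacian:
  assumes "f \<in> l2"
  shows "Im (\<Sum>\<^sub>\<infinity>n. laplacian f n * cnj (f n)) = 0"
proof -
  have "(\<Sum>\<^sub>\<infinity>n. laplacian f n * cnj (f n)) = (\<Sum>\<^sub>\<infinity>n. f n * laplacian (\<lambda>m. cnj (f m)) n)"
    by (rule laplacian_symmetric[OF assms l2_cnj[OF assms]])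
  also have "\<dots> = (\<Sum>\<^sub>\<infinity>n. cnj (laplacian f n * cnj (f n)))"
    by (simp add: laplacian_cnj mult.commute)
  also have "\<dots> = cnj (\<Sum>\<^sub>\<infinity>n. laplacian f n * cnj (f n))" by (rule infsum_cnj)
  finally have "Im (\<Sum>\<^sub>\<infinity>n. laplacian f n * cnj (f n)) = - Im (\<Sum>\<^sub>\<infinity>n. laplacian f n * cnj (f n))"
    by (metis cnj.simps(2))
  then show ?thesis by simp
qed

lemma sq_norm_laplacian_form_le:
  fixes f :: "('n::finite) seq"
  assumes "f \<in> l2"
  shows "cmod (\<Sum>\<^sub>\<infinity>n. laplacian f n * cnj (f n)) \<le> real CARD('n) * sq_norm f"
proof -
  have s: "(\<lambda>n. f (n + e) * cnj (f n)) summable_on UNIV" for e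
    using l2_mult_summable(2)[OF l2_reindex(1)[OF bij_translate(1) assms] l2_cnj[OF assms]] .
  have b: "cmod (\<Sum>\<^sub>\<infinity>n. f (n + e) * cnj (f n)) \<le> sq_norm f" for e
    using l2_mult_summable(4)[OF l2_reindex(1)[OF bij_translate(1)[of e] assms] l2_cnj[OF assms]]
    by (simp add: l2_reindex(2)[OF bij_translate(1) assms] sq_norm_cnj sq_norm_nonneg)
  have "(\<Sum>\<^sub>\<infinity>n. laplacian f n * cnj (f n)) = (\<Sum>\<^sub>\<infinity>n. (1/2) * (\<Sum>e\<in>steps. f (n + e) * cnj (f n)))"
    by (simp add: laplacian_eq sum_distrib_right)
  also have "\<dots> = (1/2) * (\<Sum>e\<in>steps. \<Sum>\<^sub>\<infinity>n. f (n + e) * cnj (f n))"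
    by (simp only: infsum_cmult_right' infsum_finite_sum[OF finite_steps s])
  also have "cmod \<dots> \<le> (1/2) * (\<Sum>e\<in>(steps :: (int ^ 'n) set). sq_norm f)"
    unfolding norm_mult by (intro mult_mono order.trans[OF norm_sum] sum_mono b) (auto intro!: sum_nonneg sq_norm_nonneg)
  also have "\<dots> = (1/2) * (real (card (steps :: (int ^ 'n) set)) * sq_norm f)" by simp
  also have "\<dots> \<le> (1/2) * (real (2 * CARD('n)) * sq_norm f)"
    using card_steps_le[where 'n = 'n] by (intro mult_left_mono mult_right_mono of_nat_mono) (auto simp: sq_norm_nonneg)
  finally show ?thesis by simp
qed

text \<open>After pairing with the conjugate of g, both quadratic forms are real. The finite support
  makes the potential term summable, and W = 0 covers the free Laplacian.\<close>

lemma perturbed_eigenvalue_real: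
  fixes g :: "('n::finite) seq" and W :: "int ^ 'n \<Rightarrow> real"
  assumes g: "g \<in> l2" and K: "finite K" "\<And>n. n \<notin> K \<Longrightarrow> W n = 0"
    and eq: "\<And>n. laplacian g n + of_real (W n) * g n = lam * g n"
  shows "Im lam * sq_norm g = 0"
proof -
  have s1: "(\<lambda>n. lam * (g n * cnj (g n))) summable_on UNIV" "(\<lambda>n. laplacian g n * cnj (g n)) summable_on UNIV"
    by (intro summable_on_cmult_right l2_mult_summable(2) g l2_cnj l2_laplacian)+
  have "lam * of_real (sq_norm g) = (\<Sum>\<^sub>\<infinity>n. lam * (g n * cnj (g n)))"
    by (simp only: infsum_cmult_right' infsum_mult_cnj[OF g])
  also have "\<dots> = (\<Sum>\<^sub>\<infinity>n. laplacian g n * cnj (g n) + of_real (W n) * (g n * cnj (g n)))"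
  proof (intro infsum_cong)
    fix n
    have "lam * (g n * cnj (g n)) = (laplacian g n + of_real (W n) * g n) * cnj (g n)" by (simp add: eq)
    then show "lam * (g n * cnj (g n)) = laplacian g n * cnj (g n) + of_real (W n) * (g n * cnj (g n))"
      by (simp add: algebra_simps)
  qed
  also have "\<dots> = (\<Sum>\<^sub>\<infinity>n. laplacian g n * cnj (g n)) + (\<Sum>\<^sub>\<infinity>n. of_real (W n) * (g n * cnj (g n)))"
  proof (rule infsum_add[OF s1(2)])
    have "(\<lambda>n. of_real (W n) * (g n * cnj (g n))) summable_on K" using K(1) by simp
    then show "(\<lambda>n. of_real (W n) * (g n * cnj (g n))) summable_on UNIV"
      by (rule summable_on_cong_neutral[THEN iffD1, rotated -1]) (use K(2) in auto)
  qed
  also have "(\<Sum>\<^sub>\<infinity>n. of_real (W n) * (g n * cnj (g n))) = (\<Sum>n\<in>K. of_real (W n) * (g n * cnj (g n)))"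
    unfolding infsum_finite[OF K(1), symmetric] by (rule infsum_cong_neutral) (use K(2) in auto)
  also have "\<dots> = of_real (\<Sum>n\<in>K. W n * (cmod (g n))\<^sup>2)"
    by (simp add: complex_norm_square del: of_real_power)
  finally have "Im (lam * of_real (sq_norm g)) = Im (\<Sum>\<^sub>\<infinity>n. laplacian g n * cnj (g n)) + Im (of_real (\<Sum>n\<in>K. W n * (cmod (g n))\<^sup>2))"
    by (simp only: plus_complex.sel)
  then show ?thesis using cnj_form_laplacian[OF g] by simp
qed

lemma off_spectrum_iff:
  "lam \<in> off_spectrum TYPE('n::finite) \<longleftrightarrow> Im lam \<noteq> 0 \<or> \<bar>Re lam\<bar> > real CARD('n)"
proof -
  have "lam \<in> complex_of_real ` {- real CARD('n)..real CARD('n)} \<longleftrightarrow> Im lam = 0 \<and> \<bar>Re lam\<bar> \<le> real CARD('n)"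
  proof
    assume "Im lam = 0 \<and> \<bar>Re lam\<bar> \<le> real CARD('n)"
    then have "lam = of_real (Re lam)" "Re lam \<in> {- real CARD('n)..real CARD('n)}" by (auto simp: complex_eq_iff)
    then show "lam \<in> complex_of_real ` {- real CARD('n)..real CARD('n)}" by blast
  qed auto
  then show ?thesis unfolding off_spectrum_def by auto
qed

text \<open>Off the real axis this is symmetry of the Laplacian; on the real axis outside [-d, d] it
  holds because the quadratic form is bounded by d times the squared norm.\<close>

lemma laplacian_no_eigenvalue:
  fixes h :: "('n::finite) seq"
  assumes h: "h \<in> l2" and lam: "lam \<in> off_spectrum TYPE('n)" and eq: "\<And>n. laplacian h n = lam * h n"
  shows "h n = 0"
proof -
  have "Im lam * sq_norm h = 0"
    using perturbed_eigenvalue_real[OF h finite.emptyI, of "\<lambda>_. 0" lam] eq by simp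
  then consider "sq_norm h = 0" | "Im lam = 0" by auto
  then have "sq_norm h = 0"
  proof cases
    case 2
    then have "\<bar>Re lam\<bar> > real CARD('n)" "cmod lam = \<bar>Re lam\<bar>"
      using lam by (auto simp: off_spectrum_iff cmod_def)
    moreover have "cmod lam * sq_norm h \<le> real CARD('n) * sq_norm h"
    proof -
      have "(\<Sum>\<^sub>\<infinity>n. laplacian h n * cnj (h n)) = lam * of_real (sq_norm h)"
        by (simp only: eq mult.assoc infsum_cmult_right' infsum_mult_cnj[OF h])
      then show ?thesis using sq_norm_laplacian_form_le[OF h] by (simp add: norm_mult sq_norm_nonneg)
    qed
    ultimately have "\<not> sq_norm h > 0" using mult_le_cancel_right_pos[of "sq_norm h" "cmod lam" "real CARD('n)"] by linarith
    then show ?thesis using sq_norm_nonneg[of h] by linarith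
  qed
  then show ?thesis by (rule sq_norm_eq_0[OF h])
qed

lemma l2_resolvent_unique:
  fixes g h :: "('n::finite) seq"
  assumes "lam \<in> off_spectrum TYPE('n)" "g \<in> l2" "h \<in> l2"
    and "\<And>n. laplacian g n - lam * g n = f n" "\<And>n. laplacian h n - lam * h n = f n"
  shows "g = h"
proof
  fix n
  have "g n - h n = 0"
  proof (rule laplacian_no_eigenvalue[OF l2_diff[OF assms(2,3)] assms(1)])
    fix m
    have "laplacian g m = f m + lam * g m" "laplacian h m = f m + lam * h m"
      using assms(4,5)[of m] by (metis diff_add_cancel)+
    then show "laplacian (\<lambda>n. g n - h n) m = lam * (g m - h m)"
      unfolding laplacian_diff by (simp add: right_diff_distrib)
  qed
  then show "g n = h n" by simp
qed

text \<open>Uniqueness of l2 solutions off the spectrum is what makes the definite description in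
  \<open>free_resolvent\<close> denote.\<close>

lemma free_resolvent_eqI:
  fixes g :: "('n::finite) seq"
  assumes "lam \<in> off_spectrum TYPE('n)" "g \<in> l2" "\<And>n. laplacian g n - lam * g n = f n"
  shows "free_resolvent lam f = g"
  unfolding free_resolvent_def
proof (rule the_equality)
  show "g \<in> l2 \<and> (\<lambda>n. laplacian g n - lam * g n) = f" using assms by auto
  fix h assume "h \<in> l2 \<and> (\<lambda>n. laplacian h n - lam * h n) = f"
  then show "h = g" using assms by (intro l2_resolvent_unique[OF assms(1)]) auto
qed

text \<open>Pair the equation with the conjugate of g: the Laplacian contributes nothing imaginary,
  the delta contributes the conjugate of g 0. A pointwise bound at the origin thus becomes an l2
  bound of size 1 / Im lam.\<close>

lemma is_green_energy:
  assumes "is_green lam g"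
  shows "Im lam * sq_norm g = Im (g 0)"
proof -
  have g: "g \<in> l2" and eq: "laplacian g n = lam * g n + (if n = 0 then 1 else 0)" for n
    using assms by (auto simp: is_green_def algebra_simps)
  have "(\<Sum>\<^sub>\<infinity>n. laplacian g n * cnj (g n)) = (\<Sum>\<^sub>\<infinity>n. lam * (g n * cnj (g n)) + (if n = 0 then cnj (g 0) else 0))"
    by (intro infsum_cong) (simp add: eq algebra_simps)
  also have "\<dots> = (\<Sum>\<^sub>\<infinity>n. lam * (g n * cnj (g n))) + (\<Sum>\<^sub>\<infinity>n::int ^ 'a. if n = 0 then cnj (g 0) else 0)"
  proof (rule infsum_add)
    show "(\<lambda>n. lam * (g n * cnj (g n))) summable_on UNIV"
      using l2_mult_summable(2)[OF g l2_cnj[OF g]] by (rule summable_on_cmult_right)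
    have "(\<lambda>n::int ^ 'a. if n = 0 then cnj (g 0) else 0) summable_on {0}" by simp
    then show "(\<lambda>n::int ^ 'a. if n = 0 then cnj (g 0) else 0) summable_on UNIV"
      by (rule summable_on_cong_neutral[THEN iffD1, rotated -1]) auto
  qed
  also have "(\<Sum>\<^sub>\<infinity>n::int ^ 'a. if n = 0 then cnj (g 0) else 0) = (\<Sum>\<^sub>\<infinity>n\<in>{0::int ^ 'a}. cnj (g 0))"
    by (rule infsum_cong_neutral) auto
  also have "(\<Sum>\<^sub>\<infinity>n. lam * (g n * cnj (g n))) = lam * of_real (sq_norm g)"
    by (simp only: infsum_cmult_right' infsum_mult_cnj[OF g])
  finally have "Im (\<Sum>\<^sub>\<infinity>n. laplacian g n * cnj (g n)) = Im lam * sq_norm g - Im (g 0)" by simp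
  then show ?thesis using cnj_form_laplacian[OF g] by simp
qed

definition lconv :: "('n::finite) seq \<Rightarrow> 'n seq \<Rightarrow> 'n seq" where
  "lconv g f = (\<lambda>n. \<Sum>\<^sub>\<infinity>m. g (n - m) * f m)"

lemma l2_bounded: "g \<in> l2 \<Longrightarrow> cmod (g n) \<le> sqrt (sq_norm g)"
  using cmod_le_sq_norm[of g n] by (simp add: real_le_rsqrt)

lemma lconv_summable:
  assumes "g \<in> l2" "(\<lambda>m. cmod (f m)) summable_on UNIV"
  shows "(\<lambda>m. cmod (g (n - m) * f m)) summable_on UNIV" "(\<lambda>m. g (n - m) * f m) summable_on UNIV"
proof -
  have "(\<lambda>m. sqrt (sq_norm g) * cmod (f m)) summable_on UNIV"
    using assms(2) by (rule summable_on_cmult_right)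
  then show 1: "(\<lambda>m. cmod (g (n - m) * f m)) summable_on UNIV"
    by (rule summable_on_comparison_test) (auto simp: norm_mult intro!: mult_right_mono l2_bounded assms(1))
  then show "(\<lambda>m. g (n - m) * f m) summable_on UNIV" by (rule abs_summable_summable)
qed

text \<open>Cauchy-Schwarz with weight |f m| bounds the squared modulus of the convolution by the l1
  norm of f times the convolution of |f| with |g|^2; summing over n gives \<open>sq_norm g\<close>
  times the squared l1 norm of f.\<close>

lemma l2_lconv:
  assumes g: "g \<in> l2" and f: "(\<lambda>m. cmod (f m)) summable_on UNIV"
  shows "lconv g f \<in> l2"
proof (rule l2I(1))
  fix F :: "(int ^ 'a) set" assume F: "finite F"
  define L where "L = (\<Sum>\<^sub>\<infinity>m. cmod (f m))"
  have L: "L \<ge> 0" unfolding L_def by (intro infsum_nonneg) auto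
  have sf: "(\<lambda>m. cmod (f m) * (cmod (g (n - m)))\<^sup>2) summable_on UNIV" for n
  proof (rule summable_on_comparison_test)
    show "(\<lambda>m. sq_norm g * cmod (f m)) summable_on UNIV" using f by (rule summable_on_cmult_right)
    show "cmod (f m) * (cmod (g (n - m)))\<^sup>2 \<le> sq_norm g * cmod (f m)" for m
      using mult_left_mono[OF cmod_le_sq_norm[OF g, of "n - m"], of "cmod (f m)"] by (simp add: mult.commute)
  qed auto
  have 1: "(cmod (lconv g f n))\<^sup>2 \<le> L * (\<Sum>\<^sub>\<infinity>m. cmod (f m) * (cmod (g (n - m)))\<^sup>2)" for n
  proof -
    have "cmod (lconv g f n) \<le> (\<Sum>\<^sub>\<infinity>m. cmod (g (n - m) * f m))"
      unfolding lconv_def by (rule norm_infsum_bound[OF lconv_summable(1)[OF g f]])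
    also have "\<dots> = (\<Sum>\<^sub>\<infinity>m. sqrt (cmod (f m)) * (sqrt (cmod (f m)) * cmod (g (n - m))))"
      by (intro infsum_cong) (simp add: norm_mult mult.assoc[symmetric])
    also have "\<dots> \<le> sqrt (\<Sum>\<^sub>\<infinity>m. (sqrt (cmod (f m)))\<^sup>2) * sqrt (\<Sum>\<^sub>\<infinity>m. (sqrt (cmod (f m)) * cmod (g (n - m)))\<^sup>2)"
      by (rule infsum_nonneg_cauchy_schwarz) (use f sf in \<open>auto simp: power_mult_distrib\<close>)
    also have "\<dots> = sqrt (L * (\<Sum>\<^sub>\<infinity>m. cmod (f m) * (cmod (g (n - m)))\<^sup>2))"
      by (simp add: L_def power_mult_distrib real_sqrt_mult)
    finally have "(cmod (lconv g f n))\<^sup>2 \<le> (sqrt (L * (\<Sum>\<^sub>\<infinity>m. cmod (f m) * (cmod (g (n - m)))\<^sup>2)))\<^sup>2"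
      by (intro power_mono) auto
    also have "\<dots> = L * (\<Sum>\<^sub>\<infinity>m. cmod (f m) * (cmod (g (n - m)))\<^sup>2)"
      using L by (intro real_sqrt_pow2 mult_nonneg_nonneg infsum_nonneg) auto
    finally show ?thesis .
  qed
  have "(\<Sum>n\<in>F. (cmod (lconv g f n))\<^sup>2) \<le> (\<Sum>n\<in>F. L * (\<Sum>\<^sub>\<infinity>m. cmod (f m) * (cmod (g (n - m)))\<^sup>2))"
    by (intro sum_mono 1)
  also have "\<dots> = L * (\<Sum>\<^sub>\<infinity>m. \<Sum>n\<in>F. cmod (f m) * (cmod (g (n - m)))\<^sup>2)"
    by (simp add: infsum_finite_sum[OF F sf] sum_distrib_left)
  also have "(\<Sum>\<^sub>\<infinity>m. \<Sum>n\<in>F. cmod (f m) * (cmod (g (n - m)))\<^sup>2) \<le> (\<Sum>\<^sub>\<infinity>m. sq_norm g * cmod (f m))"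
  proof (rule infsum_mono)
    show "(\<lambda>m. \<Sum>n\<in>F. cmod (f m) * (cmod (g (n - m)))\<^sup>2) summable_on UNIV" by (intro summable_on_finite_sum F sf)
    show "(\<lambda>m. sq_norm g * cmod (f m)) summable_on UNIV" using f by (rule summable_on_cmult_right)
    fix m
    have "(\<Sum>n\<in>F. (cmod (g (n - m)))\<^sup>2) \<le> sq_norm g"
      using sum_le_sq_norm[OF l2_reindex(1)[OF bij_translate(3)[of m] g] F] by (simp add: l2_reindex(2)[OF bij_translate(3) g])
    then show "(\<Sum>n\<in>F. cmod (f m) * (cmod (g (n - m)))\<^sup>2) \<le> sq_norm g * cmod (f m)"
      unfolding sum_distrib_left[symmetric] mult.commute[of "sq_norm g"] by (rule mult_left_mono) simp
  qed
  also have "\<dots> = sq_norm g * L" by (simp add: L_def infsum_cmult_right')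
  finally show "(\<Sum>n\<in>F. (cmod (lconv g f n))\<^sup>2) \<le> L * (sq_norm g * L)"
    using L by (simp add: mult_left_mono)
qed

lemma laplacian_lconv:
  assumes "g \<in> l2" "(\<lambda>m. cmod (f m)) summable_on UNIV"
  shows "laplacian (lconv g f) n = (\<Sum>\<^sub>\<infinity>m. laplacian g (n - m) * f m)"
proof -
  have s: "(\<lambda>m. g (n + e - m) * f m) summable_on UNIV" for e by (rule lconv_summable(2)[OF assms])
  have "laplacian (lconv g f) n = (1/2) * (\<Sum>e\<in>steps. \<Sum>\<^sub>\<infinity>m. g (n + e - m) * f m)"
    by (simp add: laplacian_eq lconv_def)
  also have "\<dots> = (\<Sum>\<^sub>\<infinity>m. (1/2) * (\<Sum>e\<in>steps. g (n + e - m) * f m))"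
    by (simp only: infsum_cmult_right' infsum_finite_sum[OF finite_steps s])
  also have "\<dots> = (\<Sum>\<^sub>\<infinity>m. laplacian g (n - m) * f m)"
  proof (intro infsum_cong)
    fix m
    show "(1/2) * (\<Sum>e\<in>steps. g (n + e - m) * f m) = laplacian g (n - m) * f m"
      by (simp add: laplacian_eq sum_distrib_right[symmetric] diff_add_eq)
  qed
  finally show ?thesis .
qed

text \<open>Absolute summability of f makes the convolution converge and land in l2; unit sequences
  and the columns of the kernels met later are of this kind.\<close>

lemma free_resolvent_lconv:
  fixes g :: "('n::finite) seq"
  assumes lam: "lam \<in> off_spectrum TYPE('n)" and g: "is_green lam g" and f: "(\<lambda>m. cmod (f m)) summable_on UNIV"
  shows "free_resolvent lam f = lconv g f"
proof (rule free_resolvent_eqI[OF lam])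
  have g2: "g \<in> l2" using g by (simp add: is_green_def)
  show "lconv g f \<in> l2" by (rule l2_lconv[OF g2 f])
  fix n
  have s: "(\<lambda>m. g (n - m) * f m) summable_on UNIV" "(\<lambda>m. laplacian g (n - m) * f m) summable_on UNIV"
    using lconv_summable(2)[OF g2 f] lconv_summable(2)[OF l2_laplacian[OF g2] f] by auto
  have "laplacian (lconv g f) n - lam * lconv g f n
      = (\<Sum>\<^sub>\<infinity>m. laplacian g (n - m) * f m) - (\<Sum>\<^sub>\<infinity>m. lam * (g (n - m) * f m))"
    by (simp only: laplacian_lconv[OF g2 f] infsum_cmult_right') (simp only: lconv_def)
  also have "\<dots> = (\<Sum>\<^sub>\<infinity>m. laplacian g (n - m) * f m - lam * (g (n - m) * f m))"
    using s by (intro infsum_diff[symmetric] summable_on_cmult_right)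
  also have "\<dots> = (\<Sum>\<^sub>\<infinity>m. (laplacian g (n - m) - lam * g (n - m)) * f m)" by (simp add: algebra_simps)
  also have "\<dots> = (\<Sum>\<^sub>\<infinity>m. if m = n then f n else 0)"
    using g by (intro infsum_cong) (auto simp: is_green_def)
  also have "\<dots> = (\<Sum>\<^sub>\<infinity>m\<in>{n}. f n)" by (rule infsum_cong_neutral) auto
  finally show "laplacian (lconv g f) n - lam * lconv g f n = f n" by simp
qed

section \<open>Green's functions\<close>

text \<open>The Laplacian has symbol cos in each coordinate, and the Fourier coefficients of exp (-
  \<i> t cos) are (- \<i>)^n J_n t; the phases of all coordinates are collected here.\<close>

definition bessel_phase :: "int ^ ('n::finite) \<Rightarrow> complex" where
  "bessel_phase n = (- \<i>) powi (\<Sum>i\<in>UNIV. n $ i)"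

text \<open>The kernel of \<open>exp (- \<i> t \<Delta>)\<close>, a product of one-dimensional kernels.\<close>

definition propagator :: "int ^ ('n::finite) \<Rightarrow> real \<Rightarrow> complex" where
  "propagator n t = bessel_phase n * of_real (bessel_prod n t)"

lemma cmod_bessel_phase [simp]: "cmod (bessel_phase n) = 1"
  by (simp add: bessel_phase_def norm_power_int)

lemma cmod_propagator: "cmod (propagator n t) = \<bar>bessel_prod n t\<bar>"
  by (simp add: propagator_def norm_mult)

lemma abs_bessel_prod_le_1: "\<bar>bessel_prod n t\<bar> \<le> 1"
  unfolding bessel_prod_def abs_prod by (intro prod_le_1) (auto simp: abs_bessel_le_1)

lemma propagator_0: "propagator n 0 = (if n = 0 then 1 else 0)"
proof (cases "n = 0")
  case False
  then obtain i where "n $ i \<noteq> 0" by (auto simp: Finite_Cartesian_Product.vec_eq_iff)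
  then have "bessel_prod n 0 = 0" unfolding bessel_prod_def by (intro prod_zero) (auto simp: bessel_at_0 intro!: bexI[of _ i])
  then show ?thesis using False by (simp add: propagator_def)
qed (simp add: propagator_def bessel_phase_def bessel_prod_def bessel_at_0)

lemma steps_sum: "(\<Sum>e\<in>steps. f e) = (\<Sum>i\<in>(UNIV :: ('n::finite) set). f (axis i 1) + f (axis i (- 1)))"
proof -
  have inj: "inj_on (\<lambda>(i :: 'n, s :: int). axis i s) (UNIV \<times> {1, -1})"
    by (auto simp: inj_on_def axis_eq_axis)
  have "(\<Sum>e\<in>steps. f e) = (\<Sum>(i, s)\<in>(UNIV :: 'n set) \<times> {1, -1}. f (axis i s))"
    unfolding steps_def by (subst sum.reindex[OF inj]) (auto intro!: sum.cong)
  also have "\<dots> = (\<Sum>i\<in>(UNIV :: 'n set). \<Sum>s\<in>{1, -1}. f (axis i s))" by (rule sum.cartesian_product[symmetric])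
  finally show ?thesis by simp
qed

lemma bessel_phase_step:
  "bessel_phase (n + axis i 1) = - \<i> * bessel_phase n" "bessel_phase (n + axis i (- 1)) = \<i> * bessel_phase n"
proof -
  have "(\<Sum>j\<in>UNIV. axis i s $ j) = (s::int)" for s
    by (simp add: axis_def)
  then have s: "(\<Sum>j\<in>UNIV. (n + axis i s) $ j) = (\<Sum>j\<in>UNIV. n $ j) + s" for s by (simp add: sum.distrib)
  show "bessel_phase (n + axis i 1) = - \<i> * bessel_phase n" "bessel_phase (n + axis i (- 1)) = \<i> * bessel_phase n"
    unfolding bessel_phase_def s by (simp_all add: power_int_add power_int_diff power_int_minus divide_inverse mult.commute)
qed

lemma bessel_prod_has_derivative:
  "(bessel_prod n has_real_derivative (\<Sum>i\<in>UNIV. bessel_prod (n + axis i (- 1)) t - bessel_prod (n + axis i 1) t) / 2) (at t)"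
proof -
  have "((\<lambda>t. \<Prod>i\<in>UNIV. bessel (n $ i) t) has_real_derivative
     (\<Sum>i\<in>UNIV. (bessel (n $ i - 1) t - bessel (n $ i + 1) t) / 2 * (\<Prod>j\<in>UNIV - {i}. bessel (n $ j) t))) (at t)"
    by (rule has_field_derivative_prod) (rule bessel_has_field_derivative)
  moreover have "bessel_prod (n + axis i s) t = bessel (n $ i + s) t * (\<Prod>j\<in>UNIV - {i}. bessel (n $ j) t)" for i s
    unfolding bessel_prod_def by (subst prod.remove[of UNIV i]) (auto simp: axis_def intro!: prod.cong)
  ultimately show ?thesis
    by (simp add: bessel_prod_def[abs_def] sum_divide_distrib algebra_simps diff_divide_distrib)
qed

text \<open>J_n' is half the difference of its neighbours, and the phases - \<i> and \<i> of the two
  neighbouring sites turn this difference into the sum of the Laplacian.\<close>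

lemma propagator_has_vector_derivative:
  "(propagator n has_vector_derivative (- \<i> * laplacian (\<lambda>m. propagator m t) n)) (at t)"
proof -
  have "(propagator n has_vector_derivative bessel_phase n * of_real ((\<Sum>i\<in>UNIV. bessel_prod (n + axis i (- 1)) t - bessel_prod (n + axis i 1) t) / 2)) (at t)"
    unfolding propagator_def[abs_def]
    by (intro has_vector_derivative_mult_right has_vector_derivative_of_real)
       (use bessel_prod_has_derivative[of n t] in \<open>simp add: has_real_derivative_iff_has_vector_derivative\<close>)
  moreover have "bessel_phase n * of_real ((\<Sum>i\<in>UNIV. bessel_prod (n + axis i (- 1)) t - bessel_prod (n + axis i 1) t) / 2)
     = - \<i> * laplacian (\<lambda>m. propagator m t) n"
  proof -
    have "- \<i> * laplacian (\<lambda>m. propagator m t) n = (\<Sum>i\<in>UNIV. - \<i> * (propagator (n + axis i 1) t + propagator (n + axis i (-1)) t)) / 2"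
      by (simp add: laplacian_eq steps_sum sum.distrib sum_negf flip: sum_distrib_left)
    also have "\<dots> = (\<Sum>i\<in>UNIV. bessel_phase n * of_real (bessel_prod (n + axis i (- 1)) t - bessel_prod (n + axis i 1) t)) / 2"
      by (intro arg_cong2[where f = "(/)"] sum.cong refl) (simp add: propagator_def bessel_phase_step algebra_simps)
    finally show ?thesis by (simp add: sum_distrib_left)
  qed
  ultimately show ?thesis by simp
qed

lemma continuous_on_propagator [continuous_intros]: "continuous_on A (propagator n)"
  unfolding propagator_def by (intro continuous_intros)

text \<open>Enclose F in a box: over the box the sum factors into one-dimensional sums, each at most
  1.\<close>

lemma sum_bessel_prod_squares_le_1:
  fixes F :: "(int ^ ('n::finite)) set"
  assumes "t \<ge> 0" "finite F"
  shows "(\<Sum>n\<in>F. (bessel_prod n t)\<^sup>2) \<le> 1"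
proof -
  define A where "A = (\<Union>n\<in>F. range (($) n))"
  have A: "finite A" unfolding A_def using assms by auto
  have "(\<Sum>n\<in>F. (bessel_prod n t)\<^sup>2) \<le> (\<Sum>g\<in>PiE UNIV (\<lambda>_::'n. A). \<Prod>i\<in>UNIV. (bessel (g i) t)\<^sup>2)"
  proof -
    have "(\<Sum>n\<in>F. (bessel_prod n t)\<^sup>2) = (\<Sum>g\<in>($) ` F. \<Prod>i\<in>UNIV. (bessel (g i) t)\<^sup>2)"
      by (subst sum.reindex) (auto simp: inj_on_def Finite_Cartesian_Product.vec_eq_iff bessel_prod_def prod_power_distrib)
    also have "\<dots> \<le> (\<Sum>g\<in>PiE UNIV (\<lambda>_::'n. A). \<Prod>i\<in>UNIV. (bessel (g i) t)\<^sup>2)"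
      using A by (intro sum_mono2 finite_PiE) (auto simp: A_def intro!: prod_nonneg)
    finally show ?thesis .
  qed
  also have "\<dots> = (\<Prod>i\<in>(UNIV :: 'n set). \<Sum>a\<in>A. (bessel a t)\<^sup>2)"
    using A by (intro prod_sum_PiE[symmetric]) auto
  also have "\<dots> \<le> 1"
    using sum_bessel_squares_le_1[OF assms(1) A] by (intro prod_le_1) (auto intro!: sum_nonneg)
  finally show ?thesis .
qed

section \<open>Green's function in the upper half plane as an integral over time\<close>

definition time_green :: "real \<Rightarrow> complex \<Rightarrow> int ^ ('n::finite) \<Rightarrow> complex" where
  "time_green X lam n = \<i> * integral {0..X} (\<lambda>t. exp (\<i> * lam * of_real t) * propagator n t)"

lemma time_green_integrable:
  "(\<lambda>t. exp (\<i> * lam * of_real t) * propagator n t) integrable_on {a..b}"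
  by (intro integrable_continuous_interval continuous_intros)

lemma cmod_exp_i: "cmod (exp (\<i> * lam * of_real t)) = exp (- Im lam * t)"
  by simp

text \<open>Integrate the derivative of exp (\<i> lam t) times the propagator over [0, X]. The end
  point 0 produces the delta, the end point X an error that decays for Im lam > 0.\<close>

lemma laplacian_time_green:
  fixes n :: "int ^ ('n::finite)"
  assumes "X \<ge> 0"
  shows "laplacian (time_green X lam) n - lam * time_green X lam n
     = (if n = 0 then 1 else 0) - exp (\<i> * lam * of_real X) * propagator n X"
proof -
  let ?e = "\<lambda>t. exp (\<i> * lam * of_real t)"
  let ?P = "propagator n" and ?D = "\<lambda>t. laplacian (\<lambda>m. propagator m t) n"
  have e: "(?e has_vector_derivative (\<i> * lam * ?e t)) (at t within S)" for t S
  proof -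
    have "((\<lambda>z. exp (\<i> * lam * z)) has_field_derivative (\<i> * lam * exp (\<i> * lam * of_real t))) (at (of_real t))"
      by (auto intro!: derivative_eq_intros)
    from has_vector_derivative_real_field[OF this] show ?thesis
      by (simp add: has_vector_derivative_at_within)
  qed
  have "((\<lambda>t. ?e t * ?P t) has_vector_derivative (?e t * (- \<i> * ?D t) + \<i> * lam * ?e t * ?P t)) (at t within {0..X})" for t
    by (intro has_vector_derivative_mult e has_vector_derivative_at_within[OF propagator_has_vector_derivative])
  then have "((\<lambda>t. ?e t * (- \<i> * ?D t) + \<i> * lam * ?e t * ?P t) has_integral (?e X * ?P X - ?e 0 * ?P 0)) {0..X}"
    using assms by (intro fundamental_theorem_of_calculus) auto
  moreover have "((\<lambda>t. ?e t * (- \<i> * ?D t) + \<i> * lam * ?e t * ?P t) has_integral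
     (- laplacian (time_green X lam) n + lam * time_green X lam n)) {0..X}"
  proof (rule has_integral_add)
    have "((\<lambda>t. ?e t * propagator m t) has_integral integral {0..X} (\<lambda>t. ?e t * propagator m t)) {0..X}" for m :: "int ^ 'n"
      by (intro integrable_integral time_green_integrable)
    note h = this
    from has_integral_mult_right[OF h, of "\<i> * lam" n]
    show "((\<lambda>t. \<i> * lam * ?e t * ?P t) has_integral lam * time_green X lam n) {0..X}"
      by (simp add: time_green_def mult_ac)
    have "((\<lambda>t. \<Sum>e\<in>steps. - \<i> * (?e t * propagator (n + e) t) / 2) has_integral
       (\<Sum>e\<in>steps. - \<i> * integral {0..X} (\<lambda>t. ?e t * propagator (n + e) t) / 2)) {0..X}"
      by (intro has_integral_sum finite_steps has_integral_divide has_integral_mult_right h)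
    then show "((\<lambda>t. ?e t * (- \<i> * ?D t)) has_integral - laplacian (time_green X lam) n) {0..X}"
      by (simp add: laplacian_eq time_green_def sum_distrib_left sum_negf[symmetric] sum_divide_distrib mult_ac)
  qed
  ultimately have "?e X * ?P X - ?e 0 * ?P 0 = - laplacian (time_green X lam) n + lam * time_green X lam n"
    by (rule has_integral_unique)
  then show ?thesis by (simp add: propagator_0 algebra_simps)
qed

lemma time_green_diff_le:
  assumes "0 \<le> X" "X \<le> Y" "Im lam > 0"
  shows "cmod (time_green Y lam n - time_green X lam n) \<le> exp (- Im lam * X) / Im lam"
proof -
  let ?f = "\<lambda>t. exp (\<i> * lam * of_real t) * propagator n t"
  have c: "integral {0..X} ?f + integral {X..Y} ?f = integral {0..Y} ?f"
    by (rule Henstock_Kurzweil_Integration.integral_combine[OF assms(1,2) time_green_integrable])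
  have "time_green Y lam n - time_green X lam n = \<i> * integral {X..Y} ?f"
    unfolding time_green_def c[symmetric] by (simp only: distrib_left add_diff_cancel_left')
  then have "cmod (time_green Y lam n - time_green X lam n) = cmod (integral {X..Y} ?f)" by (simp add: norm_mult)
  also have "\<dots> \<le> integral {X..Y} (\<lambda>t. exp (- Im lam * t))"
  proof (rule integral_norm_bound_integral)
    fix t
    show "cmod (?f t) \<le> exp (- Im lam * t)"
      using mult_left_mono[OF abs_bessel_prod_le_1[of n t], of "exp (- Im lam * t)"]
      by (simp add: norm_mult cmod_propagator del: norm_exp_eq_Re)  (simp add: mult.commute)
  qed (auto intro!: integrable_continuous_interval continuous_intros)
  also have "\<dots> = exp (- Im lam * X) / Im lam - exp (- Im lam * Y) / Im lam"
  proof (rule integral_unique)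
    have "((\<lambda>t. exp (- Im lam * t)) has_integral (- exp (- Im lam * Y) / Im lam - - exp (- Im lam * X) / Im lam)) {X..Y}"
      using assms by (intro fundamental_theorem_of_calculus)
        (auto intro!: derivative_eq_intros simp: has_real_derivative_iff_has_vector_derivative[symmetric])
    then show "((\<lambda>t. exp (- Im lam * t)) has_integral (exp (- Im lam * X) / Im lam - exp (- Im lam * Y) / Im lam)) {X..Y}"
      by simp
  qed
  also have "\<dots> \<le> exp (- Im lam * X) / Im lam" using assms by simp
  finally show ?thesis .
qed

definition upper_green :: "complex \<Rightarrow> int ^ ('n::finite) \<Rightarrow> complex" where
  "upper_green lam n = lim (\<lambda>k. time_green (real k) lam n)"

lemma exp_decay_tendsto: "c > 0 \<Longrightarrow> (\<lambda>k. exp (- c * real k) / c) \<longlonglongrightarrow> 0"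
  by real_asymp

lemma time_green_tendsto:
  assumes "Im lam > 0"
  shows "(\<lambda>k. time_green (real k) lam n) \<longlonglongrightarrow> upper_green lam n"
proof -
  have "Cauchy (\<lambda>k. time_green (real k) lam n)"
  proof (rule metric_CauchyI)
    fix e :: real assume "e > 0"
    then have "eventually (\<lambda>k. exp (- Im lam * real k) / Im lam < e / 2) sequentially"
      by (intro order_tendstoD(2)[OF exp_decay_tendsto[OF assms]]) simp
    then obtain N where N: "\<And>k. k \<ge> N \<Longrightarrow> exp (- Im lam * real k) / Im lam < e / 2"
      unfolding eventually_sequentially by blast
    have "dist (time_green (real m) lam n) (time_green (real N) lam n) < e / 2" if "m \<ge> N" for m
    proof -
      have "dist (time_green (real m) lam n) (time_green (real N) lam n) \<le> exp (- Im lam * real N) / Im lam"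
        unfolding dist_norm by (rule time_green_diff_le) (use that assms in auto)
      also have "\<dots> < e / 2" by (rule N) simp
      finally show ?thesis .
    qed
    then have "dist (time_green (real m) lam n) (time_green (real k) lam n) < e" if "m \<ge> N" "k \<ge> N" for m k
      using that dist_triangle_half_l by blast
    then show "\<exists>M. \<forall>m\<ge>M. \<forall>k\<ge>M. dist (time_green (real m) lam n) (time_green (real k) lam n) < e" by blast
  qed
  then show ?thesis unfolding upper_green_def by (simp add: Cauchy_convergent_iff convergent_LIMSEQ_iff)
qed

lemma upper_green_approx:
  assumes "Im lam > 0"
  shows "cmod (upper_green lam n - time_green (real k) lam n) \<le> exp (- Im lam * real k) / Im lam"
proof (rule Lim_bounded)
  show "(\<lambda>m. cmod (time_green (real m) lam n - time_green (real k) lam n)) \<longlonglongrightarrow> cmod (upper_green lam n - time_green (real k) lam n)"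
    by (intro tendsto_intros time_green_tendsto assms)
  show "\<forall>m\<ge>k. cmod (time_green (real m) lam n - time_green (real k) lam n) \<le> exp (- Im lam * real k) / Im lam"
    by (intro allI impI time_green_diff_le) (use assms in auto)
qed

text \<open>The exponential has modulus at most 1, and the Bessel products are integrable for d
  \<ge> 3; hence the bound is uniform in X and up to the spectrum.\<close>

lemma cmod_time_green_le:
  fixes n :: "int ^ ('n::finite)"
  assumes "X \<ge> 0" "Im lam \<ge> 0" "3 \<le> CARD('n)"
  shows "cmod (time_green X lam n) \<le> 3"
proof -
  let ?f = "\<lambda>t. exp (\<i> * lam * of_real t) * propagator n t"
  have "cmod (integral {0..X} ?f) \<le> integral {0..X} (\<lambda>t. \<bar>bessel_prod n t\<bar>)"
  proof (rule integral_norm_bound_integral)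
    fix t assume "t \<in> {0..X}"
    then show "cmod (?f t) \<le> \<bar>bessel_prod n t\<bar>"
      using assms by (simp add: norm_mult cmod_propagator mult_left_le_one_le)
  qed (auto intro!: integrable_continuous_interval continuous_intros)
  also have "\<dots> \<le> 3" by (rule integral_bessel_prod_le[OF assms(1,3)])
  finally show ?thesis by (simp add: time_green_def norm_mult)
qed

lemma cmod_upper_green_le:
  assumes "Im lam > 0" "3 \<le> CARD('n)"
  shows "cmod (upper_green lam (n :: int ^ ('n::finite))) \<le> 3"
proof (rule Lim_bounded[OF tendsto_norm[OF time_green_tendsto[OF assms(1)]]])
  show "\<forall>k\<ge>0. cmod (time_green (real k) lam n) \<le> 3"
    by (intro allI impI cmod_time_green_le) (use assms in auto)
qed

lemma integral_exp_diff_le: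
  fixes n :: "int ^ ('n::finite)"
  assumes "X \<ge> 0" "c \<ge> 0" "\<epsilon> > 0" "0 < r" "r \<le> 3" "2 + r \<le> CARD('n)"
    and "\<And>t. 0 \<le> t \<Longrightarrow> cmod (exp (\<i> * lam * of_real t) - exp (\<i> * mu * of_real t)) \<le> c * min 1 (\<epsilon> * t)"
  shows "cmod (time_green X lam n - time_green X mu n) \<le> c * ((3 ^ r + 6 / real r) * \<epsilon> powr (real r / 3))"
proof -
  let ?f = "\<lambda>lam t. exp (\<i> * lam * of_real t) * propagator n t"
  have "time_green X lam n - time_green X mu n = \<i> * integral {0..X} (\<lambda>t. ?f lam t - ?f mu t)"
    by (simp add: time_green_def right_diff_distrib integral_diff time_green_integrable)
  then have "cmod (time_green X lam n - time_green X mu n) = cmod (integral {0..X} (\<lambda>t. ?f lam t - ?f mu t))"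
    by (simp add: norm_mult)
  also have "\<dots> \<le> integral {0..X} (\<lambda>t. c * (min 1 (\<epsilon> * t) * \<bar>bessel_prod n t\<bar>))"
  proof (rule integral_norm_bound_integral)
    fix t assume "t \<in> {0..X}"
    then have "cmod (exp (\<i> * lam * of_real t) - exp (\<i> * mu * of_real t)) * \<bar>bessel_prod n t\<bar> \<le> c * min 1 (\<epsilon> * t) * \<bar>bessel_prod n t\<bar>"
      using assms(7)[of t] by (intro mult_right_mono) auto
    then show "cmod (?f lam t - ?f mu t) \<le> c * (min 1 (\<epsilon> * t) * \<bar>bessel_prod n t\<bar>)"
      unfolding left_diff_distrib[symmetric] norm_mult cmod_propagator by (simp only: mult.assoc)
  qed (auto intro!: integrable_continuous_interval continuous_intros)
  also have "\<dots> = c * integral {0..X} (\<lambda>t. min 1 (\<epsilon> * t) * \<bar>bessel_prod n t\<bar>)" by simp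
  also have "\<dots> \<le> c * ((3 ^ r + 6 / real r) * \<epsilon> powr (real r / 3))"
    by (intro mult_left_mono integral_min_bessel_prod_le assms)
  finally show ?thesis .
qed

lemma upper_green_shift_le:
  fixes n :: "int ^ ('n::finite)"
  assumes "Im lam > 0" "\<epsilon> > 0" "0 < r" "r \<le> 3" "2 + r \<le> CARD('n)"
  shows "cmod (upper_green lam n - upper_green (lam + \<i> * of_real \<epsilon>) n) \<le> (3 ^ r + 6 / real r) * \<epsilon> powr (real r / 3)"
proof (rule Lim_bounded)
  show "(\<lambda>k. cmod (time_green (real k) lam n - time_green (real k) (lam + \<i> * of_real \<epsilon>) n)) \<longlonglongrightarrow> cmod (upper_green lam n - upper_green (lam + \<i> * of_real \<epsilon>) n)"
    by (intro tendsto_intros time_green_tendsto) (use assms in auto)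
  have "cmod (exp (\<i> * lam * of_real t) - exp (\<i> * (lam + \<i> * of_real \<epsilon>) * of_real t)) \<le> 1 * min 1 (\<epsilon> * t)" if t: "0 \<le> t" for t
  proof -
    have "exp (\<i> * (lam + \<i> * of_real \<epsilon>) * of_real t) = exp (\<i> * lam * of_real t) * of_real (exp (- \<epsilon> * t))"
      by (simp add: exp_add[symmetric] exp_of_real[symmetric] algebra_simps)
    then have "exp (\<i> * lam * of_real t) - exp (\<i> * (lam + \<i> * of_real \<epsilon>) * of_real t) = exp (\<i> * lam * of_real t) * of_real (1 - exp (- \<epsilon> * t))"
      by (simp add: algebra_simps)
    then have "cmod (exp (\<i> * lam * of_real t) - exp (\<i> * (lam + \<i> * of_real \<epsilon>) * of_real t)) = exp (- Im lam * t) * \<bar>1 - exp (- \<epsilon> * t)\<bar>"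
      by (simp only: norm_mult cmod_exp_i norm_of_real)
    also have "\<dots> \<le> 1 * \<bar>1 - exp (- \<epsilon> * t)\<bar>" using assms t by (intro mult_right_mono) auto
    also have "\<dots> \<le> 1 * min 1 (\<epsilon> * t)"
    proof -
      have "\<epsilon> * t \<ge> 0" using assms(2) t by simp
      then have "exp (- \<epsilon> * t) \<le> 1" by simp
      then show ?thesis using exp_ge_add_one_self[of "- \<epsilon> * t"] exp_ge_zero[of "- \<epsilon> * t"] by (simp add: min_def)
    qed
    finally show ?thesis .
  qed
  then show "\<forall>k\<ge>0. cmod (time_green (real k) lam n - time_green (real k) (lam + \<i> * of_real \<epsilon>) n) \<le> (3 ^ r + 6 / real r) * \<epsilon> powr (real r / 3)"
    using integral_exp_diff_le[of _ 1 \<epsilon> r lam "lam + \<i> * of_real \<epsilon>" n] assms by simp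
qed

lemma upper_green_holder:
  fixes n :: "int ^ ('n::finite)"
  assumes "Im lam > 0" "Im mu > 0" "3 \<le> CARD('n)"
  shows "cmod (upper_green lam n - upper_green mu n) \<le> 18 * cmod (lam - mu) powr (1 / 3)"
proof (cases "lam = mu")
  case False
  define \<epsilon> where "\<epsilon> = cmod (lam - mu)"
  have \<epsilon>: "\<epsilon> > 0" using False by (simp add: \<epsilon>_def)
  have b: "cmod (exp (\<i> * lam * of_real t) - exp (\<i> * mu * of_real t)) \<le> 2 * min 1 (\<epsilon> * t)" if t: "0 \<le> t" for t
  proof -
    have 1: "cmod (exp (\<i> * lam * of_real t) - exp (\<i> * mu * of_real t)) \<le> 2"
    proof -
      have "Im lam * t \<ge> 0" "Im mu * t \<ge> 0" using t assms(1,2) by simp_all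
      then have "exp (- Im lam * t) \<le> 1" "exp (- Im mu * t) \<le> 1" by simp_all
      then show ?thesis
        using norm_triangle_ineq4[of "exp (\<i> * lam * of_real t)" "exp (\<i> * mu * of_real t)"]
        unfolding cmod_exp_i by linarith
    qed
    \<comment> \<open>The derivative of exp has modulus at most 1 on the closed left half plane,
      which is convex and contains both arguments.\<close>
    have "cmod (exp (\<i> * lam * of_real t) - exp (\<i> * mu * of_real t)) \<le> 1 * cmod (\<i> * lam * of_real t - \<i> * mu * of_real t)"
    proof (rule field_differentiable_bound[where S = "{z. Re z \<le> 0}" and f' = exp])
      show "convex {z. Re z \<le> 0}" by (rule convex_halfspace_Re_le)
    qed (use t assms in \<open>auto intro: DERIV_subset[OF DERIV_exp]\<close>)
    also have "\<dots> = \<epsilon> * t"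
      using t by (simp add: \<epsilon>_def left_diff_distrib[symmetric] right_diff_distrib[symmetric] norm_mult)
    finally have "cmod (exp (\<i> * lam * of_real t) - exp (\<i> * mu * of_real t)) \<le> \<epsilon> * t" .
    moreover have "\<epsilon> * t \<ge> 0" using \<epsilon> t by simp
    ultimately show ?thesis using 1 by (simp add: min_def)
  qed
  have "cmod (upper_green lam n - upper_green mu n) \<le> 18 * \<epsilon> powr (1 / 3)"
  proof (rule Lim_bounded)
    show "(\<lambda>k. cmod (time_green (real k) lam n - time_green (real k) mu n)) \<longlonglongrightarrow> cmod (upper_green lam n - upper_green mu n)"
      by (intro tendsto_intros time_green_tendsto) (use assms in auto)
    show "\<forall>k\<ge>0. cmod (time_green (real k) lam n - time_green (real k) mu n) \<le> 18 * \<epsilon> powr (1 / 3)"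
      using integral_exp_diff_le[of _ 2 \<epsilon> 1 lam mu n] b \<epsilon> assms by simp
  qed
  then show ?thesis by (simp add: \<epsilon>_def)
qed simp

lemma integral_weighted_square_le:
  fixes w h :: "real \<Rightarrow> real"
  assumes "continuous_on {a..b} w" "continuous_on {a..b} h" "\<And>t. t \<in> {a..b} \<Longrightarrow> w t \<ge> 0"
  shows "(integral {a..b} (\<lambda>t. w t * h t))\<^sup>2 \<le> integral {a..b} w * integral {a..b} (\<lambda>t. w t * (h t)\<^sup>2)"
proof -
  let ?A = "integral {a..b} w" and ?B = "integral {a..b} (\<lambda>t. w t * h t)" and ?C = "integral {a..b} (\<lambda>t. w t * (h t)\<^sup>2)"
  have quad: "?C - 2 * c * ?B + c\<^sup>2 * ?A \<ge> 0" for c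
  proof -
    have "((\<lambda>t. w t * (h t)\<^sup>2 - 2 * c * (w t * h t) + c\<^sup>2 * w t) has_integral (?C - 2 * c * ?B + c\<^sup>2 * ?A)) {a..b}"
      using assms(1,2)
      by (intro has_integral_add has_integral_diff has_integral_mult_right integrable_integral integrable_continuous_interval continuous_intros)
    moreover have "w t * (h t)\<^sup>2 - 2 * c * (w t * h t) + c\<^sup>2 * w t = w t * (h t - c)\<^sup>2" for t
      by (simp add: power2_eq_square algebra_simps)
    ultimately have "((\<lambda>t. w t * (h t - c)\<^sup>2) has_integral (?C - 2 * c * ?B + c\<^sup>2 * ?A)) {a..b}" by simp
    then show ?thesis by (rule has_integral_nonneg) (use assms(3) in auto)
  qed
  have A: "?A \<ge> 0" using assms by (intro integral_nonneg integrable_continuous_interval) auto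
  show ?thesis
  proof (cases "?A = 0")
    case True
    have "?B = 0"
    proof (rule ccontr)
      assume "?B \<noteq> 0"
      then show False using quad[of "(?C + 1) / (2 * ?B)"] True by simp
    qed
    then show ?thesis using True by simp
  next
    case False
    then have "?A > 0" using A by simp
    moreover have "?A * (?C - 2 * (?B / ?A) * ?B + (?B / ?A)\<^sup>2 * ?A) \<ge> 0" by (rule mult_nonneg_nonneg[OF A quad])
    moreover have "?A * (?C - 2 * (?B / ?A) * ?B + (?B / ?A)\<^sup>2 * ?A) = ?A * ?C - ?B\<^sup>2"
      using False by (simp add: power2_eq_square field_simps)
    ultimately show ?thesis by simp
  qed
qed

text \<open>Cauchy-Schwarz in t with weight exp (- Im lam t), then the Parseval-type inequality for
  Bessel products. Cruder than the energy identity near the spectrum, but it puts Green's function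
  into l2, where that identity applies.\<close>

lemma sum_time_green_squares_le:
  fixes F :: "(int ^ ('n::finite)) set"
  assumes "X \<ge> 0" "Im lam > 0" "finite F"
  shows "(\<Sum>n\<in>F. (cmod (time_green X lam n))\<^sup>2) \<le> (1 / Im lam)\<^sup>2"
proof -
  let ?w = "\<lambda>t. exp (- Im lam * t)"
  have wc: "continuous_on A ?w" for A by (intro continuous_intros)
  have W: "integral {0..X} ?w \<le> 1 / Im lam" "integral {0..X} ?w \<ge> 0"
  proof -
    have "(?w has_integral (- exp (- Im lam * X) / Im lam - - exp (- Im lam * 0) / Im lam)) {0..X}"
      using assms by (intro fundamental_theorem_of_calculus)
        (auto intro!: derivative_eq_intros simp: has_real_derivative_iff_has_vector_derivative[symmetric])
    from integral_unique[OF this] have "integral {0..X} ?w = 1 / Im lam - exp (- Im lam * X) / Im lam" by simp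
    moreover have "exp (- Im lam * X) / Im lam \<ge> 0" using assms by simp
    ultimately show "integral {0..X} ?w \<le> 1 / Im lam" by linarith
    show "integral {0..X} ?w \<ge> 0" by (intro integral_nonneg integrable_continuous_interval wc) auto
  qed
  have 1: "(cmod (time_green X lam n))\<^sup>2 \<le> 1 / Im lam * integral {0..X} (\<lambda>t. ?w t * (bessel_prod n t)\<^sup>2)" for n :: "int ^ 'n"
  proof -
    have "cmod (time_green X lam n) \<le> integral {0..X} (\<lambda>t. ?w t * \<bar>bessel_prod n t\<bar>)"
      unfolding time_green_def norm_mult norm_ii mult_1_left
    proof (rule integral_norm_bound_integral)
      show "cmod (exp (\<i> * lam * of_real t) * propagator n t) \<le> ?w t * \<bar>bessel_prod n t\<bar>" for t
        by (simp add: norm_mult cmod_propagator)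
    qed (auto intro!: integrable_continuous_interval continuous_intros)
    then have "(cmod (time_green X lam n))\<^sup>2 \<le> (integral {0..X} (\<lambda>t. ?w t * \<bar>bessel_prod n t\<bar>))\<^sup>2"
      by (intro power_mono) auto
    also have "\<dots> \<le> integral {0..X} ?w * integral {0..X} (\<lambda>t. ?w t * \<bar>bessel_prod n t\<bar>\<^sup>2)"
      by (rule integral_weighted_square_le) (auto intro!: continuous_intros)
    also have "\<dots> \<le> 1 / Im lam * integral {0..X} (\<lambda>t. ?w t * \<bar>bessel_prod n t\<bar>\<^sup>2)"
      by (intro mult_right_mono W integral_nonneg integrable_continuous_interval continuous_intros) auto
    finally show ?thesis by simp
  qed
  have "(\<Sum>n\<in>F. (cmod (time_green X lam n))\<^sup>2) \<le> (\<Sum>n\<in>F. 1 / Im lam * integral {0..X} (\<lambda>t. ?w t * (bessel_prod n t)\<^sup>2))"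
    by (intro sum_mono 1)
  also have "\<dots> = 1 / Im lam * integral {0..X} (\<lambda>t. ?w t * (\<Sum>n\<in>F. (bessel_prod n t)\<^sup>2))"
  proof -
    have "(\<Sum>n\<in>F. integral {0..X} (\<lambda>t. ?w t * (bessel_prod n t)\<^sup>2)) = integral {0..X} (\<lambda>t. \<Sum>n\<in>F. ?w t * (bessel_prod n t)\<^sup>2)"
      by (rule integral_sum[symmetric, OF assms(3)]) (intro integrable_continuous_interval continuous_intros)
    then show ?thesis by (simp only: sum_distrib_left[symmetric])
  qed
  also have "\<dots> \<le> 1 / Im lam * integral {0..X} ?w"
  proof (intro mult_left_mono integral_le)
    fix t assume "t \<in> {0..X}"
    then show "?w t * (\<Sum>n\<in>F. (bessel_prod n t)\<^sup>2) \<le> ?w t"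
      using mult_left_mono[OF sum_bessel_prod_squares_le_1[of t F], of "?w t"] assms by simp
  qed (use assms in \<open>auto intro!: integrable_continuous_interval continuous_intros\<close>)
  also have "\<dots> \<le> 1 / Im lam * (1 / Im lam)" using W assms by (intro mult_left_mono) auto
  finally show ?thesis by (simp add: power2_eq_square)
qed

lemma is_green_upper_green:
  assumes "Im lam > 0"
  shows "is_green lam (upper_green lam :: ('n::finite) seq)"
  unfolding is_green_def
proof (intro conjI allI)
  show "(upper_green lam :: 'n seq) \<in> l2"
  proof (rule l2I(1))
    fix F :: "(int ^ 'n) set" assume F: "finite F"
    show "(\<Sum>n\<in>F. (cmod (upper_green lam n))\<^sup>2) \<le> (1 / Im lam)\<^sup>2"
    proof (rule Lim_bounded)
      show "(\<lambda>k. \<Sum>n\<in>F. (cmod (time_green (real k) lam n))\<^sup>2) \<longlonglongrightarrow> (\<Sum>n\<in>F. (cmod (upper_green lam n))\<^sup>2)"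
        by (intro tendsto_intros time_green_tendsto assms)
      show "\<forall>k\<ge>0. (\<Sum>n\<in>F. (cmod (time_green (real k) lam n))\<^sup>2) \<le> (1 / Im lam)\<^sup>2"
        using sum_time_green_squares_le[OF _ assms F] by simp
    qed
  qed
  fix n :: "int ^ 'n"
  have "(\<lambda>k. laplacian (time_green (real k) lam) n - lam * time_green (real k) lam n) \<longlonglongrightarrow> laplacian (upper_green lam) n - lam * upper_green lam n"
    unfolding laplacian_eq by (intro tendsto_intros time_green_tendsto assms) simp
  moreover have "(\<lambda>k. laplacian (time_green (real k) lam) n - lam * time_green (real k) lam n) \<longlonglongrightarrow> (if n = 0 then 1 else 0) - 0"
    unfolding laplacian_time_green[OF of_nat_0_le_iff]
  proof (rule tendsto_diff[OF tendsto_const], rule Lim_null_comparison)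
    show "\<forall>\<^sub>F k in sequentially. cmod (exp (\<i> * lam * of_real (real k)) * propagator n (real k)) \<le> exp (- Im lam * real k)"
      using mult_left_mono[OF abs_bessel_prod_le_1[of n "real _"], of "exp (- Im lam * real _)"]
      by (intro always_eventually allI) (simp add: norm_mult cmod_propagator)
    show "(\<lambda>k. exp (- Im lam * real k)) \<longlonglongrightarrow> 0" using assms by real_asymp
  qed
  ultimately show "laplacian (upper_green lam) n - lam * upper_green lam n = (if n = 0 then 1 else 0)"
    using LIMSEQ_unique by fastforce
qed

lemma holomorphic_time_green: "(\<lambda>lam. time_green X lam n) holomorphic_on A"
proof -
  have "(\<lambda>lam. integral (cbox 0 X) (\<lambda>t. exp (\<i> * lam * of_real t) * propagator n t)) holomorphic_on UNIV"
  proof (rule leibniz_rule_holomorphic)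
    fix lam :: complex and t :: real
    show "((\<lambda>lam. exp (\<i> * lam * of_real t) * propagator n t) has_field_derivative
       \<i> * of_real t * exp (\<i> * lam * of_real t) * propagator n t) (at lam within UNIV)"
      by (auto intro!: derivative_eq_intros)
    show "(\<lambda>t. exp (\<i> * lam * of_real t) * propagator n t) integrable_on cbox 0 X"
      using time_green_integrable by simp
  next
    show "continuous_on (UNIV \<times> cbox 0 X) (\<lambda>(lam, t). \<i> * of_real t * exp (\<i> * lam * of_real t) * propagator n t)"
      unfolding propagator_def case_prod_unfold
      by (intro continuous_intros continuous_on_compose2[OF continuous_on_bessel_prod[of UNIV]]) auto
  qed auto
  then have "(\<lambda>lam. \<i> * integral {0..X} (\<lambda>t. exp (\<i> * lam * of_real t) * propagator n t)) holomorphic_on A"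
    by (intro holomorphic_intros) (auto intro: holomorphic_on_subset)
  then show ?thesis by (simp add: time_green_def)
qed

text \<open>A locally uniform limit of the entire functions \<open>time_green\<close>: where Im lam
  \<ge> \<eta> the missing tail is at most exp (- \<eta> k) / \<eta>.\<close>

lemma holomorphic_upper_green: "(\<lambda>lam. upper_green lam n) holomorphic_on {lam. Im lam > 0}"
proof (rule holomorphic_uniform_sequence)
  show "open {lam. Im lam > 0}" by (rule open_halfspace_Im_gt)
  show "(\<lambda>lam. time_green (real k) lam n) holomorphic_on {lam. Im lam > 0}" for k by (rule holomorphic_time_green)
  fix mu :: complex assume mu: "mu \<in> {lam. Im lam > 0}"
  define \<eta> where "\<eta> = Im mu / 2"
  have \<eta>: "\<eta> > 0" using mu by (simp add: \<eta>_def)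
  have im: "Im lam \<ge> \<eta>" if "lam \<in> cball mu \<eta>" for lam
    using that abs_Im_le_cmod[of "mu - lam"] by (auto simp: \<eta>_def dist_norm)
  have "uniform_limit (cball mu \<eta>) (\<lambda>k lam. time_green (real k) lam n) (\<lambda>lam. upper_green lam n) sequentially"
  proof (rule uniform_limitI)
    fix e :: real assume "e > 0"
    with exp_decay_tendsto[OF \<eta>] have "eventually (\<lambda>k. exp (- \<eta> * real k) / \<eta> < e) sequentially"
      by (rule order_tendstoD(2))
    then show "\<forall>\<^sub>F k in sequentially. \<forall>lam\<in>cball mu \<eta>. dist (time_green (real k) lam n) (upper_green lam n) < e"
    proof eventually_elim
      case (elim k)
      show ?case
      proof
        fix lam assume lam: "lam \<in> cball mu \<eta>"
        have "dist (time_green (real k) lam n) (upper_green lam n) \<le> exp (- Im lam * real k) / Im lam"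
          using upper_green_approx[of lam n k] im[OF lam] \<eta> by (simp add: dist_norm norm_minus_commute)
        also have "\<dots> \<le> exp (- \<eta> * real k) / \<eta>"
          using im[OF lam] \<eta> by (intro frac_le) (auto intro: mult_right_mono)
        finally show "dist (time_green (real k) lam n) (upper_green lam n) < e" using elim by simp
      qed
    qed
  qed
  then show "\<exists>d>0. cball mu d \<subseteq> {lam. Im lam > 0} \<and> uniform_limit (cball mu d) (\<lambda>k lam. time_green (real k) lam n) (\<lambda>lam. upper_green lam n) sequentially"
    using \<eta> im by (intro exI[of _ \<eta>]) force
qed

section \<open>The Neumann series for large spectral parameter\<close>

definition l1_bounded :: "('n::finite) seq \<Rightarrow> real \<Rightarrow> bool" where
  "l1_bounded f L \<longleftrightarrow> (\<forall>F. finite F \<longrightarrow> (\<Sum>n\<in>F. cmod (f n)) \<le> L)"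

lemma l1_bounded_laplacian:
  fixes f :: "('n::finite) seq"
  assumes "l1_bounded f L"
  shows "l1_bounded (laplacian f) (real CARD('n) * L)"
  unfolding l1_bounded_def
proof (intro allI impI)
  fix F :: "(int ^ 'n) set" assume F: "finite F"
  have L: "L \<ge> 0" using assms[unfolded l1_bounded_def, rule_format, of "{}"] by simp
  have "(\<Sum>n\<in>F. cmod (laplacian f n)) \<le> (\<Sum>n\<in>F. (\<Sum>e\<in>steps. cmod (f (n + e))) / 2)"
    by (intro sum_mono) (auto simp: laplacian_eq norm_divide intro!: norm_sum)
  also have "\<dots> = (\<Sum>e\<in>steps. \<Sum>n\<in>F. cmod (f (n + e))) / 2"
    by (subst sum.swap) (simp add: sum_divide_distrib)
  also have "\<dots> \<le> (\<Sum>e\<in>(steps :: (int ^ 'n) set). L) / 2"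
  proof (intro divide_right_mono sum_mono)
    fix e :: "int ^ 'n"
    have "(\<Sum>n\<in>F. cmod (f (n + e))) = (\<Sum>n\<in>(\<lambda>n. n + e) ` F. cmod (f n))"
      by (subst sum.reindex) (auto simp: inj_on_def)
    also have "\<dots> \<le> L" using assms F by (auto simp: l1_bounded_def)
    finally show "(\<Sum>n\<in>F. cmod (f (n + e))) \<le> L" .
  qed simp
  also have "\<dots> = real (card (steps :: (int ^ 'n) set)) * L / 2" by simp
  also have "\<dots> \<le> real (2 * CARD('n)) * L / 2"
    using card_steps_le[where 'n = 'n] L by (intro divide_right_mono mult_right_mono of_nat_mono) auto
  finally show "(\<Sum>n\<in>F. cmod (laplacian f n)) \<le> real CARD('n) * L" by simp
qed

definition laplacian_pow :: "nat \<Rightarrow> ('n::finite) seq" where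
  "laplacian_pow k = (laplacian ^^ k) (unit_seq 0)"

lemma laplacian_pow_Suc: "laplacian_pow (Suc k) n = laplacian (laplacian_pow k) n"
  by (simp add: laplacian_pow_def)

lemma l1_bounded_laplacian_pow: "l1_bounded (laplacian_pow k :: ('n::finite) seq) (real CARD('n) ^ k)"
proof (induction k)
  case 0
  have "(\<Sum>n\<in>F. cmod (unit_seq 0 (n :: int ^ 'n))) \<le> 1" if "finite F" for F
  proof -
    have "(\<Sum>n\<in>F. cmod (unit_seq 0 (n :: int ^ 'n))) \<le> (\<Sum>n\<in>insert 0 F. if n = 0 then 1 else 0)"
      unfolding unit_seq_def using that by (intro order.trans[OF eq_refl sum_mono2]) (auto intro!: sum.cong)
    then show ?thesis using that by simp
  qed
  then show ?case by (simp add: laplacian_pow_def l1_bounded_def)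
next
  case (Suc k)
  then show ?case using l1_bounded_laplacian[OF Suc] by (simp add: laplacian_pow_def)
qed

lemma cmod_laplacian_pow_le: "cmod (laplacian_pow k (n :: int ^ ('n::finite))) \<le> real CARD('n) ^ k"
  using l1_bounded_laplacian_pow[of k, unfolded l1_bounded_def, rule_format, of "{n}"] by simp

text \<open>The expansion in u = 1 / lam of the resolvent applied to the delta at 0. It covers a
  neighbourhood of infinity and the real parameters outside [-d, d], which the time integral does
  not reach.\<close>

definition neumann_green :: "complex \<Rightarrow> ('n::finite) seq" where
  "neumann_green u n = - (\<Sum>k. laplacian_pow k n * u ^ k) * u"

lemma neumann_summable:
  fixes n :: "int ^ ('n::finite)"
  assumes "cmod u * real CARD('n) < 1"
  shows "summable (\<lambda>k. cmod (laplacian_pow k n * u ^ k))"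
proof (rule summable_comparison_test)
  show "\<exists>N. \<forall>k\<ge>N. norm (cmod (laplacian_pow k n * u ^ k)) \<le> (cmod u * real CARD('n)) ^ k"
    using mult_right_mono[OF cmod_laplacian_pow_le[of _ n], of "cmod u ^ _"]
    by (auto simp: norm_mult norm_power power_mult_distrib mult.commute)
  show "summable (\<lambda>k. (cmod u * real CARD('n)) ^ k)" using assms by (intro summable_geometric) auto
qed

text \<open>The Laplacian has l1 operator norm at most d, so the k-th coefficient has l1 norm at
  most d^k and a geometric series remains.\<close>

lemma sum_neumann_green_le:
  fixes F :: "(int ^ ('n::finite)) set"
  assumes "cmod u * real CARD('n) < 1" "finite F"
  shows "(\<Sum>n\<in>F. cmod (neumann_green u n)) \<le> cmod u / (1 - cmod u * real CARD('n))"
proof -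
  have g: "(\<lambda>k. (cmod u * real CARD('n)) ^ k) sums (1 / (1 - cmod u * real CARD('n)))"
    using assms by (intro geometric_sums) auto
  have "(\<Sum>n\<in>F. cmod (neumann_green u n)) \<le> (\<Sum>n\<in>F. (\<Sum>k. cmod (laplacian_pow k n * u ^ k)) * cmod u)"
    unfolding neumann_green_def norm_mult[of _ u] norm_minus_cancel
    by (intro sum_mono mult_right_mono summable_norm neumann_summable assms) auto
  also have "\<dots> = (\<Sum>k. \<Sum>n\<in>F. cmod (laplacian_pow k n * u ^ k)) * cmod u"
    unfolding sum_distrib_right[symmetric] by (subst suminf_sum) (intro neumann_summable assms, simp)
  also have "\<dots> \<le> (\<Sum>k. (cmod u * real CARD('n)) ^ k) * cmod u"
  proof (intro mult_right_mono suminf_le)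
    show "(\<Sum>n\<in>F. cmod (laplacian_pow k n * u ^ k)) \<le> (cmod u * real CARD('n)) ^ k" for k
    proof -
      have "(\<Sum>n\<in>F. cmod (laplacian_pow k n)) \<le> real CARD('n) ^ k"
        using l1_bounded_laplacian_pow[of k] assms(2) by (auto simp: l1_bounded_def)
      then have "(\<Sum>n\<in>F. cmod (laplacian_pow k n)) * cmod u ^ k \<le> real CARD('n) ^ k * cmod u ^ k"
        by (intro mult_right_mono) auto
      then show ?thesis by (simp add: norm_mult norm_power sum_distrib_left[symmetric] power_mult_distrib mult.commute)
    qed
    show "summable (\<lambda>k. \<Sum>n\<in>F. cmod (laplacian_pow k n * u ^ k))" by (intro summable_sum neumann_summable assms)
    show "summable (\<lambda>k. (cmod u * real CARD('n)) ^ k)" using g by (rule sums_summable)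
  qed simp
  also have "\<dots> = cmod u / (1 - cmod u * real CARD('n))" by (simp add: sums_unique[OF g, symmetric])
  finally show ?thesis .
qed

lemma is_green_neumann_green:
  fixes u :: complex
  assumes u: "cmod u * real CARD('n) < 1" "u \<noteq> 0"
  shows "is_green (1 / u) (neumann_green u :: ('n::finite) seq)"
    "sq_norm (neumann_green u :: ('n::finite) seq) \<le> (cmod u / (1 - cmod u * real CARD('n)))\<^sup>2"
proof -
  have sq: "(\<Sum>n\<in>F. (cmod (neumann_green u (n :: int ^ 'n)))\<^sup>2) \<le> (cmod u / (1 - cmod u * real CARD('n)))\<^sup>2" if F: "finite F" for F
  proof -
    have "(\<Sum>n\<in>F. (cmod (neumann_green u (n :: int ^ 'n)))\<^sup>2) \<le> (\<Sum>n\<in>F. cmod (neumann_green u n))\<^sup>2"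
    proof -
      have "(\<Sum>n\<in>F. (cmod (neumann_green u n))\<^sup>2) \<le> (\<Sum>n\<in>F. cmod (neumann_green u n) * (\<Sum>m\<in>F. cmod (neumann_green u m)))"
        unfolding power2_eq_square using F by (intro sum_mono mult_left_mono member_le_sum) auto
      then show ?thesis by (simp add: sum_distrib_right[symmetric] power2_eq_square)
    qed
    also have "\<dots> \<le> (cmod u / (1 - cmod u * real CARD('n)))\<^sup>2"
      by (intro power_mono sum_neumann_green_le u F sum_nonneg) auto
    finally show ?thesis .
  qed
  note l2I[OF sq]
  then show "sq_norm (neumann_green u :: 'n seq) \<le> (cmod u / (1 - cmod u * real CARD('n)))\<^sup>2" by blast
  have s: "summable (\<lambda>k. laplacian_pow k n * u ^ k)" for n :: "int ^ 'n"
    using neumann_summable[OF u(1)] by (rule summable_norm_cancel)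
  show "is_green (1 / u) (neumann_green u :: 'n seq)"
    unfolding is_green_def
  proof (intro conjI allI l2I(1)[OF sq])
    fix n :: "int ^ 'n"
    have "laplacian (neumann_green u) n = - ((\<Sum>e\<in>steps. \<Sum>k. laplacian_pow k (n + e) * u ^ k) / 2) * u"
      by (simp add: laplacian_eq neumann_green_def sum_distrib_right[symmetric] sum_negf)
    also have "(\<Sum>e\<in>steps. \<Sum>k. laplacian_pow k (n + e) * u ^ k) / 2 = (\<Sum>k. (\<Sum>e\<in>steps. laplacian_pow k (n + e) * u ^ k) / 2)"
      by (subst suminf_sum[symmetric, OF s]) (rule suminf_divide[symmetric], intro summable_sum s)
    also have "\<dots> = (\<Sum>k. laplacian_pow (Suc k) n * u ^ k)"
      by (simp add: laplacian_pow_Suc laplacian_eq sum_distrib_right)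
    finally have 0: "laplacian (neumann_green u) n = - (\<Sum>k. laplacian_pow (Suc k) n * u ^ k) * u" .
    have 1: "laplacian (neumann_green u) n = - (\<Sum>k. laplacian_pow (Suc k) n * u ^ Suc k)"
    proof -
      have "summable (\<lambda>k. laplacian_pow (Suc k) n * u ^ k)"
      proof -
        have "summable (\<lambda>k. laplacian_pow (Suc k) n * u ^ Suc k)" using s[of n] by (subst summable_Suc_iff)
        then have "summable (\<lambda>k. (laplacian_pow (Suc k) n * u ^ Suc k) / u)" by (rule summable_divide)
        then show ?thesis using u(2) by simp
      qed
      from suminf_mult2[OF this, of u] have "(\<Sum>k. laplacian_pow (Suc k) n * u ^ k) * u = (\<Sum>k. laplacian_pow (Suc k) n * u ^ Suc k)"
        by (simp add: mult_ac)
      then show ?thesis unfolding 0 by simp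
    qed
    have 2: "1 / u * neumann_green u n = - (\<Sum>k. laplacian_pow k n * u ^ k)" using u(2) by (simp add: neumann_green_def)
    have 3: "(\<Sum>k. laplacian_pow (Suc k) n * u ^ Suc k) = (\<Sum>k. laplacian_pow k n * u ^ k) - laplacian_pow 0 n"
      using suminf_split_head[OF s[of n]] by simp
    have 4: "laplacian_pow 0 n = (if n = 0 then 1 else 0)" by (simp add: laplacian_pow_def unit_seq_def)
    show "laplacian (neumann_green u) n - 1 / u * neumann_green u n = (if n = 0 then 1 else 0)"
      unfolding 1 2 3 4 by simp
  qed
qed

lemma holomorphic_neumann_green:
  "(\<lambda>u. neumann_green u (n :: int ^ ('n::finite))) holomorphic_on ball 0 (1 / real CARD('n))"
proof -
  have "(\<lambda>u. \<Sum>k. laplacian_pow k n * (u - 0) ^ k) holomorphic_on ball 0 (1 / real CARD('n))"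
  proof (rule power_series_holomorphic)
    fix w :: complex assume "w \<in> ball 0 (1 / real CARD('n))"
    then have "cmod w * real CARD('n) < 1" by (simp add: dist_norm field_simps)
    then have "summable (\<lambda>k. laplacian_pow k n * w ^ k)" by (intro summable_norm_cancel[OF neumann_summable])
    then show "(\<lambda>k. laplacian_pow k n * (w - 0) ^ k) sums (\<Sum>k. laplacian_pow k n * (w - 0) ^ k)"
      by (simp add: summable_sums)
  qed
  then show ?thesis unfolding neumann_green_def[abs_def] by (intro holomorphic_intros) simp
qed

section \<open>Green's function in the disc variable\<close>

definition disc_green :: "complex \<Rightarrow> ('n::finite) seq" where
  "disc_green z = (if z = 0 then (\<lambda>_. 0) else free_resolvent (joukowski CARD('n) z) (unit_seq 0))"

lemma disc_green_eqI:
  assumes "z \<noteq> 0" "joukowski CARD('n) z \<in> off_spectrum TYPE('n)" "is_green (joukowski CARD('n) z) g"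
  shows "disc_green z = (g :: ('n::finite) seq)"
  unfolding disc_green_def using assms
  by (auto simp: is_green_def unit_seq_def intro!: free_resolvent_eqI)

lemma Im_joukowski: "Im (joukowski d z) = real d / 2 * (Im z * (1 - 1 / (cmod z)\<^sup>2))"
proof -
  have "Im (joukowski d z) = real d / 2 * (Im z + Im (1 / z))"
    unfolding joukowski_def by (simp add: Im_divide power2_eq_square)
  also have "Im (1 / z) = - Im z / (cmod z)\<^sup>2" by (simp add: Im_divide cmod_power2)
  finally show ?thesis by (simp add: algebra_simps)
qed

lemma Im_joukowski_sign:
  assumes "cmod z < 1" "z \<noteq> 0" "d > 0"
  shows "Im (joukowski d z) > 0 \<longleftrightarrow> Im z < 0" "Im (joukowski d z) < 0 \<longleftrightarrow> Im z > 0"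
    "Im (joukowski d z) = 0 \<longleftrightarrow> Im z = 0"
proof -
  have "(cmod z)\<^sup>2 < 1" using assms by (simp add: power_less_one_iff)
  then have n: "1 - 1 / (cmod z)\<^sup>2 < 0" using assms by (simp add: field_simps)
  then show "Im (joukowski d z) > 0 \<longleftrightarrow> Im z < 0" "Im (joukowski d z) < 0 \<longleftrightarrow> Im z > 0"
    "Im (joukowski d z) = 0 \<longleftrightarrow> Im z = 0"
    unfolding Im_joukowski using assms(3) by (auto simp: zero_less_mult_iff mult_less_0_iff)
qed

lemma joukowski_off_spectrum:
  assumes "cmod z < 1" "z \<noteq> 0"
  shows "joukowski CARD('n) z \<in> off_spectrum TYPE('n::finite)"
proof (cases "Im z = 0")
  case False
  then show ?thesis using Im_joukowski_sign(3)[OF assms, of "CARD('n)"] by (simp add: off_spectrum_iff)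
next
  case True
  then obtain x where x: "z = of_real x" by (metis complex_is_Real_iff Reals_cases)
  have x1: "\<bar>x\<bar> < 1" "x \<noteq> 0" using assms x by auto
  have R: "Re (joukowski CARD('n) z) = real CARD('n) / 2 * (x + 1 / x)"
    unfolding x joukowski_def by (simp add: Re_divide power2_eq_square)
  have "\<bar>x + 1 / x\<bar> > 2"
  proof -
    have "(\<bar>x\<bar> - 1)\<^sup>2 > 0" using x1 by simp
    then have "2 * \<bar>x\<bar> < \<bar>x\<bar> * \<bar>x\<bar> + 1" by (simp add: power2_eq_square algebra_simps)
    then have "2 < (\<bar>x\<bar> * \<bar>x\<bar> + 1) / \<bar>x\<bar>" using x1 by (simp add: pos_less_divide_eq)
    also have "(\<bar>x\<bar> * \<bar>x\<bar> + 1) / \<bar>x\<bar> = \<bar>x + 1 / x\<bar>"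
    proof -
      have "x + 1 / x = (x * x + 1) / x" using x1 by (simp add: field_simps)
      then have "\<bar>x + 1 / x\<bar> = \<bar>x * x + 1\<bar> / \<bar>x\<bar>" by (simp add: abs_divide)
      then show ?thesis by (simp add: abs_mult[symmetric])
    qed
    finally show ?thesis .
  qed
  then have "real CARD('n) / 2 * 2 < real CARD('n) / 2 * \<bar>x + 1 / x\<bar>" by (intro mult_strict_left_mono) auto
  then have "\<bar>Re (joukowski CARD('n) z)\<bar> > real CARD('n)" unfolding R abs_mult by simp
  then show ?thesis by (simp add: off_spectrum_iff)
qed

lemma is_green_cnj: "is_green lam g \<Longrightarrow> is_green (cnj lam) (\<lambda>n. cnj (g n))"
  unfolding is_green_def laplacian_cnj
  by (auto simp: l2_cnj simp flip: complex_cnj_mult complex_cnj_diff)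

lemma joukowski_cnj: "joukowski d (cnj z) = cnj (joukowski d z)"
  by (simp add: joukowski_def)

lemma disc_green_upper:
  assumes "cmod z < 1" "Im z < 0"
  shows "disc_green z = (upper_green (joukowski CARD('n) z) :: ('n::finite) seq)"
    "Im (joukowski CARD('n) z) > 0"
proof -
  have z: "z \<noteq> 0" using assms by auto
  show i: "Im (joukowski CARD('n) z) > 0" using Im_joukowski_sign(1)[OF assms(1) z] assms(2) by simp
  show "disc_green z = (upper_green (joukowski CARD('n) z) :: 'n seq)"
    by (rule disc_green_eqI[OF z joukowski_off_spectrum[OF assms(1) z] is_green_upper_green[OF i]])
qed

lemma inverse_joukowski:
  assumes "z \<noteq> 0" "d > 0" "1 + z\<^sup>2 \<noteq> 0"
  shows "1 / (2 * z / (of_nat d * (1 + z\<^sup>2))) = joukowski d z"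
  using assms by (simp add: joukowski_def field_simps power2_eq_square)

text \<open>Here u = 1 / \<lambda>(z) = 2 z / (d (1 + z^2)), so the condition |u| < 1 / d becomes |2
  z| < |1 + z^2|. At z = 0 both sides vanish: the value put into \<open>disc_green\<close> there is
  the analytic one.\<close>

lemma disc_green_neumann:
  fixes z :: complex
  assumes "cmod z < 1" "cmod (2 * z) < cmod (1 + z\<^sup>2)"
  shows "disc_green z = (neumann_green (2 * z / (of_nat CARD('n) * (1 + z\<^sup>2))) :: ('n::finite) seq)"
    and "2 * z / (of_nat CARD('n) * (1 + z\<^sup>2)) \<in> ball 0 (1 / real CARD('n))"
proof -
  have nz: "1 + z\<^sup>2 \<noteq> 0" using assms(2) by auto
  let ?u = "2 * z / (of_nat CARD('n) * (1 + z\<^sup>2))"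
  have u: "cmod ?u < 1 / real CARD('n)"
  proof -
    have e: "a / (d * b) < 1 / d" if "b > 0" "d > 0" "a < b" for a b d :: real
      using that by (simp add: field_simps)
    have "cmod ?u = cmod (2 * z) / (real CARD('n) * cmod (1 + z\<^sup>2))" by (simp add: norm_divide norm_mult)
    then show ?thesis using e[of "cmod (1 + z\<^sup>2)" "real CARD('n)" "cmod (2 * z)"] assms(2) nz by simp
  qed
  then show "?u \<in> ball 0 (1 / real CARD('n))" by simp
  show "disc_green z = (neumann_green ?u :: 'n seq)"
  proof (cases "z = 0")
    case True
    then show ?thesis by (auto simp: disc_green_def neumann_green_def)
  next
    case False
    then have "?u \<noteq> 0" using nz by simp
    moreover have "cmod ?u * real CARD('n) < 1" using u by (simp add: field_simps)
    ultimately have "is_green (1 / ?u) (neumann_green ?u :: 'n seq)" by (rule is_green_neumann_green(1)[rotated])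
    then have "is_green (joukowski CARD('n) z) (neumann_green ?u :: 'n seq)"
      using inverse_joukowski[OF False _ nz, of "CARD('n)"] by simp
    then show ?thesis by (intro disc_green_eqI False joukowski_off_spectrum assms(1))
  qed
qed

text \<open>This is (|x| - 1)^2 > 0. The Neumann region thus contains the whole real diameter, and
  together with the two open half discs it covers the unit disc.\<close>

lemma real_neumann_region:
  assumes "cmod z < 1" "Im z = 0"
  shows "cmod (2 * z) < cmod (1 + z\<^sup>2)"
proof -
  obtain x where x: "z = of_real x" using assms(2) by (metis complex_is_Real_iff Reals_cases)
  have "(\<bar>x\<bar> - 1)\<^sup>2 > 0" using assms(1) x by simp
  then have "2 * \<bar>x\<bar> < 1 + x\<^sup>2" by (simp add: power2_eq_square algebra_simps)
  moreover have "cmod (1 + z\<^sup>2) = 1 + x\<^sup>2"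
  proof -
    have "1 + z\<^sup>2 = of_real (1 + x\<^sup>2)" by (simp add: x)
    then show ?thesis by (simp only: norm_of_real) simp
  qed
  ultimately show ?thesis by (simp add: x norm_mult)
qed

lemma disc_green_cnj:
  assumes "cmod z < 1"
  shows "disc_green (cnj z) = (\<lambda>n::int ^ ('n::finite). cnj (disc_green z n))"
proof (cases "z = 0")
  case False
  obtain g :: "'n seq" where g: "is_green (joukowski CARD('n) z) g"
  proof -
    consider "Im z < 0" | "Im z = 0" | "Im z > 0" by linarith
    then show ?thesis
    proof cases
      case 1
      then show ?thesis using that is_green_upper_green[OF disc_green_upper(2)[OF assms]] by blast
    next
      case 2
      note nr = real_neumann_region[OF assms 2]
      have nz: "1 + z\<^sup>2 \<noteq> 0" using nr by auto
      have "cmod (2 * z / (of_nat CARD('n) * (1 + z\<^sup>2))) * real CARD('n) < 1"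
        using disc_green_neumann(2)[OF assms nr, where 'n = 'n] by (simp add: field_simps)
      from is_green_neumann_green(1)[OF this] that show ?thesis
        using inverse_joukowski[OF False _ nz, of "CARD('n)"] False nz by auto
    next
      case 3
      then have "is_green (joukowski CARD('n) (cnj z)) (upper_green (joukowski CARD('n) (cnj z)) :: 'n seq)"
        using assms by (intro is_green_upper_green disc_green_upper(2)) auto
      from is_green_cnj[OF this] that show ?thesis by (simp add: joukowski_cnj)
    qed
  qed
  then have "disc_green z = g" by (intro disc_green_eqI False joukowski_off_spectrum assms)
  moreover have "disc_green (cnj z) = (\<lambda>n. cnj (g n))"
    using is_green_cnj[OF g] False assms by (intro disc_green_eqI joukowski_off_spectrum) (auto simp: joukowski_cnj)
  ultimately show ?thesis by simp
qed (simp add: disc_green_def)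

lemma is_green_disc_green:
  assumes "cmod z < 1" "z \<noteq> 0"
  shows "is_green (joukowski CARD('n) z) (disc_green z :: ('n::finite) seq)"
proof -
  have up: "is_green (joukowski CARD('n) w) (disc_green w :: 'n seq)" if "cmod w < 1" "Im w < 0" for w
    using disc_green_upper[OF that, where 'n = 'n] is_green_upper_green by metis
  consider "Im z < 0" | "Im z = 0" | "Im z > 0" by linarith
  then show ?thesis
  proof cases
    case 2
    note nr = real_neumann_region[OF assms(1) 2]
    have nz: "1 + z\<^sup>2 \<noteq> 0" using nr by auto
    have "cmod (2 * z / (of_nat CARD('n) * (1 + z\<^sup>2))) * real CARD('n) < 1"
      using disc_green_neumann(2)[OF assms(1) nr, where 'n = 'n] by (simp add: field_simps)
    from is_green_neumann_green(1)[OF this] show ?thesis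
      using inverse_joukowski[OF assms(2) _ nz, of "CARD('n)"] assms(2) nz disc_green_neumann(1)[OF assms(1) nr, where 'n = 'n] by auto
  next
    case 3
    then have "is_green (joukowski CARD('n) (cnj z)) (disc_green (cnj z) :: 'n seq)" using up[of "cnj z"] assms by simp
    from is_green_cnj[OF this] show ?thesis by (simp add: joukowski_cnj disc_green_cnj[OF assms(1)])
  qed (use up assms in blast)
qed

text \<open>Three open sets cover the disc: the lower half through \<open>upper_green\<close>, the
  upper half by reflection, and the Neumann region around the real diameter, where the halves are
  glued.\<close>

lemma holomorphic_disc_green: "(\<lambda>z. disc_green z (n :: int ^ ('n::finite))) holomorphic_on ball 0 1"
proof -
  let ?A = "{z. cmod z < 1 \<and> Im z < 0}" and ?B = "{z. cmod z < 1 \<and> Im z > 0}"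
    and ?C = "{z. cmod z < 1 \<and> cmod (2 * z) < cmod (1 + z\<^sup>2)}"
  have op: "open ?A" "open ?B" "open ?C"
    by (intro open_Collect_conj open_Collect_less continuous_intros)+
  have A: "(\<lambda>z. disc_green z n) holomorphic_on ?A"
  proof -
    have "(\<lambda>lam. upper_green lam n) \<circ> joukowski CARD('n) holomorphic_on ?A"
    proof (rule holomorphic_on_compose_gen[OF _ holomorphic_upper_green])
      show "joukowski CARD('n) holomorphic_on ?A"
        unfolding joukowski_def[abs_def] by (intro holomorphic_intros) auto
      show "joukowski CARD('n) ` ?A \<subseteq> {lam. Im lam > 0}" using disc_green_upper(2) by auto
    qed
    then show ?thesis by (rule holomorphic_transform) (auto simp: disc_green_upper(1))
  qed
  have B: "(\<lambda>z. disc_green z n) holomorphic_on ?B"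
  proof -
    have "cnj ` ?B = ?A"
    proof -
      have "z \<in> cnj ` ?B" if "z \<in> ?A" for z using that by (intro image_eqI[of _ _ "cnj z"]) auto
      then show ?thesis by auto
    qed
    then have "cnj \<circ> (\<lambda>z. disc_green z n) \<circ> cnj holomorphic_on ?B"
      using holomorphic_on_compose_cnj_cnj[OF _ op(2), of "\<lambda>z. disc_green z n"] A by simp
    then show ?thesis by (rule holomorphic_transform) (auto simp: disc_green_cnj)
  qed
  have C: "(\<lambda>z. disc_green z n) holomorphic_on ?C"
  proof -
    have "(\<lambda>u. neumann_green u n) \<circ> (\<lambda>z. 2 * z / (of_nat CARD('n) * (1 + z\<^sup>2))) holomorphic_on ?C"
    proof (rule holomorphic_on_compose_gen[OF _ holomorphic_neumann_green])
      show "(\<lambda>z. 2 * z / (of_nat CARD('n) * (1 + z\<^sup>2))) holomorphic_on ?C"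
        by (intro holomorphic_intros) auto
      show "(\<lambda>z. 2 * z / (of_nat CARD('n) * (1 + z\<^sup>2))) ` ?C \<subseteq> ball 0 (1 / real CARD('n))"
        using disc_green_neumann(2) by auto
    qed
    then show ?thesis by (rule holomorphic_transform) (auto simp: disc_green_neumann(1))
  qed
  have "(\<lambda>z. disc_green z n) holomorphic_on ?A \<union> ?B \<union> ?C"
    by (intro holomorphic_on_Un A B C op open_Un)
  moreover have "ball 0 1 \<subseteq> ?A \<union> ?B \<union> ?C"
    using real_neumann_region by (force simp: not_less)
  ultimately show ?thesis by (rule holomorphic_on_subset)
qed

lemma sq_norm_disc_green_le:
  assumes "cmod z < 1" "cmod (2 * z) < cmod (1 + z\<^sup>2)"
  shows "sq_norm (disc_green z :: ('n::finite) seq)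
    \<le> (cmod (2 * z) / (real CARD('n) * (cmod (1 + z\<^sup>2) - cmod (2 * z))))\<^sup>2"
proof (cases "z = 0")
  case True
  then show ?thesis by (simp add: disc_green_def sq_norm_def)
next
  case False
  have nz: "1 + z\<^sup>2 \<noteq> 0" using assms(2) by auto
  let ?u = "2 * z / (of_nat CARD('n) * (1 + z\<^sup>2))"
  have u: "cmod ?u * real CARD('n) < 1" "?u \<noteq> 0"
    using disc_green_neumann(2)[OF assms, where 'n = 'n] False nz by (simp add: field_simps, simp)
  have "cmod ?u / (1 - cmod ?u * real CARD('n)) = cmod (2 * z) / (real CARD('n) * (cmod (1 + z\<^sup>2) - cmod (2 * z)))"
  proof -
    have e: "a / (d * b) / (1 - a / (d * b) * d) = a / (d * (b - a))" if "b > 0" "d > 0" "a < b" for a b d :: real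
      using that by (simp add: field_simps)
    have "cmod ?u = cmod (2 * z) / (real CARD('n) * cmod (1 + z\<^sup>2))" by (simp add: norm_divide norm_mult)
    then show ?thesis using e[of "cmod (1 + z\<^sup>2)" "real CARD('n)" "cmod (2 * z)"] assms(2) nz by simp
  qed
  then show ?thesis
    unfolding disc_green_neumann(1)[OF assms] using is_green_neumann_green(2)[OF u] by simp
qed

section \<open>Hilbert-Schmidt bounds\<close>

text \<open>The energy identity combined with the bound 3 at the origin.\<close>

lemma sq_norm_upper_green_le:
  assumes "Im lam > 0" "3 \<le> CARD('n)"
  shows "sq_norm (upper_green lam :: ('n::finite) seq) \<le> 3 / Im lam"
proof -
  have "Im lam * sq_norm (upper_green lam :: 'n seq) = Im (upper_green lam (0 :: int ^ 'n))"
    by (rule is_green_energy[OF is_green_upper_green[OF assms(1)]])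
  also have "\<dots> \<le> 3"
    using cmod_upper_green_le[OF assms, of "0 :: int ^ 'n"] abs_Im_le_cmod[of "upper_green lam (0 :: int ^ 'n)"] by linarith
  finally show ?thesis using assms(1) by (simp add: field_simps)
qed

text \<open>If \<open>\<epsilon> \<le> \<epsilon>\<^sub>n\<close> := \<open>(\<bar>G n\<bar> / 2 C)\<^bsup>3/r\<^esup>\<close>, then shifting the spectral parameter by \<open>\<i> \<epsilon>\<close>
  costs at most half of \<open>\<bar>G n\<bar>\<close>, while the \<open>\<ell>\<^sup>2\<close> norm of the shifted kernel is at most \<open>(3/\<epsilon>)\<^bsup>1/2\<^esup>\<close>.
  Integrating over \<open>\<epsilon>\<close> trades these two bounds for an \<open>\<ell>\<^sup>Q\<close> bound.\<close>

lemma sum_upper_green_power_le: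
  fixes F :: "(int ^ ('n::finite)) set" and Q C :: real
  assumes lam: "Im lam > 0" and r: "0 < r" "r \<le> 3" "2 + r \<le> CARD('n)" and F: "finite F"
  defines "C \<equiv> 3 ^ r + 6 / real r" and "Q \<equiv> 2 + 4 / real r"
  shows "(\<Sum>n\<in>F. cmod (upper_green lam n) powr Q)
    \<le> (2 * C) powr (4 / real r) * (48 * (3 / (2 * C)) powr (1 / real r))"
proof -
  let ?G = "\<lambda>n. cmod (upper_green lam (n :: int ^ 'n))"
  have d3: "3 \<le> CARD('n)" using r by simp
  have C: "C > 0" using r by (simp add: C_def add_pos_pos)
  define en where "en = (\<lambda>n. (?G n / (2 * C)) powr (3 / real r))"
  define E where "E = (3 / (2 * C)) powr (3 / real r)"
  have E: "E \<ge> 0" by (simp add: E_def)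
  have en: "0 \<le> en n" "en n \<le> E" for n
    using cmod_upper_green_le[OF lam d3, of n] C r
    by (auto simp: en_def E_def intro!: powr_mono2 divide_right_mono)
  have half: "(?G n)\<^sup>2 \<le> 4 * (cmod (upper_green (lam + \<i> * of_real e) n))\<^sup>2" if e: "0 < e" "e \<le> en n" for n e
  proof -
    have "C * e powr (real r / 3) \<le> C * en n powr (real r / 3)"
      using C e by (intro mult_left_mono powr_mono2) auto
    also have "\<dots> = ?G n / 2" using C r by (simp add: en_def powr_powr)
    finally have "cmod (upper_green lam n - upper_green (lam + \<i> * of_real e) n) \<le> ?G n / 2"
      using upper_green_shift_le[OF lam e(1) r, of n] unfolding C_def by linarith
    then have "?G n \<le> 2 * cmod (upper_green (lam + \<i> * of_real e) n)"
      using norm_triangle_ineq2[of "upper_green lam n" "upper_green (lam + \<i> * of_real e) n"] by linarith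
    then have "(?G n)\<^sup>2 \<le> (2 * cmod (upper_green (lam + \<i> * of_real e) n))\<^sup>2" by (intro power_mono) auto
    then show ?thesis by (simp add: power_mult_distrib)
  qed
  \<comment> \<open>The weight e^(1/3) is chosen so that against the l2 bound 3 / e it leaves the
    integrable e^(-2/3); its integral up to \<open>en n\<close> is proportional to |G n|^(4/r),
    which raises the exponent 2 to \<open>Q\<close>.\<close>
  have int: "((\<lambda>e. if e \<in> {0..en n} then e powr (1/3) else 0) has_integral (en n powr (4/3) / (4/3))) {0..E}" for n
    using has_integral_powr_from_0[of "1/3" "en n"] en[of n] by (subst has_integral_restrict) auto
  have pw: "?G n powr Q = (2 * C) powr (4 / real r) * ((?G n)\<^sup>2 * en n powr (4/3))" for n
  proof -
    have "en n powr (4/3) = (?G n / (2 * C)) powr (4 / real r)" by (simp add: en_def powr_powr)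
    then have "(2 * C) powr (4 / real r) * ((?G n)\<^sup>2 * en n powr (4/3)) = (?G n)\<^sup>2 * ?G n powr (4 / real r)"
      using C by (simp add: powr_divide)
    also have "\<dots> = ?G n powr 2 * ?G n powr (4 / real r)" by (cases "?G n = 0") (auto simp: powr_realpow)
    also have "\<dots> = ?G n powr Q" unfolding Q_def by (rule powr_add[symmetric])
    finally show ?thesis ..
  qed
  have "(\<Sum>n\<in>F. (?G n)\<^sup>2 * (en n powr (4/3) / (4/3))) \<le> 12 * (E powr (-2/3 + 1) / (-2/3 + 1))"
  proof (rule has_integral_le)
    show "((\<lambda>e. \<Sum>n\<in>F. (?G n)\<^sup>2 * (if e \<in> {0..en n} then e powr (1/3) else 0)) has_integral (\<Sum>n\<in>F. (?G n)\<^sup>2 * (en n powr (4/3) / (4/3)))) {0..E}"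
      by (intro has_integral_sum F has_integral_mult_right int)
    show "((\<lambda>e. 12 * e powr (-2/3)) has_integral 12 * (E powr (-2/3 + 1) / (-2/3 + 1))) {0..E}"
      by (intro has_integral_mult_right has_integral_powr_from_0 E) simp
    fix e assume e: "e \<in> {0..E}"
    show "(\<Sum>n\<in>F. (?G n)\<^sup>2 * (if e \<in> {0..en n} then e powr (1/3) else 0)) \<le> 12 * e powr (-2/3)"
    proof (cases "e = 0")
      case False
      then have e0: "e > 0" using e by simp
      have lam': "Im (lam + \<i> * of_real e) > 0" using lam e0 by simp
      have "(\<Sum>n\<in>F. (?G n)\<^sup>2 * (if e \<in> {0..en n} then e powr (1/3) else 0))
         \<le> (\<Sum>n\<in>F. 4 * (cmod (upper_green (lam + \<i> * of_real e) n))\<^sup>2 * e powr (1/3))"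
        using half e0 by (intro sum_mono) (auto intro!: mult_right_mono)
      also have "\<dots> = 4 * (\<Sum>n\<in>F. (cmod (upper_green (lam + \<i> * of_real e) n))\<^sup>2) * e powr (1/3)"
        by (simp add: sum_distrib_left sum_distrib_right)
      also have "\<dots> \<le> 4 * (3 / e) * e powr (1/3)"
      proof (intro mult_right_mono mult_left_mono)
        have "(\<Sum>n\<in>F. (cmod (upper_green (lam + \<i> * of_real e) n))\<^sup>2) \<le> sq_norm (upper_green (lam + \<i> * of_real e) :: 'n seq)"
          using is_green_upper_green[OF lam'] F by (intro sum_le_sq_norm) (auto simp: is_green_def)
        also have "\<dots> \<le> 3 / Im (lam + \<i> * of_real e)" by (rule sq_norm_upper_green_le[OF lam' d3])
        also have "\<dots> \<le> 3 / e" using lam e0 by (intro divide_left_mono) auto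
        finally show "(\<Sum>n\<in>F. (cmod (upper_green (lam + \<i> * of_real e) n))\<^sup>2) \<le> 3 / e" .
      qed auto
      also have "\<dots> = 12 * (e powr (1/3) * e powr (-1))" using e0 by (simp add: powr_minus_divide)
      also have "e powr (1/3) * e powr (-1) = e powr (-2/3)" unfolding powr_add[symmetric] by simp
      finally show ?thesis .
    qed (auto intro!: sum_nonpos)
  qed
  note * = this
  have **: "(\<Sum>n\<in>F. (?G n)\<^sup>2 * en n powr (4/3)) \<le> 48 * E powr (1/3)"
  proof -
    have "(\<Sum>n\<in>F. (?G n)\<^sup>2 * (en n powr (4/3) / (4/3))) = 3 / 4 * (\<Sum>n\<in>F. (?G n)\<^sup>2 * en n powr (4/3))"
      by (simp add: sum_distrib_left mult_ac)
    with * show ?thesis by simp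
  qed
  have "(\<Sum>n\<in>F. ?G n powr Q) = (2 * C) powr (4 / real r) * (\<Sum>n\<in>F. (?G n)\<^sup>2 * en n powr (4/3))"
    by (simp only: pw sum_distrib_left)
  also have "\<dots> \<le> (2 * C) powr (4 / real r) * (48 * E powr (1/3))" using ** by (intro mult_left_mono) auto
  also have "E powr (1/3) = (3 / (2 * C)) powr (1 / real r)" by (simp add: E_def powr_powr)
  finally show ?thesis .
qed

text \<open>The case r = 1: 2 C = 18, and 18^4 times 48 / 6 is 839808.\<close>

lemma sum_upper_green_power6_le:
  assumes "Im lam > 0" "3 \<le> CARD('n)" "finite F"
  shows "(\<Sum>n\<in>F. cmod (upper_green lam (n :: int ^ ('n::finite))) powr 6) \<le> 839808"
proof -
  have "(18::real) powr 4 = 104976" by (subst powr_numeral) auto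
  then show ?thesis using sum_upper_green_power_le[of lam 1 F] assms by (simp add: powr_divide)
qed

text \<open>The case r = 2: 2 C = 24, and 24^2 times 48 times 0.36 is below 10000.\<close>

lemma sum_upper_green_power4_le:
  assumes "Im lam > 0" "4 \<le> CARD('n)" "finite F"
  shows "(\<Sum>n\<in>F. cmod (upper_green lam (n :: int ^ ('n::finite))) powr 4) \<le> 10000"
proof -
  have "(24::real) powr 2 = 576" by (subst powr_numeral) auto
  moreover have "(1/8::real) powr (1/2) \<le> 36 / 100"
  proof -
    have "sqrt (1/8::real) \<le> 36 / 100" by (rule real_le_lsqrt) (auto simp: power2_eq_square)
    then show ?thesis by (simp add: powr_half_sqrt)
  qed
  ultimately show ?thesis using sum_upper_green_power_le[of lam 2 F] assms by simp
qed

section \<open>Young's inequality for a bilinear form\<close>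

lemma weighted_amgm3:
  fixes x y z :: real
  assumes "x > 0" "y > 0" "z > 0" "\<alpha> \<ge> 0" "\<beta> \<ge> 0" "\<gamma> \<ge> 0" "\<alpha> + \<beta> + \<gamma> = 1"
  shows "x powr \<alpha> * y powr \<beta> * z powr \<gamma> \<le> \<alpha> * x + \<beta> * y + \<gamma> * z"
proof -
  \<comment> \<open>M is the logarithm of the weighted geometric mean. The tangent of exp at M
    bounds each of x, y, z from below, and averaging the three tangents removes the
    logarithms.\<close>
  define M where "M = \<alpha> * ln x + \<beta> * ln y + \<gamma> * ln z"
  have tangent: "exp M * (1 + ln w - M) \<le> w" if "w > 0" for w
  proof -
    have "exp M * (1 + (ln w - M)) \<le> exp M * exp (ln w - M)" by (intro mult_left_mono exp_ge_add_one_self) auto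
    also have "\<dots> = w" using that by (simp add: exp_add[symmetric])
    finally show ?thesis by (simp add: algebra_simps)
  qed
  have "x powr \<alpha> * y powr \<beta> * z powr \<gamma> = exp M" using assms by (simp add: powr_def exp_add M_def)
  also have "\<dots> = \<alpha> * (exp M * (1 + ln x - M)) + \<beta> * (exp M * (1 + ln y - M)) + \<gamma> * (exp M * (1 + ln z - M))"
  proof -
    have "\<alpha> * (e * (1 + ln x - M)) + \<beta> * (e * (1 + ln y - M)) + \<gamma> * (e * (1 + ln z - M))
       = e * ((\<alpha> + \<beta> + \<gamma>) * (1 - M) + M)" for e by (simp add: M_def algebra_simps)
    then show ?thesis using assms(7) by simp
  qed
  also have "\<dots> \<le> \<alpha> * x + \<beta> * y + \<gamma> * z"
    by (intro add_mono mult_left_mono tangent assms)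
  finally show ?thesis .
qed

text \<open>The exponents satisfy 1/p + 1/p + 2/q = 2. Each term is the product of (a^p
  h^(q/2))^(1/q), (b^p h^(q/2))^(1/q) and (a^p b^p)^(1 - 2/q); the weighted mean inequality
  separates it into three double sums that are at most 1.\<close>

lemma young_bilinear_normalized:
  fixes a b :: "int ^ ('n::finite) \<Rightarrow> real" and h :: "int ^ 'n \<Rightarrow> real" and p q :: real
  assumes p: "p > 1" "1 / p + 1 / q = 1" "q \<ge> 2"
    and nn: "\<And>i. a i \<ge> 0" "\<And>i. b i \<ge> 0" "\<And>i. h i \<ge> 0" and fin: "finite A" "finite B"
    and a: "(\<Sum>i\<in>A. a i powr p) \<le> 1" and b: "(\<Sum>i\<in>B. b i powr p) \<le> 1"
    and h: "\<And>F. finite F \<Longrightarrow> (\<Sum>n\<in>F. h n powr (q / 2)) \<le> 1"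
  shows "(\<Sum>i\<in>A. \<Sum>j\<in>B. a i * b j * h (i - j)) \<le> 1"
proof -
  have q: "q > 0" using p by simp
  have pq: "p * (1 - 1 / q) = 1" using p by (simp add: field_simps)
  have pt: "a i * b j * h (i - j) \<le> 1 / q * (a i powr p * h (i - j) powr (q / 2)) + 1 / q * (b j powr p * h (i - j) powr (q / 2))
     + (1 - 2 / q) * (a i powr p * b j powr p)" for i j
  proof (cases "a i = 0 \<or> b j = 0 \<or> h (i - j) = 0")
    case True
    have "0 \<le> 1 / q * (a i powr p * h (i - j) powr (q / 2)) + 1 / q * (b j powr p * h (i - j) powr (q / 2))
     + (1 - 2 / q) * (a i powr p * b j powr p)"
      using q p(3) by (intro add_nonneg_nonneg mult_nonneg_nonneg) auto
    then show ?thesis using True by auto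
  next
    case False
    define x y z where "x = a i" and "y = b j" and "z = h (i - j)"
    have pos: "x > 0" "y > 0" "z > 0" using False nn[of i] nn(2)[of j] nn(3)[of "i - j"] by (auto simp: x_def y_def z_def less_le)
    have e: "p * (1 / q) + p * (1 - 2 / q) = 1" "q / 2 * (1 / q) + q / 2 * (1 / q) = 1"
      using pq q by (auto simp: field_simps)
    have "(x powr p * z powr (q/2)) powr (1/q) * (y powr p * z powr (q/2)) powr (1/q) * (x powr p * y powr p) powr (1 - 2/q)
       = (x powr (p * (1/q)) * x powr (p * (1 - 2/q))) * (y powr (p * (1/q)) * y powr (p * (1 - 2/q)))
         * (z powr (q / 2 * (1/q)) * z powr (q / 2 * (1/q)))"
      using pos by (simp add: powr_mult powr_powr mult_ac)
    also have "\<dots> = x * y * z" using pos by (simp only: powr_add[symmetric] e powr_one)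
    finally have "x * y * z = (x powr p * z powr (q/2)) powr (1/q) * (y powr p * z powr (q/2)) powr (1/q) * (x powr p * y powr p) powr (1 - 2/q)" ..
    also have "\<dots> \<le> 1/q * (x powr p * z powr (q/2)) + 1/q * (y powr p * z powr (q/2)) + (1 - 2/q) * (x powr p * y powr p)"
      by (rule weighted_amgm3) (use pos q p(3) in auto)
    finally show ?thesis by (simp only: x_def y_def z_def)
  qed
  have h1: "(\<Sum>j\<in>B. h (i - j) powr (q / 2)) \<le> 1" for i
  proof -
    have "(\<Sum>j\<in>B. h (i - j) powr (q / 2)) = (\<Sum>n\<in>(\<lambda>j. i - j) ` B. h n powr (q / 2))"
      by (subst sum.reindex) (auto simp: inj_on_def)
    then show ?thesis using h[of "(\<lambda>j. i - j) ` B"] fin by simp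
  qed
  have h2: "(\<Sum>i\<in>A. h (i - j) powr (q / 2)) \<le> 1" for j
  proof -
    have "(\<Sum>i\<in>A. h (i - j) powr (q / 2)) = (\<Sum>n\<in>(\<lambda>i. i - j) ` A. h n powr (q / 2))"
      by (subst sum.reindex) (auto simp: inj_on_def)
    then show ?thesis using h[of "(\<lambda>i. i - j) ` A"] fin by simp
  qed
  have s1: "(\<Sum>i\<in>A. \<Sum>j\<in>B. a i powr p * h (i - j) powr (q / 2)) \<le> 1"
  proof -
    have "(\<Sum>i\<in>A. \<Sum>j\<in>B. a i powr p * h (i - j) powr (q / 2)) \<le> (\<Sum>i\<in>A. a i powr p * 1)"
      unfolding sum_distrib_left[symmetric] by (intro sum_mono mult_left_mono h1) auto
    then show ?thesis using a by simp
  qed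
  have s2: "(\<Sum>i\<in>A. \<Sum>j\<in>B. b j powr p * h (i - j) powr (q / 2)) \<le> 1"
  proof -
    have "(\<Sum>i\<in>A. \<Sum>j\<in>B. b j powr p * h (i - j) powr (q / 2)) = (\<Sum>j\<in>B. \<Sum>i\<in>A. b j powr p * h (i - j) powr (q / 2))"
      by (rule sum.swap)
    also have "\<dots> \<le> (\<Sum>j\<in>B. b j powr p * 1)"
      unfolding sum_distrib_left[symmetric] by (intro sum_mono mult_left_mono h2) auto
    finally show ?thesis using b by simp
  qed
  have s3: "(\<Sum>i\<in>A. \<Sum>j\<in>B. a i powr p * b j powr p) \<le> 1"
    unfolding sum_product[symmetric] by (intro mult_le_one a b sum_nonneg) auto
  have "(\<Sum>i\<in>A. \<Sum>j\<in>B. a i * b j * h (i - j))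
    \<le> (\<Sum>i\<in>A. \<Sum>j\<in>B. 1 / q * (a i powr p * h (i - j) powr (q / 2)) + 1 / q * (b j powr p * h (i - j) powr (q / 2))
       + (1 - 2 / q) * (a i powr p * b j powr p))"
    by (intro sum_mono pt)
  also have "\<dots> = 1 / q * (\<Sum>i\<in>A. \<Sum>j\<in>B. a i powr p * h (i - j) powr (q / 2)) + 1 / q * (\<Sum>i\<in>A. \<Sum>j\<in>B. b j powr p * h (i - j) powr (q / 2))
       + (1 - 2 / q) * (\<Sum>i\<in>A. \<Sum>j\<in>B. a i powr p * b j powr p)"
    by (simp only: sum.distrib sum_distrib_left)
  also have "\<dots> \<le> 1 / q * 1 + 1 / q * 1 + (1 - 2 / q) * 1"
    by (intro add_mono mult_left_mono s1 s2 s3) (use q p(3) in auto)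
  also have "\<dots> = 1" by simp
  finally show ?thesis .
qed

lemma young_bilinear:
  fixes a b :: "int ^ ('n::finite) \<Rightarrow> real" and h :: "int ^ 'n \<Rightarrow> real" and p q :: real
  assumes p: "p > 1" "1 / p + 1 / q = 1" "q \<ge> 2"
    and nn: "\<And>i. a i \<ge> 0" "\<And>i. b i \<ge> 0" "\<And>i. h i \<ge> 0" and fin: "finite A" "finite B"
    and a: "(\<Sum>i\<in>A. a i powr p) \<le> \<alpha> powr p" and b: "(\<Sum>i\<in>B. b i powr p) \<le> \<beta> powr p"
    and h: "\<And>F. finite F \<Longrightarrow> (\<Sum>n\<in>F. h n powr (q / 2)) \<le> H powr (q / 2)"
    and pos: "\<alpha> > 0" "\<beta> > 0" "H > 0"
  shows "(\<Sum>i\<in>A. \<Sum>j\<in>B. a i * b j * h (i - j)) \<le> H * \<alpha> * \<beta>"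
proof -
  have sc: "(\<Sum>i\<in>F. (f i / c) powr s) \<le> 1" if "(\<Sum>i\<in>F. f i powr s) \<le> c powr s" "c > 0" "\<And>i. f i \<ge> 0" for F :: "(int ^ 'n) set" and f and c s :: real
  proof -
    have "(\<Sum>i\<in>F. (f i / c) powr s) = (\<Sum>i\<in>F. f i powr s) / c powr s"
      using that by (simp add: powr_divide sum_divide_distrib)
    then show ?thesis using that by (simp add: divide_le_eq)
  qed
  have "(\<Sum>i\<in>A. \<Sum>j\<in>B. (a i / \<alpha>) * (b j / \<beta>) * (h (i - j) / H)) \<le> 1"
    by (rule young_bilinear_normalized[OF p]) (use nn fin pos in \<open>auto intro!: sc a b h\<close>)
  moreover have "(\<Sum>i\<in>A. \<Sum>j\<in>B. (a i / \<alpha>) * (b j / \<beta>) * (h (i - j) / H)) = (\<Sum>i\<in>A. \<Sum>j\<in>B. a i * b j * h (i - j)) / (H * \<alpha> * \<beta>)"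
    by (simp add: sum_divide_distrib mult_ac)
  ultimately show ?thesis using pos by (simp add: divide_le_eq)
qed

section \<open>Lower bounds for the constants in the theorem\<close>

lemma Gamma_d4_tendsto:
  "((\<lambda>q::real. (3 + 2 * ((5 * q - 1) / (4 - 3 * q)) powr ((5 * q - 4) / (4 * (q - 1)))) powr (4 * (q - 1) / q)) \<longlongrightarrow> 4) (at_right 1)"
  by real_asymp

text \<open>With B = (5 p - 1) / (4 - 3 p), \<open>kappa_const\<close> grows like B^(1 / (4 (p -
  1))) while the outer exponent tends to 0 at the matching rate; what is left is the value of B at p
  = 1.\<close>

lemma Gamma_const_4_at_1: "Gamma_const 1 4 = 4"
proof -
  have "Lim (at_right 1) (\<lambda>q. (3 + 2 * kappa_const q 4) powr (real 4 * (q - 1) / q)) = 4"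
    by (rule tendsto_Lim) (use Gamma_d4_tendsto in \<open>simp_all add: kappa_const_def\<close>)
  then show ?thesis by (simp add: Gamma_const_def)
qed

lemma C_const_ge_1: "1 \<le> p \<Longrightarrow> C_const p d \<ge> 1"
  by (auto simp: C_const_def intro!: ge_one_powr_ge_zero)

lemma Gamma_const_3_ge:
  assumes "1 \<le> p" "p < 6 / 5"
  shows "Gamma_const p 3 \<ge> 3 powr (3 * (p - 1) / p)"
proof -
  have "kappa_const p 3 \<ge> 0" using assms by (simp add: kappa_const_def)
  then show ?thesis using assms by (auto simp: Gamma_const_def intro!: powr_mono2)
qed

text \<open>Of 3 + 2 \<open>kappa_const\<close> only one \<open>kappa_const\<close> is kept; then
  the two exponents multiply to 1 + 4 (p - 1) / p, and the base is at least 4.\<close>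

lemma Gamma_const_4_ge:
  assumes "1 \<le> p" "p < 4 / 3"
  shows "Gamma_const p 4 \<ge> 4 * 256 powr ((p - 1) / p)"
proof (cases "p = 1")
  case False
  then have p: "p > 1" using assms by simp
  define B where "B = (5 * p - 1) / (4 - 3 * p)"
  have B: "B \<ge> 4" using assms p by (simp add: B_def le_divide_eq)
  have k: "kappa_const p 4 = B powr ((5 * p - 4) / (4 * (p - 1)))" by (simp add: kappa_const_def B_def)
  have "4 * 256 powr ((p - 1) / p) = (4::real) powr 1 * (4 powr 4) powr ((p - 1) / p)" by (simp add: powr_numeral)
  also have "\<dots> = 4 powr (1 + 4 * ((p - 1) / p))" by (simp only: powr_powr powr_add)
  also have "1 + 4 * ((p - 1) / p) = (5 * p - 4) / (4 * (p - 1)) * (4 * (p - 1) / p)"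
    using p by (simp add: field_simps)
  also have "4 powr \<dots> \<le> B powr ((5 * p - 4) / (4 * (p - 1)) * (4 * (p - 1) / p))"
    using B p by (intro powr_mono2) auto
  also have "\<dots> = kappa_const p 4 powr (4 * (p - 1) / p)" by (simp only: k powr_powr)
  also have "\<dots> \<le> (3 + 2 * kappa_const p 4) powr (4 * (p - 1) / p)"
    using p by (intro powr_mono2) (auto simp: k)
  finally show ?thesis using False by (simp add: Gamma_const_def)
qed (simp add: Gamma_const_4_at_1)

lemma Gamma_const_ge_5_ge:
  assumes "1 \<le> p" "p < 4 / 3" "d \<ge> 5"
  shows "Gamma_const p d \<ge> 3 powr (5 * ((p - 1) / p))"
proof -
  have "(2 * real d + 1) * p \<le> (2 * real d + 1) * (4 / 3)" using assms by (intro mult_left_mono) auto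
  also have "\<dots> \<le> 3 * real d" using assms by simp
  finally have "kappa_const p d \<ge> 0" using assms by (simp add: kappa_const_def)
  then have "3 powr (real d * (p - 1) / p) \<le> Gamma_const p d" using assms by (auto simp: Gamma_const_def intro!: powr_mono2)
  moreover have "3 powr (5 * ((p - 1) / p)) \<le> (3::real) powr (real d * ((p - 1) / p))"
    using assms by (intro powr_mono mult_right_mono) auto
  moreover have "real d * ((p - 1) / p) = real d * (p - 1) / p" by simp
  ultimately show ?thesis by (simp only:)
qed

text \<open>Put m = d - 4. As ln 2 \<ge> 2/3, 2^(m/4) is at least (1 + m / 12)^2, a parabola that
  stays above 2 m / 7.\<close>

lemma C0_const_ge_8:
  assumes "d \<ge> 5" shows "C0_const d \<ge> 8"
proof -
  define m where "m = real d - 4"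
  have m: "m \<ge> 1" using assms by (simp add: m_def)
  have "1 + m / 8 * (2 / 3) \<le> 1 + m / 8 * ln 2"
    using m ln2_ge_two_thirds by (intro add_left_mono mult_left_mono) auto
  also have "\<dots> \<le> exp (m / 8 * ln 2)" by (rule exp_ge_add_one_self)
  also have "\<dots> = 2 powr (m / 8)" by (simp add: powr_def)
  finally have "(1 + m / 8 * (2 / 3))\<^sup>2 \<le> (2 powr (m / 8))\<^sup>2" using m by (intro power_mono) auto
  also have "(2 powr (m / 8))\<^sup>2 = 2 powr (m / 4)" by (simp add: powr_realpow[symmetric] powr_powr)
  finally have 1: "(1 + m / 8 * (2 / 3))\<^sup>2 \<le> 2 powr (m / 4)" .
  have "0 \<le> (m / 8 * (2 / 3) - 1)\<^sup>2 + (4 * (1 / 12) - 4 / 14) * m"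
    using m by (intro add_nonneg_nonneg mult_nonneg_nonneg) auto
  also have "\<dots> = (1 + m / 8 * (2 / 3))\<^sup>2 - 4 / 14 * m" by (simp add: power2_eq_square algebra_simps)
  finally have "8 * m \<le> 14 * (2 * 2 powr (m / 4))" using 1 by simp
  also have "2 * 2 powr (m / 4) = 2 powr (real d / 4)"
  proof -
    have "real d / 4 = 1 + m / 4" by (simp add: m_def field_simps)
    then show ?thesis by (simp only: powr_add) simp
  qed
  finally have "8 \<le> 14 * 2 powr (real d / 4) / m" using m by (simp add: pos_le_divide_eq)
  then show ?thesis using assms by (simp add: C0_const_def m_def)
qed

definition admissible :: "real \<Rightarrow> nat \<Rightarrow> bool" where
  "admissible p d \<longleftrightarrow> d \<ge> 3 \<and> 1 \<le> p \<and> (d = 3 \<longrightarrow> p < 6 / 5) \<and> (d \<ge> 4 \<longrightarrow> p < 4 / 3)"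

text \<open>The Hilbert-Schmidt norm of the Birman-Schwinger operator turns out to be smaller than
  \<open>C_*\<close> by a factor of more than \<open>(2 \<pi>)\<^bsup>1/2\<^esup>\<close>, which is what the third trace inequality needs.\<close>

definition hs_const :: "real \<Rightarrow> nat \<Rightarrow> real" where
  "hs_const p d = (C_star p d)\<^sup>2 / (2 * pi) - 1 / (real d)\<^sup>2"

text \<open>2 pi < 7, and in (1 + w)^2 = w^2 + (1 + 2 w) the bracket is at least 17, which divided
  by 7 pays for 1 / d^2 \<le> 1/9.\<close>

lemma hs_const_ge:
  assumes "d \<ge> 3" "C_star p d \<ge> 1 + w" "w \<ge> 8"
  shows "hs_const p d \<ge> w\<^sup>2 / 7"
proof -
  have "(1 + w)\<^sup>2 \<le> (C_star p d)\<^sup>2" using assms by (intro power_mono) auto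
  then have "(1 + w)\<^sup>2 / 7 \<le> (C_star p d)\<^sup>2 / (2 * pi)"
    using pi_approx by (intro frac_le) auto
  moreover have "1 / (real d)\<^sup>2 \<le> 1 / 3\<^sup>2" using assms(1) by (intro divide_left_mono power_mono) auto
  moreover have "(1 + w)\<^sup>2 / 7 \<ge> w\<^sup>2 / 7 + 1 / 3\<^sup>2"
  proof -
    have "(1 + w)\<^sup>2 = w\<^sup>2 + (1 + 2 * w)" by (simp add: power2_eq_square algebra_simps)
    then show ?thesis using assms(3) by (simp add: add_divide_distrib)
  qed
  ultimately show ?thesis unfolding hs_const_def by linarith
qed

lemma powr_squared: "(b powr (k * x))\<^sup>2 = (b powr (2 * k)) powr (x :: real)"
  by (simp add: power2_eq_square powr_add[symmetric] powr_powr mult.assoc)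

text \<open>The bases 839808 / 3^6 and 10000 / 3^4 are the power sums of Green's function relative
  to its sup bound 3; the exponent is the 2 / q that Young's inequality produces. At p = 1 the
  targets reduce to 9 = 3^2.\<close>

lemma hs_const_bounds:
  assumes "admissible p d"
  shows "hs_const p d \<ge> 9"
    and "d = 3 \<Longrightarrow> hs_const p d \<ge> 9 * (839808 / 3 powr 6) powr (2 * ((p - 1) / p))"
    and "d \<ge> 4 \<Longrightarrow> hs_const p d \<ge> 9 * (10000 / 3 powr 4) powr (2 * ((p - 1) / p))"
proof -
  define x where "x = (p - 1) / p"
  have p: "p \<ge> 1" "p < 4 / 3" using assms by (auto simp: admissible_def)
  have x: "x \<ge> 0" using p by (simp add: x_def)
  have C: "C_star p d \<ge> 1 + C0_const d * g" if "Gamma_const p d \<ge> g" "C0_const d \<ge> 0" for g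
    unfolding C_star_def using C_const_ge_1[OF p(1), of d] that by (intro add_mono mult_left_mono) auto
  have d3: "hs_const p d \<ge> 36 * (729 powr x)" if "d = 3"
  proof -
    have "Gamma_const p d \<ge> 3 powr (3 * x)" using Gamma_const_3_ge[of p] assms that by (simp add: admissible_def x_def)
    then have "C_star p d \<ge> 1 + 16 * 3 powr (3 * x)" using C[of "3 powr (3 * x)"] that by (simp add: C0_const_def)
    moreover have "3 powr (3 * x) \<ge> (1::real)" using x by (intro ge_one_powr_ge_zero) auto
    ultimately have "hs_const p d \<ge> (16 * 3 powr (3 * x))\<^sup>2 / 7" using that by (intro hs_const_ge) auto
    also have "(16 * 3 powr (3 * x))\<^sup>2 = 256 * 729 powr x" by (simp only: power_mult_distrib powr_squared) simp
    finally show ?thesis using powr_ge_zero[of 729 x] by linarith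
  qed
  have d4: "hs_const p d \<ge> 36 * (65536 powr x)" if "d = 4"
  proof -
    have "Gamma_const p d \<ge> 4 * 256 powr x" using Gamma_const_4_ge[of p] p that by (simp add: x_def)
    then have "C_star p d \<ge> 1 + 16 * 256 powr x" using C[of "4 * 256 powr x"] that by (simp add: C0_const_def)
    moreover have "256 powr x \<ge> (1::real)" using x by (intro ge_one_powr_ge_zero) auto
    ultimately have "hs_const p d \<ge> (16 * 256 powr x)\<^sup>2 / 7" using that by (intro hs_const_ge) auto
    also have "(16 * 256 powr x)\<^sup>2 = 256 * (65536::real) powr x"
    proof -
      have "(256 powr x)\<^sup>2 = ((256::real) * 256) powr x" unfolding power2_eq_square by (rule powr_mult[symmetric])
      then show ?thesis by (simp add: power_mult_distrib)
    qed
    finally show ?thesis using powr_ge_zero[of 65536 x] by linarith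
  qed
  have d5: "hs_const p d \<ge> 9 * (59049 powr x)" if "d \<ge> 5"
  proof -
    have "Gamma_const p d \<ge> 3 powr (5 * x)" using Gamma_const_ge_5_ge[of p d] p that by (simp add: x_def)
    then have "C_star p d \<ge> 1 + C0_const d * 3 powr (5 * x)" using C0_const_ge_8[OF that] by (intro C) auto
    then have C5: "C_star p d \<ge> 1 + 8 * 3 powr (5 * x)"
      using mult_right_mono[OF C0_const_ge_8[OF that], of "3 powr (5 * x)"] powr_ge_zero[of 3 "5 * x"] by linarith
    moreover have "3 powr (5 * x) \<ge> (1::real)" using x by (intro ge_one_powr_ge_zero) auto
    ultimately have "hs_const p d \<ge> (8 * 3 powr (5 * x))\<^sup>2 / 7" using that by (intro hs_const_ge) auto
    also have "(8 * 3 powr (5 * x))\<^sup>2 = 64 * 59049 powr x" by (simp only: power_mult_distrib powr_squared) simp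
    finally show ?thesis using powr_ge_zero[of 59049 x] by linarith
  qed
  have ge1: "c powr x \<ge> 1" if "c \<ge> 1" for c :: real using that x by (intro ge_one_powr_ge_zero)
  have "d \<ge> 3" using assms by (simp add: admissible_def)
  then consider "d = 3" | "d = 4" | "d \<ge> 5" by linarith
  then show "hs_const p d \<ge> 9"
    using d3 d4 d5 ge1[of 729] ge1[of 65536] ge1[of 59049] by cases auto
  have sq: "c powr (2 * x) = (c * c) powr x" if "c > 0" for c :: real
    using that by (simp add: powr_mult powr_add[symmetric])
  show "hs_const p d \<ge> 9 * (839808 / 3 powr 6) powr (2 * ((p - 1) / p))" if "d = 3"
  proof -
    \<comment> \<open>Here p < 6/5 enters as x < 1/6: 1152^2 is at most 1821 times 729, and 1821^x
      is at most 4096^(1/6) = 4, which is the room between 36 and 9.\<close>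
    have x6: "x < 1 / 6" using assms that by (simp add: x_def admissible_def field_simps)
    have "(839808 / 3 powr 6) powr (2 * x) = (1152 * 1152 :: real) powr x" by (subst sq) auto
    also have "\<dots> \<le> (1821 * 729) powr x" using x by (intro powr_mono2) auto
    also have "\<dots> = 1821 powr x * 729 powr x" by (rule powr_mult)
    also have "1821 powr x \<le> (4096 :: real) powr x" using x by (intro powr_mono2) auto
    also have "(4096 :: real) powr x \<le> 4096 powr (1 / 6)" using x6 by (intro powr_mono) auto
    also have "(4096 :: real) powr (1 / 6) = (4 powr 6) powr (1 / 6)" by simp
    also have "\<dots> = 4" unfolding powr_powr by simp
    finally have "(839808 / 3 powr 6) powr (2 * x) \<le> 4 * (729::real) powr x" by simp
    with d3[OF that] show ?thesis using ge1[of 729] by (simp add: x_def[symmetric])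
  qed
  show "hs_const p d \<ge> 9 * (10000 / 3 powr 4) powr (2 * ((p - 1) / p))" if "d \<ge> 4"
  proof -
    have "(10000 / 3 powr 4) powr (2 * x) = ((10000 / 81) * (10000 / 81) :: real) powr x" by (subst sq) auto
    also have "\<dots> \<le> 59049 powr x" using x by (intro powr_mono2) auto
    finally have 1: "(10000 / 3 powr 4) powr (2 * x) \<le> (59049::real) powr x" .
    have 2: "(59049::real) powr x \<le> 65536 powr x" using x by (intro powr_mono2) auto
    have "d = 4 \<or> d \<ge> 5" using that by auto
    then show ?thesis using d4 d5 1 2 ge1[of 59049] ge1[of 65536] by (auto simp: x_def[symmetric])
  qed
qed

text \<open>For p = 1 the sup bound 3 suffices. For p > 1 Young's inequality asks for the l^q norm
  of Green's function with q = p / (p - 1), obtained by interpolating between l^Q and the sup norm;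
  q \<ge> Q means p \<le> 6/5 for Q = 6 and p \<le> 4/3 for Q = 4.\<close>

lemma upper_green_hs_bound:
  fixes a b :: "int ^ ('n::finite) \<Rightarrow> real"
  assumes adm: "admissible p CARD('n)" and lam: "Im lam > 0"
    and nn: "\<And>i. a i \<ge> 0" "\<And>i. b i \<ge> 0" and fin: "finite A" "finite B" and pos: "\<alpha> > 0" "\<beta> > 0"
    and a: "(\<Sum>i\<in>A. a i powr p) \<le> \<alpha> powr p" and b: "(\<Sum>i\<in>B. b i powr p) \<le> \<beta> powr p"
  shows "(\<Sum>i\<in>A. \<Sum>j\<in>B. a i * b j * (cmod (upper_green lam (i - j)))\<^sup>2) \<le> hs_const p CARD('n) * \<alpha> * \<beta>"
proof -
  let ?G = "\<lambda>n. cmod (upper_green lam (n :: int ^ 'n))"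
  have d3: "CARD('n) \<ge> 3" and p1: "p \<ge> 1" using adm by (auto simp: admissible_def)
  have G3: "?G n \<le> 3" for n by (rule cmod_upper_green_le[OF lam d3])
  show ?thesis
  proof (cases "p = 1")
    case True
    have "(\<Sum>i\<in>A. \<Sum>j\<in>B. a i * b j * (?G (i - j))\<^sup>2) \<le> (\<Sum>i\<in>A. \<Sum>j\<in>B. a i * b j * 3\<^sup>2)"
      using nn G3 by (intro sum_mono mult_left_mono power_mono mult_nonneg_nonneg) auto
    also have "\<dots> = (\<Sum>i\<in>A. \<Sum>j\<in>B. a i * b j) * 3\<^sup>2" by (simp only: sum_distrib_right)
    also have "\<dots> = 9 * ((\<Sum>i\<in>A. a i) * (\<Sum>j\<in>B. b j))" by (simp add: sum_product)
    also have "\<dots> \<le> 9 * (\<alpha> * \<beta>)"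
      using a b nn pos True by (intro mult_left_mono mult_mono sum_nonneg) auto
    also have "\<dots> \<le> hs_const p CARD('n) * (\<alpha> * \<beta>)"
      using hs_const_bounds(1)[OF adm] pos by (intro mult_right_mono) auto
    finally show ?thesis by (simp add: mult.assoc)
  next
    case False
    then have p: "p > 1" using p1 by simp
    define q where "q = p / (p - 1)"
    have q: "1 / p + 1 / q = 1" "1 / q = (p - 1) / p" using p by (auto simp: q_def field_simps)
    have main: ?thesis if Q: "Q \<ge> 2" "q \<ge> Q" and S: "S > 0" "\<And>F. finite F \<Longrightarrow> (\<Sum>n\<in>F. ?G n powr Q) \<le> S"
      and hs: "hs_const p CARD('n) \<ge> 9 * (S / 3 powr Q) powr (2 * ((p - 1) / p))" for Q S
    proof -
      define H where "H = 9 * (S / 3 powr Q) powr (2 / q)"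
      have q0: "q > 0" using Q by simp
      have H: "H > 0" using S by (simp add: H_def)
      have Hq: "H powr (q / 2) = 3 powr q * (S / 3 powr Q)"
      proof -
        have "(9::real) powr (q / 2) = (3 powr 2) powr (q / 2)" by simp
        also have "\<dots> = 3 powr q" unfolding powr_powr by simp
        finally show ?thesis using S q0 by (simp add: H_def powr_mult powr_powr)
      qed
      have "(\<Sum>i\<in>A. \<Sum>j\<in>B. a i * b j * (?G (i - j))\<^sup>2) \<le> H * \<alpha> * \<beta>"
      proof (rule young_bilinear[OF p q(1)])
        fix F :: "(int ^ 'n) set" assume F: "finite F"
        have "(\<Sum>n\<in>F. (?G n)\<^sup>2 powr (q / 2)) \<le> (\<Sum>n\<in>F. 3 powr (q - Q) * ?G n powr Q)"
        proof (rule sum_mono)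
          fix n
          have "(?G n)\<^sup>2 powr (q / 2) = ?G n powr q"
          proof (cases "?G n = 0")
            case False
            then have "(?G n)\<^sup>2 = ?G n powr 2" by (simp add: powr_realpow)
            then show ?thesis by (simp only: powr_powr) simp
          qed simp
          also have "\<dots> = ?G n powr (q - Q) * ?G n powr Q" by (simp add: powr_add[symmetric])
          also have "\<dots> \<le> 3 powr (q - Q) * ?G n powr Q" using G3 Q by (intro mult_right_mono powr_mono2) auto
          finally show "(?G n)\<^sup>2 powr (q / 2) \<le> 3 powr (q - Q) * ?G n powr Q" .
        qed
        also have "\<dots> \<le> 3 powr (q - Q) * S" unfolding sum_distrib_left[symmetric] using S(2)[OF F] by (intro mult_left_mono) auto
        also have "\<dots> = H powr (q / 2)" unfolding Hq by (simp add: powr_diff)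
        finally show "(\<Sum>n\<in>F. (?G n)\<^sup>2 powr (q / 2)) \<le> H powr (q / 2)" .
      qed (use Q nn fin a b pos H in auto)
      also have "H * \<alpha> * \<beta> \<le> hs_const p CARD('n) * \<alpha> * \<beta>"
        using hs pos by (intro mult_right_mono) (auto simp: H_def q(2)[symmetric])
      finally show ?thesis .
    qed
    show ?thesis
    proof (cases "CARD('n) = 3")
      case True
      then have "p < 6 / 5" using adm by (simp add: admissible_def)
      then have "q \<ge> 6" using p by (simp add: q_def pos_le_divide_eq)
      then show ?thesis
        using hs_const_bounds(2)[OF adm True] sum_upper_green_power6_le[OF lam d3]
        by (intro main[of 6 839808]) auto
    next
      case False
      then have d4: "CARD('n) \<ge> 4" using d3 by simp
      then have "p < 4 / 3" using adm by (simp add: admissible_def)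
      then have "q \<ge> 4" using p by (simp add: q_def pos_le_divide_eq)
      then show ?thesis
        using hs_const_bounds(3)[OF adm d4] sum_upper_green_power4_le[OF lam d4]
        by (intro main[of 4 10000]) auto
    qed
  qed
qed

lemma disc_green_cases:
  assumes "cmod z < 1" "Im z \<noteq> 0"
  obtains w where "w = z \<or> w = cnj z" "cmod w < 1" "Im w < 0" "Im (joukowski CARD('n) w) > 0"
    "\<And>n :: int ^ ('n::finite). cmod (disc_green z n) = cmod (upper_green (joukowski CARD('n) w) n)"
proof (cases "Im z < 0")
  case True
  then show ?thesis
    using that[of z] assms disc_green_upper[OF assms(1) True, where 'n = 'n] by auto
next
  case False
  then have "Im (cnj z) < 0" "cmod (cnj z) < 1" using assms by auto
  moreover have "cmod (disc_green z n) = cmod (disc_green (cnj z) n)" for n :: "int ^ 'n"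
    using disc_green_cnj[OF assms(1), where 'n = 'n] by simp
  ultimately show ?thesis using that[of "cnj z"] disc_green_upper[of "cnj z", where 'n = 'n] by auto
qed

lemma disc_green_hs_bound:
  fixes a b :: "int ^ ('n::finite) \<Rightarrow> real"
  assumes "admissible p CARD('n)" "cmod z < 1" "Im z \<noteq> 0"
    "\<And>i. a i \<ge> 0" "\<And>i. b i \<ge> 0" "finite A" "finite B" "\<alpha> > 0" "\<beta> > 0"
    "(\<Sum>i\<in>A. a i powr p) \<le> \<alpha> powr p" "(\<Sum>i\<in>B. b i powr p) \<le> \<beta> powr p"
  shows "(\<Sum>i\<in>A. \<Sum>j\<in>B. a i * b j * (cmod (disc_green z (i - j)))\<^sup>2) \<le> hs_const p CARD('n) * \<alpha> * \<beta>"
proof -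
  obtain w where w: "Im (joukowski CARD('n) w) > 0"
    "\<And>n :: int ^ 'n. cmod (disc_green z n) = cmod (upper_green (joukowski CARD('n) w) n)"
    by (rule disc_green_cases[OF assms(2,3), where 'n = 'n]) (rule that)
  show ?thesis unfolding w(2) by (rule upper_green_hs_bound[OF assms(1) w(1) assms(4-)])
qed

section \<open>Finite determinants\<close>

text \<open>Indexing by a set of lattice points matches \<open>principal_minor\<close> and lets
  minors be restricted to subsets without enumerating them; \<open>fdet_eq_det\<close> is the bridge
  to matrices.\<close>

definition fdet :: "'a set \<Rightarrow> ('a \<Rightarrow> 'a \<Rightarrow> complex) \<Rightarrow> complex" where
  "fdet S M = (\<Sum>\<pi> | \<pi> permutes S. of_int (sign \<pi>) * (\<Prod>i\<in>S. M i (\<pi> i)))"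

lemma fdet_cong: "(\<And>i j. i \<in> S \<Longrightarrow> j \<in> S \<Longrightarrow> M i j = N i j) \<Longrightarrow> fdet S M = fdet S N"
  unfolding fdet_def by (intro sum.cong arg_cong2[where f = times] prod.cong) (auto simp: permutes_in_image)

lemma fdet_zero_row:
  assumes "finite S" "i \<in> S" "\<And>j. j \<in> S \<Longrightarrow> M i j = 0"
  shows "fdet S M = 0"
  unfolding fdet_def
proof (intro sum.neutral ballI)
  fix \<pi> assume "\<pi> \<in> {\<pi>. \<pi> permutes S}"
  then have "M i (\<pi> i) = 0" using assms by (auto simp: permutes_in_image)
  then have "(\<Prod>i\<in>S. M i (\<pi> i)) = 0" using assms by (auto intro!: bexI[of _ i])
  then show "of_int (sign \<pi>) * (\<Prod>i\<in>S. M i (\<pi> i)) = 0" by simp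
qed

lemma fdet_zero_col:
  assumes "finite S" "j \<in> S" "\<And>i. i \<in> S \<Longrightarrow> M i j = 0"
  shows "fdet S M = 0"
  unfolding fdet_def
proof (intro sum.neutral ballI)
  fix \<pi> assume "\<pi> \<in> {\<pi>. \<pi> permutes S}"
  then have "\<pi> permutes S" by simp
  then obtain i where "i \<in> S" "\<pi> i = j" using assms(2) by (metis permutes_image image_iff)
  then have "(\<Prod>i\<in>S. M i (\<pi> i)) = 0" using assms by (auto intro!: bexI[of _ i])
  then show "of_int (sign \<pi>) * (\<Prod>i\<in>S. M i (\<pi> i)) = 0" by simp
qed

lemma fdet_scale:
  assumes "finite S"
  shows "fdet S (\<lambda>i j. a i * M i j * b j) = (\<Prod>i\<in>S. a i) * (\<Prod>i\<in>S. b i) * fdet S M"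
proof -
  have "(\<Prod>i\<in>S. a i * M i (\<pi> i) * b (\<pi> i)) = (\<Prod>i\<in>S. a i) * (\<Prod>i\<in>S. b i) * (\<Prod>i\<in>S. M i (\<pi> i))"
    if "\<pi> permutes S" for \<pi>
    using prod.permute[OF that, of b] by (simp add: prod.distrib o_def)
  then show ?thesis
    unfolding fdet_def sum_distrib_left by (intro sum.cong) (auto simp: mult_ac)
qed

lemma fdet_conj:
  assumes "finite S" "\<And>i. i \<in> S \<Longrightarrow> c i \<noteq> 0"
  shows "fdet S (\<lambda>i j. M i j * c j / c i) = fdet S M"
proof -
  have "fdet S (\<lambda>i j. M i j * c j / c i) = fdet S (\<lambda>i j. inverse (c i) * M i j * c j)"
    by (simp add: divide_inverse mult_ac)
  also have "\<dots> = (\<Prod>i\<in>S. inverse (c i) * c i) * fdet S M"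
    using assms(1) by (simp add: fdet_scale prod.distrib)
  also have "(\<Prod>i\<in>S. inverse (c i) * c i) = 1" using assms(2) by (intro prod.neutral) auto
  also have "1 * fdet S M = fdet S M" by simp
  finally show ?thesis .
qed

text \<open>Expand the product over i: a subset X survives for \<pi> only if \<pi> fixes every point
  outside X, that is, if \<pi> permutes X.\<close>

lemma fdet_one_plus:
  assumes "finite S"
  shows "fdet S (\<lambda>i j. (if i = j then 1 else 0) + M i j) = (\<Sum>X\<in>Pow S. fdet X M)"
proof -
  let ?d = "\<lambda>i j. if i = j then 1 else (0::complex)"
  have 1: "(\<Prod>i\<in>S. ?d i (\<pi> i) + M i (\<pi> i)) = (\<Sum>X\<in>Pow S. if \<pi> permutes X then \<Prod>i\<in>X. M i (\<pi> i) else 0)"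
    if p: "\<pi> permutes S" for \<pi>
  proof -
    have "(\<Prod>i\<in>S. M i (\<pi> i) + ?d i (\<pi> i)) = (\<Sum>X\<in>Pow S. (\<Prod>i\<in>X. M i (\<pi> i)) * (\<Prod>i\<in>S - X. ?d i (\<pi> i)))"
      by (rule prod_add[OF assms])
    also have "\<dots> = (\<Sum>X\<in>Pow S. if \<pi> permutes X then \<Prod>i\<in>X. M i (\<pi> i) else 0)"
    proof (intro sum.cong refl)
      fix X assume X: "X \<in> Pow S"
      show "(\<Prod>i\<in>X. M i (\<pi> i)) * (\<Prod>i\<in>S - X. ?d i (\<pi> i)) = (if \<pi> permutes X then \<Prod>i\<in>X. M i (\<pi> i) else 0)"
      proof (cases "\<pi> permutes X")
        case True
        then have "(\<Prod>i\<in>S - X. ?d i (\<pi> i)) = 1" by (intro prod.neutral) (auto simp: permutes_not_in)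
        then show ?thesis using True by simp
      next
        case False
        have "\<exists>i\<in>S - X. \<pi> i \<noteq> i"
        proof (rule ccontr)
          assume "\<not> ?thesis"
          then have "\<pi> permutes X" using p by (intro permutes_superset[of \<pi> S X]) auto
          with False show False by simp
        qed
        then obtain i where "i \<in> S - X" "\<pi> i \<noteq> i" by blast
        then have "(\<Prod>i\<in>S - X. ?d i (\<pi> i)) = 0" using assms by (intro prod_zero bexI[of _ i]) auto
        then show ?thesis using False by simp
      qed
    qed
    finally show ?thesis by (simp only: add.commute)
  qed
  have "fdet S (\<lambda>i j. ?d i j + M i j)
      = (\<Sum>\<pi> | \<pi> permutes S. \<Sum>X\<in>Pow S. if \<pi> permutes X then of_int (sign \<pi>) * (\<Prod>i\<in>X. M i (\<pi> i)) else 0)"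
    unfolding fdet_def by (intro sum.cong refl) (auto simp: 1 sum_distrib_left intro!: sum.cong)
  also have "\<dots> = (\<Sum>X\<in>Pow S. \<Sum>\<pi> | \<pi> permutes S. if \<pi> permutes X then of_int (sign \<pi>) * (\<Prod>i\<in>X. M i (\<pi> i)) else 0)"
    by (rule sum.swap)
  also have "\<dots> = (\<Sum>X\<in>Pow S. fdet X M)"
  proof (intro sum.cong refl)
    fix X assume X: "X \<in> Pow S"
    have "{\<pi>. \<pi> permutes S} \<inter> {\<pi>. \<pi> permutes X} = {\<pi>. \<pi> permutes X}"
      using X permutes_subset by blast
    then show "(\<Sum>\<pi> | \<pi> permutes S. if \<pi> permutes X then of_int (sign \<pi>) * (\<Prod>i\<in>X. M i (\<pi> i)) else 0) = fdet X M"
      unfolding fdet_def using assms by (simp add: sum.inter_restrict[symmetric] finite_permutations sum.If_cases)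
  qed
  finally show ?thesis .
qed

lemma fdet_eq_det:
  assumes f: "bij_betw f {0..<n} S"
  shows "fdet S M = det (mat n n (\<lambda>(a, b). M (f a) (f b)))"
proof -
  let ?N = "{0..<n}"
  let ?A = "mat n n (\<lambda>(a, b). M (f a) (f b))"
  define g where "g = inv_into ?N f"
  have g: "bij_betw g S ?N" unfolding g_def by (rule bij_betw_inv_into[OF f])
  have gf: "g (f x) = x" if "x \<in> ?N" for x using f that by (simp add: g_def bij_betw_def)
  have fg: "f (g y) = y" if "y \<in> S" for y using f that by (simp add: g_def bij_betw_def f_inv_into_f)
  have inj: "inj_on f ?N" using f by (simp add: bij_betw_def)
  have bb: "bij_betw (map_permutation ?N f) {\<pi>. \<pi> permutes ?N} {\<pi>. \<pi> permutes S}"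
    by (rule bij_betwI[where g = "map_permutation S g"])
       (use map_permutation_permutes[OF f] map_permutation_permutes[OF g] map_permutation_compose_inv[OF f _ gf]
          map_permutation_compose_inv[OF g _ fg] in auto)
  have "fdet S M = (\<Sum>p | p permutes ?N. of_int (sign (map_permutation ?N f p)) * (\<Prod>i\<in>S. M i (map_permutation ?N f p i)))"
    unfolding fdet_def by (rule sum.reindex_bij_betw[OF bb, symmetric])
  also have "\<dots> = (\<Sum>p | p permutes ?N. of_int (sign p) * (\<Prod>i = 0..<n. ?A $$ (i, p i)))"
  proof (intro sum.cong refl)
    fix p assume "p \<in> {p. p permutes ?N}"
    then have p: "p permutes ?N" by simp
    have s: "sign (map_permutation ?N f p) = sign p" by (rule sign_map_permutation[OF inj p]) simp
    have "(\<Prod>i\<in>S. M i (map_permutation ?N f p i)) = (\<Prod>i\<in>?N. M (f i) (map_permutation ?N f p (f i)))"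
      by (rule prod.reindex_bij_betw[OF f, symmetric])
    also have "\<dots> = (\<Prod>i = 0..<n. ?A $$ (i, p i))"
      using p permutes_in_image[OF p] by (intro prod.cong) (auto simp: map_permutation_apply[OF inj])
    finally show "of_int (sign (map_permutation ?N f p)) * (\<Prod>i\<in>S. M i (map_permutation ?N f p i)) = of_int (sign p) * (\<Prod>i = 0..<n. ?A $$ (i, p i))"
      by (simp add: s)
  qed
  also have "\<dots> = det ?A" by (simp add: det_def)
  finally show ?thesis .
qed

section \<open>Traces, Schur form and determinants bounded by Hilbert-Schmidt norms\<close>

definition mtrace :: "complex mat \<Rightarrow> complex" where
  "mtrace A = (\<Sum>i<dim_row A. A $$ (i, i))"

lemma index_mult_mat_sum:
  assumes "A \<in> carrier_mat n m" "B \<in> carrier_mat m k" "i < n" "j < k"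
  shows "(A * B) $$ (i, j) = (\<Sum>l<m. A $$ (i, l) * B $$ (l, j))"
  using assms by (simp add: scalar_prod_def atLeast0LessThan)

lemma mtrace_mult_commute:
  assumes "A \<in> carrier_mat n n" "B \<in> carrier_mat n n"
  shows "mtrace (A * B) = mtrace (B * A)"
proof -
  have "mtrace (A * B) = (\<Sum>i<n. \<Sum>l<n. A $$ (i, l) * B $$ (l, i))"
    unfolding mtrace_def using assms by (intro sum.cong) (auto simp: index_mult_mat_sum[OF assms] simp del: index_mult_mat(1))
  also have "\<dots> = (\<Sum>l<n. \<Sum>i<n. B $$ (l, i) * A $$ (i, l))"
    by (subst sum.swap) (simp add: mult.commute)
  also have "\<dots> = mtrace (B * A)"
    unfolding mtrace_def using assms by (intro sum.cong) (auto simp: index_mult_mat_sum[OF assms(2,1)] simp del: index_mult_mat(1))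
  finally show ?thesis .
qed

lemma mtrace_similar:
  assumes "similar_mat_wit A B P Q" "A \<in> carrier_mat n n"
  shows "mtrace A = mtrace B"
proof -
  note w = similar_mat_witD2[OF assms(2,1)]
  have "mtrace A = mtrace (P * (B * Q))" using w by (simp add: assoc_mult_mat[of P n n B n Q n])
  also have "\<dots> = mtrace (B * Q * P)" using w by (intro mtrace_mult_commute) auto
  also have "B * Q * P = B" using w by (simp add: assoc_mult_mat[of B n n Q n P n])
  finally show ?thesis .
qed

lemma complex_schur:
  assumes "(A :: complex mat) \<in> carrier_mat n n"
  obtains B P Q as where "similar_mat_wit A B P Q" "upper_triangular B" "B \<in> carrier_mat n n"
    "diag_mat B = as" "char_poly A = (\<Prod>a\<leftarrow>as. [:- a, 1:])" "length as = n"
proof -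
  from char_poly_factorized[OF assms] obtain as where as: "char_poly A = (\<Prod>a\<leftarrow>as. [:- a, 1:])" "length as = n"
    by blast
  obtain B P Q where "schur_decomposition A as = (B, P, Q)" by (metis prod_cases3)
  from schur_decomposition[OF assms as(1) this] similar_mat_witD2[OF assms, of B P Q] that as
  show ?thesis by blast
qed

lemma det_mtrace_diag:
  assumes "similar_mat_wit A B P Q" "upper_triangular B" "A \<in> carrier_mat n n" "B \<in> carrier_mat n n"
  shows "det A = (\<Prod>i<n. B $$ (i, i))" "mtrace A = (\<Sum>i<n. B $$ (i, i))"
proof -
  have "det A = det B" using assms(1) by (intro det_similar) (auto simp: similar_mat_def)
  also have "\<dots> = prod_list (diag_mat B)" by (rule det_upper_triangular[OF assms(2,4)])
  also have "\<dots> = (\<Prod>i<n. B $$ (i, i))"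
    using assms(4) by (simp add: diag_mat_def prod.list_conv_set_nth atLeast0LessThan)
  finally show "det A = (\<Prod>i<n. B $$ (i, i))" .
  show "mtrace A = (\<Sum>i<n. B $$ (i, i))"
    using mtrace_similar[OF assms(1,3)] assms(4) by (simp add: mtrace_def)
qed

lemma of_real_cmod_squared: "(complex_of_real (cmod z))\<^sup>2 = z * cnj z"
  using complex_norm_square[of z] by simp

text \<open>The eigenvalues r of N times its adjoint are nonnegative, their product is |det N|^2 and
  their sum is the squared Hilbert-Schmidt norm; r \<le> exp (r - 1) for each of them.\<close>

lemma norm_det_le_exp:
  fixes N :: "nat \<Rightarrow> nat \<Rightarrow> complex"
  shows "(cmod (det (mat n n (\<lambda>(i, j). N i j))))\<^sup>2 \<le> exp ((\<Sum>i<n. \<Sum>j<n. (cmod (N i j))\<^sup>2) - real n)"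
proof -
  let ?N = "mat n n (\<lambda>(i, j). N i j)" and ?S = "mat n n (\<lambda>(i, j). cnj (N j i))"
  define M where "M = ?N * ?S"
  have M: "M \<in> carrier_mat n n" unfolding M_def by (rule mult_carrier_mat[of _ n n]) auto
  have Mij: "M $$ (i, j) = (\<Sum>l<n. N i l * cnj (N j l))" if "i < n" "j < n" for i j
    unfolding M_def using that by (subst index_mult_mat_sum[of _ n n _ n]) auto
  obtain B P Q as where B: "similar_mat_wit M B P Q" "upper_triangular B" "B \<in> carrier_mat n n"
     "diag_mat B = as" "char_poly M = (\<Prod>a\<leftarrow>as. [:- a, 1:])" "length as = n"
    by (rule complex_schur[OF M])
  have ev: "\<exists>r\<ge>0. B $$ (i, i) = of_real r" if i: "i < n" for i
  proof -
    let ?a = "B $$ (i, i)"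
    have "?a \<in> set as" using i B(3) unfolding B(4)[symmetric] diag_mat_def by auto
    then have "poly (char_poly M) ?a = 0" unfolding B(5) by (auto simp: poly_prod_list prod_list_zero_iff o_def)
    then have "eigenvalue M ?a" using eigenvalue_root_char_poly[OF M] by blast
    then obtain v where v: "v \<in> carrier_vec n" "v \<noteq> 0\<^sub>v n" "M *\<^sub>v v = ?a \<cdot>\<^sub>v v"
      unfolding eigenvalue_def eigenvector_def using M by auto
    define x where "x = (\<lambda>j. v $ j)"
    have eq: "(\<Sum>j<n. M $$ (k, j) * x j) = ?a * x k" if "k < n" for k
    proof -
      have "(M *\<^sub>v v) $ k = (\<Sum>j<n. M $$ (k, j) * x j)"
        using that M v(1) by (simp add: scalar_prod_def atLeast0LessThan x_def)
      then show ?thesis unfolding v(3) using that v(1) by (simp add: x_def)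
    qed
    \<comment> \<open>y is the conjugate of the adjoint of N applied to the eigenvector x, so the
      quadratic form of M at x is the sum of |y l|^2 and the eigenvalue is a quotient of sums of
      squares.\<close>
    define y where "y = (\<lambda>l. \<Sum>k<n. N k l * cnj (x k))"
    have "?a * of_real (\<Sum>k<n. (cmod (x k))\<^sup>2) = (\<Sum>k<n. cnj (x k) * (?a * x k))"
      by (simp add: sum_distrib_left of_real_cmod_squared mult_ac)
    also have "\<dots> = (\<Sum>k<n. cnj (x k) * (\<Sum>j<n. (\<Sum>l<n. N k l * cnj (N j l)) * x j))"
      by (intro sum.cong refl) (simp add: eq[symmetric] Mij)
    also have "\<dots> = (\<Sum>k<n. \<Sum>j<n. \<Sum>l<n. (N k l * cnj (x k)) * cnj (N j l * cnj (x j)))"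
      by (simp add: sum_distrib_left sum_distrib_right mult_ac)
    also have "\<dots> = (\<Sum>k<n. \<Sum>l<n. \<Sum>j<n. (N k l * cnj (x k)) * cnj (N j l * cnj (x j)))"
      by (intro sum.cong refl sum.swap)
    also have "\<dots> = (\<Sum>l<n. \<Sum>k<n. \<Sum>j<n. (N k l * cnj (x k)) * cnj (N j l * cnj (x j)))"
      by (rule sum.swap)
    also have "\<dots> = (\<Sum>l<n. y l * cnj (y l))"
      unfolding y_def cnj_sum sum_product ..
    also have "\<dots> = of_real (\<Sum>l<n. (cmod (y l))\<^sup>2)" by (simp add: of_real_cmod_squared)
    finally have *: "?a * of_real (\<Sum>k<n. (cmod (x k))\<^sup>2) = of_real (\<Sum>l<n. (cmod (y l))\<^sup>2)" .
    obtain k where k: "k < n" "x k \<noteq> 0"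
    proof -
      have "\<exists>k<n. v $ k \<noteq> 0" using v(1,2) by (metis carrier_vecD eq_vecI index_zero_vec)
      then show ?thesis using that by (auto simp: x_def)
    qed
    have pos: "(\<Sum>k<n. (cmod (x k))\<^sup>2) > 0"
      by (rule sum_pos2[of _ k]) (use k in auto)
    then have "?a = of_real ((\<Sum>l<n. (cmod (y l))\<^sup>2) / (\<Sum>k<n. (cmod (x k))\<^sup>2))"
      using * by (simp add: field_simps del: of_real_sum)
    moreover have "(\<Sum>l<n. (cmod (y l))\<^sup>2) / (\<Sum>k<n. (cmod (x k))\<^sup>2) \<ge> 0" by (intro divide_nonneg_nonneg sum_nonneg) auto
    ultimately show ?thesis by blast
  qed
  then obtain r where r: "\<And>i. i < n \<Longrightarrow> r i \<ge> 0 \<and> B $$ (i, i) = of_real (r i)" by metis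
  have "det M = det ?N * det ?S" unfolding M_def by (rule det_mult[of _ n]) auto
  also have "det ?S = cnj (det ?N)"
  proof -
    have "det ?S = det (transpose_mat ?S)" by (rule det_transpose[symmetric, of _ n]) auto
    also have "transpose_mat ?S = mat n n (\<lambda>(i, j). cnj (N i j))" by auto
    also have "det \<dots> = cnj (det ?N)" by (auto simp: det_def intro!: sum.cong prod.cong)
    finally show ?thesis .
  qed
  also have "det ?N * cnj (det ?N) = of_real ((cmod (det ?N))\<^sup>2)" by (simp only: complex_norm_square)
  finally have "of_real ((cmod (det ?N))\<^sup>2) = (\<Prod>i<n. B $$ (i, i))" using det_mtrace_diag(1)[OF B(1,2) M B(3)] by simp
  also have "\<dots> = of_real (\<Prod>i<n. r i)" using r by simp
  finally have "(cmod (det ?N))\<^sup>2 = (\<Prod>i<n. r i)" using of_real_eq_iff by blast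
  also have "\<dots> \<le> (\<Prod>i<n. exp (r i - 1))"
    using r exp_ge_add_one_self[of "r _ - 1"] by (intro prod_mono) auto
  also have "\<dots> = exp ((\<Sum>i<n. r i) - real n)" by (simp add: exp_sum[symmetric] sum_subtractf)
  also have "(\<Sum>i<n. r i) = (\<Sum>i<n. \<Sum>j<n. (cmod (N i j))\<^sup>2)"
  proof -
    have "of_real (\<Sum>i<n. r i) = mtrace M" using det_mtrace_diag(2)[OF B(1,2) M B(3)] r by simp
    also have "\<dots> = (\<Sum>i<n. \<Sum>j<n. N i j * cnj (N i j))" using M by (simp add: mtrace_def Mij)
    also have "\<dots> = of_real (\<Sum>i<n. \<Sum>j<n. (cmod (N i j))\<^sup>2)" by (simp add: of_real_cmod_squared)
    finally show ?thesis using of_real_eq_iff by blast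
  qed
  finally show ?thesis .
qed

section \<open>The finite determinant of (I + A) exp (- A)\<close>

primrec fpow :: "'a set \<Rightarrow> ('a \<Rightarrow> 'a \<Rightarrow> complex) \<Rightarrow> nat \<Rightarrow> 'a \<Rightarrow> 'a \<Rightarrow> complex" where
  "fpow S A 0 i j = (if i = j then 1 else 0)"
| "fpow S A (Suc k) i j = (\<Sum>l\<in>S. A i l * fpow S A k l j)"

lemma pow_mat_commute: "A \<in> carrier_mat n n \<Longrightarrow> A ^\<^sub>m k * A = A * A ^\<^sub>m k"
proof (induction k)
  case (Suc k)
  then have "A ^\<^sub>m Suc k * A = A * A ^\<^sub>m k * A" by simp
  also have "\<dots> = A * (A ^\<^sub>m k * A)" using Suc.prems by (intro assoc_mult_mat[of _ n n _ n _ n]) (auto simp: pow_carrier_mat)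
  finally show ?case by simp
qed simp

lemma upper_triangular_mult:
  assumes "A \<in> carrier_mat n n" "B \<in> carrier_mat n n" "upper_triangular A" "upper_triangular B"
  shows "upper_triangular (A * B)" "\<And>i. i < n \<Longrightarrow> (A * B) $$ (i, i) = A $$ (i, i) * B $$ (i, i)"
proof -
  have z: "A $$ (i, l) * B $$ (l, j) = 0" if "i < n" "l < n" "j \<le> i" "l \<noteq> i \<or> j < i" for i j l
  proof (cases "l < i")
    case True
    then have "A $$ (i, l) = 0" using assms that by auto
    then show ?thesis by simp
  next
    case False
    then have "j < l" using that by auto
    then have "B $$ (l, j) = 0" using assms that by auto
    then show ?thesis by simp
  qed
  show "upper_triangular (A * B)"
  proof (rule upper_triangularI)
    fix i j assume ij: "j < i" "i < dim_row (A * B)"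
    then have "(A * B) $$ (i, j) = (\<Sum>l<n. A $$ (i, l) * B $$ (l, j))"
      using assms by (intro index_mult_mat_sum[OF assms(1,2)]) auto
    also have "\<dots> = 0" using ij assms z by (intro sum.neutral) auto
    finally show "(A * B) $$ (i, j) = 0" .
  qed
  fix i assume i: "i < n"
  have "(A * B) $$ (i, i) = (\<Sum>l<n. A $$ (i, l) * B $$ (l, i))"
    using i by (intro index_mult_mat_sum[OF assms(1,2)]) auto
  also have "\<dots> = (\<Sum>l\<in>{i}. A $$ (i, l) * B $$ (l, i))"
    by (rule sum.mono_neutral_right) (use i z in auto)
  finally show "(A * B) $$ (i, i) = A $$ (i, i) * B $$ (i, i)" by simp
qed

lemma upper_triangular_pow:
  assumes "B \<in> carrier_mat n n" "upper_triangular B"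
  shows "upper_triangular (B ^\<^sub>m k) \<and> (\<forall>i<n. (B ^\<^sub>m k) $$ (i, i) = (B $$ (i, i)) ^ k)"
proof (induction k)
  case (Suc k)
  have c: "B ^\<^sub>m k \<in> carrier_mat n n" using assms by simp
  show ?case using Suc upper_triangular_mult[OF c assms(1) _ assms(2)] by (auto simp: power_commutes)
qed (use assms in auto)

lemma index_mult_mat_sum3:
  assumes "P \<in> carrier_mat n n" "X \<in> carrier_mat n n" "Q \<in> carrier_mat n n" "i < n" "j < n"
  shows "(P * X * Q) $$ (i, j) = (\<Sum>b<n. \<Sum>a<n. P $$ (i, a) * X $$ (a, b) * Q $$ (b, j))"
proof -
  have "(P * X * Q) $$ (i, j) = (\<Sum>b<n. (P * X) $$ (i, b) * Q $$ (b, j))"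
    using assms by (intro index_mult_mat_sum[of _ n n _ n]) auto
  also have "\<dots> = (\<Sum>b<n. (\<Sum>a<n. P $$ (i, a) * X $$ (a, b)) * Q $$ (b, j))"
    using assms by (intro sum.cong refl arg_cong2[where f = times] index_mult_mat_sum[of _ n n _ n]) auto
  finally show ?thesis by (simp add: sum_distrib_right)
qed

text \<open>Partial sums are polynomials in A, so conjugation to triangular form and triangularity
  itself pass through them; the limit is left to the scalars on the diagonal.\<close>

lemma det_power_series_partial:
  fixes A :: "complex mat" and c :: "nat \<Rightarrow> complex"
  assumes "similar_mat_wit A B P Q" "upper_triangular B" "A \<in> carrier_mat n n" "B \<in> carrier_mat n n"
  shows "det (mat n n (\<lambda>(i, j). \<Sum>k<m. c k * (A ^\<^sub>m k) $$ (i, j))) = (\<Prod>i<n. \<Sum>k<m. c k * (B $$ (i, i)) ^ k)"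
proof -
  note w = similar_mat_witD2[OF assms(3,1)]
  let ?E = "\<lambda>A. mat n n (\<lambda>(i, j). \<Sum>k<m. c k * (A ^\<^sub>m k) $$ (i, j))"
  have pB: "B ^\<^sub>m k \<in> carrier_mat n n" for k using assms by simp
  have "?E A = P * ?E B * Q"
  proof (rule eq_matI)
    fix i j assume "i < dim_row (P * ?E B * Q)" "j < dim_col (P * ?E B * Q)"
    then have ij: "i < n" "j < n" using w by auto
    have "?E A $$ (i, j) = (\<Sum>k<m. c k * (P * B ^\<^sub>m k * Q) $$ (i, j))"
      using ij by (simp add: similar_mat_wit_pow_id[OF assms(1)])
    also have "\<dots> = (\<Sum>k<m. c k * (\<Sum>b<n. \<Sum>a<n. P $$ (i, a) * (B ^\<^sub>m k) $$ (a, b) * Q $$ (b, j)))"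
      by (intro sum.cong refl arg_cong2[where f = times] index_mult_mat_sum3) (use w pB ij in auto)
    also have "\<dots> = (\<Sum>k<m. \<Sum>b<n. \<Sum>a<n. P $$ (i, a) * (c k * (B ^\<^sub>m k) $$ (a, b)) * Q $$ (b, j))"
      by (simp add: sum_distrib_left mult_ac)
    also have "\<dots> = (\<Sum>b<n. \<Sum>k<m. \<Sum>a<n. P $$ (i, a) * (c k * (B ^\<^sub>m k) $$ (a, b)) * Q $$ (b, j))"
      by (rule sum.swap)
    also have "\<dots> = (\<Sum>b<n. \<Sum>a<n. \<Sum>k<m. P $$ (i, a) * (c k * (B ^\<^sub>m k) $$ (a, b)) * Q $$ (b, j))"
      by (intro sum.cong refl sum.swap)
    also have "\<dots> = (\<Sum>b<n. \<Sum>a<n. P $$ (i, a) * ?E B $$ (a, b) * Q $$ (b, j))"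
      by (intro sum.cong refl) (simp add: sum_distrib_left sum_distrib_right)
    also have "\<dots> = (P * ?E B * Q) $$ (i, j)"
      using w ij by (intro index_mult_mat_sum3[symmetric]) auto
    finally show "?E A $$ (i, j) = (P * ?E B * Q) $$ (i, j)" .
  qed (use w in auto)
  then have "similar_mat_wit (?E A) (?E B) P Q"
    using w by (intro similar_mat_witI[of _ _ n]) auto
  moreover have "upper_triangular (?E B)"
  proof (rule upper_triangularI)
    fix i j assume ij: "j < i" "i < dim_row (?E B)"
    then have "(B ^\<^sub>m k) $$ (i, j) = 0" for k
      using upper_triangular_pow[OF assms(4,2), of k] pB[of k] by (intro upper_triangularD) auto
    then show "?E B $$ (i, j) = 0" using ij by simp
  qed
  ultimately have "det (?E A) = (\<Prod>i<n. ?E B $$ (i, i))"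
    by (intro det_mtrace_diag(1)) auto
  then show ?thesis using upper_triangular_pow[OF assms(4,2)] by simp
qed

text \<open>For partial sums E of exp (- A), multiplicativity of det separates I + A from E exactly.
  In Schur form det E tends to the product of exp (- b) over the diagonal entries b, which is exp of
  minus the trace, and \<open>fdet\<close> is continuous in the entries.\<close>

lemma fdet_exp:
  assumes S: "finite S"
    and e: "\<And>i j. i \<in> S \<Longrightarrow> j \<in> S \<Longrightarrow> (\<lambda>k. (- 1) ^ k / fact k * fpow S A k i j) sums e i j"
  shows "fdet S (\<lambda>i j. e i j + (\<Sum>l\<in>S. A i l * e l j))
    = fdet S (\<lambda>i j. (if i = j then 1 else 0) + A i j) * exp (- (\<Sum>i\<in>S. A i i))"
proof -
  obtain f where f: "bij_betw f {0..<card S} S" using ex_bij_betw_nat_finite[OF S] by blast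
  define n where "n = card S"
  note f' = f[folded n_def]
  have inj: "f a = f b \<longleftrightarrow> a = b" if "a < n" "b < n" for a b
    using f' that by (auto simp: bij_betw_def inj_on_def)
  have fS: "f a \<in> S" if "a < n" for a using f' that by (auto simp: bij_betw_def)
  have sumS: "(\<Sum>l\<in>S. h l) = (\<Sum>l<n. h (f l))" for h :: "'a \<Rightarrow> complex"
    using sum.reindex_bij_betw[OF f', of h] by (simp add: atLeast0LessThan)
  define Am where "Am = mat n n (\<lambda>(a, b). A (f a) (f b))"
  have Am: "Am \<in> carrier_mat n n" by (simp add: Am_def)
  have pow: "(Am ^\<^sub>m k) $$ (a, b) = fpow S A k (f a) (f b)" if "a < n" "b < n" for a b k
    using that
  proof (induction k arbitrary: a b)
    case (Suc k)
    have "(Am ^\<^sub>m Suc k) $$ (a, b) = (Am * Am ^\<^sub>m k) $$ (a, b)" by (simp add: pow_mat_commute[OF Am])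
    also have "\<dots> = (\<Sum>l<n. Am $$ (a, l) * (Am ^\<^sub>m k) $$ (l, b))"
      using Suc.prems Am by (intro index_mult_mat_sum[of _ n n _ n]) auto
    also have "\<dots> = fpow S A (Suc k) (f a) (f b)"
      using Suc by (simp add: sumS Am_def)
    finally show ?case .
  qed (use inj Am in auto)
  obtain B P Q where B: "similar_mat_wit Am B P Q" "upper_triangular B" "B \<in> carrier_mat n n"
    by (rule complex_schur[OF Am])
  define c where "c = (\<lambda>k. (- 1) ^ k / fact k :: complex)"
  define E where "E = (\<lambda>m i j. \<Sum>k<m. c k * fpow S A k i j)"
  define Em where "Em = (\<lambda>m. mat n n (\<lambda>(a, b). E m (f a) (f b)))"
  have Em: "Em m \<in> carrier_mat n n" for m by (simp add: Em_def)
  have detE: "det (Em m) = (\<Prod>i<n. \<Sum>k<m. c k * (B $$ (i, i)) ^ k)" for m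
  proof -
    have "Em m = mat n n (\<lambda>(i, j). \<Sum>k<m. c k * (Am ^\<^sub>m k) $$ (i, j))"
      by (rule eq_matI) (auto simp: Em_def E_def pow)
    then show ?thesis using det_power_series_partial[OF B(1,2) Am B(3), of c m] by simp
  qed
  have fin: "fdet S (\<lambda>i j. E m i j + (\<Sum>l\<in>S. A i l * E m l j))
      = fdet S (\<lambda>i j. (if i = j then 1 else 0) + A i j) * (\<Prod>i<n. \<Sum>k<m. c k * (B $$ (i, i)) ^ k)" for m
  proof -
    have "fdet S (\<lambda>i j. E m i j + (\<Sum>l\<in>S. A i l * E m l j))
       = det (mat n n (\<lambda>(a, b). E m (f a) (f b) + (\<Sum>l\<in>S. A (f a) l * E m l (f b))))"
      by (rule fdet_eq_det[OF f'])
    also have "mat n n (\<lambda>(a, b). E m (f a) (f b) + (\<Sum>l\<in>S. A (f a) l * E m l (f b)))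
       = mat n n (\<lambda>(a, b). (if f a = f b then 1 else 0) + A (f a) (f b)) * Em m" (is "?L = ?X * _")
    proof (rule eq_matI)
      fix a b assume "a < dim_row (?X * Em m)" "b < dim_col (?X * Em m)"
      then have ab: "a < n" "b < n" by (auto simp: Em_def)
      have "(?X * Em m) $$ (a, b) = (\<Sum>l<n. ?X $$ (a, l) * Em m $$ (l, b))"
        using ab Em by (intro index_mult_mat_sum[of _ n n _ n]) auto
      also have "\<dots> = (\<Sum>l<n. (if a = l then E m (f l) (f b) else 0) + A (f a) (f l) * E m (f l) (f b))"
        using ab inj by (intro sum.cong refl) (auto simp: Em_def algebra_simps)
      also have "\<dots> = E m (f a) (f b) + (\<Sum>l\<in>S. A (f a) l * E m l (f b))"
        using ab by (simp add: sum.distrib sumS)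
      finally show "?L $$ (a, b) = (?X * Em m) $$ (a, b)" using ab by simp
    qed (auto simp: Em_def)
    also have "det (?X * Em m) = det ?X * det (Em m)" by (rule det_mult[of _ n]) (auto simp: Em)
    also have "det ?X = fdet S (\<lambda>i j. (if i = j then 1 else 0) + A i j)" by (rule fdet_eq_det[OF f', symmetric])
    finally show ?thesis by (simp only: detE)
  qed
  have Elim: "(\<lambda>m. E m i j) \<longlonglongrightarrow> e i j" if "i \<in> S" "j \<in> S" for i j
    using e[OF that] unfolding sums_def E_def c_def .
  have "(\<lambda>m. fdet S (\<lambda>i j. E m i j + (\<Sum>l\<in>S. A i l * E m l j))) \<longlonglongrightarrow> fdet S (\<lambda>i j. e i j + (\<Sum>l\<in>S. A i l * e l j))"
    unfolding fdet_def
    by (intro tendsto_intros Elim) (auto simp: permutes_in_image)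
  moreover have "(\<lambda>m. fdet S (\<lambda>i j. E m i j + (\<Sum>l\<in>S. A i l * E m l j)))
     \<longlonglongrightarrow> fdet S (\<lambda>i j. (if i = j then 1 else 0) + A i j) * (\<Prod>i<n. exp (- (B $$ (i, i))))"
  proof -
    have "(\<lambda>m. \<Sum>k<m. c k * b ^ k) \<longlonglongrightarrow> exp (- b)" for b
    proof -
      have "(\<lambda>k. (- b) ^ k /\<^sub>R fact k) sums exp (- b)" by (rule exp_converges)
      moreover have "(- b) ^ k /\<^sub>R fact k = c k * b ^ k" for k
        by (simp add: c_def scaleR_conv_of_real power_minus[of b] field_simps)
      ultimately show ?thesis by (simp add: sums_def)
    qed
    then show ?thesis unfolding fin by (intro tendsto_intros)
  qed
  ultimately have "fdet S (\<lambda>i j. e i j + (\<Sum>l\<in>S. A i l * e l j))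
     = fdet S (\<lambda>i j. (if i = j then 1 else 0) + A i j) * (\<Prod>i<n. exp (- (B $$ (i, i))))"
    by (rule LIMSEQ_unique)
  also have "(\<Prod>i<n. exp (- (B $$ (i, i)))) = exp (- (\<Sum>i\<in>S. A i i))"
  proof -
    have "(\<Sum>i\<in>S. A i i) = mtrace Am" by (simp add: mtrace_def Am_def sumS)
    also have "\<dots> = (\<Sum>i<n. B $$ (i, i))" by (rule det_mtrace_diag(2)[OF B(1,2) Am B(3)])
    finally show ?thesis by (simp add: exp_sum[symmetric] sum_negf)
  qed
  finally show ?thesis .
qed

section \<open>Kernel vectors and Hadamard's inequality\<close>

lemma fdet_eq_0_imp_kernel:
  assumes "finite S" "fdet S M = 0"
  obtains x where "\<exists>i\<in>S. x i \<noteq> 0" "\<And>i. i \<in> S \<Longrightarrow> (\<Sum>j\<in>S. M i j * x j) = 0"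
proof -
  obtain f where f: "bij_betw f {0..<card S} S" using ex_bij_betw_nat_finite[OF assms(1)] by blast
  define n where "n = card S"
  note f' = f[folded n_def]
  define Mm where "Mm = mat n n (\<lambda>(a, b). M (f a) (f b))"
  have Mm: "Mm \<in> carrier_mat n n" by (simp add: Mm_def)
  have "det Mm = 0" using assms(2) fdet_eq_det[OF f', of M] by (simp add: Mm_def)
  then obtain v where v: "v \<in> carrier_vec n" "v \<noteq> 0\<^sub>v n" "Mm *\<^sub>v v = 0\<^sub>v n"
    using det_0_iff_vec_prod_zero_field[OF Mm] by blast
  define g where "g = inv_into {0..<n} f"
  have gf: "g (f a) = a" if "a < n" for a using f' that by (simp add: g_def bij_betw_def)
  have fS: "f a \<in> S" if "a < n" for a using f' that by (auto simp: bij_betw_def)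
  have Sf: "\<exists>a<n. i = f a" if "i \<in> S" for i using f' that by (auto simp: bij_betw_def)
  show ?thesis
  proof (rule that[of "\<lambda>i. v $ g i"])
    obtain a where "a < n" "v $ a \<noteq> 0" using v(1,2) by (metis carrier_vecD eq_vecI index_zero_vec)
    then show "\<exists>i\<in>S. v $ g i \<noteq> 0" using fS gf by (intro bexI[of _ "f a"]) auto
    fix i assume "i \<in> S"
    then obtain a where a: "a < n" "i = f a" using Sf by blast
    have "(\<Sum>j\<in>S. M i j * v $ g j) = (\<Sum>b<n. M i (f b) * v $ g (f b))"
      using sum.reindex_bij_betw[OF f', of "\<lambda>j. M i j * v $ g j"] by (simp add: atLeast0LessThan)
    also have "\<dots> = (Mm *\<^sub>v v) $ a"
      using a v(1) gf by (simp add: Mm_def scalar_prod_def atLeast0LessThan)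
    finally show "(\<Sum>j\<in>S. M i j * v $ g j) = 0" using v(3) a by simp
  qed
qed

lemma norm_fdet_le_exp:
  assumes "finite S"
  shows "(cmod (fdet S M))\<^sup>2 \<le> exp ((\<Sum>i\<in>S. \<Sum>j\<in>S. (cmod (M i j))\<^sup>2) - real (card S))"
proof -
  obtain f where f: "bij_betw f {0..<card S} S" using ex_bij_betw_nat_finite[OF assms(1)] by blast
  have s: "(\<Sum>l\<in>S. h l) = (\<Sum>l<card S. h (f l))" for h :: "'a \<Rightarrow> real"
    using sum.reindex_bij_betw[OF f, of h] by (simp add: atLeast0LessThan)
  show ?thesis unfolding fdet_eq_det[OF f] s by (rule norm_det_le_exp)
qed

text \<open>Dividing entry (i, j) by p i, q j and sqrt n brings the squared Hilbert-Schmidt norm to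
  at most n, and \<open>norm_fdet_le_exp\<close> then bounds the determinant by 1. A vanishing p i
  or q i means a zero row or column.\<close>

lemma fdet_hadamard:
  assumes "finite S" and le: "\<And>i j. i \<in> S \<Longrightarrow> j \<in> S \<Longrightarrow> cmod (M i j) \<le> p i * q j"
    and "\<And>i. i \<in> S \<Longrightarrow> p i \<ge> 0" "\<And>i. i \<in> S \<Longrightarrow> q i \<ge> 0"
  shows "cmod (fdet S M) \<le> sqrt (real (card S)) ^ card S * (\<Prod>i\<in>S. p i * q i)"
proof (cases "\<exists>i\<in>S. p i = 0 \<or> q i = 0")
  case True
  then obtain i where i: "i \<in> S" "p i = 0 \<or> q i = 0" by blast
  have "fdet S M = 0"
  proof (cases "p i = 0")
    case True
    then have "M i j = 0" if "j \<in> S" for j using le[OF i(1) that] by simp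
    then show ?thesis by (intro fdet_zero_row[OF assms(1) i(1)])
  next
    case False
    then have "M j i = 0" if "j \<in> S" for j using le[OF that i(1)] i(2) by simp
    then show ?thesis by (intro fdet_zero_col[OF assms(1) i(1)])
  qed
  then show ?thesis using assms by (auto intro!: prod_nonneg mult_nonneg_nonneg)
next
  case False
  then have pos: "p i > 0" "q i > 0" if "i \<in> S" for i using assms(3,4)[OF that] that by (auto simp: less_le)
  show ?thesis
  proof (cases "S = {}")
    case False
    define n where "n = card S"
    have n: "n > 0" using False assms(1) by (auto simp: n_def card_gt_0_iff)
    define N where "N = (\<lambda>i j. M i j / of_real (p i * q j * sqrt n))"
    have N: "(cmod (N i j))\<^sup>2 \<le> 1 / real n" if "i \<in> S" "j \<in> S" for i j
    proof -
      have "cmod (N i j) = cmod (M i j) / (p i * q j) / sqrt n"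
        using pos(1)[OF that(1)] pos(2)[OF that(2)] n by (simp add: N_def norm_divide norm_mult)
      also have "\<dots> \<le> 1 / sqrt n" using le[OF that] pos that by (intro divide_right_mono) (auto simp: divide_le_eq)
      finally have "(cmod (N i j))\<^sup>2 \<le> (1 / sqrt n)\<^sup>2" by (intro power_mono) auto
      then show ?thesis by (simp add: power_divide)
    qed
    have "(\<Sum>i\<in>S. \<Sum>j\<in>S. (cmod (N i j))\<^sup>2) \<le> (\<Sum>i\<in>S. \<Sum>j\<in>S. 1 / real n)"
      by (intro sum_mono N)
    also have "\<dots> = real n" using n by (simp add: n_def)
    finally have "(cmod (fdet S N))\<^sup>2 \<le> exp 0"
      using norm_fdet_le_exp[OF assms(1), of N] by (smt (verit) exp_le_cancel_iff n_def)
    then have 1: "cmod (fdet S N) \<le> 1" by (simp add: power2_le_iff_abs_le abs_square_le_1)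
    have "fdet S M = fdet S (\<lambda>i j. of_real (p i) * N i j * of_real (q j * sqrt n))"
      using pos n by (intro fdet_cong) (force simp: N_def)
    also have "\<dots> = (\<Prod>i\<in>S. of_real (p i)) * (\<Prod>i\<in>S. of_real (q i * sqrt n)) * fdet S N" by (rule fdet_scale[OF assms(1)])
    also have "\<dots> = of_real (sqrt n ^ n * (\<Prod>i\<in>S. p i * q i)) * fdet S N"
      by (simp add: prod.distrib n_def)
    finally have "cmod (fdet S M) = (sqrt n ^ n * (\<Prod>i\<in>S. p i * q i)) * cmod (fdet S N)"
      using assms(3,4) by (simp add: norm_mult prod_nonneg abs_mult norm_power del: of_real_mult of_real_prod)
    also have "\<dots> \<le> (sqrt n ^ n * (\<Prod>i\<in>S. p i * q i)) * 1"
      using 1 assms(3,4) by (intro mult_left_mono) (auto intro!: prod_nonneg mult_nonneg_nonneg)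
    finally show ?thesis by (simp add: n_def)
  qed (simp add: fdet_def)
qed

section \<open>Fredholm determinants\<close>

lemma infsum_dominated_convergence:
  fixes f :: "nat \<Rightarrow> 'a \<Rightarrow> 'b :: banach"
  assumes h: "h summable_on A" and le: "\<And>m x. x \<in> A \<Longrightarrow> norm (f m x) \<le> h x"
    and lim: "\<And>x. x \<in> A \<Longrightarrow> (\<lambda>m. f m x) \<longlonglongrightarrow> g x"
  shows "(\<lambda>m. infsum (f m) A) \<longlonglongrightarrow> infsum g A"
proof -
  have gle: "norm (g x) \<le> h x" if "x \<in> A" for x
    by (rule Lim_bounded[OF tendsto_norm[OF lim[OF that]], of 0]) (use le that in auto)
  have sf: "(\<lambda>x. norm (f m x)) summable_on A" for m
    by (rule summable_on_comparison_test[OF h]) (use le in auto)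
  have sg: "(\<lambda>x. norm (g x)) summable_on A"
    by (rule summable_on_comparison_test[OF h]) (use gle in auto)
  show ?thesis
  proof (rule LIMSEQ_I)
    fix e :: real assume e: "e > 0"
    have "(h has_sum infsum h A) A" using h by simp
    then obtain F where F: "finite F" "F \<subseteq> A" "dist (sum h F) (infsum h A) \<le> e / 4"
      using has_sum_finite_approximation[of h A "infsum h A" "e / 4"] e by auto
    have hF: "h summable_on (A - F)" "infsum h (A - F) \<le> e / 4"
    proof -
      show "h summable_on (A - F)" by (rule summable_on_subset_banach[OF h]) auto
      have "infsum h A = infsum h F + infsum h (A - F)"
        using infsum_Un_disjoint[of h F "A - F"] summable_on_subset_banach[OF h, of "A - F"] F by (simp add: Un_absorb1)
      then show "infsum h (A - F) \<le> e / 4" using F by (simp add: dist_real_def)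
    qed
    have tail: "norm (infsum k (A - F)) \<le> e / 4" if "\<And>x. x \<in> A \<Longrightarrow> norm (k x) \<le> h x" for k :: "'a \<Rightarrow> 'b"
    proof -
      have s: "(\<lambda>x. norm (k x)) summable_on (A - F)" by (rule summable_on_comparison_test[OF hF(1)]) (use that in auto)
      have "norm (infsum k (A - F)) \<le> infsum (\<lambda>x. norm (k x)) (A - F)" by (rule norm_infsum_bound[OF s])
      also have "\<dots> \<le> infsum h (A - F)" by (rule infsum_mono[OF s hF(1)]) (use that in auto)
      finally show ?thesis using hF(2) by simp
    qed
    have split: "infsum k A = sum k F + infsum k (A - F)" if "(\<lambda>x. norm (k x)) summable_on A" for k :: "'a \<Rightarrow> 'b"
    proof -
      have "k summable_on A" by (rule abs_summable_summable[OF that])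
      then have "k summable_on (A - F)" by (rule summable_on_subset_banach) auto
      then show ?thesis using infsum_Un_disjoint[of k F "A - F"] F by (simp add: Un_absorb1)
    qed
    have "(\<lambda>m. sum (f m) F) \<longlonglongrightarrow> sum g F" using F lim by (intro tendsto_sum) auto
    then obtain N where N: "\<And>m. m \<ge> N \<Longrightarrow> norm (sum (f m) F - sum g F) < e / 4"
      using LIMSEQ_D[of _ _ "e / 4"] e by (metis divide_pos_pos zero_less_numeral)
    show "\<exists>N. \<forall>m\<ge>N. norm (infsum (f m) A - infsum g A) < e"
    proof (intro exI allI impI)
      fix m assume "m \<ge> N"
      have "infsum (f m) A - infsum g A = (sum (f m) F - sum g F) + (infsum (f m) (A - F) - infsum g (A - F))"
        using split[OF sf[of m]] split[OF sg] by simp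
      also have "norm \<dots> \<le> norm (sum (f m) F - sum g F) + (norm (infsum (f m) (A - F)) + norm (infsum g (A - F)))"
        by (intro norm_triangle_le add_mono norm_triangle_ineq4) auto
      also have "\<dots> < e / 4 + (e / 4 + e / 4)"
        using N[OF \<open>m \<ge> N\<close>] tail[of "f m"] tail[of g] le gle by (intro add_less_le_mono add_mono) auto
      finally show "norm (infsum (f m) A - infsum g A) < e" using e by simp
    qed
  qed
qed

lemma suminf_dominated_convergence:
  fixes f :: "nat \<Rightarrow> nat \<Rightarrow> 'b :: {real_normed_algebra, banach}"
  assumes h: "summable h" and le: "\<And>m k. norm (f m k) \<le> h k" and lim: "\<And>k. (\<lambda>m. f m k) \<longlonglongrightarrow> g k"
  shows "(\<lambda>m. \<Sum>k. f m k) \<longlonglongrightarrow> (\<Sum>k. g k)"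
proof -
  have "eventually (\<lambda>(k, m). norm (f m k) \<le> h k) (at_top \<times>\<^sub>F sequentially)"
    using le by (intro always_eventually) auto
  from tannerys_theorem[OF lim this h] show ?thesis by simp
qed

text \<open>Induction on U: a set of size m + 1 in \<open>insert x U\<close> either avoids x or
  comes from a set of size m in U, and s^(m+1) + (m+1) w s^m \<le> (w + s)^(m+1) as in Bernoulli's
  inequality.\<close>

lemma elementary_symmetric_le:
  fixes w :: "'a \<Rightarrow> real"
  assumes "finite U" "\<And>i. w i \<ge> 0"
  shows "(\<Sum>S | S \<subseteq> U \<and> card S = k. \<Prod>i\<in>S. w i) \<le> (\<Sum>i\<in>U. w i) ^ k / fact k"
  using assms(1)
proof (induction U arbitrary: k rule: finite_induct)
  case empty
  have "{S. S \<subseteq> {} \<and> card S = k} = (if k = 0 then {{}} else {} :: 'a set set)" by auto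
  then show ?case by simp
next
  case (insert x U)
  show ?case
  proof (cases k)
    case 0
    have "S = {}" if "S \<subseteq> insert x U" "card S = 0" for S
      using that insert(1) finite_subset[OF that(1)] by simp
    then have "{S. S \<subseteq> insert x U \<and> card S = 0} = {{}}" by auto
    then show ?thesis using 0 by simp
  next
    case (Suc m)
    let ?P = "\<lambda>U k. {S. S \<subseteq> U \<and> card S = k}"
    have fin: "finite (?P U l)" for l using insert(1) by simp
    have new: "finite S" "x \<notin> S" if "S \<in> ?P U l" for S l
      using that insert(1,2) finite_subset[of S U] by auto
    have split: "?P (insert x U) (Suc m) = ?P U (Suc m) \<union> insert x ` ?P U m"
    proof (intro equalityI subsetI)
      fix S assume S: "S \<in> ?P (insert x U) (Suc m)"
      show "S \<in> ?P U (Suc m) \<union> insert x ` ?P U m"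
      proof (cases "x \<in> S")
        case True
        then have "S = insert x (S - {x})" by blast
        moreover have "S - {x} \<in> ?P U m" using S True by auto
        ultimately show ?thesis by blast
      next
        case False
        then show ?thesis using S by blast
      qed
    next
      fix S assume "S \<in> ?P U (Suc m) \<union> insert x ` ?P U m"
      then show "S \<in> ?P (insert x U) (Suc m)"
      proof
        assume "S \<in> insert x ` ?P U m"
        then obtain T where T: "T \<in> ?P U m" "S = insert x T" by blast
        then show ?thesis using new[OF T(1)] by auto
      qed auto
    qed
    define s where "s = (\<Sum>i\<in>U. w i)"
    have s: "s \<ge> 0" unfolding s_def by (intro sum_nonneg assms)
    have inj: "inj_on (insert x) (?P U m)" using new by (metis (no_types, lifting) inj_onI insert_ident)
    have "(\<Sum>S\<in>?P (insert x U) (Suc m). \<Prod>i\<in>S. w i) = (\<Sum>S\<in>?P U (Suc m). \<Prod>i\<in>S. w i) + (\<Sum>S\<in>insert x ` ?P U m. \<Prod>i\<in>S. w i)"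
      unfolding split using insert(2) by (intro sum.union_disjoint finite_imageI fin) auto
    also have "(\<Sum>S\<in>insert x ` ?P U m. \<Prod>i\<in>S. w i) = (\<Sum>S\<in>?P U m. w x * (\<Prod>i\<in>S. w i))"
    proof -
      have "(\<Prod>i\<in>insert x S. w i) = w x * (\<Prod>i\<in>S. w i)" if "S \<in> ?P U m" for S
        by (rule prod.insert[OF new[OF that]])
      then show ?thesis by (subst sum.reindex[OF inj]) (rule sum.cong[OF refl], simp)
    qed
    also have "\<dots> = w x * (\<Sum>S\<in>?P U m. \<Prod>i\<in>S. w i)" by (simp add: sum_distrib_left)
    also have "(\<Sum>S\<in>?P U (Suc m). \<Prod>i\<in>S. w i) + \<dots> \<le> s ^ Suc m / fact (Suc m) + w x * (s ^ m / fact m)"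
      unfolding s_def by (intro add_mono mult_left_mono insert.IH assms)
    also have "\<dots> = (s ^ Suc m + real (Suc m) * w x * s ^ m) / fact (Suc m)"
    proof -
      have "w x * (s ^ m / fact m) = real (Suc m) * w x * s ^ m / fact (Suc m)"
        by (simp only: fact_Suc of_nat_mult) (simp del: of_nat_Suc)
      then show ?thesis by (simp only: add_divide_distrib)
    qed
    also have "\<dots> \<le> (w x + s) ^ Suc m / fact (Suc m)"
    proof (rule divide_right_mono)
      show "s ^ Suc m + real (Suc m) * w x * s ^ m \<le> (w x + s) ^ Suc m"
      proof (induction m)
        case (Suc m)
        have "(y + s) * (s * r + c * y * r) = s * (s * r) + (c + 1) * y * (s * r) + c * y * y * r" for y c r
          by (simp add: algebra_simps)
        from this[of "w x" "s ^ m" "real (Suc m)"]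
        have "(w x + s) * (s ^ Suc m + real (Suc m) * w x * s ^ m)
           = s ^ Suc (Suc m) + real (Suc (Suc m)) * w x * s ^ Suc m + real (Suc m) * w x * w x * s ^ m"
          by simp
        moreover have "real (Suc m) * w x * w x * s ^ m \<ge> 0" using s assms(2)[of x] by simp
        ultimately have "s ^ Suc (Suc m) + real (Suc (Suc m)) * w x * s ^ Suc m
            \<le> (w x + s) * (s ^ Suc m + real (Suc m) * w x * s ^ m)"
          by linarith
        also have "\<dots> \<le> (w x + s) * (w x + s) ^ Suc m" using Suc s assms(2)[of x] by (intro mult_left_mono) auto
        finally show ?case by simp
      qed simp
    qed simp
    finally show ?thesis using insert(1,2) Suc by (simp add: s_def)
  qed
qed

text \<open>k^k \<le> exp k times the factorial of k; so the factorial outweighs the growth k^(k/2)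
  that Hadamard's inequality brings into minors of size k.\<close>

lemma summable_sqrt_power_over_fact: "summable (\<lambda>k. sqrt (real k) ^ k * c ^ k / fact k)" if "c \<ge> 0" for c :: real
proof (rule summable_comparison_test_ev)
  have "eventually (\<lambda>k. real k \<ge> (2 * exp 1 * c)\<^sup>2) sequentially" by real_asymp
  moreover have "eventually (\<lambda>k. k > 0) sequentially" by (rule eventually_gt_at_top)
  ultimately show "\<forall>\<^sub>F k in sequentially. norm (sqrt (real k) ^ k * c ^ k / fact k) \<le> (1 / 2) ^ k"
  proof eventually_elim
    case (elim k)
    have k: "real k > 0" using elim by simp
    have f: "real k ^ k \<le> exp (real k) * fact k"
    proof -
      have "real k ^ k /\<^sub>R fact k \<le> (\<Sum>n. real k ^ n /\<^sub>R fact n)"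
        using sum_le_suminf[OF summable_exp_generic[of "real k"], of "{k}"] by simp
      then have "real k ^ k / fact k \<le> exp (real k)" by (simp add: exp_def divide_inverse mult.commute)
      then show ?thesis by (simp add: divide_le_eq)
    qed
    have "2 * exp 1 * c \<le> sqrt (real k)" using elim that by (intro real_le_rsqrt) auto
    then have "(2 * exp 1 * c) ^ k \<le> sqrt (real k) ^ k" using that by (intro power_mono) auto
    then have "sqrt (real k) ^ k * (2 ^ k * exp 1 ^ k * c ^ k) \<le> sqrt (real k) ^ k * sqrt (real k) ^ k"
      by (intro mult_left_mono) (auto simp: power_mult_distrib)
    also have "\<dots> = real k ^ k" by (simp add: power_mult_distrib[symmetric])
    also have "\<dots> \<le> exp (real k) * fact k" by (rule f)
    also have "exp (real k) = exp 1 ^ k" using exp_of_nat_mult[of k "1::real"] by simp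
    finally have "exp 1 ^ k * (sqrt (real k) ^ k * c ^ k * 2 ^ k) \<le> exp 1 ^ k * (fact k :: real)"
      by (simp add: mult_ac)
    then have "sqrt (real k) ^ k * c ^ k * 2 ^ k \<le> fact k" by (simp add: mult_le_cancel_left)
    then show ?case using that by (simp add: field_simps power_divide abs_mult)
  qed
qed simp

section \<open>Powers of the kernel and their majorants\<close>

primrec kpow :: "('a \<Rightarrow> real) \<Rightarrow> ('a \<Rightarrow> 'a \<Rightarrow> complex) \<Rightarrow> nat \<Rightarrow> 'a \<Rightarrow> 'a \<Rightarrow> complex" where
  "kpow W g 0 i j = (if i = j then 1 else 0)"
| "kpow W g (Suc k) i j = of_real (W i) * (\<Sum>\<^sub>\<infinity>l. g i l * kpow W g k l j)"

text \<open>An entrywise majorant of \<open>kpow\<close> for every W with |W| \<le> |V|, so that one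
  summable bound serves the potential and all its truncations.\<close>

primrec akpow :: "('a \<Rightarrow> real) \<Rightarrow> ('a \<Rightarrow> 'a \<Rightarrow> complex) \<Rightarrow> nat \<Rightarrow> 'a \<Rightarrow> 'a \<Rightarrow> real" where
  "akpow V g 0 i j = (if i = j then 1 else 0)"
| "akpow V g (Suc k) i j = \<bar>V i\<bar> * (\<Sum>\<^sub>\<infinity>l. cmod (g i l) * akpow V g k l j)"

definition exp_coeff :: "nat \<Rightarrow> complex" where
  "exp_coeff k = (- 1) ^ k / fact k"

definition kexp :: "('a \<Rightarrow> real) \<Rightarrow> ('a \<Rightarrow> 'a \<Rightarrow> complex) \<Rightarrow> 'a \<Rightarrow> 'a \<Rightarrow> complex" where
  "kexp W g i j = (\<Sum>k. exp_coeff k * kpow W g k i j)"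

text \<open>The kernel of \<open>(I + A) exp (- A) - I\<close>, whose power series starts with the quadratic term.\<close>

definition kdet2 :: "('a \<Rightarrow> real) \<Rightarrow> ('a \<Rightarrow> 'a \<Rightarrow> complex) \<Rightarrow> 'a \<Rightarrow> 'a \<Rightarrow> complex" where
  "kdet2 W g i j = (\<Sum>k. (exp_coeff (k + 2) + exp_coeff (k + 1)) * kpow W g (k + 2) i j)"

definition kfred :: "('a \<Rightarrow> real) \<Rightarrow> ('a \<Rightarrow> 'a \<Rightarrow> complex) \<Rightarrow> complex" where
  "kfred W g = (\<Sum>k. \<Sum>\<^sub>\<infinity>S\<in>{S. finite S \<and> card S = k}. fdet S (kdet2 W g))"

lemma cmod_exp_coeff: "cmod (exp_coeff k) = 1 / fact k"
  by (simp add: exp_coeff_def norm_divide norm_power)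

lemma cmod_exp_coeff_sum_le: "cmod (exp_coeff (k + 2) + exp_coeff (k + 1)) \<le> 1 / fact k"
proof -
  have "exp_coeff (k + 2) + exp_coeff (k + 1) = (- 1) ^ k * of_real (1 / fact (k + 2) - 1 / fact (k + 1))"
    by (simp add: exp_coeff_def algebra_simps)
  then have "cmod (exp_coeff (k + 2) + exp_coeff (k + 1)) = \<bar>1 / fact (k + 2) - 1 / fact (k + 1)\<bar>"
    by (simp only: norm_mult norm_power norm_minus_cancel norm_one power_one mult_1 norm_of_real)
  also have "\<dots> \<le> 1 / fact k"
  proof -
    have "(0::real) \<le> 1 / fact (k + 2)" "(1::real) / fact (k + 2) \<le> 1 / fact (k + 1)" "(1::real) / fact (k + 1) \<le> 1 / fact k"
      by (auto intro!: divide_left_mono fact_mono)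
    then show ?thesis by linarith
  qed
  finally show ?thesis .
qed

text \<open>\<open>hs\<close> bounds the Hilbert-Schmidt norm of the symmetrized kernel |V|^(1/2) g
  |V|^(1/2) by H, while \<open>V_sq\<close> and \<open>col\<close> make V g a bounded map on l1. The
  first estimate controls minors, the second the convergence of powers.\<close>

locale hs_kernel =
  fixes V :: "'a \<Rightarrow> real" and g :: "'a \<Rightarrow> 'a \<Rightarrow> complex" and \<gamma> H :: real
  assumes V_sq: "(\<lambda>i. (V i)\<^sup>2) summable_on UNIV"
    and col: "finite F \<Longrightarrow> (\<Sum>i\<in>F. (cmod (g i l))\<^sup>2) \<le> \<gamma>\<^sup>2"
    and row: "finite F \<Longrightarrow> (\<Sum>l\<in>F. (cmod (g i l))\<^sup>2) \<le> \<gamma>\<^sup>2"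
    and nonneg: "\<gamma> \<ge> 0" "H \<ge> 0"
    and hs: "finite A \<Longrightarrow> finite B \<Longrightarrow> (\<Sum>i\<in>A. \<Sum>j\<in>B. \<bar>V i\<bar> * \<bar>V j\<bar> * (cmod (g i j))\<^sup>2) \<le> H\<^sup>2"
begin

definition c where "c = sqrt (\<Sum>\<^sub>\<infinity>i. (V i)\<^sup>2) * \<gamma>"

lemma c_nonneg: "c \<ge> 0"
  using nonneg by (simp add: c_def infsum_nonneg)

lemma g_le: "cmod (g i l) \<le> \<gamma>"
proof -
  have "(cmod (g i l))\<^sup>2 \<le> \<gamma>\<^sup>2" using row[of "{l}" i] by simp
  then show ?thesis by (rule power2_le_imp_le[OF _ nonneg(1)])
qed

lemma sum_Vg_le: "finite F \<Longrightarrow> (\<Sum>i\<in>F. \<bar>V i\<bar> * cmod (g i l)) \<le> c"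
proof -
  assume F: "finite F"
  have "(\<Sum>i\<in>F. \<bar>V i\<bar> * cmod (g i l)) \<le> L2_set (\<lambda>i. \<bar>V i\<bar>) F * L2_set (\<lambda>i. cmod (g i l)) F"
    using L2_set_mult_ineq[of "\<lambda>i. \<bar>V i\<bar>" "\<lambda>i. cmod (g i l)" F] by simp
  also have "\<dots> \<le> sqrt (\<Sum>\<^sub>\<infinity>i. (V i)\<^sup>2) * \<gamma>"
    unfolding L2_set_def using V_sq nonneg F col[OF F, of l]
    by (intro mult_mono real_sqrt_le_mono real_le_lsqrt) (auto intro!: finite_sum_le_infsum sum_nonneg infsum_nonneg)
  finally show ?thesis by (simp add: c_def)
qed

lemma akpow_nonneg: "akpow V g k i j \<ge> 0"
  by (induction k arbitrary: i) (auto intro!: infsum_nonneg mult_nonneg_nonneg)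

text \<open>By Cauchy-Schwarz the kernel |V i| |g i l| has column sums at most c, so it maps l1 to
  itself with norm at most c.\<close>

lemma akpow_l1:
  "(\<lambda>l. akpow V g k l j) summable_on UNIV \<and> (\<forall>F. finite F \<longrightarrow> (\<Sum>l\<in>F. akpow V g k l j) \<le> c ^ k)"
proof (induction k)
  case 0
  have b: "(\<Sum>l\<in>F. akpow V g 0 l j) \<le> 1" if "finite F" for F
  proof -
    have "(\<Sum>l\<in>F. akpow V g 0 l j) \<le> (\<Sum>l\<in>insert j F. if l = j then 1 else 0)"
      using that by (intro order.trans[OF eq_refl sum_mono2]) (auto intro!: sum.cong)
    then show ?thesis using that by simp
  qed
  then have "(\<lambda>l. akpow V g 0 l j) summable_on UNIV"
    by (intro nonneg_bdd_above_summable_on) (auto simp: bdd_above_def simp del: akpow.simps intro: akpow_nonneg)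
  with b show ?case by (auto simp del: akpow.simps)
next
  case (Suc k)
  then have s: "(\<lambda>l. akpow V g k l j) summable_on UNIV" and b: "\<And>F. finite F \<Longrightarrow> (\<Sum>l\<in>F. akpow V g k l j) \<le> c ^ k" by auto
  have sg: "(\<lambda>l. cmod (g i l) * akpow V g k l j) summable_on UNIV" for i
    by (rule summable_on_comparison_test[OF summable_on_cmult_right[OF s, of \<gamma>]])
       (auto intro!: mult_right_mono g_le akpow_nonneg mult_nonneg_nonneg)
  have "(\<Sum>i\<in>F. akpow V g (Suc k) i j) \<le> c ^ Suc k" if F: "finite F" for F
  proof -
    have "(\<Sum>i\<in>F. akpow V g (Suc k) i j) = (\<Sum>i\<in>F. \<Sum>\<^sub>\<infinity>l. \<bar>V i\<bar> * (cmod (g i l) * akpow V g k l j))"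
      by (simp add: infsum_cmult_right')
    also have "\<dots> = (\<Sum>\<^sub>\<infinity>l. \<Sum>i\<in>F. \<bar>V i\<bar> * (cmod (g i l) * akpow V g k l j))"
      by (intro infsum_finite_sum[symmetric] F summable_on_cmult_right sg)
    also have "\<dots> \<le> (\<Sum>\<^sub>\<infinity>l. c * akpow V g k l j)"
    proof (rule infsum_mono)
      show "(\<lambda>l. \<Sum>i\<in>F. \<bar>V i\<bar> * (cmod (g i l) * akpow V g k l j)) summable_on UNIV"
        by (intro summable_on_finite_sum F summable_on_cmult_right sg)
      show "(\<lambda>l. c * akpow V g k l j) summable_on UNIV" by (rule summable_on_cmult_right[OF s])
      fix l
      have "(\<Sum>i\<in>F. \<bar>V i\<bar> * cmod (g i l)) * akpow V g k l j \<le> c * akpow V g k l j"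
        by (intro mult_right_mono sum_Vg_le F akpow_nonneg)
      then show "(\<Sum>i\<in>F. \<bar>V i\<bar> * (cmod (g i l) * akpow V g k l j)) \<le> c * akpow V g k l j"
        by (simp add: sum_distrib_right mult.assoc)
    qed
    also have "\<dots> = c * (\<Sum>\<^sub>\<infinity>l. akpow V g k l j)" by (rule infsum_cmult_right')
    also have "\<dots> \<le> c * c ^ k" using b by (intro mult_left_mono infsum_le_finite_sums[OF s] c_nonneg) auto
    finally show ?thesis by simp
  qed
  moreover from this have "(\<lambda>l. akpow V g (Suc k) l j) summable_on UNIV"
    by (intro nonneg_bdd_above_summable_on) (auto simp: bdd_above_def simp del: akpow.simps intro: akpow_nonneg)
  ultimately show ?case by blast
qed

lemma akpow_le: "akpow V g k i j \<le> c ^ k"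
  using akpow_l1[of k j, THEN conjunct2, rule_format, of "{i}"] by simp

lemma g_akpow_summable: "(\<lambda>l. cmod (g i l) * akpow V g k l j) summable_on UNIV"
  by (rule summable_on_comparison_test[OF summable_on_cmult_right[OF conjunct1[OF akpow_l1], of \<gamma>]])
     (auto intro!: mult_right_mono g_le akpow_nonneg mult_nonneg_nonneg)

lemma kpow_le:
  assumes "\<And>i. \<bar>W i\<bar> \<le> \<bar>V i\<bar>"
  shows "cmod (kpow W g k i j) \<le> akpow V g k i j"
proof (induction k arbitrary: i)
  case (Suc k)
  have s: "(\<lambda>l. cmod (g i l * kpow W g k l j)) summable_on UNIV"
    by (rule summable_on_comparison_test[OF g_akpow_summable[of i k j]]) (auto simp: norm_mult intro!: mult_left_mono Suc)
  have "cmod (kpow W g (Suc k) i j) = \<bar>W i\<bar> * cmod (\<Sum>\<^sub>\<infinity>l. g i l * kpow W g k l j)" by (simp add: norm_mult)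
  also have "\<dots> \<le> \<bar>V i\<bar> * (\<Sum>\<^sub>\<infinity>l. cmod (g i l * kpow W g k l j))"
    by (intro mult_mono assms norm_infsum_bound[OF s]) auto
  also have "\<dots> \<le> \<bar>V i\<bar> * (\<Sum>\<^sub>\<infinity>l. cmod (g i l) * akpow V g k l j)"
    by (intro mult_left_mono infsum_mono s g_akpow_summable) (auto simp: norm_mult intro!: mult_left_mono Suc)
  finally show ?case by simp
qed simp

lemma g_kpow_summable:
  assumes "\<And>i. \<bar>W i\<bar> \<le> \<bar>V i\<bar>"
  shows "(\<lambda>l. g i l * kpow W g k l j) summable_on UNIV"
  by (rule abs_summable_summable, rule summable_on_comparison_test[OF g_akpow_summable[of i k j]])
     (auto simp: norm_mult intro!: mult_left_mono kpow_le assms)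

definition v where "v i = sqrt \<bar>V i\<bar>"
definition y where "y i l = v i * cmod (g i l) * v l"
definition prow where "prow i = sqrt (\<Sum>\<^sub>\<infinity>l. (y i l)\<^sup>2)"
definition qcol where "qcol j = sqrt (\<Sum>\<^sub>\<infinity>i. (y i j)\<^sup>2)"

lemma v_nonneg: "v i \<ge> 0" by (simp add: v_def)
lemma v_sq: "v i * v i = \<bar>V i\<bar>" by (simp add: v_def)
lemma y_nonneg: "y i l \<ge> 0" by (simp add: y_def v_nonneg)

lemma y_hs: "finite A \<Longrightarrow> finite B \<Longrightarrow> (\<Sum>i\<in>A. \<Sum>j\<in>B. (y i j)\<^sup>2) \<le> H\<^sup>2"
  using hs[of A B] by (simp add: y_def power_mult_distrib v_def mult_ac)

lemma y_summable: "(\<lambda>l. (y i l)\<^sup>2) summable_on UNIV" "(\<lambda>i. (y i j)\<^sup>2) summable_on UNIV"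
proof -
  show "(\<lambda>l. (y i l)\<^sup>2) summable_on UNIV"
    by (rule nonneg_bdd_above_summable_on) (use y_hs[of "{i}"] in \<open>auto simp: bdd_above_def\<close>)
  show "(\<lambda>i. (y i j)\<^sup>2) summable_on UNIV"
    by (rule nonneg_bdd_above_summable_on) (use y_hs[of _ "{j}"] in \<open>auto simp: bdd_above_def\<close>)
qed

lemma prow_sq: "(prow i)\<^sup>2 = (\<Sum>\<^sub>\<infinity>l. (y i l)\<^sup>2)" and qcol_sq: "(qcol j)\<^sup>2 = (\<Sum>\<^sub>\<infinity>i. (y i j)\<^sup>2)"
  by (simp_all add: prow_def qcol_def infsum_nonneg)

lemma prow_nonneg: "prow i \<ge> 0" and qcol_nonneg: "qcol i \<ge> 0"
  by (simp_all add: prow_def qcol_def infsum_nonneg)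

lemma sum_prow_le: "finite F \<Longrightarrow> (\<Sum>i\<in>F. (prow i)\<^sup>2) \<le> H\<^sup>2"
  unfolding prow_sq using y_summable y_hs
  by (subst infsum_finite_sum[symmetric]) (auto intro!: infsum_le_finite_sums summable_on_finite_sum simp: sum.swap[of _ F])

lemma sum_qcol_le: "finite F \<Longrightarrow> (\<Sum>j\<in>F. (qcol j)\<^sup>2) \<le> H\<^sup>2"
  unfolding qcol_sq using y_summable y_hs
  by (subst infsum_finite_sum[symmetric]) (auto intro!: infsum_le_finite_sums summable_on_finite_sum)

lemma sum_prow_qcol_le: "finite F \<Longrightarrow> (\<Sum>i\<in>F. prow i * qcol i) \<le> H\<^sup>2"
proof -
  assume F: "finite F"
  have "prow i * qcol i \<le> ((prow i)\<^sup>2 + (qcol i)\<^sup>2) / 2" for i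
    using sum_squares_bound[of "prow i" "qcol i"] by simp
  then have "(\<Sum>i\<in>F. prow i * qcol i) \<le> (\<Sum>i\<in>F. ((prow i)\<^sup>2 + (qcol i)\<^sup>2) / 2)" by (rule sum_mono)
  also have "\<dots> = ((\<Sum>i\<in>F. (prow i)\<^sup>2) + (\<Sum>i\<in>F. (qcol i)\<^sup>2)) / 2" by (simp add: sum.distrib sum_divide_distrib[symmetric])
  also have "\<dots> \<le> H\<^sup>2" using sum_prow_le[OF F] sum_qcol_le[OF F] by simp
  finally show ?thesis .
qed

lemma prow_summable: "(\<lambda>l. (prow l)\<^sup>2) summable_on UNIV" "(\<Sum>\<^sub>\<infinity>l. (prow l)\<^sup>2) \<le> H\<^sup>2"
proof -
  show s: "(\<lambda>l. (prow l)\<^sup>2) summable_on UNIV"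
    by (rule nonneg_bdd_above_summable_on) (use sum_prow_le in \<open>auto simp: bdd_above_def\<close>)
  show "(\<Sum>\<^sub>\<infinity>l. (prow l)\<^sup>2) \<le> H\<^sup>2" by (rule infsum_le_finite_sums[OF s]) (use sum_prow_le in auto)
qed

text \<open>Since |V i| |g i j| v j = v i y i j |V j|^(1/2) / v j times v j, the power k + 2 is a
  power of y up to conjugation by v. Its outer factors contribute a row and a column norm, each
  inner one a factor H. Keeping \<open>v j\<close> on the left avoids division at zeros of
  V.\<close>

lemma akpow_hs: "akpow V g (k + 2) i j * v j \<le> v i * prow i * H ^ k * qcol j"
proof (induction k arbitrary: i)
  case 0
  have 1: "akpow V g 1 l j = \<bar>V l\<bar> * cmod (g l j)" for l
  proof -
    have "(\<Sum>\<^sub>\<infinity>m. cmod (g l m) * akpow V g 0 m j) = (\<Sum>\<^sub>\<infinity>m\<in>{j}. cmod (g l m))"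
      by (rule infsum_cong_neutral) auto
    then show ?thesis by simp
  qed
  have "akpow V g (0 + 2) i j * v j = \<bar>V i\<bar> * (\<Sum>\<^sub>\<infinity>l. cmod (g i l) * akpow V g 1 l j) * v j"
    by (simp add: numeral_2_eq_2)
  also have "\<dots> = \<bar>V i\<bar> * ((\<Sum>\<^sub>\<infinity>l. cmod (g i l) * (\<bar>V l\<bar> * cmod (g l j))) * v j)" by (simp only: 1 mult.assoc)
  also have "\<dots> = \<bar>V i\<bar> * (\<Sum>\<^sub>\<infinity>l. cmod (g i l) * (\<bar>V l\<bar> * cmod (g l j)) * v j)" by (simp only: infsum_cmult_left')
  also have "\<dots> = v i * (v i * (\<Sum>\<^sub>\<infinity>l. cmod (g i l) * (\<bar>V l\<bar> * cmod (g l j)) * v j))" by (simp add: v_sq[symmetric] mult.assoc)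
  also have "\<dots> = v i * (\<Sum>\<^sub>\<infinity>l. y i l * y l j)"
    by (simp add: infsum_cmult_right'[symmetric] y_def v_sq[symmetric] mult_ac)
  also have "\<dots> \<le> v i * (sqrt (\<Sum>\<^sub>\<infinity>l. (y i l)\<^sup>2) * sqrt (\<Sum>\<^sub>\<infinity>l. (y l j)\<^sup>2))"
    by (intro mult_left_mono infsum_nonneg_cauchy_schwarz y_summable y_nonneg v_nonneg)
  finally show ?case by (simp add: prow_def qcol_def mult_ac)
next
  case (Suc k)
  have "akpow V g (Suc k + 2) i j * v j = \<bar>V i\<bar> * ((\<Sum>\<^sub>\<infinity>l. cmod (g i l) * akpow V g (k + 2) l j) * v j)"
    by (simp add: mult.assoc)
  also have "\<dots> = \<bar>V i\<bar> * (\<Sum>\<^sub>\<infinity>l. cmod (g i l) * (akpow V g (k + 2) l j * v j))"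
    by (simp only: infsum_cmult_left'[symmetric] mult.assoc)
  also have "\<dots> \<le> \<bar>V i\<bar> * (\<Sum>\<^sub>\<infinity>l. cmod (g i l) * (v l * prow l * H ^ k * qcol j))"
  proof (rule mult_left_mono[OF infsum_mono])
    show "(\<lambda>l. cmod (g i l) * (akpow V g (k + 2) l j * v j)) summable_on UNIV"
      using summable_on_cmult_left[OF g_akpow_summable[of i "k + 2" j], of "v j"] by (simp only: mult.assoc)
    show s: "(\<lambda>l. cmod (g i l) * (v l * prow l * H ^ k * qcol j)) summable_on UNIV"
    \<comment> \<open>Away from zeros of V this is summability of y i l against prow l. At a zero of
      V, y i vanishes and carries no information on g, so the l2 bound on the row of g is
      used.\<close>
    proof (cases "v i = 0")
      case False
      have "(\<lambda>l. y i l * prow l) summable_on UNIV"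
        by (intro infsum_nonneg_cauchy_schwarz(1) y_summable prow_summable y_nonneg prow_nonneg)
      then have "(\<lambda>l. (H ^ k * qcol j / v i) * (y i l * prow l)) summable_on UNIV" by (rule summable_on_cmult_right)
      moreover have "(H ^ k * qcol j / v i) * (y i l * prow l) = cmod (g i l) * (v l * prow l * H ^ k * qcol j)" for l
        using False by (simp add: y_def)
      ultimately show ?thesis by simp
    next
      case True
      have "(\<lambda>l. cmod (g i l) * (v l * prow l)) summable_on UNIV"
      proof (rule infsum_nonneg_cauchy_schwarz(1)[of _ UNIV])
        show "(\<lambda>l. (cmod (g i l))\<^sup>2) summable_on UNIV"
          by (rule nonneg_bdd_above_summable_on) (use row in \<open>auto simp: bdd_above_def\<close>)
        show "(\<lambda>l. (v l * prow l)\<^sup>2) summable_on UNIV"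
        proof (rule summable_on_comparison_test[OF summable_on_cmult_right[OF prow_summable(1), of "sqrt (\<Sum>\<^sub>\<infinity>i. (V i)\<^sup>2)"]])
          fix l
          have "\<bar>V l\<bar> \<le> sqrt (\<Sum>\<^sub>\<infinity>i. (V i)\<^sup>2)"
            using finite_sum_le_infsum[OF V_sq, of "{l}"] by (intro real_le_rsqrt) auto
          then show "(v l * prow l)\<^sup>2 \<le> sqrt (\<Sum>\<^sub>\<infinity>i. (V i)\<^sup>2) * (prow l)\<^sup>2"
            by (simp add: power_mult_distrib v_def mult_right_mono)
        qed simp
      qed (auto simp: v_nonneg prow_nonneg)
      from summable_on_cmult_left[OF this, of "H ^ k * qcol j"] show ?thesis by (simp add: mult_ac)
    qed
    fix l
    show "cmod (g i l) * (akpow V g (k + 2) l j * v j) \<le> cmod (g i l) * (v l * prow l * H ^ k * qcol j)"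
      by (intro mult_left_mono Suc) auto
  qed auto
  also have "\<dots> = v i * (\<Sum>\<^sub>\<infinity>l. (H ^ k * qcol j) * (y i l * prow l))"
    by (simp add: v_sq[symmetric] infsum_cmult_right'[symmetric] y_def mult_ac)
  also have "\<dots> = v i * (H ^ k * qcol j) * (\<Sum>\<^sub>\<infinity>l. y i l * prow l)" by (simp only: infsum_cmult_right' mult.assoc)
  also have "\<dots> \<le> v i * (H ^ k * qcol j) * (prow i * H)"
  proof (rule mult_left_mono)
    have "(\<Sum>\<^sub>\<infinity>l. y i l * prow l) \<le> sqrt (\<Sum>\<^sub>\<infinity>l. (y i l)\<^sup>2) * sqrt (\<Sum>\<^sub>\<infinity>l. (prow l)\<^sup>2)"
      by (intro infsum_nonneg_cauchy_schwarz(2) y_summable prow_summable y_nonneg prow_nonneg)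
    also have "\<dots> \<le> prow i * H"
      unfolding prow_def[symmetric] using prow_summable(2) nonneg
      by (intro mult_left_mono real_le_lsqrt prow_nonneg infsum_nonneg) auto
    finally show "(\<Sum>\<^sub>\<infinity>l. y i l * prow l) \<le> prow i * H" .
  qed (use nonneg in \<open>auto simp: v_nonneg qcol_nonneg\<close>)
  finally show ?case by (simp add: mult_ac)
qed

end

section \<open>The exponential series of the kernel and bounds for its minors\<close>

lemma kdet2_zero_row: "W i = 0 \<Longrightarrow> kdet2 W g i j = 0"
  by (simp add: kdet2_def)

lemma summable_power_over_fact: "summable (\<lambda>k. x ^ k / fact k :: real)"
  using summable_exp[of x] by (simp add: divide_inverse mult.commute)

lemma suminf_power_over_fact: "(\<Sum>k. x ^ k / fact k :: real) = exp x"
  by (simp add: exp_def divide_inverse mult.commute)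

context hs_kernel
begin

definition aexp where "aexp j l = (\<Sum>k. akpow V g k l j / fact k)"

lemma akpow_over_fact_summable: "summable (\<lambda>k. akpow V g k l j / fact k)"
  by (rule summable_comparison_test'[OF summable_power_over_fact[of c], of 0])
     (use akpow_le akpow_nonneg in \<open>auto intro!: divide_right_mono\<close>)

lemma aexp_nonneg: "aexp j l \<ge> 0"
  unfolding aexp_def by (intro suminf_nonneg akpow_over_fact_summable) (simp add: akpow_nonneg)

lemma sum_aexp_le: "finite F \<Longrightarrow> (\<Sum>l\<in>F. aexp j l) \<le> exp c"
proof -
  assume F: "finite F"
  have "(\<Sum>l\<in>F. aexp j l) = (\<Sum>k. \<Sum>l\<in>F. akpow V g k l j / fact k)"
    unfolding aexp_def by (rule suminf_sum[symmetric]) (rule akpow_over_fact_summable)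
  also have "\<dots> \<le> (\<Sum>k. c ^ k / fact k)"
  proof (rule suminf_le)
    show "(\<Sum>l\<in>F. akpow V g k l j / fact k) \<le> c ^ k / fact k" for k
      unfolding sum_divide_distrib[symmetric] using akpow_l1[of k j] F by (intro divide_right_mono) auto
  qed (intro summable_sum akpow_over_fact_summable summable_power_over_fact)+
  finally show ?thesis by (simp add: suminf_power_over_fact)
qed

lemma aexp_summable: "aexp j summable_on UNIV"
  by (rule nonneg_bdd_above_summable_on) (use sum_aexp_le aexp_nonneg in \<open>auto simp: bdd_above_def\<close>)

context
  fixes W :: "'a \<Rightarrow> real"
  assumes W: "\<And>i. \<bar>W i\<bar> \<le> \<bar>V i\<bar>"
begin

lemma kexp_term_le: "cmod (exp_coeff k * kpow W g k i j) \<le> akpow V g k i j / fact k"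
  using kpow_le[of W k i j] W by (simp add: norm_mult cmod_exp_coeff divide_right_mono)

lemma kexp_sums: "(\<lambda>k. exp_coeff k * kpow W g k i j) sums kexp W g i j"
  unfolding kexp_def
  by (rule summable_sums, rule summable_comparison_test'[OF akpow_over_fact_summable, of 0]) (rule kexp_term_le)

lemma partial_kexp_le: "cmod (\<Sum>k<m. exp_coeff k * kpow W g k i j) \<le> aexp j i"
proof -
  have "cmod (\<Sum>k<m. exp_coeff k * kpow W g k i j) \<le> (\<Sum>k<m. akpow V g k i j / fact k)"
    by (intro sum_norm_le kexp_term_le)
  also have "\<dots> \<le> aexp j i"
    unfolding aexp_def by (intro sum_le_suminf akpow_over_fact_summable) (auto simp: akpow_nonneg)
  finally show ?thesis .
qed

lemma kexp_le: "cmod (kexp W g i j) \<le> aexp j i"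
proof (rule Lim_bounded)
  show "(\<lambda>m. cmod (\<Sum>k<m. exp_coeff k * kpow W g k i j)) \<longlonglongrightarrow> cmod (kexp W g i j)"
    using kexp_sums unfolding sums_def by (rule tendsto_norm)
qed (use partial_kexp_le in auto)

lemma g_kexp_sums:
  "(\<lambda>k. exp_coeff k * (\<Sum>\<^sub>\<infinity>l. g i l * kpow W g k l j)) sums (\<Sum>\<^sub>\<infinity>l. g i l * kexp W g l j)"
proof -
  have "(\<lambda>m. \<Sum>\<^sub>\<infinity>l. \<Sum>k<m. exp_coeff k * (g i l * kpow W g k l j)) \<longlonglongrightarrow> (\<Sum>\<^sub>\<infinity>l. g i l * kexp W g l j)"
  proof (rule infsum_dominated_convergence[where h = "\<lambda>l. \<gamma> * aexp j l"])
    show "(\<lambda>l. \<gamma> * aexp j l) summable_on UNIV" by (rule summable_on_cmult_right[OF aexp_summable])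
    have e: "(\<Sum>k<m. exp_coeff k * (g i l * kpow W g k l j)) = g i l * (\<Sum>k<m. exp_coeff k * kpow W g k l j)" for m l
      by (simp add: sum_distrib_left mult_ac)
    show "norm (\<Sum>k<m. exp_coeff k * (g i l * kpow W g k l j)) \<le> \<gamma> * aexp j l" for m l
      unfolding e norm_mult by (intro mult_mono g_le partial_kexp_le nonneg) auto
    show "(\<lambda>m. \<Sum>k<m. exp_coeff k * (g i l * kpow W g k l j)) \<longlonglongrightarrow> g i l * kexp W g l j" for l
      unfolding e using kexp_sums unfolding sums_def by (intro tendsto_mult_left)
  qed
  also have "(\<lambda>m. \<Sum>\<^sub>\<infinity>l. \<Sum>k<m. exp_coeff k * (g i l * kpow W g k l j))
      = (\<lambda>m. \<Sum>k<m. exp_coeff k * (\<Sum>\<^sub>\<infinity>l. g i l * kpow W g k l j))"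
    using g_kpow_summable[of W] W
    by (intro ext) (subst infsum_finite_sum, auto intro!: summable_on_cmult_right simp: infsum_cmult_right')
  finally show ?thesis unfolding sums_def .
qed

text \<open>Split two terms off the series of exp (- A) and one off that of A exp (- A): I - A and A
  cancel against I, and the remainder starts at A^2.\<close>

lemma kdet2_eq:
  "kexp W g i j + of_real (W i) * (\<Sum>\<^sub>\<infinity>l. g i l * kexp W g l j) - (if i = j then 1 else 0) = kdet2 W g i j"
proof -
  have a: "(\<lambda>k. exp_coeff (k + 2) * kpow W g (k + 2) i j)
      sums (kexp W g i j - (\<Sum>k<2. exp_coeff k * kpow W g k i j))"
    using kexp_sums by (rule sums_split_initial_segment)
  have "(\<lambda>k. of_real (W i) * (exp_coeff k * (\<Sum>\<^sub>\<infinity>l. g i l * kpow W g k l j))) sums (of_real (W i) * (\<Sum>\<^sub>\<infinity>l. g i l * kexp W g l j))"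
    by (rule sums_mult[OF g_kexp_sums])
  then have "(\<lambda>k. exp_coeff k * kpow W g (Suc k) i j) sums (of_real (W i) * (\<Sum>\<^sub>\<infinity>l. g i l * kexp W g l j))"
    by (simp add: mult_ac)
  then have b: "(\<lambda>k. exp_coeff (k + 1) * kpow W g (Suc (k + 1)) i j)
      sums (of_real (W i) * (\<Sum>\<^sub>\<infinity>l. g i l * kexp W g l j) - (\<Sum>k<1. exp_coeff k * kpow W g (Suc k) i j))"
    by (rule sums_split_initial_segment)
  have e: "exp_coeff 0 = 1" "exp_coeff 1 = - 1" by (simp_all add: exp_coeff_def)
  have "(\<lambda>k. (exp_coeff (k + 2) + exp_coeff (k + 1)) * kpow W g (k + 2) i j)
      sums ((kexp W g i j - (\<Sum>k<2. exp_coeff k * kpow W g k i j))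
        + (of_real (W i) * (\<Sum>\<^sub>\<infinity>l. g i l * kexp W g l j) - (\<Sum>k<1. exp_coeff k * kpow W g (Suc k) i j)))"
    using sums_add[OF a b] by (simp add: ring_distribs)
  then have "kdet2 W g i j = ((kexp W g i j - (\<Sum>k<2. exp_coeff k * kpow W g k i j))
        + (of_real (W i) * (\<Sum>\<^sub>\<infinity>l. g i l * kexp W g l j) - (\<Sum>k<1. exp_coeff k * kpow W g (Suc k) i j)))"
    unfolding kdet2_def by (rule sums_unique[symmetric])
  then show ?thesis using e by (simp add: numeral_2_eq_2)
qed

lemma kdet2_term_le:
  "cmod ((exp_coeff (k + 2) + exp_coeff (k + 1)) * kpow W g (k + 2) i j) \<le> akpow V g (k + 2) i j / fact k"
proof -
  have "cmod (exp_coeff (k + 2) + exp_coeff (k + 1)) * cmod (kpow W g (k + 2) i j) \<le> 1 / fact k * akpow V g (k + 2) i j"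
    by (rule mult_mono[OF cmod_exp_coeff_sum_le kpow_le]) (use W in auto)
  then show ?thesis by (simp only: norm_mult) simp
qed

text \<open>As the series starts at A^2, every term factors through one row norm and one column norm
  by \<open>akpow_hs\<close>; the remaining powers of H sum to exp H.\<close>

lemma kdet2_bound: "cmod (kdet2 W g i j) * v j \<le> v i * prow i * (qcol j * exp H)"
proof -
  have s: "summable (\<lambda>k. v i * prow i * qcol j * (H ^ k / fact k))"
    by (rule summable_mult[OF summable_power_over_fact])
  have le: "cmod ((exp_coeff (k + 2) + exp_coeff (k + 1)) * kpow W g (k + 2) i j * of_real (v j))
      \<le> v i * prow i * qcol j * (H ^ k / fact k)" for k
  proof -
    have "cmod ((exp_coeff (k + 2) + exp_coeff (k + 1)) * kpow W g (k + 2) i j) * v j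
        \<le> akpow V g (k + 2) i j / fact k * v j"
      by (rule mult_right_mono[OF kdet2_term_le v_nonneg])
    also have "\<dots> = (akpow V g (k + 2) i j * v j) / fact k" by simp
    also have "\<dots> \<le> (v i * prow i * H ^ k * qcol j) / fact k"
      by (rule divide_right_mono[OF akpow_hs]) simp
    finally show ?thesis by (simp add: norm_mult v_nonneg mult_ac)
  qed
  have s': "summable (\<lambda>k. cmod ((exp_coeff (k + 2) + exp_coeff (k + 1)) * kpow W g (k + 2) i j * of_real (v j)))"
    by (rule summable_comparison_test'[OF s, of 0]) (use le in simp)
  have "cmod (kdet2 W g i j) * v j = cmod (kdet2 W g i j * of_real (v j))" by (simp add: norm_mult v_nonneg)
  also have "kdet2 W g i j * of_real (v j) = (\<Sum>k. (exp_coeff (k + 2) + exp_coeff (k + 1)) * kpow W g (k + 2) i j * of_real (v j))"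
    unfolding kdet2_def
  proof (rule suminf_mult2)
    show "summable (\<lambda>k. (exp_coeff (k + 2) + exp_coeff (k + 1)) * kpow W g (k + 2) i j)"
    proof (rule summable_comparison_test'[of "\<lambda>k. c ^ 2 * (c ^ k / fact k)" 0])
      show "summable (\<lambda>k. c ^ 2 * (c ^ k / fact k))" by (rule summable_mult[OF summable_power_over_fact])
      fix k
      show "cmod ((exp_coeff (k + 2) + exp_coeff (k + 1)) * kpow W g (k + 2) i j) \<le> c ^ 2 * (c ^ k / fact k)"
      proof (rule order.trans[OF kdet2_term_le])
        have "akpow V g (k + 2) i j / fact k \<le> c ^ (k + 2) / fact k"
          by (rule divide_right_mono[OF akpow_le]) simp
        then show "akpow V g (k + 2) i j / fact k \<le> c ^ 2 * (c ^ k / fact k)"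
          by (simp only: power_add mult_ac times_divide_eq_right)
      qed
    qed
  qed
  also have "cmod \<dots> \<le> (\<Sum>k. cmod ((exp_coeff (k + 2) + exp_coeff (k + 1)) * kpow W g (k + 2) i j * of_real (v j)))"
    by (rule summable_norm[OF s'])
  also have "\<dots> \<le> (\<Sum>k. v i * prow i * qcol j * (H ^ k / fact k))" by (rule suminf_le[OF le s' s])
  also have "\<dots> = v i * prow i * qcol j * exp H"
    by (simp only: suminf_mult[OF summable_power_over_fact] suminf_power_over_fact)
  finally show ?thesis by (simp add: mult_ac)
qed

lemma fdet_kdet2_le:
  assumes "finite S"
  shows "cmod (fdet S (kdet2 W g)) \<le> sqrt (real (card S)) ^ card S * (\<Prod>i\<in>S. prow i * (qcol i * exp H))"
proof (cases "\<exists>i\<in>S. V i = 0")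
  case True
  then obtain i where i: "i \<in> S" "V i = 0" by blast
  have "fdet S (kdet2 W g) = 0"
    using W[of i] i by (intro fdet_zero_row[OF assms i(1)] kdet2_zero_row) auto
  then show ?thesis by (simp add: prod_nonneg prow_nonneg qcol_nonneg)
next
  case False
  then have v: "v i > 0" if "i \<in> S" for i using that by (auto simp: v_def)
  have "fdet S (kdet2 W g) = fdet S (\<lambda>i j. kdet2 W g i j * of_real (v j) / of_real (v i))"
    using v by (intro fdet_conj[symmetric] assms) force
  also have "cmod \<dots> \<le> sqrt (real (card S)) ^ card S * (\<Prod>i\<in>S. prow i * (qcol i * exp H))"
  proof (rule fdet_hadamard[OF assms])
    fix i j assume "i \<in> S" "j \<in> S"
    then show "cmod (kdet2 W g i j * of_real (v j) / of_real (v i)) \<le> prow i * (qcol j * exp H)"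
      using kdet2_bound[of i j] v[of i] v_nonneg[of j] by (simp add: norm_mult norm_divide pos_divide_le_eq mult_ac)
  qed (auto simp: prow_nonneg qcol_nonneg)
  finally show ?thesis .
qed

end

end

section \<open>Convergence under truncation and the case of finite support\<close>

context hs_kernel
begin

definition minor_bound where
  "minor_bound S = sqrt (real (card S)) ^ card S * (\<Prod>i\<in>S. prow i * (qcol i * exp H))"

lemma minor_bound_nonneg: "minor_bound S \<ge> 0"
  unfolding minor_bound_def by (intro mult_nonneg_nonneg prod_nonneg) (auto simp: prow_nonneg qcol_nonneg)

text \<open>Sums over sets of size k are dominated by elementary symmetric polynomials in the
  numbers prow i qcol i exp H, whose sum the Hilbert-Schmidt norm controls.\<close>

lemma sum_minor_bound_le:
  assumes F: "finite F" "F \<subseteq> {S. finite S \<and> card S = k}"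
  shows "(\<Sum>S\<in>F. minor_bound S) \<le> sqrt (real k) ^ k * (exp H * H\<^sup>2) ^ k / fact k"
proof -
  define U where "U = \<Union>F"
  let ?x = "\<lambda>i. prow i * (qcol i * exp H)"
  have U: "finite U" using F by (auto simp: U_def)
  have nn: "?x i \<ge> 0" for i by (simp add: prow_nonneg qcol_nonneg)
  have "(\<Sum>S\<in>F. minor_bound S) = sqrt (real k) ^ k * (\<Sum>S\<in>F. \<Prod>i\<in>S. ?x i)"
    unfolding sum_distrib_left by (rule sum.cong) (use F in \<open>auto simp: minor_bound_def\<close>)
  also have "(\<Sum>S\<in>F. \<Prod>i\<in>S. ?x i) \<le> (\<Sum>S | S \<subseteq> U \<and> card S = k. \<Prod>i\<in>S. ?x i)"
  proof (rule sum_mono2)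
    show "finite {S. S \<subseteq> U \<and> card S = k}" using U by simp
    show "F \<subseteq> {S. S \<subseteq> U \<and> card S = k}" using F by (auto simp: U_def)
  qed (intro prod_nonneg nn)
  also have "\<dots> \<le> (\<Sum>i\<in>U. ?x i) ^ k / fact k" by (rule elementary_symmetric_le[OF U nn])
  also have "(\<Sum>i\<in>U. ?x i) = exp H * (\<Sum>i\<in>U. prow i * qcol i)" by (simp add: sum_distrib_left mult_ac)
  also have "\<dots> ^ k / fact k \<le> (exp H * H\<^sup>2) ^ k / fact k"
    using sum_prow_qcol_le[OF U] prow_nonneg qcol_nonneg
    by (intro divide_right_mono power_mono mult_left_mono mult_nonneg_nonneg sum_nonneg) auto
  finally show ?thesis by (simp add: mult_left_mono)
qed

lemma minor_bound_summable: "minor_bound summable_on {S. finite S \<and> card S = k}"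
  by (rule nonneg_bdd_above_summable_on) (use sum_minor_bound_le minor_bound_nonneg in \<open>auto simp: bdd_above_def\<close>)

lemma infsum_minor_bound_le:
  "infsum minor_bound {S. finite S \<and> card S = k} \<le> sqrt (real k) ^ k * (exp H * H\<^sup>2) ^ k / fact k"
  by (rule infsum_le_finite_sums[OF minor_bound_summable]) (rule sum_minor_bound_le)

context
  fixes W :: "nat \<Rightarrow> 'a \<Rightarrow> real"
  assumes W: "\<And>m i. \<bar>W m i\<bar> \<le> \<bar>V i\<bar>" and lim: "\<And>i. (\<lambda>m. W m i) \<longlonglongrightarrow> V i"
begin

lemma kpow_tendsto: "(\<lambda>m. kpow (W m) g k i j) \<longlonglongrightarrow> kpow V g k i j"
proof (induction k arbitrary: i)
  case (Suc k)
  have "(\<lambda>m. \<Sum>\<^sub>\<infinity>l. g i l * kpow (W m) g k l j) \<longlonglongrightarrow> (\<Sum>\<^sub>\<infinity>l. g i l * kpow V g k l j)"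
  proof (rule infsum_dominated_convergence[OF g_akpow_summable[of i k j]])
    show "cmod (g i l * kpow (W m) g k l j) \<le> cmod (g i l) * akpow V g k l j" for m l
      unfolding norm_mult by (intro mult_left_mono kpow_le W) auto
  qed (intro tendsto_mult_left Suc)
  then show ?case using lim by (auto intro!: tendsto_mult tendsto_of_real)
qed simp

lemma kdet2_tendsto: "(\<lambda>m. kdet2 (W m) g i j) \<longlonglongrightarrow> kdet2 V g i j"
  unfolding kdet2_def
proof (rule suminf_dominated_convergence)
  show "summable (\<lambda>k. c ^ (k + 2) / fact k)"
    using summable_mult[OF summable_power_over_fact[of c], of "c ^ 2"] by (simp only: power_add mult_ac times_divide_eq_right)
  show "norm ((exp_coeff (k + 2) + exp_coeff (k + 1)) * kpow (W m) g (k + 2) i j) \<le> c ^ (k + 2) / fact k" for m k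
    by (rule order.trans[OF kdet2_term_le[OF W] divide_right_mono[OF akpow_le]]) simp
qed (intro tendsto_mult_left kpow_tendsto)

text \<open>Dominated convergence twice: over sets of size k with majorant
  \<open>minor_bound\<close>, then over k with the bound from
  \<open>infsum_minor_bound_le\<close>.\<close>

lemma kfred_tendsto: "(\<lambda>m. kfred (W m) g) \<longlonglongrightarrow> kfred V g"
  unfolding kfred_def
proof (rule suminf_dominated_convergence)
  have "exp H * H\<^sup>2 \<ge> 0" by simp
  then show "summable (\<lambda>k. sqrt (real k) ^ k * (exp H * H\<^sup>2) ^ k / fact k)"
    by (rule summable_sqrt_power_over_fact)
  have le: "cmod (fdet S (kdet2 (W m) g)) \<le> minor_bound S" if "finite S" for S m
    unfolding minor_bound_def by (rule fdet_kdet2_le[OF W that])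
  show "norm (\<Sum>\<^sub>\<infinity>S\<in>{S. finite S \<and> card S = k}. fdet S (kdet2 (W m) g)) \<le> sqrt (real k) ^ k * (exp H * H\<^sup>2) ^ k / fact k" for m k
  proof -
    have s: "(\<lambda>S. cmod (fdet S (kdet2 (W m) g))) summable_on {S. finite S \<and> card S = k}"
      by (rule summable_on_comparison_test[OF minor_bound_summable]) (use le in auto)
    have "norm (\<Sum>\<^sub>\<infinity>S\<in>{S. finite S \<and> card S = k}. fdet S (kdet2 (W m) g))
      \<le> (\<Sum>\<^sub>\<infinity>S\<in>{S. finite S \<and> card S = k}. cmod (fdet S (kdet2 (W m) g)))"
      by (rule norm_infsum_bound[OF s])
    also have "\<dots> \<le> infsum minor_bound {S. finite S \<and> card S = k}"
      by (rule infsum_mono[OF s minor_bound_summable]) (use le in auto)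
    finally show ?thesis using infsum_minor_bound_le[of k] by simp
  qed
  show "(\<lambda>m. \<Sum>\<^sub>\<infinity>S\<in>{S. finite S \<and> card S = k}. fdet S (kdet2 (W m) g)) \<longlonglongrightarrow>
      (\<Sum>\<^sub>\<infinity>S\<in>{S. finite S \<and> card S = k}. fdet S (kdet2 V g))" for k
  proof (rule infsum_dominated_convergence[OF minor_bound_summable])
    show "(\<lambda>m. fdet S (kdet2 (W m) g)) \<longlonglongrightarrow> fdet S (kdet2 V g)" for S
      unfolding fdet_def by (intro tendsto_sum tendsto_mult_left tendsto_prod kdet2_tendsto)
  qed (use le in auto)
qed

end

text \<open>Rows outside K vanish, so only subsets of K contribute and the series sums to a finite
  determinant of I + \<open>kdet2\<close>. On K this kernel is (I + A) exp (- A), and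
  \<open>fdet_exp\<close> splits off the trace.\<close>

lemma kfred_finite:
  assumes W: "\<And>i. \<bar>W i\<bar> \<le> \<bar>V i\<bar>" and K: "finite K" and zero: "\<And>i. i \<notin> K \<Longrightarrow> W i = 0"
  shows "kfred W g = fdet K (\<lambda>i j. (if i = j then 1 else 0) + of_real (W i) * g i j)
    * exp (- (\<Sum>i\<in>K. of_real (W i) * g i i))"
proof -
  let ?A = "\<lambda>i j. of_real (W i) * g i j"
  have z: "kpow W g k l j = 0" if "l \<notin> K" "j \<in> K" for k l j
    using that zero by (cases k) auto
  have red: "(\<Sum>\<^sub>\<infinity>l. g i l * h l) = (\<Sum>l\<in>K. g i l * h l)" if "\<And>l. l \<notin> K \<Longrightarrow> h l = 0" for i h
  proof -
    have "(\<Sum>\<^sub>\<infinity>l. g i l * h l) = (\<Sum>\<^sub>\<infinity>l\<in>K. g i l * h l)" by (rule infsum_cong_neutral) (use that in auto)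
    then show ?thesis using K by simp
  qed
  have p: "kpow W g k i j = fpow K ?A k i j" if "i \<in> K" "j \<in> K" for i j k
    using that(1)
  proof (induction k arbitrary: i)
    case (Suc k)
    have "kpow W g (Suc k) i j = of_real (W i) * (\<Sum>l\<in>K. g i l * kpow W g k l j)"
      using z[OF _ that(2)] by (simp add: red)
    also have "\<dots> = (\<Sum>l\<in>K. ?A i l * fpow K ?A k l j)" using Suc.IH by (simp add: sum_distrib_left mult.assoc)
    finally show ?case by simp
  qed simp
  have ze: "kexp W g l j = 0" if "l \<notin> K" "j \<in> K" for l j unfolding kexp_def by (simp add: z[OF that])
  have d0: "fdet S (kdet2 W g) = 0" if S: "finite S" "\<not> S \<subseteq> K" for S
  proof -
    obtain i where "i \<in> S" "i \<notin> K" using S by blast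
    then show ?thesis using zero by (intro fdet_zero_row[OF S(1)] kdet2_zero_row) auto
  qed
  have "(\<Sum>\<^sub>\<infinity>S\<in>{S. finite S \<and> card S = k}. fdet S (kdet2 W g)) = (\<Sum>S\<in>{S \<in> Pow K. card S = k}. fdet S (kdet2 W g))" for k
  proof -
    have "(\<Sum>\<^sub>\<infinity>S\<in>{S. finite S \<and> card S = k}. fdet S (kdet2 W g)) = (\<Sum>\<^sub>\<infinity>S\<in>{S \<in> Pow K. card S = k}. fdet S (kdet2 W g))"
      by (rule infsum_cong_neutral) (use K d0 in \<open>auto intro: finite_subset\<close>)
    then show ?thesis using K by simp
  qed
  then have "kfred W g = (\<Sum>k. \<Sum>S\<in>{S \<in> Pow K. card S = k}. fdet S (kdet2 W g))" by (simp add: kfred_def)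
  also have "\<dots> = (\<Sum>k\<le>card K. \<Sum>S\<in>{S \<in> Pow K. card S = k}. fdet S (kdet2 W g))"
  proof (rule suminf_finite)
    fix k assume "k \<notin> {..card K}"
    then have "{S \<in> Pow K. card S = k} = {}" using K card_mono by fastforce
    then show "(\<Sum>S\<in>{S \<in> Pow K. card S = k}. fdet S (kdet2 W g)) = 0" by (simp only: sum.empty)
  qed simp
  also have "\<dots> = (\<Sum>S\<in>Pow K. fdet S (kdet2 W g))"
    using K by (intro sum.group) (auto intro: card_mono)
  also have "\<dots> = fdet K (\<lambda>i j. (if i = j then 1 else 0) + kdet2 W g i j)" by (rule fdet_one_plus[OF K, symmetric])
  also have "\<dots> = fdet K (\<lambda>i j. kexp W g i j + (\<Sum>l\<in>K. ?A i l * kexp W g l j))"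
  proof (rule fdet_cong)
    fix i j assume ij: "i \<in> K" "j \<in> K"
    show "(if i = j then 1 else 0) + kdet2 W g i j = kexp W g i j + (\<Sum>l\<in>K. ?A i l * kexp W g l j)"
      using kdet2_eq[OF W, of i j] red[of "\<lambda>l. kexp W g l j" i] ze[OF _ ij(2)]
      by (simp add: sum_distrib_left mult.assoc algebra_simps)
  qed
  also have "\<dots> = fdet K (\<lambda>i j. (if i = j then 1 else 0) + ?A i j) * exp (- (\<Sum>i\<in>K. ?A i i))"
    by (rule fdet_exp[OF K]) (use kexp_sums[OF W] in \<open>simp only: exp_coeff_def p[symmetric]\<close>)
  finally show ?thesis .
qed

end

section \<open>The operator determinant as a determinant of kernels\<close>

lemma green_hs_kernel:
  fixes G :: "('n::finite) seq"
  assumes G: "G \<in> l2" and V: "(\<lambda>i. (V i)\<^sup>2) summable_on UNIV"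
  shows "hs_kernel V (\<lambda>i l. G (i - l)) (sqrt (sq_norm G)) (sqrt (\<Sum>\<^sub>\<infinity>i. (V i)\<^sup>2) * sqrt (sq_norm G))"
proof
  have nn: "sq_norm G \<ge> 0" "(\<Sum>\<^sub>\<infinity>i. (V i)\<^sup>2) \<ge> 0" by (simp_all add: sq_norm_nonneg infsum_nonneg)
  show "(\<lambda>i. (V i)\<^sup>2) summable_on UNIV" by (rule V)
  have reindex: "(\<Sum>i\<in>F. (cmod (G (h i)))\<^sup>2) \<le> sq_norm G" if "finite F" "inj_on h F" for F h
    using sum_le_sq_norm[OF G, of "h ` F"] that by (simp add: sum.reindex)
  show col: "(\<Sum>i\<in>F. (cmod (G (i - l)))\<^sup>2) \<le> (sqrt (sq_norm G))\<^sup>2" if "finite F" for F l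
    using reindex[OF that, of "\<lambda>i. i - l"] nn by (simp add: inj_on_def)
  show row: "(\<Sum>l\<in>F. (cmod (G (i - l)))\<^sup>2) \<le> (sqrt (sq_norm G))\<^sup>2" if "finite F" for F i
    using reindex[OF that, of "\<lambda>l. i - l"] nn by (simp add: inj_on_def)
  show "0 \<le> sqrt (sq_norm G)" "0 \<le> sqrt (\<Sum>\<^sub>\<infinity>i. (V i)\<^sup>2) * sqrt (sq_norm G)" using nn by auto
  fix A B :: "(int ^ 'n) set" assume AB: "finite A" "finite B"
  have sumV: "(\<Sum>i\<in>F. (V i)\<^sup>2) \<le> (\<Sum>\<^sub>\<infinity>i. (V i)\<^sup>2)" if "finite F" for F
    using V that by (intro finite_sum_le_infsum) auto
  \<comment> \<open>2 |V i| |V j| \<le> (V i)^2 + (V j)^2 reduces the double sum to l2 norms of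
    single rows and columns of g.\<close>
  have "\<bar>V i\<bar> * \<bar>V j\<bar> * (cmod (G (i - j)))\<^sup>2 \<le> ((V i)\<^sup>2 * (cmod (G (i - j)))\<^sup>2 + (V j)\<^sup>2 * (cmod (G (i - j)))\<^sup>2) / 2" for i j
    using mult_right_mono[OF sum_squares_bound[of "\<bar>V i\<bar>" "\<bar>V j\<bar>"], of "(cmod (G (i - j)))\<^sup>2"]
    by (simp add: algebra_simps)
  then have "(\<Sum>i\<in>A. \<Sum>j\<in>B. \<bar>V i\<bar> * \<bar>V j\<bar> * (cmod (G (i - j)))\<^sup>2)
      \<le> (\<Sum>i\<in>A. \<Sum>j\<in>B. ((V i)\<^sup>2 * (cmod (G (i - j)))\<^sup>2 + (V j)\<^sup>2 * (cmod (G (i - j)))\<^sup>2) / 2)"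
    by (intro sum_mono)
  also have "\<dots> = ((\<Sum>i\<in>A. (V i)\<^sup>2 * (\<Sum>j\<in>B. (cmod (G (i - j)))\<^sup>2)) + (\<Sum>j\<in>B. (V j)\<^sup>2 * (\<Sum>i\<in>A. (cmod (G (i - j)))\<^sup>2))) / 2"
    by (simp add: sum_divide_distrib[symmetric] sum.distrib sum_distrib_left sum.swap[of _ B A])
  also have "\<dots> \<le> ((\<Sum>\<^sub>\<infinity>i. (V i)\<^sup>2) * sq_norm G + (\<Sum>\<^sub>\<infinity>i. (V i)\<^sup>2) * sq_norm G) / 2"
  proof (intro divide_right_mono add_mono)
    have "(\<Sum>i\<in>A. (V i)\<^sup>2 * (\<Sum>j\<in>B. (cmod (G (i - j)))\<^sup>2)) \<le> (\<Sum>i\<in>A. (V i)\<^sup>2 * sq_norm G)"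
      using row[OF AB(2)] nn by (intro sum_mono mult_left_mono) auto
    also have "\<dots> \<le> (\<Sum>\<^sub>\<infinity>i. (V i)\<^sup>2) * sq_norm G"
      unfolding sum_distrib_right[symmetric] by (intro mult_right_mono sumV AB nn)
    finally show "(\<Sum>i\<in>A. (V i)\<^sup>2 * (\<Sum>j\<in>B. (cmod (G (i - j)))\<^sup>2)) \<le> (\<Sum>\<^sub>\<infinity>i. (V i)\<^sup>2) * sq_norm G" .
    have "(\<Sum>j\<in>B. (V j)\<^sup>2 * (\<Sum>i\<in>A. (cmod (G (i - j)))\<^sup>2)) \<le> (\<Sum>j\<in>B. (V j)\<^sup>2 * sq_norm G)"
      using col[OF AB(1)] nn by (intro sum_mono mult_left_mono) auto
    also have "\<dots> \<le> (\<Sum>\<^sub>\<infinity>i. (V i)\<^sup>2) * sq_norm G"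
      unfolding sum_distrib_right[symmetric] by (intro mult_right_mono sumV AB nn)
    finally show "(\<Sum>j\<in>B. (V j)\<^sup>2 * (\<Sum>i\<in>A. (cmod (G (i - j)))\<^sup>2)) \<le> (\<Sum>\<^sub>\<infinity>i. (V i)\<^sup>2) * sq_norm G" .
  qed auto
  finally show "(\<Sum>i\<in>A. \<Sum>j\<in>B. \<bar>V i\<bar> * \<bar>V j\<bar> * (cmod (G (i - j)))\<^sup>2)
      \<le> (sqrt (\<Sum>\<^sub>\<infinity>i. (V i)\<^sup>2) * sqrt (sq_norm G))\<^sup>2"
    using nn by (simp add: power_mult_distrib mult.commute)
qed

text \<open>The resolvent is a convolution on absolutely summable sequences; the majorants
  \<open>akpow\<close> and \<open>aexp\<close> show that all iterates of unit sequences and the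
  exponential stay in that class.\<close>

lemma regularized_det_eq_kfred:
  fixes G :: "('n::finite) seq"
  assumes lam: "lam \<in> off_spectrum TYPE('n)" and G: "is_green lam G" and V: "(\<lambda>i. (V i)\<^sup>2) summable_on UNIV"
  shows "regularized_det (mult_op V \<circ> free_resolvent lam) = kfred V (\<lambda>i l. G (i - l))"
proof -
  define g where "g = (\<lambda>i l. G (i - l))"
  have "G \<in> l2" using G by (simp add: is_green_def)
  from green_hs_kernel[OF this V, folded g_def]
  interpret hs_kernel V g "sqrt (sq_norm G)" "sqrt (\<Sum>\<^sub>\<infinity>i. (V i)\<^sup>2) * sqrt (sq_norm G)" .
  define T where "T = mult_op V \<circ> free_resolvent lam"
  have T: "T f i = of_real (V i) * (\<Sum>\<^sub>\<infinity>l. g i l * f l)" if "(\<lambda>m. cmod (f m)) summable_on UNIV" for f i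
    by (simp add: T_def mult_op_def free_resolvent_lconv[OF lam G that] lconv_def g_def)
  have iter: "((\<lambda>h m. - T h m) ^^ k) (unit_seq j) = (\<lambda>i. (- 1) ^ k * kpow V g k i j)" for k j
  proof (induction k)
    case (Suc k)
    have "(\<lambda>m. cmod ((- 1) ^ k * kpow V g k m j)) summable_on UNIV"
      by (rule summable_on_comparison_test[OF conjunct1[OF akpow_l1[of k j]]])
         (use kpow_le[of V k _ j] in \<open>simp_all add: norm_mult norm_power\<close>)
    from T[OF this] show ?case
      by (simp add: Suc infsum_cmult_right' mult.left_commute[of _ "(- 1) ^ k"])
  qed (auto simp: unit_seq_def)
  have e: "op_exp (\<lambda>h m. - T h m) (unit_seq j) = (\<lambda>i. kexp V g i j)" for j
    by (simp add: op_exp_def iter kexp_def exp_coeff_def)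
  have ke: "(\<lambda>m. cmod (kexp V g m j)) summable_on UNIV" for j
    by (rule summable_on_comparison_test[OF aexp_summable[of j]]) (use kexp_le[of V _ j] in simp_all)
  define R where "R = (\<lambda>f n. let g = op_exp (\<lambda>h m. - T h m) f in g n + T g n - f n)"
  have R: "R (unit_seq j) i = kdet2 V g i j" for i j
    unfolding R_def Let_def e T[OF ke] using kdet2_eq[of V i j] by (simp add: unit_seq_def)
  have "regularized_det T = fredholm_det_I_plus R" by (simp add: regularized_det_def R_def)
  also have "\<dots> = kfred V g" by (simp add: fredholm_det_I_plus_def kfred_def principal_minor_def fdet_def R)
  finally show ?thesis by (simp add: T_def g_def)
qed

text \<open>The finite form of det ((I + A) exp (- A)), with the determinant of the exponential
  already evaluated through the trace.\<close>

definition fdet2 :: "'a set \<Rightarrow> ('a \<Rightarrow> complex) \<Rightarrow> ('a \<Rightarrow> 'a \<Rightarrow> complex) \<Rightarrow> complex" where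
  "fdet2 K a g = fdet K (\<lambda>i j. (if i = j then 1 else 0) + a i * g i j) * exp (- (\<Sum>i\<in>K. a i * g i i))"

definition trunc_det :: "(int ^ ('n::finite) \<Rightarrow> real) \<Rightarrow> (int ^ 'n) set \<Rightarrow> complex \<Rightarrow> complex" where
  "trunc_det V K z = fdet2 K (\<lambda>i. of_real (V i)) (\<lambda>i j. disc_green z (i - j))"

lemma trunc_det_0:
  assumes K: "finite (K :: (int ^ ('n::finite)) set)"
  shows "trunc_det V K 0 = 1"
proof -
  have "fdet X (\<lambda>i j. 0) = (if X = {} then 1 else 0)" if "X \<subseteq> K" for X :: "(int ^ 'n) set"
  proof (cases "X = {}")
    case False
    then obtain i where "i \<in> X" by blast
    then show ?thesis using fdet_zero_row[of X i "\<lambda>i j. 0"] that K finite_subset by auto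
  qed (simp add: fdet_def)
  then have "(\<Sum>X\<in>Pow K. fdet X (\<lambda>i j. 0)) = (\<Sum>X\<in>Pow K. if X = {} then 1 else 0)" by (intro sum.cong) auto
  then show ?thesis
    using fdet_one_plus[OF K, of "\<lambda>i j. 0"] K by (simp add: trunc_det_def fdet2_def disc_green_def)
qed

text \<open>Cutting V off outside K m keeps |W| \<le> |V|, so the majorants of the full kernel serve
  all truncations, and the kernel determinant of a cut-off potential is the finite one.\<close>

lemma pert_det_tendsto:
  fixes V :: "int ^ ('n::finite) \<Rightarrow> real"
  assumes V: "(\<lambda>i. (V i)\<^sup>2) summable_on UNIV" and z: "cmod z < 1"
    and K: "\<And>m. finite (K m)" "\<And>i. eventually (\<lambda>m. i \<in> K m) sequentially"
  shows "(\<lambda>m. trunc_det V (K m) z) \<longlonglongrightarrow> pert_det V z"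
proof (cases "z = 0")
  case True
  then show ?thesis using K by (simp add: trunc_det_0 pert_det_def)
next
  case False
  note green = is_green_disc_green[OF z False, where 'n = 'n] and off = joukowski_off_spectrum[OF z False, where 'n = 'n]
  define g where "g = (\<lambda>i l. disc_green z (i - l :: int ^ 'n))"
  have "disc_green z \<in> (l2 :: 'n seq set)" using green by (simp add: is_green_def)
  from green_hs_kernel[OF this V, folded g_def]
  interpret hs_kernel V g "sqrt (sq_norm (disc_green z :: 'n seq))"
    "sqrt (\<Sum>\<^sub>\<infinity>i. (V i)\<^sup>2) * sqrt (sq_norm (disc_green z :: 'n seq))" .
  define W where "W = (\<lambda>m i. if i \<in> K m then V i else 0)"
  have W: "\<bar>W m i\<bar> \<le> \<bar>V i\<bar>" for m i by (simp add: W_def)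
  have lim: "(\<lambda>m. W m i) \<longlonglongrightarrow> V i" for i
    unfolding W_def by (rule tendsto_eventually, rule eventually_mono[OF K(2)[of i]]) simp
  have "kfred (W m) g = trunc_det V (K m) z" for m
  proof -
    have "kfred (W m) g = fdet (K m) (\<lambda>i j. (if i = j then 1 else 0) + of_real (W m i) * g i j)
        * exp (- (\<Sum>i\<in>K m. of_real (W m i) * g i i))"
      by (rule kfred_finite[OF W K(1)]) (simp add: W_def)
    also have "\<dots> = trunc_det V (K m) z"
      unfolding trunc_det_def fdet2_def
      by (intro arg_cong2[where f = times] arg_cong[where f = exp] fdet_cong arg_cong[where f = uminus] sum.cong)
         (auto simp: W_def g_def)
    finally show ?thesis .
  qed
  moreover have "pert_det V z = kfred V g"
    using False by (simp add: pert_det_def regularized_det_eq_kfred[OF off green V] g_def)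
  ultimately show ?thesis using kfred_tendsto[OF W lim] by simp
qed

section \<open>The perturbation determinant\<close>

lemma fdet2_restrict:
  assumes K: "finite K" "L \<subseteq> K" and zero: "\<And>i. i \<in> K \<Longrightarrow> i \<notin> L \<Longrightarrow> a i = 0"
  shows "fdet2 K a g = fdet2 L a g"
proof -
  have L: "finite L" using K finite_subset by blast
  have "(\<Sum>X\<in>Pow K. fdet X (\<lambda>i j. a i * g i j)) = (\<Sum>X\<in>Pow L. fdet X (\<lambda>i j. a i * g i j))"
  proof (rule sum.mono_neutral_right)
    show "\<forall>X\<in>Pow K - Pow L. fdet X (\<lambda>i j. a i * g i j) = 0"
    proof
      fix X assume X: "X \<in> Pow K - Pow L"
      then obtain i where "i \<in> X" "i \<notin> L" by blast
      then show "fdet X (\<lambda>i j. a i * g i j) = 0"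
        using X K zero by (intro fdet_zero_row[of X i]) (auto intro: finite_subset)
    qed
  qed (use K in auto)
  moreover have "(\<Sum>i\<in>K. a i * g i i) = (\<Sum>i\<in>L. a i * g i i)"
    using K zero by (intro sum.mono_neutral_right) auto
  ultimately show ?thesis by (simp add: fdet2_def fdet_one_plus K L)
qed

lemma fdet2_cong: "(\<And>i. i \<in> K \<Longrightarrow> a i = b i) \<Longrightarrow> fdet2 K a g = fdet2 K b g"
  unfolding fdet2_def by (intro arg_cong2[where f = times] fdet_cong arg_cong[where f = exp] arg_cong[where f = uminus] sum.cong) auto

text \<open>Conjugating by \<open>\<bar>a\<bar>\<^bsup>1/2\<^esup>\<close> symmetrizes the kernel; the trace terms cancel against the exponential.\<close>

lemma norm_fdet2_le:
  assumes K: "finite K" and le: "(\<Sum>i\<in>K. \<Sum>j\<in>K. cmod (a i) * cmod (a j) * (cmod (g i j))\<^sup>2) \<le> B"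
  shows "cmod (fdet2 K a g) \<le> exp (B / 2)"
proof -
  define L where "L = {i \<in> K. a i \<noteq> 0}"
  have L: "finite L" "L \<subseteq> K" using K by (auto simp: L_def)
  define v where "v = (\<lambda>i. sqrt (cmod (a i)))"
  have v: "v i > 0" if "i \<in> L" for i using that by (simp add: v_def L_def)
  have vv: "v i * v i = cmod (a i)" for i by (simp add: v_def)
  define Y where "Y = (\<lambda>i j. a i * g i j * of_real (v j) / of_real (v i))"
  define N where "N = (\<lambda>i j. (if i = j then 1 else 0) + Y i j)"
  have Yii: "Y i i = a i * g i i" if "i \<in> L" for i using v[OF that] by (simp add: Y_def)
  have "fdet L (\<lambda>i j. (if i = j then 1 else 0) + a i * g i j)
      = fdet L (\<lambda>i j. ((if i = j then 1 else 0) + a i * g i j) * of_real (v j) / of_real (v i))"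
    using v by (intro fdet_conj[symmetric] L) force
  also have "\<dots> = fdet L N"
  proof (rule fdet_cong)
    fix i j assume "i \<in> L" "j \<in> L"
    then show "((if i = j then 1 else 0) + a i * g i j) * of_real (v j) / of_real (v i) = N i j"
      using v[of i] v[of j] by (auto simp: N_def Y_def add_divide_distrib distrib_right)
  qed
  finally have "(cmod (fdet2 L a g))\<^sup>2 = (cmod (fdet L N))\<^sup>2 * (cmod (exp (- (\<Sum>i\<in>L. a i * g i i))))\<^sup>2"
    by (simp add: fdet2_def norm_mult power_mult_distrib)
  also have "\<dots> \<le> exp ((\<Sum>i\<in>L. \<Sum>j\<in>L. (cmod (N i j))\<^sup>2) - real (card L)) * (cmod (exp (- (\<Sum>i\<in>L. a i * g i i))))\<^sup>2"
    by (intro mult_right_mono norm_fdet_le_exp L) simp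
  also have "(\<Sum>i\<in>L. \<Sum>j\<in>L. (cmod (N i j))\<^sup>2)
      = real (card L) + 2 * (\<Sum>i\<in>L. Re (a i * g i i)) + (\<Sum>i\<in>L. \<Sum>j\<in>L. cmod (a i) * cmod (a j) * (cmod (g i j))\<^sup>2)"
  proof -
    have "(cmod (N i j))\<^sup>2 = (if i = j then 1 + 2 * Re (Y i i) else 0) + (cmod (Y i j))\<^sup>2" for i j
    proof -
      have "(cmod (1 + w))\<^sup>2 = 1 + 2 * Re w + (cmod w)\<^sup>2" for w
        unfolding cmod_power2 by (simp add: power2_eq_square algebra_simps)
      then show ?thesis by (simp add: N_def)
    qed
    moreover have "(cmod (Y i j))\<^sup>2 = cmod (a i) * cmod (a j) * (cmod (g i j))\<^sup>2" if "i \<in> L" for i j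
    proof -
      have p: "v i > 0" "v j \<ge> 0" using v[OF that] by (simp_all add: v_def)
      then have "(cmod (Y i j))\<^sup>2 = (cmod (a i) * cmod (g i j) * v j)\<^sup>2 / (v i * v i)"
        by (simp add: Y_def norm_mult norm_divide power_divide power2_eq_square)
      also have "\<dots> = (cmod (a i) * cmod (g i j))\<^sup>2 * (v j * v j) / (v i * v i)"
        by (simp add: power2_eq_square mult_ac)
      also have "\<dots> = cmod (a i) * cmod (a j) * (cmod (g i j))\<^sup>2"
        unfolding vv using that by (simp add: L_def power2_eq_square)
      finally show ?thesis .
    qed
    ultimately have "(\<Sum>i\<in>L. \<Sum>j\<in>L. (cmod (N i j))\<^sup>2)
        = (\<Sum>i\<in>L. \<Sum>j\<in>L. (if i = j then 1 + 2 * Re (Y i i) else 0) + cmod (a i) * cmod (a j) * (cmod (g i j))\<^sup>2)"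
      by (intro sum.cong) auto
    also have "\<dots> = (\<Sum>i\<in>L. 1 + 2 * Re (Y i i)) + (\<Sum>i\<in>L. \<Sum>j\<in>L. cmod (a i) * cmod (a j) * (cmod (g i j))\<^sup>2)"
      using L by (simp add: sum.distrib)
    also have "(\<Sum>i\<in>L. 1 + 2 * Re (Y i i)) = (\<Sum>i\<in>L. 1 + 2 * Re (a i * g i i))" by (intro sum.cong) (simp_all only: Yii)
    finally show ?thesis by (simp add: sum.distrib sum_distrib_left)
  qed
  also have "(cmod (exp (- (\<Sum>i\<in>L. a i * g i i))))\<^sup>2 = exp (- 2 * (\<Sum>i\<in>L. Re (a i * g i i)))"
    by (simp add: power2_eq_square exp_add[symmetric] sum_negf[symmetric])
  finally have "(cmod (fdet2 L a g))\<^sup>2 \<le> exp (\<Sum>i\<in>L. \<Sum>j\<in>L. cmod (a i) * cmod (a j) * (cmod (g i j))\<^sup>2)"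
    by (simp add: exp_add[symmetric])
  also have "(\<Sum>i\<in>L. \<Sum>j\<in>L. cmod (a i) * cmod (a j) * (cmod (g i j))\<^sup>2)
      \<le> (\<Sum>i\<in>K. \<Sum>j\<in>K. cmod (a i) * cmod (a j) * (cmod (g i j))\<^sup>2)"
    using K L by (intro order.trans[OF sum_mono[OF sum_mono2] sum_mono2]) (auto intro!: sum_nonneg)
  also have "\<dots> \<le> B" by (rule le)
  also have "exp B = (exp (B / 2))\<^sup>2" by (simp add: power2_eq_square exp_add[symmetric])
  finally have "cmod (fdet2 L a g) \<le> exp (B / 2)" by (rule power2_le_imp_le) auto
  moreover have "fdet2 K a g = fdet2 L a g" by (rule fdet2_restrict[OF K L(2)]) (simp add: L_def)
  ultimately show ?thesis by simp
qed

text \<open>Cauchy's estimate in the coupling constant \<open>\<zeta>\<close> of the potential on \<open>K - L\<close>.\<close>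

lemma fdet2_diff_le:
  fixes R :: real
  assumes K: "finite K" "L \<subseteq> K" and R: "R > 1"
    and le: "\<And>\<zeta>. cmod \<zeta> \<le> R \<Longrightarrow> cmod (fdet2 K (\<lambda>i. if i \<in> L then a i else \<zeta> * a i) g) \<le> C"
  shows "cmod (fdet2 K a g - fdet2 L a g) \<le> C / (R - 1)"
proof -
  define f where "f = (\<lambda>\<zeta>. fdet2 K (\<lambda>i. if i \<in> L then a i else \<zeta> * a i) g)"
  have hol: "f holomorphic_on S" for S
  proof -
    have "(\<lambda>\<zeta>. if i \<in> L then a i else \<zeta> * a i) holomorphic_on S" for i
      by (cases "i \<in> L") (auto intro!: holomorphic_intros)
    then show ?thesis unfolding f_def fdet2_def fdet_def by (intro holomorphic_intros)
  qed
  \<comment> \<open>A circle of radius R - 1 about a point of the unit disc stays inside |\<zeta>|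
    \<le> R.\<close>
  have d: "cmod (deriv f \<xi>) \<le> C / (R - 1)" if "cmod \<xi> \<le> 1" for \<xi>
  proof -
    have "cmod ((deriv ^^ 1) f \<xi>) \<le> fact 1 * C / (R - 1) ^ 1"
    proof (rule Cauchy_inequality)
      fix x assume "norm (\<xi> - x) = R - 1"
      then have "cmod x \<le> R" using that norm_triangle_ineq4[of \<xi> "\<xi> - x"] by simp
      then show "cmod (f x) \<le> C" unfolding f_def by (rule le)
    qed (use R hol in \<open>auto intro: holomorphic_on_imp_continuous_on\<close>)
    then show ?thesis by simp
  qed
  have "cmod (f 1 - f 0) \<le> C / (R - 1) * cmod (1 - 0)"
  proof (rule field_differentiable_bound[of "cball 0 1" f "deriv f"])
    show "(f has_field_derivative deriv f x) (at x within cball 0 1)" for x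
      by (rule has_field_derivative_at_within)
         (use holomorphic_derivI[OF hol[of UNIV]] in auto)
  qed (use d in auto)
  moreover have "f 1 = fdet2 K a g" unfolding f_def by (rule fdet2_cong) auto
  moreover have "f 0 = fdet2 L a g"
  proof -
    have "f 0 = fdet2 L (\<lambda>i. if i \<in> L then a i else 0 * a i) g" unfolding f_def by (rule fdet2_restrict[OF K]) auto
    also have "\<dots> = fdet2 L a g" by (rule fdet2_cong) auto
    finally show ?thesis .
  qed
  ultimately show ?thesis by simp
qed

text \<open>The Hilbert-Schmidt bounds come from the open half planes of the spectral parameter;
  continuity carries them over the real diameter.\<close>

lemma le_on_ball_if_le_nonreal:
  fixes f :: "complex \<Rightarrow> real"
  assumes f: "continuous_on (ball 0 1) f" and le: "\<And>z. cmod z < 1 \<Longrightarrow> Im z \<noteq> 0 \<Longrightarrow> f z \<le> c" and z: "cmod z < 1"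
  shows "f z \<le> c"
proof (cases "Im z = 0")
  case True
  define h where "h = (\<lambda>n. z + \<i> * of_real (1 / real (Suc n)))"
  have "(\<lambda>n. 1 / real (Suc n)) \<longlonglongrightarrow> 0" by real_asymp
  then have "(\<lambda>n. z + \<i> * of_real (1 / real (Suc n))) \<longlonglongrightarrow> z + \<i> * of_real 0" by (intro tendsto_intros)
  then have h: "h \<longlonglongrightarrow> z" by (simp add: h_def)
  have "isCont f z" using f z by (simp add: continuous_on_eq_continuous_at)
  then have "(\<lambda>n. f (h n)) \<longlonglongrightarrow> f z" using h by (rule isCont_tendsto_compose)
  moreover have "eventually (\<lambda>n. h n \<in> ball 0 1) sequentially"
    using h z by (intro topological_tendstoD) auto
  then have "eventually (\<lambda>n. f (h n) \<le> c) sequentially"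
    by eventually_elim (use True in \<open>auto intro!: le simp: h_def\<close>)
  ultimately show ?thesis by (rule tendsto_upperbound) simp
qed (use le z in blast)

section \<open>Truncation to cubes and uniform convergence in the disc\<close>

definition cube :: "nat \<Rightarrow> (int ^ ('n::finite)) set" where
  "cube m = vec_lambda ` (\<Pi>\<^sub>E i\<in>UNIV. {- int m..int m})"

lemma finite_cube: "finite (cube m)"
  unfolding cube_def by (intro finite_imageI finite_PiE) auto

lemma mem_cube_iff: "n \<in> cube m \<longleftrightarrow> (\<forall>i. \<bar>n $ i\<bar> \<le> int m)"
proof
  assume "\<forall>i. \<bar>n $ i\<bar> \<le> int m"
  then have "vec_nth n \<in> (\<Pi>\<^sub>E i\<in>UNIV. {- int m..int m})" by (force simp: abs_le_iff)
  then show "n \<in> cube m" unfolding cube_def by (metis imageI vec_nth_inverse)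
next
  assume "n \<in> cube m"
  then obtain x where "n = vec_lambda x" "x \<in> (\<Pi>\<^sub>E i\<in>UNIV. {- int m..int m})" by (auto simp: cube_def)
  then have "n $ i \<in> {- int m..int m}" for i using PiE_mem[of x UNIV "\<lambda>_. {- int m..int m}" i] by simp
  then show "\<forall>i. \<bar>n $ i\<bar> \<le> int m" by (simp add: abs_le_iff minus_le_iff)
qed

lemma cube_mono: "k \<le> m \<Longrightarrow> cube k \<subseteq> cube m"
  unfolding mem_cube_iff subset_iff by (meson of_nat_mono order.trans)

lemma eventually_mem_cube: "eventually (\<lambda>m. n \<in> cube m) sequentially"
proof -
  define M where "M = Max (range (\<lambda>i. nat \<bar>n $ i\<bar>))"
  have "nat \<bar>n $ i\<bar> \<le> M" for i unfolding M_def by (rule Max_ge) auto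
  then have "\<bar>n $ i\<bar> \<le> int M" for i by (simp add: nat_le_iff)
  then show ?thesis unfolding eventually_sequentially mem_cube_iff by (meson of_nat_mono order.trans)
qed

lemma eventually_subset_cube: "finite F \<Longrightarrow> eventually (\<lambda>m. F \<subseteq> cube m) sequentially"
  unfolding subset_eq by (simp add: eventually_ball_finite_distrib eventually_mem_cube)

locale potential =
  fixes V :: "int ^ ('n::finite) \<Rightarrow> real" and p :: real
  assumes adm: "admissible p CARD('n)" and V: "V \<in> lp p"
begin

definition S where "S = (\<Sum>\<^sub>\<infinity>n. \<bar>V n\<bar> powr p)"
definition nv where "nv = lp_norm p V"
definition M where "M = hs_const p CARD('n) * nv\<^sup>2 / 2"

lemma p: "1 \<le> p" "p < 2" using adm by (auto simp: admissible_def not_le numeral_3_eq_3 numeral_eq_Suc dest: le_neq_implies_less)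

lemma V_summable: "(\<lambda>n. \<bar>V n\<bar> powr p) summable_on UNIV" using V by (simp add: lp_def)

lemma S_nonneg: "S \<ge> 0" unfolding S_def by (intro infsum_nonneg) auto

lemma nv_nonneg: "nv \<ge> 0" by (simp add: nv_def lp_norm_def)

lemma nv_powr: "nv powr p = S"
  using p S_nonneg by (simp add: nv_def lp_norm_def S_def[symmetric] powr_powr)

lemma sum_powr_le: "finite F \<Longrightarrow> (\<Sum>n\<in>F. \<bar>V n\<bar> powr p) \<le> S"
  unfolding S_def using V_summable by (intro finite_sum_le_infsum) auto

lemma abs_V_le: "\<bar>V n\<bar> \<le> nv"
proof (rule ccontr)
  assume "\<not> \<bar>V n\<bar> \<le> nv"
  then have "nv powr p < \<bar>V n\<bar> powr p" using p nv_nonneg by (intro powr_less_mono2) auto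
  then show False using sum_powr_le[of "{n}"] nv_powr by simp
qed

lemma V_sq_le: "(V n)\<^sup>2 \<le> nv powr (2 - p) * \<bar>V n\<bar> powr p"
proof -
  have "(V n)\<^sup>2 = \<bar>V n\<bar> powr (2 - p) * \<bar>V n\<bar> powr p"
    by (cases "V n = 0") (simp_all add: powr_add[symmetric])
  also have "\<dots> \<le> nv powr (2 - p) * \<bar>V n\<bar> powr p"
    using p abs_V_le by (intro mult_right_mono powr_mono2) auto
  finally show ?thesis .
qed

lemma V_sq_summable: "(\<lambda>n. (V n)\<^sup>2) summable_on UNIV"
  by (rule summable_on_comparison_test[OF summable_on_cmult_right[OF V_summable, of "nv powr (2 - p)"]])
     (use V_sq_le in auto)

definition Q where "Q = (\<Sum>\<^sub>\<infinity>n. (V n)\<^sup>2)"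

lemma Q_nonneg: "Q \<ge> 0" unfolding Q_def by (intro infsum_nonneg) auto

text \<open>The embedding of l^p into l^2 with constant 1, by interpolation with the sup norm. It is
  what exchanges half of Tr V^2 for the norm of V in the last inequality.\<close>

lemma Q_le: "Q \<le> nv\<^sup>2"
proof -
  have "Q \<le> (\<Sum>\<^sub>\<infinity>n. nv powr (2 - p) * \<bar>V n\<bar> powr p)"
    unfolding Q_def by (rule infsum_mono[OF V_sq_summable summable_on_cmult_right[OF V_summable]]) (rule V_sq_le)
  also have "\<dots> = nv powr (2 - p) * nv powr p" by (simp only: infsum_cmult_right' S_def[symmetric] nv_powr)
  also have "\<dots> = nv\<^sup>2" using nv_nonneg by (cases "nv = 0") (simp_all add: powr_add[symmetric])
  finally show ?thesis .
qed

abbreviation "tdet m \<equiv> trunc_det V (cube m)"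
abbreviation "D \<equiv> pert_det V"

lemma tdet_tendsto: "cmod z < 1 \<Longrightarrow> (\<lambda>m. tdet m z) \<longlonglongrightarrow> D z"
  by (rule pert_det_tendsto[OF V_sq_summable _ finite_cube eventually_mem_cube])

lemma tdet_holomorphic: "tdet m holomorphic_on ball 0 1"
  unfolding trunc_det_def fdet2_def fdet_def
  by (intro holomorphic_intros holomorphic_disc_green)

lemma fdet2_hs_le:
  assumes z: "cmod z < 1" "Im z \<noteq> 0" and K: "finite K" and \<alpha>: "\<alpha> > 0" "(\<Sum>i\<in>K. cmod (a i) powr p) \<le> \<alpha> powr p"
  shows "cmod (fdet2 K a (\<lambda>i j. disc_green z (i - j :: int ^ 'n))) \<le> exp (hs_const p CARD('n) * \<alpha>\<^sup>2 / 2)"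
  using disc_green_hs_bound[OF adm z, of "\<lambda>i. cmod (a i)" "\<lambda>i. cmod (a i)" K K \<alpha> \<alpha>] K \<alpha>
  by (intro norm_fdet2_le) (auto simp: power2_eq_square mult.assoc)

lemma tdet_le_nonreal:
  assumes z: "cmod z < 1" "Im z \<noteq> 0"
  shows "cmod (tdet m z) \<le> exp M"
proof (cases "nv = 0")
  case True
  then have "V i = 0" for i using abs_V_le[of i] by simp
  then show ?thesis unfolding trunc_det_def M_def using True by (intro norm_fdet2_le finite_cube) simp
next
  case False
  then show ?thesis unfolding trunc_det_def M_def
    using nv_nonneg sum_powr_le[OF finite_cube] by (intro fdet2_hs_le z finite_cube) (auto simp: nv_powr)
qed

text \<open>Beyond a large cube V is so small in l^p that it can be multiplied by any \<zeta> with
  |\<zeta>| \<le> R while the p-th power sum stays below S + 1. The determinant is then at most C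
  for all these couplings, uniformly in z, and Cauchy's estimate gives C / (R - 1) = e.\<close>

lemma tdet_uniformly_Cauchy:
  assumes e: "e > 0"
  shows "\<exists>M. \<forall>m\<ge>M. \<forall>l\<ge>m. \<forall>z. cmod z < 1 \<longrightarrow> cmod (tdet l z - tdet m z) \<le> e"
proof -
  define \<alpha> where "\<alpha> = (S + 1) powr (1 / p)"
  have \<alpha>: "\<alpha> > 0" "\<alpha> powr p = S + 1" using S_nonneg p by (simp_all add: \<alpha>_def powr_powr)
  define C where "C = exp (hs_const p CARD('n) * \<alpha>\<^sup>2 / 2)"
  define R where "R = 1 + C / e"
  have C: "C > 0" by (simp add: C_def)
  then have R: "R > 1" "C / (R - 1) = e" using e by (simp_all add: R_def)
  have "((\<lambda>n. \<bar>V n\<bar> powr p) has_sum S) UNIV" using V_summable by (simp add: S_def)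
  moreover have "(1 / R) powr p > 0" using R by simp
  ultimately obtain F0 where F0: "finite F0" "dist (\<Sum>n\<in>F0. \<bar>V n\<bar> powr p) S \<le> (1 / R) powr p"
    using has_sum_finite_approximation by blast
  obtain M where M: "\<And>m. m \<ge> M \<Longrightarrow> F0 \<subseteq> cube m"
    using eventually_subset_cube[OF F0(1)] unfolding eventually_sequentially by blast
  have nonreal: "cmod (tdet l z - tdet m z) \<le> e" if ml: "M \<le> m" "m \<le> l" and z: "cmod z < 1" "Im z \<noteq> 0" for m l z
  proof -
    have tail: "(\<Sum>i\<in>cube l - cube m. \<bar>V i\<bar> powr p) \<le> (1 / R) powr p"
    proof -
      have "(\<Sum>i\<in>F0. \<bar>V i\<bar> powr p) + (\<Sum>i\<in>cube l - cube m. \<bar>V i\<bar> powr p) = (\<Sum>i\<in>F0 \<union> (cube l - cube m). \<bar>V i\<bar> powr p)"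
        using F0 M[OF ml(1)] finite_cube by (intro sum.union_disjoint[symmetric]) auto
      also have "\<dots> \<le> S" using F0 finite_cube by (intro sum_powr_le) auto
      finally show ?thesis using F0(2) by (simp add: dist_real_def)
    qed
    have "cmod (fdet2 (cube l) (\<lambda>i. if i \<in> cube m then of_real (V i) else \<zeta> * of_real (V i)) (\<lambda>i j. disc_green z (i - j :: int ^ 'n))) \<le> C"
      if \<zeta>: "cmod \<zeta> \<le> R" for \<zeta>
      unfolding C_def
    proof (rule fdet2_hs_le[OF z finite_cube \<alpha>(1)])
      let ?a = "\<lambda>i. if i \<in> cube m then of_real (V i) else \<zeta> * of_real (V i)"
      have "(\<Sum>i\<in>cube l. cmod (?a i) powr p) = (\<Sum>i\<in>cube l - cube m. cmod (?a i) powr p) + (\<Sum>i\<in>cube m. cmod (?a i) powr p)"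
        by (rule sum.subset_diff[OF cube_mono[OF ml(2)] finite_cube])
      also have "(\<Sum>i\<in>cube m. cmod (?a i) powr p) = (\<Sum>i\<in>cube m. \<bar>V i\<bar> powr p)" by (intro sum.cong) auto
      also have "\<dots> \<le> S" by (rule sum_powr_le[OF finite_cube])
      also have "(\<Sum>i\<in>cube l - cube m. cmod (?a i) powr p) \<le> (\<Sum>i\<in>cube l - cube m. R powr p * \<bar>V i\<bar> powr p)"
      proof (rule sum_mono)
        fix i :: "int ^ 'n" assume "i \<in> cube l - cube m"
        then have "cmod (?a i) powr p = (cmod \<zeta> * \<bar>V i\<bar>) powr p" by (simp add: norm_mult)
        also have "\<dots> \<le> (R * \<bar>V i\<bar>) powr p" using p \<zeta> R by (intro powr_mono2 mult_right_mono) auto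
        also have "\<dots> = R powr p * \<bar>V i\<bar> powr p" using R by (intro powr_mult)
        finally show "cmod (?a i) powr p \<le> R powr p * \<bar>V i\<bar> powr p" .
      qed
      also have "\<dots> \<le> R powr p * (1 / R) powr p"
        unfolding sum_distrib_left[symmetric] by (intro mult_left_mono tail) simp
      also have "\<dots> = 1" using R by (simp add: powr_mult[symmetric])
      finally show "(\<Sum>i\<in>cube l. cmod (?a i) powr p) \<le> \<alpha> powr p" by (simp add: \<alpha>)
    qed
    from fdet2_diff_le[OF finite_cube cube_mono[OF ml(2)] R(1) this] show ?thesis
      unfolding trunc_det_def R(2) .
  qed
  show ?thesis
  proof (intro exI allI impI)
    fix m l and z :: complex assume "M \<le> m" "m \<le> l" and z: "cmod z < 1"
    then show "cmod (tdet l z - tdet m z) \<le> e"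
      by (intro le_on_ball_if_le_nonreal[OF _ nonreal z] continuous_intros
          holomorphic_on_imp_continuous_on tdet_holomorphic)
  qed
qed

lemma tdet_uniform:
  assumes "e > 0"
  shows "\<exists>M. \<forall>m\<ge>M. \<forall>z. cmod z < 1 \<longrightarrow> cmod (D z - tdet m z) \<le> e"
proof -
  obtain M where M: "\<And>m l z. m \<ge> M \<Longrightarrow> l \<ge> m \<Longrightarrow> cmod z < 1 \<Longrightarrow> cmod (tdet l z - tdet m z) \<le> e"
    using tdet_uniformly_Cauchy[OF assms] by blast
  have "cmod (D z - tdet m z) \<le> e" if "m \<ge> M" "cmod z < 1" for m z
  proof (rule Lim_bounded)
    show "(\<lambda>l. cmod (tdet l z - tdet m z)) \<longlonglongrightarrow> cmod (D z - tdet m z)"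
      by (intro tendsto_intros tdet_tendsto that)
  qed (use M that in auto)
  then show ?thesis by blast
qed

lemma uniform_limit_tdet: "uniform_limit (ball 0 1) tdet D sequentially"
proof (rule uniform_limitI)
  fix e :: real assume "e > 0"
  then obtain M where "\<forall>m\<ge>M. \<forall>z. cmod z < 1 \<longrightarrow> cmod (D z - tdet m z) \<le> e / 2"
    using tdet_uniform[of "e / 2"] by auto
  then show "\<forall>\<^sub>F m in sequentially. \<forall>z\<in>ball 0 1. dist (tdet m z) (D z) < e"
    unfolding eventually_sequentially using \<open>e > 0\<close>
    by (intro exI[of _ M]) (force simp: dist_norm norm_minus_commute)
qed

lemma D_holomorphic: "D holomorphic_on ball 0 1"
proof (rule holomorphic_uniform_sequence[OF open_ball tdet_holomorphic])
  fix x :: complex assume "x \<in> ball 0 1"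
  then obtain r where "r > 0" "cball x r \<subseteq> ball 0 1" using open_contains_cball[of "ball 0 1"] open_ball by blast
  then show "\<exists>d>0. cball x d \<subseteq> ball 0 1 \<and> uniform_limit (cball x d) tdet D sequentially"
    using uniform_limit_on_subset[OF uniform_limit_tdet] by blast
qed

lemma norm_D_le: "cmod z < 1 \<Longrightarrow> cmod (D z) \<le> exp M"
proof -
  assume z: "cmod z < 1"
  have "cmod (tdet m z) \<le> exp M" for m
    by (rule le_on_ball_if_le_nonreal[OF _ tdet_le_nonreal z])
       (intro continuous_intros holomorphic_on_imp_continuous_on tdet_holomorphic)
  then show ?thesis by (intro Lim_bounded[OF tendsto_norm[OF tdet_tendsto[OF z]]]) auto
qed

text \<open>The squared Hilbert-Schmidt norm is at most Tr V^2 times the squared l2 norm of Green's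
  function, which is of order |z|^2. This second-order information at the origin is not contained in
  \<open>norm_D_le\<close>.\<close>

lemma norm_D_le_near_0:
  assumes z: "cmod z < 1"
  shows "cmod (D z) \<le> exp (Q * sq_norm (disc_green z :: 'n seq) / 2)"
proof (cases "z = 0")
  case True
  then show ?thesis by (simp add: pert_det_def disc_green_def sq_norm_def)
next
  case False
  have "disc_green z \<in> (l2 :: 'n seq set)" using is_green_disc_green[OF z False, where 'n = 'n] by (simp add: is_green_def)
  from green_hs_kernel[OF this V_sq_summable, folded Q_def]
  interpret hs_kernel V "\<lambda>i l. disc_green z (i - l)" "sqrt (sq_norm (disc_green z :: 'n seq))"
    "sqrt Q * sqrt (sq_norm (disc_green z :: 'n seq))" .
  have "cmod (tdet m z) \<le> exp (Q * sq_norm (disc_green z :: 'n seq) / 2)" for m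
    unfolding trunc_det_def using hs[OF finite_cube finite_cube, of m m] Q_nonneg sq_norm_nonneg[of "disc_green z :: 'n seq"]
    by (intro norm_fdet2_le finite_cube) (simp add: power_mult_distrib)
  then show ?thesis by (intro Lim_bounded[OF tendsto_norm[OF tdet_tendsto[OF z]]]) auto
qed

end

section \<open>Reality of the zeros\<close>

lemma trunc_det_zero_real:
  fixes V :: "int ^ ('n::finite) \<Rightarrow> real"
  assumes K: "finite K" and z: "cmod z < 1" "Im z \<noteq> 0"
  shows "trunc_det V K z \<noteq> 0"
proof
  assume 0: "trunc_det V K z = 0"
  have z0: "z \<noteq> 0" using z by auto
  note G = is_green_disc_green[OF z(1) z0, where 'n = 'n]
  let ?G = "disc_green z :: 'n seq"
  define lam where "lam = joukowski CARD('n) z"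
  have G2: "?G \<in> l2" using G by (simp add: is_green_def)
  have kernel: "fdet K (\<lambda>i j. (if i = j then 1 else 0) + of_real (V i) * ?G (i - j)) = 0"
    using 0 by (simp add: trunc_det_def fdet2_def)
  obtain x where x: "\<exists>i\<in>K. x i \<noteq> 0"
    "\<And>i. i \<in> K \<Longrightarrow> (\<Sum>j\<in>K. ((if i = j then 1 else 0) + of_real (V i) * ?G (i - j)) * x j) = 0"
  proof (rule fdet_eq_0_imp_kernel[OF K kernel])
    fix y assume "\<exists>i\<in>K. y i \<noteq> 0"
      "\<And>i. i \<in> K \<Longrightarrow> (\<Sum>j\<in>K. ((if i = j then 1 else 0) + of_real (V i) * ?G (i - j)) * y j) = 0"
    then show thesis by (rule that)
  qed
  \<comment> \<open>The kernel vector extended by 0 satisfies f = - W u, where u is the convolution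
    of Green's function with f and W is V cut off to K. So u is an l2 eigenfunction of the Laplacian
    plus W at the nonreal \<open>lam\<close>, which forces u = 0 and then f = 0.\<close>
  define f where "f = (\<lambda>m. if m \<in> K then x m else 0)"
  have s: "(\<lambda>m. cmod (f m)) summable_on UNIV"
    by (rule summable_on_cong_neutral[THEN iffD1, OF _ _ _ summable_on_finite[OF K]]) (auto simp: f_def)
  define u where "u = lconv ?G f"
  have u2: "u \<in> l2" unfolding u_def by (rule l2_lconv[OF G2 s])
  have u: "laplacian u n - lam * u n = f n" for n
  proof -
    have "laplacian u n - lam * u n = (\<Sum>\<^sub>\<infinity>m. laplacian ?G (n - m) * f m) - (\<Sum>\<^sub>\<infinity>m. lam * (?G (n - m) * f m))"
      unfolding u_def laplacian_lconv[OF G2 s] by (simp add: lconv_def infsum_cmult_right')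
    also have "\<dots> = (\<Sum>\<^sub>\<infinity>m. laplacian ?G (n - m) * f m - lam * (?G (n - m) * f m))"
      by (intro infsum_diff[symmetric] summable_on_cmult_right lconv_summable(2) G2 s l2_laplacian)
    also have "\<dots> = (\<Sum>\<^sub>\<infinity>m\<in>{n}. f m)"
    proof (rule infsum_cong_neutral)
      fix m assume "m \<in> UNIV - {n}"
      then show "laplacian ?G (n - m) * f m - lam * (?G (n - m) * f m) = 0"
        using G by (simp add: is_green_def lam_def algebra_simps)
    next
      fix m assume "m \<in> UNIV \<inter> {n}"
      then show "laplacian ?G (n - m) * f m - lam * (?G (n - m) * f m) = f m"
        using G by (simp add: is_green_def lam_def algebra_simps)
    qed simp
    finally show ?thesis by simp
  qed
  have fu: "f i = - of_real (V i) * u i" if "i \<in> K" for i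
  proof -
    have "u i = (\<Sum>\<^sub>\<infinity>m\<in>K. ?G (i - m) * x m)"
      unfolding u_def lconv_def by (rule infsum_cong_neutral) (auto simp: f_def)
    then have "u i = (\<Sum>m\<in>K. ?G (i - m) * x m)" using K by simp
    moreover have "(\<Sum>j\<in>K. ((if i = j then 1 else 0) + of_real (V i) * ?G (i - j)) * x j)
        = (\<Sum>j\<in>K. if i = j then x j else 0) + of_real (V i) * (\<Sum>m\<in>K. ?G (i - m) * x m)"
      unfolding sum_distrib_left sum.distrib[symmetric] by (rule sum.cong) (auto simp: algebra_simps)
    ultimately show ?thesis using x(2)[OF that] that K by (simp add: f_def add_eq_0_iff)
  qed
  define W where "W = (\<lambda>n. if n \<in> K then V n else 0)"
  have "Im lam * sq_norm u = 0"
  proof (rule perturbed_eigenvalue_real[OF u2 K, of W])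
    show "laplacian u n + of_real (W n) * u n = lam * u n" for n
      using u[of n] fu[of n] by (cases "n \<in> K") (auto simp: W_def f_def algebra_simps)
  qed (simp add: W_def)
  moreover have "Im lam \<noteq> 0" using Im_joukowski_sign(3)[OF z(1) z0, of "CARD('n)"] z(2) by (simp add: lam_def)
  ultimately have "sq_norm u = 0" by simp
  then have "u n = 0" for n using sq_norm_eq_0[OF u2] by (simp add: fun_eq_iff)
  then have "f i = 0" if "i \<in> K" for i using fu[OF that] by simp
  then show False using x(1) by (auto simp: f_def)
qed

context potential
begin

lemma D_0: "D 0 = 1"
  by (simp add: pert_det_def)

text \<open>Hurwitz in the open half disc containing z, where the truncations have no zeros. D is
  not constant there: otherwise it would vanish throughout the disc, against D 0 = 1.\<close>

lemma D_zero_real: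
  assumes z: "cmod z < 1" "D z = 0"
  shows "Im z = 0"
proof (rule ccontr)
  assume im: "Im z \<noteq> 0"
  define P where "P = {w \<in> ball 0 1. Im w * Im z > 0}"
  have P: "P = ball 0 1 \<inter> {w. Im z * Im w > 0}" by (auto simp: P_def mult.commute)
  have op: "open P" unfolding P by (intro open_Int open_ball open_Collect_less continuous_intros)
  have "convex {w. Im z * Im w > 0}"
    using convex_halfspace_gt[of 0 "Complex 0 (Im z)"] by (simp add: inner_complex_def)
  then have conn: "connected P" unfolding P by (intro convex_connected convex_Int convex_ball)
  have sub: "P \<subseteq> ball 0 1" by (auto simp: P_def)
  have zP: "z \<in> P" using z im by (auto simp: P_def zero_less_mult_iff)
  have "\<not> D constant_on P"
  proof
    assume "D constant_on P"
    then have "D w = 0" if "w \<in> P" for w using zP z(2) that by (auto simp: constant_on_def)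
    moreover have "z islimpt P" using op zP by (simp add: interior_limit_point interior_open)
    ultimately have "D 0 = 0"
      using analytic_continuation[OF D_holomorphic open_ball connected_ball sub, of z 0] z by simp
    then show False by (simp add: D_0)
  qed
  moreover have "uniform_limit C tdet D sequentially" if "C \<subseteq> P" for C
    using uniform_limit_on_subset[OF uniform_limit_tdet] that sub by (meson order.trans)
  moreover have "tdet m w \<noteq> 0" if "w \<in> P" for m w
    by (rule trunc_det_zero_real[OF finite_cube]) (use that in \<open>auto simp: P_def\<close>)
  ultimately have "D z \<noteq> 0"
    using zP by (intro Hurwitz_no_zeros[OF op conn, of tdet D])
      (auto intro!: holomorphic_on_subset[OF tdet_holomorphic] holomorphic_on_subset[OF D_holomorphic] simp: P_def)
  then show False using z by simp
qed

end

section \<open>Boundary values\<close>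

lemma uniformly_continuous_on_subset:
  fixes f :: "'a :: metric_space \<Rightarrow> 'b :: metric_space"
  shows "uniformly_continuous_on T f \<Longrightarrow> S \<subseteq> T \<Longrightarrow> uniformly_continuous_on S f"
  unfolding uniformly_continuous_on_def by (meson subsetD)

text \<open>Hoelder continuity of \<open>upper_green\<close> gives uniform continuity near w, hence
  an extension to the closure; |z| > 1/2 keeps the Joukowski map uniformly continuous.\<close>

lemma disc_green_boundary_limit_lower:
  fixes n :: "int ^ ('n::finite)"
  assumes d: "3 \<le> CARD('n)" and w: "cmod w = 1" "Im w < 0"
  shows "\<exists>L. ((\<lambda>z. disc_green z n) \<longlongrightarrow> L) (at w within ball 0 1)"
proof -
  define U where "U = {z :: complex. Im z < 0 \<and> cmod z > 1 / 2}"
  define X where "X = U \<inter> ball 0 1"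
  have U: "open U" unfolding U_def by (intro open_Collect_conj open_Collect_less continuous_intros)
  have wU: "w \<in> U" using w by (simp add: U_def)
  have "w \<in> closure X"
    using open_Int_closure_subset[OF U, of "ball 0 1"] wU w by (auto simp: X_def closure_ball)
  moreover have "uniformly_continuous_on X (\<lambda>z. disc_green z n)"
  proof -
    have 1: "uniformly_continuous_on X (joukowski CARD('n))"
    proof (rule uniformly_continuous_on_subset)
      show "X \<subseteq> cball 0 1 - ball 0 (1 / 2)" by (auto simp: X_def U_def)
      show "uniformly_continuous_on (cball 0 1 - ball 0 (1 / 2)) (joukowski CARD('n))"
        unfolding joukowski_def
        by (intro compact_uniformly_continuous continuous_intros compact_diff) auto
    qed
    have 2: "uniformly_continuous_on {lam. Im lam > 0} (\<lambda>lam. upper_green lam n)"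
      unfolding uniformly_continuous_on_def
    proof (intro allI impI)
      fix e :: real assume e: "e > 0"
      show "\<exists>d>0. \<forall>x\<in>{lam. 0 < Im lam}. \<forall>x'\<in>{lam. 0 < Im lam}. dist x' x < d \<longrightarrow> dist (upper_green x' n) (upper_green x n) < e"
      proof (intro exI[of _ "(e / 18) ^ 3"] conjI ballI impI)
        fix x x' assume x: "x \<in> {lam. 0 < Im lam}" "x' \<in> {lam. 0 < Im lam}" and "dist x' x < (e / 18) ^ 3"
        then have "cmod (x' - x) powr (1 / 3) < ((e / 18) ^ 3) powr (1 / 3)"
          by (intro powr_less_mono2) (auto simp: dist_norm)
        also have "((e / 18) ^ 3) powr (1 / 3) = e / 18"
        proof -
          have "(e / 18) ^ 3 = (e / 18) powr 3" using e by simp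
          then show ?thesis using e by (simp only: powr_powr) simp
        qed
        finally show "dist (upper_green x' n) (upper_green x n) < e"
          using upper_green_holder[of x' x n] x d by (simp add: dist_norm)
      qed (use e in auto)
    qed
    have "uniformly_continuous_on X (\<lambda>z. upper_green (joukowski CARD('n) z) n)"
    proof (rule uniformly_continuous_on_compose[OF 1, unfolded o_def])
      show "uniformly_continuous_on (joukowski CARD('n) ` X) (\<lambda>lam. upper_green lam n)"
        by (rule uniformly_continuous_on_subset[OF 2])
           (auto simp: X_def U_def intro!: disc_green_upper(2)[where 'n = 'n])
    qed
    moreover have "disc_green z n = upper_green (joukowski CARD('n) z) n" if "z \<in> X" for z
      using disc_green_upper(1)[where 'n = 'n, of z] that by (simp add: X_def U_def)
    ultimately show ?thesis by (simp add: uniformly_continuous_on_def)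
  qed
  ultimately obtain L where "((\<lambda>z. disc_green z n) \<longlongrightarrow> L) (at w within X)"
    using uniformly_continuous_on_extension_at_closure by blast
  moreover have "at w within X = at w within ball 0 1"
    by (rule at_within_nhd[OF wU U]) (auto simp: X_def)
  ultimately show ?thesis by auto
qed

lemma disc_green_boundary_limit:
  fixes n :: "int ^ ('n::finite)"
  assumes d: "3 \<le> CARD('n)" and w: "cmod w = 1" "Im w \<noteq> 0"
  shows "\<exists>L. ((\<lambda>z. disc_green z n) \<longlongrightarrow> L) (at w within ball 0 1)"
proof (cases "Im w < 0")
  case False
  then have "cmod (cnj w) = 1" "Im (cnj w) < 0" using w by auto
  from disc_green_boundary_limit_lower[OF d this]
  obtain L where L: "((\<lambda>z. disc_green z n) \<longlongrightarrow> L) (at (cnj w) within ball 0 1)" by (rule exE)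
  have fl: "filterlim cnj (at (cnj w) within ball 0 1) (at w within ball 0 1)"
  proof -
    have "((\<lambda>z. cnj z) \<longlongrightarrow> cnj w) (at w within ball 0 1)" by (intro tendsto_intros)
    moreover have "\<forall>\<^sub>F z in at w within ball 0 1. cnj z \<in> ball 0 1 \<and> cnj z \<noteq> cnj w"
      unfolding eventually_at_filter by (rule always_eventually) simp
    ultimately show ?thesis unfolding filterlim_at by blast
  qed
  have "((\<lambda>z. cnj (disc_green (cnj z) n)) \<longlongrightarrow> cnj L) (at w within ball 0 1)"
    by (rule tendsto_cnj[OF filterlim_compose[OF L fl]])
  moreover have "\<forall>\<^sub>F z in at w within ball 0 1. cnj (disc_green (cnj z) n) = disc_green z n"
    unfolding eventually_at_filter by (rule always_eventually) (simp add: disc_green_cnj[where 'n = 'n])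
  ultimately have "((\<lambda>z. disc_green z n) \<longlongrightarrow> cnj L) (at w within ball 0 1)"
    by (rule Lim_transform_eventually)
  then show ?thesis by (rule exI)
next
  case True
  then show ?thesis by (rule disc_green_boundary_limit_lower[OF d w(1)])
qed

context potential
begin

text \<open>A \<open>Lim\<close> can be estimated only once the limit exists. Each truncation has a
  limit because Green's function has one, and uniform convergence in the disc allows the two limits
  to be exchanged.\<close>

lemma norm_boundary_value_le:
  assumes w: "cmod w = 1" "Im w \<noteq> 0"
  shows "cmod (boundary_value D w) \<le> exp M"
proof -
  let ?F = "at w within ball 0 1"
  have nt: "\<not> trivial_limit ?F"
    using w by (auto simp: trivial_limit_within islimpt_ball)
  have d: "3 \<le> CARD('n)" using adm by (simp add: admissible_def)
  have "\<forall>n :: int ^ 'n. \<exists>L. ((\<lambda>z. disc_green z n) \<longlongrightarrow> L) ?F"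
    by (intro allI disc_green_boundary_limit d w)
  then obtain L where L: "\<And>n :: int ^ 'n. ((\<lambda>z. disc_green z n) \<longlongrightarrow> L n) ?F"
    unfolding choice_iff by blast
  define g where "g = (\<lambda>m. fdet2 (cube m) (\<lambda>i. of_real (V i)) (\<lambda>i j. L (i - j)))"
  have g: "(tdet m \<longlongrightarrow> g m) ?F" for m
    unfolding trunc_det_def g_def fdet2_def fdet_def by (intro tendsto_intros L)
  have ball: "\<forall>\<^sub>F z in ?F. cmod z < 1" by (simp add: eventually_at_filter)
  have "Cauchy g"
    unfolding Cauchy_altdef
  proof (intro allI impI)
    fix e :: real assume "e > 0"
    then obtain m0 where m0: "\<And>m l z. m \<ge> m0 \<Longrightarrow> l \<ge> m \<Longrightarrow> cmod z < 1 \<Longrightarrow> cmod (tdet l z - tdet m z) \<le> e / 2"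
      using tdet_uniformly_Cauchy[of "e / 2"] by auto
    have "cmod (g l - g m) \<le> e / 2" if "m \<ge> m0" "l \<ge> m" for m l
    proof (rule tendsto_upperbound[OF _ _ nt])
      show "((\<lambda>z. cmod (tdet l z - tdet m z)) \<longlongrightarrow> cmod (g l - g m)) ?F" by (intro tendsto_intros g)
      show "\<forall>\<^sub>F z in ?F. cmod (tdet l z - tdet m z) \<le> e / 2" using ball by eventually_elim (rule m0[OF that])
    qed
    then have "dist (g m) (g l) < e" if "m \<ge> m0" "l > m" for m l
      unfolding dist_norm norm_minus_commute[of "g m"]
      using that \<open>e > 0\<close> by (intro order.strict_trans1[of "cmod (g l - g m)" "e / 2" e]) auto
    then show "\<exists>m0. \<forall>m\<ge>m0. \<forall>l>m. dist (g m) (g l) < e" by blast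
  qed
  then obtain l where "g \<longlonglongrightarrow> l" using Cauchy_convergent_iff convergent_def by blast
  then have D: "(D \<longlongrightarrow> l) ?F"
    by (intro swap_uniform_limit[OF _ _ uniform_limit_tdet]) (use g in auto)
  have "cmod l \<le> exp M"
    by (rule tendsto_upperbound[OF tendsto_norm[OF D] _ nt]) (use ball in eventually_elim, rule norm_D_le)
  moreover have "boundary_value D w = l"
    unfolding boundary_value_def by (rule tendsto_Lim[OF nt D])
  ultimately show ?thesis by simp
qed

end

section \<open>Blaschke products\<close>

text \<open>Beyond the finitely many zero factors that convergence permits, 1 - |b| \<le> - ln |b|
  compares with a summable series of logarithms.\<close>

lemma convergent_prod_norm_le_1_imp_summable:
  fixes b :: "nat \<Rightarrow> complex"
  assumes b: "convergent_prod b" and le: "\<And>n. cmod (b n) \<le> 1"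
  shows "summable (\<lambda>n. 1 - cmod (b n))"
proof -
  obtain m q where "raw_has_prod b m q" using b by (auto simp: convergent_prod_def)
  then have r: "raw_has_prod (\<lambda>n. cmod (b n)) m (cmod q)" by (rule raw_has_prod_norm)
  then have nz: "cmod (b (n + m)) > 0" for n
    using raw_has_prod_imp_nonzero[OF r, of "n + m"] by simp
  have "raw_has_prod (\<lambda>n. cmod (b (n + m))) 0 (cmod q)" using r by (simp add: raw_has_prod_def)
  then have "convergent_prod (\<lambda>n. cmod (b (n + m)))" by (auto simp: convergent_prod_def)
  then have s: "summable (\<lambda>n. ln (cmod (b (n + m))))" using nz by (rule summable_ln_real)
  have "summable (\<lambda>n. 1 - cmod (b (n + m)))"
  proof (rule summable_comparison_test')
    show "summable (\<lambda>n. - ln (cmod (b (n + m))))" using s by (rule summable_minus)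
    show "norm (1 - cmod (b (n + m))) \<le> - ln (cmod (b (n + m)))" for n
      using ln_le_minus_one[OF nz[of n]] le[of "n + m"] by simp
  qed
  then show ?thesis by (simp add: summable_iff_shift[of "\<lambda>n. 1 - cmod (b n)"])
qed

definition bfactor :: "real \<Rightarrow> complex \<Rightarrow> complex" where
  "bfactor x w = of_real (sgn x) * ((of_real x - w) / (1 - of_real x * w))"

lemma bfactor_1: "cmod w < 1 \<Longrightarrow> bfactor 1 w = 1"
  by (cases "w = 1") (simp_all add: bfactor_def)

lemma bfactor_0: "bfactor x 0 = of_real \<bar>x\<bar>"
  by (simp add: bfactor_def sgn_mult_self_eq abs_sgn mult.commute flip: of_real_mult)

context
  fixes x :: real assumes x: "0 < \<bar>x\<bar>" "\<bar>x\<bar> \<le> 1"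
begin

lemma bfactor_denom: "cmod w < 1 \<Longrightarrow> cmod (1 - of_real x * w) \<ge> 1 - cmod w" "cmod w < 1 \<Longrightarrow> 1 - of_real x * w \<noteq> 0"
proof -
  assume w: "cmod w < 1"
  have "cmod (of_real x * w) \<le> cmod w" using x w by (simp add: norm_mult mult_left_le_one_le)
  then show 1: "cmod (1 - of_real x * w) \<ge> 1 - cmod w"
    using norm_triangle_ineq2[of 1 "of_real x * w"] by simp
  then show "1 - of_real x * w \<noteq> 0" using w by auto
qed

text \<open>The difference is - (1 - |x|) (1 + sgn x w) / (1 - x w), so a factor is as close to 1 as
  |x| is.\<close>

lemma bfactor_minus_1:
  assumes w: "cmod w < 1"
  shows "cmod (bfactor x w - 1) \<le> (1 - \<bar>x\<bar>) * (2 / (1 - cmod w))"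
proof -
  have s: "x = sgn x * \<bar>x\<bar>" "sgn x * sgn x = 1" "\<bar>sgn x\<bar> = 1" using x by (auto simp: sgn_mult_abs sgn_if)
  have "bfactor x w - 1 = (of_real (sgn x) * (of_real x - w) - (1 - of_real x * w)) / (1 - of_real x * w)"
    using bfactor_denom(2)[OF w] by (simp add: bfactor_def divide_simps)
  also have "of_real (sgn x) * (of_real x - w) - (1 - of_real x * w) = - (of_real (1 - \<bar>x\<bar>) * (1 + of_real (sgn x) * w))"
    using x by (cases "x > 0") (auto simp: algebra_simps)
  finally have "cmod (bfactor x w - 1) = (1 - \<bar>x\<bar>) * cmod (1 + of_real (sgn x) * w) / cmod (1 - of_real x * w)"
    using x by (simp del: of_real_diff add: norm_mult norm_divide)
  also have "\<dots> \<le> (1 - \<bar>x\<bar>) * 2 / (1 - cmod w)"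
  proof (intro frac_le mult_left_mono)
    have "cmod (1 + of_real (sgn x) * w) \<le> 1 + cmod w"
      using norm_triangle_ineq[of 1 "of_real (sgn x) * w"] s by (simp add: norm_mult)
    then show "cmod (1 + of_real (sgn x) * w) \<le> 2" using w by simp
  qed (use x w bfactor_denom(1)[OF w] in auto)
  finally show ?thesis by simp
qed

lemma norm_bfactor_sq:
  assumes w: "cmod w < 1"
  shows "1 - (cmod (bfactor x w))\<^sup>2 = (1 - x\<^sup>2) * (1 - (cmod w)\<^sup>2) / (cmod (1 - of_real x * w))\<^sup>2"
proof -
  have nz: "cmod (1 - of_real x * w) \<noteq> 0" using bfactor_denom(2)[OF w] by simp
  have s: "\<bar>sgn x\<bar> = 1" using x by (auto simp: sgn_if)
  have "1 - (cmod (bfactor x w))\<^sup>2 = ((cmod (1 - of_real x * w))\<^sup>2 - (cmod (of_real x - w))\<^sup>2) / (cmod (1 - of_real x * w))\<^sup>2"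
  proof -
    have "(cmod (bfactor x w))\<^sup>2 = (cmod (of_real x - w))\<^sup>2 / (cmod (1 - of_real x * w))\<^sup>2"
      using s by (simp add: bfactor_def norm_mult norm_divide power_divide del: divide_cancel_right)
    then show ?thesis using nz by (simp only: diff_divide_distrib) simp
  qed
  also have "(cmod (1 - of_real x * w))\<^sup>2 - (cmod (of_real x - w))\<^sup>2 = (1 - x\<^sup>2) * (1 - (cmod w)\<^sup>2)"
    unfolding cmod_power2 by (simp add: power2_eq_square algebra_simps)
  finally show ?thesis .
qed

lemma norm_bfactor_le_1: "cmod w < 1 \<Longrightarrow> cmod (bfactor x w) \<le> 1"
proof -
  assume w: "cmod w < 1"
  have "(1 - x\<^sup>2) * (1 - (cmod w)\<^sup>2) / (cmod (1 - of_real x * w))\<^sup>2 \<ge> 0"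
    using x w by (intro divide_nonneg_nonneg mult_nonneg_nonneg) (auto simp: abs_square_le_1 power_le_one)
  then have "(cmod (bfactor x w))\<^sup>2 \<le> 1\<^sup>2" using norm_bfactor_sq[OF w] by simp
  then show ?thesis by (rule power2_le_imp_le) simp
qed

text \<open>By \<open>norm_bfactor_sq\<close>, convergence of the product at one point of the disc
  already forces the Blaschke condition. The 8 is 2 for 1 + |b| times 2^2 for |1 - x w|^2.\<close>

lemma one_minus_abs_le_bfactor:
  assumes w: "cmod w < 1"
  shows "1 - \<bar>x\<bar> \<le> 8 / (1 - (cmod w)\<^sup>2) * (1 - cmod (bfactor x w))"
proof -
  have w2: "1 - (cmod w)\<^sup>2 > 0" using w by (simp add: power_less_one_iff)
  have d: "cmod (1 - of_real x * w) \<le> 2"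
    using norm_triangle_ineq4[of 1 "of_real x * w"] mult_mono[of "\<bar>x\<bar>" 1 "cmod w" 1] x w by (simp add: norm_mult)
  have "1 - \<bar>x\<bar> \<le> 1 - x\<^sup>2" using x mult_left_le[of "\<bar>x\<bar>" "\<bar>x\<bar>"] by (simp add: power2_eq_square)
  then have "(1 - \<bar>x\<bar>) * (1 - (cmod w)\<^sup>2) \<le> (1 - x\<^sup>2) * (1 - (cmod w)\<^sup>2)"
    using w2 by (intro mult_right_mono) auto
  also have "\<dots> = (1 - (cmod (bfactor x w))\<^sup>2) * (cmod (1 - of_real x * w))\<^sup>2"
    using norm_bfactor_sq[OF w] bfactor_denom(2)[OF w] by simp
  also have "\<dots> \<le> (1 - (cmod (bfactor x w))\<^sup>2) * 2\<^sup>2"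
    using d norm_bfactor_le_1[OF w] by (intro mult_left_mono power_mono) (auto simp: power_le_one)
  also have "1 - (cmod (bfactor x w))\<^sup>2 = (1 + cmod (bfactor x w)) * (1 - cmod (bfactor x w))"
    by (simp add: power2_eq_square algebra_simps)
  also have "\<dots> * 2\<^sup>2 \<le> 2 * (1 - cmod (bfactor x w)) * 2\<^sup>2"
    using norm_bfactor_le_1[OF w] by (intro mult_right_mono) auto
  finally show ?thesis using w2 by (simp add: field_simps)
qed

end

lemma abs_ln_diff_le:
  fixes a b :: real
  assumes "a \<ge> 1 / 2" "b \<ge> 1 / 2"
  shows "\<bar>ln a - ln b\<bar> \<le> 2 * \<bar>a - b\<bar>"
proof -
  have *: "ln a - ln b \<le> 2 * \<bar>a - b\<bar>" if "a \<ge> 1 / 2" "b \<ge> 1 / 2" for a b :: real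
  proof -
    have "ln a - ln b \<le> (a - b) / b" using that by (intro ln_diff_le) auto
    also have "\<dots> \<le> \<bar>a - b\<bar> / b" using that by (intro divide_right_mono) auto
    also have "\<dots> \<le> \<bar>a - b\<bar> / (1 / 2)" using that by (intro frac_le) auto
    finally show ?thesis by simp
  qed
  show ?thesis using *[OF assms] *[OF assms(2,1)] by (simp add: abs_le_iff abs_minus_commute)
qed

section \<open>The Blaschke product of real zeros and its expansion at the origin\<close>

locale blaschke_zeros =
  fixes x :: "nat \<Rightarrow> real"
  assumes x: "\<And>j. 0 < \<bar>x j\<bar>" "\<And>j. \<bar>x j\<bar> \<le> 1"
    and summ: "summable (\<lambda>j. 1 - \<bar>x j\<bar>)"
begin

definition bl where "bl w = prodinf (\<lambda>j. bfactor (x j) w)"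
definition P where "P = prodinf (\<lambda>j. \<bar>x j\<bar>)"

lemma conv_bl: "cmod w < 1 \<Longrightarrow> convergent_prod (\<lambda>j. bfactor (x j) w)"
proof -
  assume w: "cmod w < 1"
  have "summable (\<lambda>j. cmod (bfactor (x j) w - 1))"
    by (rule summable_comparison_test'[OF summable_mult2[OF summ, of "2 / (1 - cmod w)"], of 0])
       (use bfactor_minus_1[OF x w] in auto)
  then show ?thesis
    by (intro abs_convergent_prod_imp_convergent_prod summable_imp_abs_convergent_prod)
qed

lemma conv_P: "convergent_prod (\<lambda>j. \<bar>x j\<bar>)"
  using conv_bl[of 0] convergent_prod_of_real_iff[of "\<lambda>j. \<bar>x j\<bar>"] by (simp add: bfactor_0 o_def)

lemma bl_0: "bl 0 = of_real P"
proof -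
  have "(\<lambda>j. \<bar>x j\<bar>) has_prod P" unfolding P_def using conv_P by (rule convergent_prod_has_prod)
  then have "(\<lambda>j. complex_of_real \<bar>x j\<bar>) has_prod of_real P" by simp
  then show ?thesis unfolding bl_def bfactor_0 by (simp add: has_prod_iff)
qed

lemma P_bounds: "P > 0" "P \<le> 1" "P \<le> \<bar>x j\<bar>"
proof -
  have l: "(\<lambda>n. \<Prod>i\<le>n. \<bar>x i\<bar>) \<longlonglongrightarrow> P" unfolding P_def by (rule convergent_prod_LIMSEQ[OF conv_P])
  have "P \<ge> 0" by (rule tendsto_lowerbound[OF l]) (auto intro!: prod_nonneg always_eventually)
  moreover have "P \<noteq> 0" unfolding P_def using prodinf_nonzero[OF conv_P] x(1) by simp
  ultimately show "P > 0" by simp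
  show *: "P \<le> \<bar>x j\<bar>" for j
  proof (rule tendsto_upperbound[OF l])
    have "(\<Prod>i\<le>n. \<bar>x i\<bar>) \<le> \<bar>x j\<bar>" if "j \<le> n" for n
    proof -
      have "(\<Prod>i\<le>n. \<bar>x i\<bar>) = \<bar>x j\<bar> * (\<Prod>i\<in>{..n} - {j}. \<bar>x i\<bar>)" using that by (intro prod.remove) auto
      also have "\<dots> \<le> \<bar>x j\<bar> * 1" using x by (intro mult_left_mono prod_le_1) auto
      finally show ?thesis by simp
    qed
    then show "\<forall>\<^sub>F n in sequentially. (\<Prod>i\<le>n. \<bar>x i\<bar>) \<le> \<bar>x j\<bar>" by (auto simp: eventually_sequentially)
  qed simp
  show "P \<le> 1" using *[of 0] x(2)[of 0] by simp
qed

lemma norm_bl_tendsto: "cmod w < 1 \<Longrightarrow> (\<lambda>n. \<Prod>i\<le>n. cmod (bfactor (x i) w)) \<longlonglongrightarrow> cmod (bl w)"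
  using tendsto_norm[OF convergent_prod_LIMSEQ[OF conv_bl]] by (simp add: bl_def prod_norm)

lemma P_tendsto: "(\<lambda>n. \<Prod>i\<le>n. \<bar>x i\<bar>) \<longlonglongrightarrow> P"
  unfolding P_def by (rule convergent_prod_LIMSEQ[OF conv_P])

lemma inverse_minus_le: "\<bar>1 / x j - x j\<bar> \<le> 2 / P * (1 - \<bar>x j\<bar>)"
proof -
  have "\<bar>1 / x j - x j\<bar> = (1 - \<bar>x j\<bar>) * (1 + \<bar>x j\<bar>) / \<bar>x j\<bar>"
  proof -
    have "1 / x j - x j = (1 - \<bar>x j\<bar>) * (1 + \<bar>x j\<bar>) / x j"
      using x(1)[of j] by (cases "x j > 0") (simp_all add: field_simps)
    then have "\<bar>1 / x j - x j\<bar> = \<bar>(1 - \<bar>x j\<bar>) * (1 + \<bar>x j\<bar>)\<bar> / \<bar>x j\<bar>" by (simp only: abs_divide)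
    then show ?thesis using x(2)[of j] by (simp add: abs_mult)
  qed
  also have "\<dots> \<le> (1 - \<bar>x j\<bar>) * 2 / P"
    using x[of j] P_bounds by (intro frac_le mult_left_mono) auto
  finally show ?thesis by (simp add: mult_ac)
qed

lemma summable_inverse_minus: "summable (\<lambda>j. \<bar>1 / x j - x j\<bar>)"
  by (rule summable_comparison_test'[OF summable_mult[OF summ, of "2 / P"], of 0]) (use inverse_minus_le in auto)

text \<open>For small real s this is the logarithm of |bfactor (x j) s| / |x j|.\<close>

definition lterm where "lterm s j = ln (1 - s / x j) - ln (1 - x j * s)"

text \<open>As P \<le> |x j|, the bound |s| \<le> P / 2 keeps both arguments of the logarithms at or
  above 1/2, away from their singularity.\<close>

lemma
  assumes s: "\<bar>s\<bar> \<le> P / 2"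
  shows lterm_le: "\<bar>lterm s j\<bar> \<le> 2 * (\<bar>s\<bar> * \<bar>1 / x j - x j\<bar>)"
    and norm_bfactor_real: "cmod (bfactor (x j) (of_real s)) = \<bar>x j\<bar> * exp (lterm s j)"
proof -
  have "\<bar>s\<bar> / \<bar>x j\<bar> \<le> (P / 2) / P" using s P_bounds x(1)[of j] by (intro frac_le) auto
  then have 1: "s / x j \<le> 1 / 2" using P_bounds abs_ge_self[of "s / x j"] unfolding abs_divide by simp
  have "\<bar>x j * s\<bar> \<le> 1 * (1 / 2)"
    unfolding abs_mult using x(2)[of j] s P_bounds by (intro mult_mono) auto
  then have 2: "x j * s \<le> 1 / 2" by (simp add: abs_le_iff)
  have "\<bar>lterm s j\<bar> \<le> 2 * \<bar>(1 - s / x j) - (1 - x j * s)\<bar>"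
    unfolding lterm_def using 1 2 by (intro abs_ln_diff_le) auto
  also have "(1 - s / x j) - (1 - x j * s) = - (s * (1 / x j - x j))" by (simp add: algebra_simps)
  finally show "\<bar>lterm s j\<bar> \<le> 2 * (\<bar>s\<bar> * \<bar>1 / x j - x j\<bar>)" by (simp add: abs_mult)
  have p: "1 - s / x j > 0" "1 - x j * s > 0" using 1 2 by linarith+
  have "cmod (bfactor (x j) (of_real s)) = \<bar>x j - s\<bar> / \<bar>1 - x j * s\<bar>"
  proof -
    have "bfactor (x j) (of_real s) = of_real (sgn (x j) * ((x j - s) / (1 - x j * s)))"
      by (simp add: bfactor_def)
    then have "cmod (bfactor (x j) (of_real s)) = \<bar>sgn (x j)\<bar> * (\<bar>x j - s\<bar> / \<bar>1 - x j * s\<bar>)"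
      by (simp only: norm_of_real abs_mult abs_divide)
    then show ?thesis using x(1)[of j] by (simp add: sgn_if)
  qed
  also have "x j - s = x j * (1 - s / x j)" using x(1)[of j] by (simp add: field_simps)
  also have "\<bar>\<dots>\<bar> / \<bar>1 - x j * s\<bar> = \<bar>x j\<bar> * ((1 - s / x j) / (1 - x j * s))"
    using p by (simp add: abs_mult)
  also have "(1 - s / x j) / (1 - x j * s) = exp (lterm s j)"
    using p by (simp add: lterm_def exp_diff)
  finally show "cmod (bfactor (x j) (of_real s)) = \<bar>x j\<bar> * exp (lterm s j)" .
qed

lemma summable_lterm: "\<bar>s\<bar> \<le> P / 2 \<Longrightarrow> summable (lterm s)"
  by (rule summable_comparison_test'[OF summable_mult[OF summable_mult[OF summable_inverse_minus, of "\<bar>s\<bar>"], of 2], of 0])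
     (use lterm_le in auto)

lemma norm_bl_real:
  assumes s: "\<bar>s\<bar> \<le> P / 2"
  shows "cmod (bl (of_real s)) = P * exp (\<Sum>j. lterm s j)"
proof -
  have "\<bar>s\<bar> < 1" using s P_bounds by simp
  then have 1: "(\<lambda>n. \<Prod>i\<le>n. cmod (bfactor (x i) (of_real s))) \<longlonglongrightarrow> cmod (bl (of_real s))"
    by (intro norm_bl_tendsto) simp
  have "(\<lambda>n. (\<Prod>i\<le>n. \<bar>x i\<bar>) * exp (\<Sum>i\<le>n. lterm s i)) \<longlonglongrightarrow> P * exp (\<Sum>j. lterm s j)"
    by (intro tendsto_intros P_tendsto summable_LIMSEQ' summable_lterm s)
  moreover have "(\<Prod>i\<le>n. cmod (bfactor (x i) (of_real s))) = (\<Prod>i\<le>n. \<bar>x i\<bar>) * exp (\<Sum>i\<le>n. lterm s i)" for n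
    by (simp add: norm_bfactor_real[OF s] prod.distrib exp_sum)
  ultimately show ?thesis using 1 LIMSEQ_unique by simp
qed

text \<open>Termwise differentiation at 0, with 2 |1 / x j - x j| as summable majorant of the
  difference quotients.\<close>

lemma ln_norm_bl_deriv:
  assumes s: "\<And>m. s m \<noteq> 0" "\<And>m. \<bar>s m\<bar> \<le> P / 2" "s \<longlonglongrightarrow> 0"
  shows "(\<lambda>m. (ln (cmod (bl (of_real (s m)))) - ln P) / s m) \<longlonglongrightarrow> (\<Sum>j. x j - 1 / x j)"
proof -
  have "(ln (cmod (bl (of_real (s m)))) - ln P) / s m = (\<Sum>j. lterm (s m) j / s m)" for m
    using P_bounds norm_bl_real[OF s(2)[of m]] suminf_divide[OF summable_lterm[OF s(2)[of m]], of "s m"]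
    by (simp add: ln_mult)
  moreover have "(\<lambda>m. \<Sum>j. lterm (s m) j / s m) \<longlonglongrightarrow> (\<Sum>j. x j - 1 / x j)"
  proof (rule suminf_dominated_convergence)
    show "summable (\<lambda>j. 2 * \<bar>1 / x j - x j\<bar>)" by (rule summable_mult[OF summable_inverse_minus])
    show "norm (lterm (s m) j / s m) \<le> 2 * \<bar>1 / x j - x j\<bar>" for m j
      using lterm_le[OF s(2)[of m], of j] s(1)[of m] by (simp add: pos_divide_le_eq mult_ac)
    fix j
    have "((\<lambda>h. lterm h j) has_real_derivative (x j - 1 / x j)) (at 0)"
      unfolding lterm_def using x(1)[of j] by (auto intro!: derivative_eq_intros)
    then have "((\<lambda>h. lterm h j / h) \<longlongrightarrow> x j - 1 / x j) (at 0)"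
      unfolding DERIV_def by (simp add: lterm_def)
    moreover have "filterlim s (at 0) sequentially"
      using s by (auto simp: filterlim_at)
    ultimately show "(\<lambda>m. lterm (s m) j / s m) \<longlonglongrightarrow> x j - 1 / x j" by (rule filterlim_compose)
  qed
  ultimately show ?thesis by simp
qed

text \<open>On the imaginary axis each factor satisfies |bfactor| \<ge> |x j|, so keeping only n of
  the quotients gives a lower bound. Summability of the quadratic series is thus not presupposed but
  follows from the final estimate.\<close>

lemma norm_bl_imag:
  assumes s: "\<bar>s\<bar> < 1"
  shows "bl (\<i> * of_real s) \<noteq> 0"
    and "(\<Sum>j<n. ln (1 + s\<^sup>2 / (x j)\<^sup>2) - ln (1 + (x j)\<^sup>2 * s\<^sup>2)) \<le> 2 * (ln (cmod (bl (\<i> * of_real s))) - ln P)"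
proof -
  define r where "r = (\<lambda>j. sqrt ((1 + s\<^sup>2 / (x j)\<^sup>2) / (1 + (x j)\<^sup>2 * s\<^sup>2)))"
  have pos: "1 + s\<^sup>2 / (x j)\<^sup>2 > 0" "1 + (x j)\<^sup>2 * s\<^sup>2 > 0" for j
    by (simp_all add: add_pos_nonneg)
  have r1: "r j \<ge> 1" for j
  proof -
    have x2: "(x j)\<^sup>2 \<le> 1" "(x j)\<^sup>2 > 0" using x[of j] by (auto simp: abs_square_le_1)
    have "(x j)\<^sup>2 * s\<^sup>2 \<le> 1 * s\<^sup>2" by (intro mult_right_mono x2) auto
    also have "\<dots> \<le> s\<^sup>2 / (x j)\<^sup>2" using x2 by (simp add: le_divide_eq mult_left_le)
    finally show ?thesis using pos[of j] by (simp add: r_def)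
  qed
  have b: "cmod (bfactor (x j) (\<i> * of_real s)) = \<bar>x j\<bar> * r j" for j
  proof -
    have "cmod (of_real (x j) - \<i> * of_real s) = sqrt ((x j)\<^sup>2 + s\<^sup>2)" "cmod (1 - of_real (x j) * (\<i> * of_real s)) = sqrt (1 + (x j)\<^sup>2 * s\<^sup>2)"
      by (simp_all add: cmod_def power_mult_distrib)
    moreover have "cmod (of_real (sgn (x j))) = 1" using x(1)[of j] by (simp add: sgn_if)
    ultimately have "cmod (bfactor (x j) (\<i> * of_real s)) = sqrt (((x j)\<^sup>2 + s\<^sup>2) / (1 + (x j)\<^sup>2 * s\<^sup>2))"
      unfolding bfactor_def norm_mult norm_divide by (simp add: real_sqrt_divide)
    also have "(x j)\<^sup>2 + s\<^sup>2 = (x j)\<^sup>2 * (1 + s\<^sup>2 / (x j)\<^sup>2)" using x(1)[of j] by (simp add: distrib_left)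
    finally show ?thesis by (simp add: r_def real_sqrt_mult real_sqrt_divide)
  qed
  have "P * (\<Prod>j<n. r j) \<le> cmod (bl (\<i> * of_real s))"
  proof (rule LIMSEQ_le)
    show "(\<lambda>m. (\<Prod>i\<le>m. \<bar>x i\<bar>) * (\<Prod>j<n. r j)) \<longlonglongrightarrow> P * (\<Prod>j<n. r j)"
      by (intro tendsto_intros P_tendsto)
    show "(\<lambda>m. \<Prod>i\<le>m. cmod (bfactor (x i) (\<i> * of_real s))) \<longlonglongrightarrow> cmod (bl (\<i> * of_real s))"
      using s by (intro norm_bl_tendsto) (simp add: norm_mult)
    have "(\<Prod>i\<le>m. \<bar>x i\<bar>) * (\<Prod>j<n. r j) \<le> (\<Prod>i\<le>m. cmod (bfactor (x i) (\<i> * of_real s)))" if "n \<le> m" for m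
    proof -
      have "(\<Prod>j<n. r j) \<le> (\<Prod>j\<le>m. r j)"
        using that r1 by (intro prod_mono2) (auto intro: order.trans[OF zero_le_one])
      then show ?thesis unfolding b prod.distrib by (intro mult_left_mono prod_nonneg) auto
    qed
    then show "\<exists>N. \<forall>m\<ge>N. (\<Prod>i\<le>m. \<bar>x i\<bar>) * (\<Prod>j<n. r j) \<le> (\<Prod>i\<le>m. cmod (bfactor (x i) (\<i> * of_real s)))" by blast
  qed
  moreover have rp: "r j > 0" for j using r1[of j] by simp
  then have "(\<Prod>j<n. r j) > 0" by (intro prod_pos) auto
  ultimately have pr: "P * (\<Prod>j<n. r j) > 0" "P * (\<Prod>j<n. r j) \<le> cmod (bl (\<i> * of_real s))"
    "(\<Prod>j<n. r j) > 0"
    using P_bounds(1) by auto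
  then have *: "ln P + ln (\<Prod>j<n. r j) \<le> ln (cmod (bl (\<i> * of_real s)))" "cmod (bl (\<i> * of_real s)) > 0"
    using P_bounds(1) by (simp_all only: ln_mult_pos[symmetric] ln_mono)
  show "bl (\<i> * of_real s) \<noteq> 0" using *(2) by simp
  have "2 * ln (\<Prod>j<n. r j) = (\<Sum>j<n. ln (1 + s\<^sup>2 / (x j)\<^sup>2) - ln (1 + (x j)\<^sup>2 * s\<^sup>2))"
  proof -
    have "2 * ln (r j) = ln (1 + s\<^sup>2 / (x j)\<^sup>2) - ln (1 + (x j)\<^sup>2 * s\<^sup>2)" for j
      using pos[of j] by (simp add: r_def ln_sqrt ln_div)
    moreover have "r j \<noteq> 0" for j using rp[of j] by simp
    then have "ln (\<Prod>j<n. r j) = (\<Sum>j<n. ln (r j))" by (intro ln_prod) simp_all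
    ultimately show ?thesis by (simp add: sum_distrib_left)
  qed
  then show "(\<Sum>j<n. ln (1 + s\<^sup>2 / (x j)\<^sup>2) - ln (1 + (x j)\<^sup>2 * s\<^sup>2)) \<le> 2 * (ln (cmod (bl (\<i> * of_real s))) - ln P)"
    using *(1) by simp
qed

end

section \<open>The canonical factorization\<close>

text \<open>The Poisson kernel, as the real part of the Herglotz kernel of the canonical
  factorization.\<close>

definition pk :: "complex \<Rightarrow> real \<Rightarrow> real" where
  "pk w t = Re ((cis t + w) / (cis t - w))"

lemma continuous_pk: "cmod w < 1 \<Longrightarrow> continuous_on UNIV (pk w)"
  and continuous_herglotz: "cmod w < 1 \<Longrightarrow> continuous_on UNIV (\<lambda>t. (cis t + w) / (cis t - w))"
proof -
  assume w: "cmod w < 1"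
  have "cis t - w \<noteq> 0" for t using w norm_cis[of t] by force
  then show "continuous_on UNIV (\<lambda>t. (cis t + w) / (cis t - w))"
    by (intro continuous_intros) (auto simp: cis_conv_exp intro!: continuous_intros)
  then show "continuous_on UNIV (pk w)" unfolding pk_def by (rule continuous_on_Re)
qed

locale boundary_data =
  fixes \<sigma> :: "real measure" and Lb :: "real \<Rightarrow> real" and M :: real
  assumes fin: "finite_measure \<sigma>" and sets_\<sigma>: "sets \<sigma> = sets (restrict_space borel {-pi..pi})"
    and Lb: "set_integrable lborel {-pi..pi} Lb"
    and Lb_le: "AE t in lborel. t \<in> {-pi..pi} \<longrightarrow> Lb t \<le> M"
begin

lemma space_\<sigma>: "space \<sigma> = {-pi..pi}"
  using sets_eq_imp_space_eq[OF sets_\<sigma>] by (simp add: space_restrict_space)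

lemma bounded_on_circle:
  fixes \<phi> :: "real \<Rightarrow> 'b :: real_normed_vector"
  assumes "continuous_on UNIV \<phi>"
  obtains C where "C \<ge> 0" "\<And>t. t \<in> {-pi..pi} \<Longrightarrow> norm (\<phi> t) \<le> C"
proof -
  have "compact (\<phi> ` {-pi..pi})" using assms by (intro compact_continuous_image) (auto intro: continuous_on_subset)
  then obtain C where C: "\<And>t. t \<in> {-pi..pi} \<Longrightarrow> norm (\<phi> t) \<le> C"
    using compact_imp_bounded bounded_iff by (metis imageI)
  show thesis using that[of C] C[of 0] order.trans[OF norm_ge_zero C[of 0]] C by simp
qed

lemma measurable_\<sigma>:
  fixes \<phi> :: "real \<Rightarrow> 'b :: topological_space"
  assumes "continuous_on UNIV \<phi>"
  shows "\<phi> \<in> borel_measurable \<sigma>"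
  using borel_measurable_continuous_on_restrict[of "{-pi..pi}" \<phi>] continuous_on_subset[OF assms]
    measurable_cong_sets[OF sets_\<sigma> refl] by blast

lemma integrable_\<sigma>:
  fixes \<phi> :: "real \<Rightarrow> 'b :: {banach, second_countable_topology}"
  assumes \<phi>: "continuous_on UNIV \<phi>"
  shows "integrable \<sigma> \<phi>"
proof -
  interpret finite_measure \<sigma> by (rule fin)
  obtain C where "\<And>t. t \<in> {-pi..pi} \<Longrightarrow> norm (\<phi> t) \<le> C" using bounded_on_circle[OF \<phi>] by blast
  then show ?thesis
    by (intro integrable_const_bound[of _ C] measurable_\<sigma> \<phi>) (auto simp: space_\<sigma> intro!: AE_I2)
qed

lemma measurable_Lb: "(\<lambda>t. indicator {-pi..pi} t *\<^sub>R Lb t) \<in> borel_measurable borel"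
  using Lb by (simp add: set_integrable_def borel_measurable_integrable flip: measurable_lborel1)

lemma measurable_mult_Lb:
  fixes \<phi> :: "real \<Rightarrow> real"
  assumes "continuous_on UNIV \<phi>"
  shows "(\<lambda>t. indicator {-pi..pi} t *\<^sub>R (\<phi> t * Lb t)) \<in> borel_measurable lborel"
proof -
  have "(\<lambda>t. \<phi> t * (indicator {-pi..pi} t *\<^sub>R Lb t)) \<in> borel_measurable borel"
    by (intro borel_measurable_times measurable_Lb borel_measurable_continuous_onI assms)
  then show ?thesis by (simp add: mult_ac)
qed

lemma integrable_Lb:
  fixes \<phi> :: "real \<Rightarrow> real"
  assumes \<phi>: "continuous_on UNIV \<phi>"
  shows "set_integrable lborel {-pi..pi} (\<lambda>t. \<phi> t * Lb t)"
proof -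
  obtain C where C: "C \<ge> 0" "\<And>t. t \<in> {-pi..pi} \<Longrightarrow> norm (\<phi> t) \<le> C" using bounded_on_circle[OF \<phi>] by blast
  show ?thesis
    unfolding set_integrable_def
  proof (rule Bochner_Integration.integrable_bound)
    show "integrable lborel (\<lambda>t. C * (indicator {-pi..pi} t *\<^sub>R Lb t))"
      using Lb by (simp add: set_integrable_def)
    show "AE t in lborel. norm (indicator {-pi..pi} t *\<^sub>R (\<phi> t * Lb t)) \<le> norm (C * (indicator {-pi..pi} t *\<^sub>R Lb t))"
      using C by (intro AE_I2) (auto simp: indicator_def abs_mult intro!: mult_right_mono)
  qed (rule measurable_mult_Lb[OF \<phi>])
qed

definition \<Lambda> where "\<Lambda> \<phi> = (LBINT t:{-pi..pi}. \<phi> t * Lb t) - (LINT t|\<sigma>. \<phi> t)"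

lemma \<Lambda>_add: "continuous_on UNIV \<phi> \<Longrightarrow> continuous_on UNIV \<psi> \<Longrightarrow> \<Lambda> (\<lambda>t. \<phi> t + \<psi> t) = \<Lambda> \<phi> + \<Lambda> \<psi>"
  by (simp add: \<Lambda>_def distrib_right integrable_Lb integrable_\<sigma>)

lemma \<Lambda>_cmult: "continuous_on UNIV \<phi> \<Longrightarrow> \<Lambda> (\<lambda>t. c * \<phi> t) = c * \<Lambda> \<phi>"
  by (simp add: \<Lambda>_def mult.assoc right_diff_distrib)

text \<open>The singular part enters with a minus sign, so it only lowers the value on \<phi> \<ge>
  0; the rest is bounded through Lb \<le> M almost everywhere.\<close>

lemma \<Lambda>_le:
  assumes \<phi>: "continuous_on UNIV \<phi>" "\<And>t. \<phi> t \<ge> 0"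
  shows "\<Lambda> \<phi> \<le> M * (LBINT t:{-pi..pi}. \<phi> t)"
proof -
  have i: "set_integrable lborel {-pi..pi} \<phi>"
    by (rule borel_integrable_atLeastAtMost') (use \<phi>(1) in \<open>auto intro: continuous_on_subset\<close>)
  have "(LBINT t:{-pi..pi}. \<phi> t * Lb t) \<le> (LBINT t:{-pi..pi}. \<phi> t * M)"
  proof (rule set_integral_mono_AE[OF integrable_Lb[OF \<phi>(1)]])
    show "set_integrable lborel {-pi..pi} (\<lambda>t. \<phi> t * M)" using i by simp
    show "AE t\<in>{-pi..pi} in lborel. \<phi> t * Lb t \<le> \<phi> t * M"
      using Lb_le by eventually_elim (use \<phi>(2) in \<open>auto intro!: mult_left_mono\<close>)
  qed
  moreover have "(LINT t|\<sigma>. \<phi> t) \<ge> 0" using \<phi>(2) by (rule Bochner_Integration.integral_nonneg)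
  ultimately show ?thesis by (simp add: \<Lambda>_def mult.commute)
qed

lemma \<Lambda>_tendsto:
  assumes \<phi>: "\<And>m. continuous_on UNIV (\<phi> m)" "continuous_on UNIV \<psi>"
    and le: "\<And>m t. \<bar>\<phi> m t\<bar> \<le> C" and lim: "\<And>t. (\<lambda>m. \<phi> m t) \<longlonglongrightarrow> \<psi> t"
  shows "(\<lambda>m. \<Lambda> (\<phi> m)) \<longlonglongrightarrow> \<Lambda> \<psi>"
  unfolding \<Lambda>_def
proof (rule tendsto_diff)
  interpret finite_measure \<sigma> by (rule fin)
  show "(\<lambda>m. LINT t|\<sigma>. \<phi> m t) \<longlonglongrightarrow> (LINT t|\<sigma>. \<psi> t)"
    by (rule integral_dominated_convergence[where w = "\<lambda>_. C"]) (auto intro!: measurable_\<sigma> \<phi> lim simp: le)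
  show "(\<lambda>m. LBINT t:{-pi..pi}. \<phi> m t * Lb t) \<longlonglongrightarrow> (LBINT t:{-pi..pi}. \<psi> t * Lb t)"
    unfolding set_lebesgue_integral_def
  proof (rule integral_dominated_convergence[where w = "\<lambda>t. C * norm (indicator {-pi..pi} t *\<^sub>R Lb t)"])
    show "integrable lborel (\<lambda>t. C * norm (indicator {-pi..pi} t *\<^sub>R Lb t))"
      using Lb by (intro integrable_mult_right integrable_norm) (simp add: set_integrable_def)
    show "AE t in lborel. (\<lambda>m. indicator {-pi..pi} t *\<^sub>R (\<phi> m t * Lb t)) \<longlonglongrightarrow> indicator {-pi..pi} t *\<^sub>R (\<psi> t * Lb t)"
      by (intro AE_I2 tendsto_intros lim)
    show "AE t in lborel. norm (indicator {-pi..pi} t *\<^sub>R (\<phi> m t * Lb t)) \<le> C * norm (indicator {-pi..pi} t *\<^sub>R Lb t)" for m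
      using le[of m] by (intro AE_I2) (auto simp: indicator_def abs_mult intro!: mult_right_mono)
  qed (rule measurable_mult_Lb, rule \<phi>)+
qed

lemma norm_factor:
  assumes w: "cmod w < 1"
  shows "cmod (exp (- (1 / (2 * of_real pi)) * (LINT t|\<sigma>. (cis t + w) / (cis t - w)))
      * exp (1 / (2 * of_real pi) * (LBINT t:{-pi..pi}. (cis t + w) / (cis t - w) * of_real (Lb t))))
    = exp (\<Lambda> (pk w) / (2 * pi))"
proof -
  define K where "K = (\<lambda>t. (cis t + w) / (cis t - w))"
  have K: "continuous_on UNIV K" unfolding K_def by (rule continuous_herglotz[OF w])
  have pk: "pk w = (\<lambda>t. Re (K t))" by (simp add: fun_eq_iff pk_def K_def)
  have 1: "Re (LINT t|\<sigma>. K t) = (LINT t|\<sigma>. pk w t)"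
    unfolding pk by (rule integral_Re[OF integrable_\<sigma>[OF K], symmetric])
  have 2: "Re (LBINT t:{-pi..pi}. K t * of_real (Lb t)) = (LBINT t:{-pi..pi}. pk w t * Lb t)"
  proof -
    have "integrable lborel (\<lambda>t. indicator {-pi..pi} t *\<^sub>R (K t * of_real (Lb t)))"
    proof -
      have r: "set_integrable lborel {-pi..pi} (\<lambda>t. Re (K t) * Lb t)" "set_integrable lborel {-pi..pi} (\<lambda>t. Im (K t) * Lb t)"
        by (intro integrable_Lb continuous_intros K)+
      have "integrable lborel (\<lambda>t. of_real (indicator {-pi..pi} t *\<^sub>R (Re (K t) * Lb t)) + \<i> * of_real (indicator {-pi..pi} t *\<^sub>R (Im (K t) * Lb t)))"
        using r unfolding set_integrable_def
        by (intro Bochner_Integration.integrable_add integrable_mult_right integrable_of_real)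
      then show ?thesis
        by (rule Bochner_Integration.integrable_cong[THEN iffD1, rotated -1]) (auto simp: complex_eq_iff)
    qed
    from integral_Re[OF this] show ?thesis
      by (simp add: set_lebesgue_integral_def pk)
  qed
  have "cmod (exp (- (1 / (2 * of_real pi)) * (LINT t|\<sigma>. K t)) * exp (1 / (2 * of_real pi) * (LBINT t:{-pi..pi}. K t * of_real (Lb t))))
      = exp (Re (- (1 / (2 * of_real pi)) * (LINT t|\<sigma>. K t)) + Re (1 / (2 * of_real pi) * (LBINT t:{-pi..pi}. K t * of_real (Lb t))))"
    by (simp only: norm_mult norm_exp_eq_Re exp_add)
  also have "Re (- (1 / (2 * of_real pi)) * (LINT t|\<sigma>. K t)) = - Re (LINT t|\<sigma>. K t) / (2 * pi)"
    by (simp add: field_simps flip: of_real_mult)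
  also have "Re (1 / (2 * of_real pi) * (LBINT t:{-pi..pi}. K t * of_real (Lb t))) = Re (LBINT t:{-pi..pi}. K t * of_real (Lb t)) / (2 * pi)"
    by (simp flip: of_real_mult)
  finally show ?thesis unfolding 1 2 K_def[symmetric] by (simp add: \<Lambda>_def diff_divide_distrib K_def)
qed

end

section \<open>The Poisson kernel near the origin\<close>

lemma pk_eq: "cmod w < 1 \<Longrightarrow> pk w t = (1 - (cmod w)\<^sup>2) / (cmod (cis t - w))\<^sup>2"
proof -
  have "Re ((c + w) * cnj (c - w)) = (cmod c)\<^sup>2 - (cmod w)\<^sup>2" for c
    unfolding cmod_power2 by (simp add: power2_eq_square algebra_simps)
  moreover have "pk w t = Re ((cis t + w) * cnj (cis t - w)) / (cmod (cis t - w))\<^sup>2"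
    unfolding pk_def complex_div_cnj[of "cis t + w"] by (simp flip: of_real_power)
  ultimately show ?thesis by (simp only: norm_cis power_one)
qed

lemma pk_real: "\<bar>s\<bar> < 1 \<Longrightarrow> pk (of_real s) t = (1 - s\<^sup>2) / (1 - 2 * s * cos t + s\<^sup>2)"
proof -
  assume s: "\<bar>s\<bar> < 1"
  have "(cmod (cis t - of_real s))\<^sup>2 = ((cos t)\<^sup>2 + (sin t)\<^sup>2) - 2 * s * cos t + s\<^sup>2"
    unfolding cmod_power2 by (simp add: power2_eq_square algebra_simps)
  then show ?thesis using s by (simp add: pk_eq)
qed

lemma pk_imag: "\<bar>s\<bar> < 1 \<Longrightarrow> pk (\<i> * of_real s) t = (1 - s\<^sup>2) / (1 - 2 * s * sin t + s\<^sup>2)"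
proof -
  assume s: "\<bar>s\<bar> < 1"
  have "(cmod (cis t - \<i> * of_real s))\<^sup>2 = ((cos t)\<^sup>2 + (sin t)\<^sup>2) - 2 * s * sin t + s\<^sup>2"
    unfolding cmod_power2 by (simp add: power2_eq_square algebra_simps)
  then show ?thesis using s by (simp add: pk_eq norm_mult)
qed

lemma poisson_denom_pos:
  fixes c s :: real
  assumes "\<bar>s\<bar> < 1" "\<bar>c\<bar> \<le> 1"
  shows "1 - 2 * s * c + s\<^sup>2 \<ge> (1 - \<bar>s\<bar>)\<^sup>2" "1 - 2 * s * c + s\<^sup>2 > 0"
proof -
  have "s * c \<le> \<bar>s\<bar> * \<bar>c\<bar>" by (simp add: abs_mult[symmetric])
  also have "\<dots> \<le> \<bar>s\<bar> * 1" using assms by (intro mult_left_mono) auto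
  finally show 1: "1 - 2 * s * c + s\<^sup>2 \<ge> (1 - \<bar>s\<bar>)\<^sup>2" by (simp add: power2_diff)
  have "(1 - \<bar>s\<bar>)\<^sup>2 > 0" using assms by simp
  then show "1 - 2 * s * c + s\<^sup>2 > 0" using 1 by linarith
qed

text \<open>The kernel is 1 + 2 s cos t to first order; the uniform bound on the difference quotient
  feeds dominated convergence.\<close>

lemma poisson_diff_real:
  assumes "0 < \<bar>s\<bar>" "\<bar>s\<bar> \<le> 1 / 4"
  shows "(pk (of_real s) t - 1) / s = (2 * cos t - 2 * s) / (1 - 2 * s * cos t + s\<^sup>2)"
    and "\<bar>(pk (of_real s) t - 1) / s\<bar> \<le> 16"
proof -
  define D where "D = 1 - 2 * s * cos t + s\<^sup>2"
  have D: "D \<ge> (1 - \<bar>s\<bar>)\<^sup>2" "D > 0" unfolding D_def using assms by (intro poisson_denom_pos; simp)+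
  have "pk (of_real s) t - 1 = ((1 - s\<^sup>2) - D) / D" using assms D by (simp add: pk_real D_def[symmetric] diff_divide_distrib)
  also have "(1 - s\<^sup>2) - D = s * (2 * cos t - 2 * s)" by (simp add: D_def power2_eq_square algebra_simps)
  finally show 1: "(pk (of_real s) t - 1) / s = (2 * cos t - 2 * s) / (1 - 2 * s * cos t + s\<^sup>2)"
    using assms by (simp add: D_def)
  have "(1 / 2)\<^sup>2 \<le> (1 - \<bar>s\<bar>)\<^sup>2" using assms by (intro power_mono) auto
  then have "D \<ge> 1 / 4" using D(1) by (simp add: power2_eq_square)
  moreover have "\<bar>2 * cos t - 2 * s\<bar> \<le> 4" using abs_cos_le_one[of t] assms by linarith
  ultimately have "\<bar>2 * cos t - 2 * s\<bar> / D \<le> 4 / (1 / 4)" by (intro frac_le) auto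
  then show "\<bar>(pk (of_real s) t - 1) / s\<bar> \<le> 16" unfolding 1 D_def[symmetric] using D by (simp add: abs_divide)
qed

text \<open>The first-order terms of s and - s cancel, and the second-order coefficient is - 4 cos
  2t.\<close>

lemma poisson_diff_imag:
  assumes "0 < s" "s \<le> 1 / 4"
  shows "(pk (\<i> * of_real s) t + pk (\<i> * of_real (- s)) t - 2) / s\<^sup>2
      = - 4 * (cos (2 * t) + s\<^sup>2) / ((1 + s\<^sup>2)\<^sup>2 - (2 * s * sin t)\<^sup>2)"
    and "\<bar>(pk (\<i> * of_real s) t + pk (\<i> * of_real (- s)) t - 2) / s\<^sup>2\<bar> \<le> 128"
proof -
  define A B where "A = 1 - 2 * s * sin t + s\<^sup>2" and "B = 1 + 2 * s * sin t + s\<^sup>2"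
  have AB: "A \<ge> (1 - \<bar>s\<bar>)\<^sup>2" "A > 0" "B \<ge> (1 - \<bar>s\<bar>)\<^sup>2" "B > 0"
    using poisson_denom_pos[of s "sin t"] poisson_denom_pos[of "- s" "sin t"] assms by (auto simp: A_def B_def)
  have c: "cos (2 * t) = 1 - 2 * (sin t)\<^sup>2" by (simp add: cos_double sin_squared_eq)
  have AB': "A * B = (1 + s\<^sup>2)\<^sup>2 - (2 * s * sin t)\<^sup>2" by (simp add: A_def B_def power2_eq_square algebra_simps)
  have "pk (\<i> * of_real s) t + pk (\<i> * of_real (- s)) t - 2 = (1 - s\<^sup>2) / A + (1 - s\<^sup>2) / B - 2"
    using assms pk_imag[of s t] pk_imag[of "- s" t] by (simp add: A_def B_def)
  also have "\<dots> = ((1 - s\<^sup>2) * (A + B) - 2 * (A * B)) / (A * B)"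
  proof -
    have "A \<noteq> 0" "B \<noteq> 0" using AB by auto
    then have "(1 - s\<^sup>2) / A = (1 - s\<^sup>2) * B / (A * B)" "(1 - s\<^sup>2) / B = (1 - s\<^sup>2) * A / (A * B)"
      "2 = 2 * (A * B) / (A * B)" by simp_all
    then show ?thesis by (simp only: distrib_left add_divide_distrib diff_divide_distrib add.commute)
  qed
  also have "(1 - s\<^sup>2) * (A + B) - 2 * (A * B) = s\<^sup>2 * (- 4 * (cos (2 * t) + s\<^sup>2))"
    unfolding AB' c by (simp add: A_def B_def power2_eq_square algebra_simps)
  finally have 1: "(pk (\<i> * of_real s) t + pk (\<i> * of_real (- s)) t - 2) / s\<^sup>2 = - 4 * (cos (2 * t) + s\<^sup>2) / (A * B)"
    using assms by simp
  then show "(pk (\<i> * of_real s) t + pk (\<i> * of_real (- s)) t - 2) / s\<^sup>2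
      = - 4 * (cos (2 * t) + s\<^sup>2) / ((1 + s\<^sup>2)\<^sup>2 - (2 * s * sin t)\<^sup>2)" unfolding AB' .
  have "(1 / 2)\<^sup>2 \<le> (1 - \<bar>s\<bar>)\<^sup>2" using assms by (intro power_mono) auto
  then have "A \<ge> 1 / 4" "B \<ge> 1 / 4" using AB by (simp_all add: power2_eq_square)
  then have "1 / 4 * (1 / 4) \<le> A * B" by (intro mult_mono) auto
  moreover have "\<bar>- 4 * (cos (2 * t) + s\<^sup>2)\<bar> \<le> 8"
  proof -
    have "s\<^sup>2 \<le> 1" using assms by (simp add: power_le_one)
    then have "\<bar>cos (2 * t) + s\<^sup>2\<bar> \<le> 2" using abs_cos_le_one[of "2 * t"] zero_le_power2[of s] by linarith
    then show ?thesis unfolding abs_mult by simp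
  qed
  ultimately have "\<bar>- 4 * (cos (2 * t) + s\<^sup>2)\<bar> / (A * B) \<le> 8 / (1 / 4 * (1 / 4))" by (intro frac_le) auto
  then show "\<bar>(pk (\<i> * of_real s) t + pk (\<i> * of_real (- s)) t - 2) / s\<^sup>2\<bar> \<le> 128"
    unfolding 1 using AB by (simp add: abs_divide abs_mult)
qed

section \<open>Trace relations at the origin\<close>

locale trace_data = blaschke_zeros x + boundary_data \<sigma> Lb M
  for x :: "nat \<Rightarrow> real" and \<sigma> :: "real measure" and Lb :: "real \<Rightarrow> real" and M :: real +
  fixes D :: "complex \<Rightarrow> complex" and k :: real
  assumes norm_D: "\<And>w. cmod w < 1 \<Longrightarrow> cmod (D w) = cmod (bl w) * exp (\<Lambda> (pk w) / (2 * pi))"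
    and D_0: "D 0 = 1"
    and D_le: "\<And>w. cmod w < 1 \<Longrightarrow> cmod (2 * w) < cmod (1 + w\<^sup>2) \<Longrightarrow>
      cmod (D w) \<le> exp (k * (cmod w)\<^sup>2 / (cmod (1 + w\<^sup>2) - cmod (2 * w))\<^sup>2)"
begin

text \<open>At the centre the Poisson kernel is constant, so D 0 = 1 determines the total
  mass.\<close>

lemma \<Lambda>_1: "\<Lambda> (\<lambda>_. 1) = - 2 * pi * ln P"
proof -
  have "pk 0 t = 1" for t by (simp add: pk_def)
  then have "pk 0 = (\<lambda>_. 1)" by blast
  then have "1 = P * exp (\<Lambda> (\<lambda>_. 1) / (2 * pi))" using norm_D[of 0] D_0 bl_0 P_bounds(1) by simp
  then have "ln 1 = ln P + \<Lambda> (\<lambda>_. 1) / (2 * pi)" using P_bounds(1) by (metis ln_mult_pos exp_gt_zero ln_exp)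
  then show ?thesis by (simp add: field_simps)
qed

lemma ln_P_le: "ln P \<le> 0"
  using P_bounds by simp

lemma integral_trig:
  assumes "n > 0"
  shows "(LBINT t:{-pi..pi}. 1 + c * cos (real n * t)) = 2 * pi"
proof -
  have "(LBINT t. indicator {-pi..pi} t *\<^sub>R (1 + c * cos (real n * t)))
      = (pi + c * sin (real n * pi) / real n) - (- pi + c * sin (real n * (- pi)) / real n)"
  proof (rule integral_FTC_atLeastAtMost)
    show "((\<lambda>t. t + c * sin (real n * t) / real n) has_vector_derivative 1 + c * cos (real n * t)) (at t within {-pi..pi})" for t
      using assms unfolding has_real_derivative_iff_has_vector_derivative[symmetric]
      by (auto intro!: derivative_eq_intros)
  qed (auto intro!: continuous_intros)
  then show ?thesis by (simp add: set_lebesgue_integral_def sin_npi)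
qed

text \<open>Test on 1 + c cos (n t) \<ge> 0; the contribution - 2 pi ln P of the constant 1 is
  nonnegative and may be dropped.\<close>

lemma \<Lambda>_cos_le:
  assumes "n > 0" "\<bar>c\<bar> = 1"
  shows "c * \<Lambda> (\<lambda>t. cos (real n * t)) \<le> 2 * pi * M"
proof -
  have "\<Lambda> (\<lambda>t. 1 + c * cos (real n * t)) = \<Lambda> (\<lambda>_. 1) + c * \<Lambda> (\<lambda>t. cos (real n * t))"
  proof -
    have "\<Lambda> (\<lambda>t. c * cos (real n * t)) = c * \<Lambda> (\<lambda>t. cos (real n * t))"
      by (rule \<Lambda>_cmult) (intro continuous_intros)
    then show ?thesis by (subst \<Lambda>_add) (auto intro!: continuous_intros)
  qed
  moreover have "\<Lambda> (\<lambda>t. 1 + c * cos (real n * t)) \<le> M * (LBINT t:{-pi..pi}. 1 + c * cos (real n * t))"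
  proof (rule \<Lambda>_le)
    fix t
    have "\<bar>c * cos (real n * t)\<bar> \<le> 1" unfolding abs_mult using assms by simp
    then show "1 + c * cos (real n * t) \<ge> 0" by linarith
  qed (intro continuous_intros)
  ultimately show ?thesis
    using ln_P_le \<Lambda>_1 integral_trig[OF assms(1), of c] mult_nonneg_nonpos[of pi "ln P"] by (simp add: mult_ac)
qed

text \<open>The value at the constant 1 is known exactly, so bounding only its absolutely continuous
  part leaves the mass of \<sigma> on the left.\<close>

lemma mass_le: "measure \<sigma> (space \<sigma>) / (2 * pi) - ln P \<le> M"
proof -
  interpret finite_measure \<sigma> by (rule fin)
  have "(LBINT t:{-pi..pi}. 1 * Lb t) \<le> (LBINT t:{-pi..pi}. M)"
    using Lb Lb_le by (intro set_integral_mono_AE) (auto simp: set_integrable_def)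
  then have "\<Lambda> (\<lambda>_. 1) + measure \<sigma> (space \<sigma>) \<le> M * (2 * pi)"
    by (simp add: \<Lambda>_def set_lebesgue_integral_def mult.commute)
  then have "measure \<sigma> (space \<sigma>) - 2 * pi * ln P \<le> M * (2 * pi)" unfolding \<Lambda>_1 by simp
  then have "(measure \<sigma> (space \<sigma>) - 2 * pi * ln P) / (2 * pi) \<le> M" by (simp add: pos_divide_le_eq)
  then show ?thesis by (simp add: diff_divide_distrib)
qed

lemma ln_norm_D_le:
  assumes "cmod w < 1" "cmod (2 * w) < cmod (1 + w\<^sup>2)" "bl w \<noteq> 0"
  shows "ln (cmod (bl w)) + \<Lambda> (pk w) / (2 * pi) \<le> k * (cmod w)\<^sup>2 / (cmod (1 + w\<^sup>2) - cmod (2 * w))\<^sup>2"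
proof -
  have "ln (cmod (bl w) * exp (\<Lambda> (pk w) / (2 * pi))) \<le> ln (exp (k * (cmod w)\<^sup>2 / (cmod (1 + w\<^sup>2) - cmod (2 * w))\<^sup>2))"
    using D_le[OF assms(1,2)] assms(3) unfolding norm_D[OF assms(1)] by (intro ln_mono) auto
  then show ?thesis using assms(3) by (simp add: ln_mult)
qed

text \<open>At real s, ln |D| is at most of order s^2, while its first-order coefficient is the
  bracket. Dividing by |s|, with s of sign \<epsilon>, gives the inequality in the limit; the two
  signs together make it an equality.\<close>

lemma sum_linear:
  assumes \<epsilon>: "\<bar>\<epsilon>\<bar> = 1"
  shows "\<epsilon> * ((\<Sum>j. x j - 1 / x j) + \<Lambda> (\<lambda>t. cos (real 1 * t)) / pi) \<le> 0"
proof -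
  have \<epsilon>': "\<epsilon> = 1 \<or> \<epsilon> = - 1" using \<epsilon> by linarith
  \<comment> \<open>The size P / 4 keeps s inside the range |s| \<le> P / 2 of the logarithmic
    expansion and below 1/4 for the Poisson bounds.\<close>
  define s where "s = (\<lambda>m. \<epsilon> * (P / 4 / real (Suc m)))"
  have abs_s: "\<bar>s m\<bar> = P / 4 / real (Suc m)" for m using \<epsilon> P_bounds by (simp add: s_def abs_mult)
  have "P / 4 / real (Suc m) \<le> P / 4 / 1" for m using P_bounds by (intro divide_left_mono) auto
  then have s: "0 < \<bar>s m\<bar>" "\<bar>s m\<bar> \<le> P / 4" "\<bar>s m\<bar> \<le> 1 / 4" for m
    unfolding abs_s using P_bounds order.trans[of "P / 4 / real (Suc m)" "P / 4" "1 / 4"] by simp_all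
  have s0: "s \<longlonglongrightarrow> 0"
  proof -
    have "(\<lambda>m. \<epsilon> * (P / 4) * (1 / real (Suc m))) \<longlonglongrightarrow> \<epsilon> * (P / 4) * 0"
      by (intro tendsto_mult_left) real_asymp
    then show ?thesis by (simp add: s_def)
  qed
  define \<phi> where "\<phi> = (\<lambda>m t. (pk (of_real (s m)) t - 1) / s m)"
  have \<phi>c: "continuous_on UNIV (\<phi> m)" for m
    unfolding \<phi>_def using s[of m] by (intro continuous_intros continuous_pk) auto
  have \<phi>lim: "(\<lambda>m. \<Lambda> (\<phi> m)) \<longlonglongrightarrow> \<Lambda> (\<lambda>t. 2 * cos (real 1 * t))"
  proof (rule \<Lambda>_tendsto[OF \<phi>c, where C = 16])
    show "continuous_on UNIV (\<lambda>t. 2 * cos (real 1 * t))" by (intro continuous_intros)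
    show "\<bar>\<phi> m t\<bar> \<le> 16" for m t unfolding \<phi>_def by (rule poisson_diff_real(2)[OF s(1,3)])
    fix t
    have "(\<lambda>m. (2 * cos t - 2 * s m) / (1 - 2 * s m * cos t + (s m)\<^sup>2)) \<longlonglongrightarrow> (2 * cos t - 2 * 0) / (1 - 2 * 0 * cos t + 0\<^sup>2)"
      by (intro tendsto_intros s0) auto
    then show "(\<lambda>m. \<phi> m t) \<longlonglongrightarrow> 2 * cos (real 1 * t)" by (simp add: \<phi>_def poisson_diff_real(1)[OF s(1,3)])
  qed
  define e where "e = (\<lambda>m. k * \<bar>s m\<bar> / (1 + (s m)\<^sup>2 - 2 * \<bar>s m\<bar>)\<^sup>2)"
  have e0: "e \<longlonglongrightarrow> 0"
  proof -
    have "e \<longlonglongrightarrow> k * \<bar>0\<bar> / (1 + 0\<^sup>2 - 2 * \<bar>0\<bar>)\<^sup>2" unfolding e_def by (intro tendsto_intros s0) auto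
    then show ?thesis by simp
  qed
  have "\<epsilon> * ((ln (cmod (bl (of_real (s m)))) - ln P) / s m + \<Lambda> (\<phi> m) / (2 * pi)) \<le> e m" for m
  proof -
    let ?w = "complex_of_real (s m)"
    have w: "cmod ?w < 1" using s(3)[of m] by simp
    have "1 + ?w\<^sup>2 = of_real (1 + (s m)\<^sup>2)" by simp
    then have n: "cmod (1 + ?w\<^sup>2) = 1 + (s m)\<^sup>2" by (simp only: norm_of_real) simp
    have "(\<bar>s m\<bar> - 1)\<^sup>2 > 0" using w by simp
    then have lt: "cmod (2 * ?w) < cmod (1 + ?w\<^sup>2)" unfolding n by (simp add: norm_mult power2_diff)
    have nz: "bl ?w \<noteq> 0" using norm_bl_real[of "s m"] s(2)[of m] P_bounds by auto
    have pkd: "pk ?w = (\<lambda>t. 1 + s m * \<phi> m t)" using s(1)[of m] by (simp add: \<phi>_def fun_eq_iff)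
    have "\<Lambda> (pk ?w) = \<Lambda> (\<lambda>_. 1) + s m * \<Lambda> (\<phi> m)"
      unfolding pkd by (subst \<Lambda>_add) (auto intro!: continuous_intros \<phi>c simp: \<Lambda>_cmult[OF \<phi>c])
    then have "\<Lambda> (pk ?w) / (2 * pi) = - ln P + s m * \<Lambda> (\<phi> m) / (2 * pi)"
      unfolding \<Lambda>_1 by (simp only: add_divide_distrib) simp
    then have "ln (cmod (bl ?w)) - ln P + s m * \<Lambda> (\<phi> m) / (2 * pi) \<le> k * \<bar>s m\<bar>\<^sup>2 / (1 + (s m)\<^sup>2 - 2 * \<bar>s m\<bar>)\<^sup>2"
      using ln_norm_D_le[OF w lt nz] unfolding n by (simp add: norm_mult)
    then have "(ln (cmod (bl ?w)) - ln P + s m * \<Lambda> (\<phi> m) / (2 * pi)) / \<bar>s m\<bar>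
        \<le> k * \<bar>s m\<bar>\<^sup>2 / (1 + (s m)\<^sup>2 - 2 * \<bar>s m\<bar>)\<^sup>2 / \<bar>s m\<bar>" by (rule divide_right_mono) simp
    also have "\<dots> = e m"
    proof -
      have "k * y\<^sup>2 / c / y = k * y / c" if "y \<noteq> 0" for y c :: real using that by (simp add: power2_eq_square)
      from this[of "\<bar>s m\<bar>"] s(1)[of m] show ?thesis unfolding e_def by simp
    qed
    finally have "(ln (cmod (bl ?w)) - ln P + s m * \<Lambda> (\<phi> m) / (2 * pi)) / \<bar>s m\<bar> \<le> e m" .
    moreover have "(a + s m * b) / \<bar>s m\<bar> = \<epsilon> * (a / s m + b)" for a b
    proof -
      have "\<bar>s m\<bar> = \<epsilon> * s m" unfolding abs_s using \<epsilon>' by (auto simp: s_def)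
      then show ?thesis using \<epsilon>' s(1)[of m] by (elim disjE) (simp_all add: add_divide_distrib)
    qed
    from this[of "ln (cmod (bl ?w)) - ln P" "\<Lambda> (\<phi> m) / (2 * pi)"]
    have "(ln (cmod (bl ?w)) - ln P + s m * \<Lambda> (\<phi> m) / (2 * pi)) / \<bar>s m\<bar>
        = \<epsilon> * ((ln (cmod (bl ?w)) - ln P) / s m + \<Lambda> (\<phi> m) / (2 * pi))" by simp
    ultimately show ?thesis by simp
  qed
  moreover have "(\<lambda>m. \<epsilon> * ((ln (cmod (bl (of_real (s m)))) - ln P) / s m + \<Lambda> (\<phi> m) / (2 * pi)))
      \<longlonglongrightarrow> \<epsilon> * ((\<Sum>j. x j - 1 / x j) + \<Lambda> (\<lambda>t. 2 * cos (real 1 * t)) / (2 * pi))"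
  proof -
    have "s m \<noteq> 0" "\<bar>s m\<bar> \<le> P / 2" for m using s[of m] P_bounds(1) by auto
    from ln_norm_bl_deriv[OF this s0] show ?thesis by (intro tendsto_intros \<phi>lim) auto
  qed
  ultimately have "\<epsilon> * ((\<Sum>j. x j - 1 / x j) + \<Lambda> (\<lambda>t. 2 * cos (real 1 * t)) / (2 * pi)) \<le> 0"
    using e0 by (intro LIMSEQ_le) auto
  moreover have "\<Lambda> (\<lambda>t. 2 * cos (real 1 * t)) = 2 * \<Lambda> (\<lambda>t. cos (real 1 * t))"
    by (rule \<Lambda>_cmult) (intro continuous_intros)
  ultimately show ?thesis by simp
qed

lemma abs_sum_linear_le: "\<bar>\<Sum>j. x j - 1 / x j\<bar> \<le> 2 * M"
proof -
  have "(\<Sum>j. x j - 1 / x j) = - \<Lambda> (\<lambda>t. cos (real 1 * t)) / pi"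
    using sum_linear[of 1] sum_linear[of "- 1"] by simp
  moreover have "\<bar>\<Lambda> (\<lambda>t. cos (real 1 * t))\<bar> \<le> 2 * pi * M"
    using \<Lambda>_cos_le[of 1 1] \<Lambda>_cos_le[of 1 "- 1"] by (simp add: abs_le_iff)
  ultimately show ?thesis by (simp add: abs_divide pos_divide_le_eq mult_ac)
qed

text \<open>Adding the bounds at \<i> s and - \<i> s cancels the first order. At order s^2 the
  Blaschke part yields the sum on the left, the Poisson part \<Lambda> (- 4 cos 2t) / (2 pi), and
  the bound on D yields 2 k.\<close>

lemma sum_quadratic_le: "(\<Sum>j<n. 1 / (x j)\<^sup>2 - (x j)\<^sup>2) \<le> 2 * k + 4 * M"
proof -
  define s where "s = (\<lambda>m. 1 / 4 / real (Suc m))"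
  have "1 / 4 / real (Suc m) \<le> 1 / 4 / 1" for m by (intro divide_left_mono) auto
  then have s: "0 < s m" "s m \<le> 1 / 4" for m by (auto simp: s_def)
  have s0: "s \<longlonglongrightarrow> 0" unfolding s_def by real_asymp
  define \<phi> where "\<phi> = (\<lambda>m t. (pk (\<i> * of_real (s m)) t + pk (\<i> * of_real (- s m)) t - 2) / (s m)\<^sup>2)"
  have cw: "cmod (\<i> * of_real (s m)) < 1" "cmod (\<i> * of_real (- s m)) < 1" for m
    using s[of m] by (simp_all add: norm_mult)
  have \<phi>c: "continuous_on UNIV (\<phi> m)" for m
    unfolding \<phi>_def using s[of m] by (intro continuous_intros continuous_pk cw) auto
  have \<phi>lim: "(\<lambda>m. \<Lambda> (\<phi> m)) \<longlonglongrightarrow> \<Lambda> (\<lambda>t. - 4 * cos (real 2 * t))"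
  proof (rule \<Lambda>_tendsto[OF \<phi>c, where C = 128])
    show "continuous_on UNIV (\<lambda>t. - 4 * cos (real 2 * t))" by (intro continuous_intros)
    show "\<bar>\<phi> m t\<bar> \<le> 128" for m t unfolding \<phi>_def by (rule poisson_diff_imag(2)[OF s])
    fix t
    have "(\<lambda>m. - 4 * (cos (2 * t) + (s m)\<^sup>2) / ((1 + (s m)\<^sup>2)\<^sup>2 - (2 * s m * sin t)\<^sup>2))
        \<longlonglongrightarrow> - 4 * (cos (2 * t) + 0\<^sup>2) / ((1 + 0\<^sup>2)\<^sup>2 - (2 * 0 * sin t)\<^sup>2)"
      by (intro tendsto_intros s0) auto
    then show "(\<lambda>m. \<phi> m t) \<longlonglongrightarrow> - 4 * cos (real 2 * t)"
      unfolding \<phi>_def poisson_diff_imag(1)[OF s] by simp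
  qed
  define L where "L = (\<lambda>\<tau>. \<Sum>j<n. ln (1 + \<tau> / (x j)\<^sup>2) - ln (1 + (x j)\<^sup>2 * \<tau>))"
  have "L ((s m)\<^sup>2) / (s m)\<^sup>2 \<le> 2 * k / (1 - (s m)\<^sup>2 - 2 * s m)\<^sup>2 - \<Lambda> (\<phi> m) / (2 * pi)" for m
  proof -
    let ?u = "\<i> * complex_of_real (s m)" and ?v = "\<i> * complex_of_real (- s m)"
    have abs1: "\<bar>s m\<bar> < 1" "\<bar>- s m\<bar> < 1" using s[of m] by auto
    have sq: "(s m)\<^sup>2 \<le> 1 / 16" using power_mono[OF s(2)[of m], of 2] s(1)[of m] by (simp add: power2_eq_square)
    have "1 + ?u\<^sup>2 = of_real (1 - (s m)\<^sup>2)" "1 + ?v\<^sup>2 = of_real (1 - (s m)\<^sup>2)" by (simp_all add: power_mult_distrib)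
    then have n: "cmod (1 + ?u\<^sup>2) = 1 - (s m)\<^sup>2" "cmod (1 + ?v\<^sup>2) = 1 - (s m)\<^sup>2"
      using sq by (simp_all only: norm_of_real)
    have lt: "cmod (2 * ?u) < cmod (1 + ?u\<^sup>2)" "cmod (2 * ?v) < cmod (1 + ?v\<^sup>2)"
      unfolding n using s[of m] sq by (simp_all add: norm_mult)
    have Lu: "L ((s m)\<^sup>2) \<le> 2 * (ln (cmod (bl ?u)) - ln P)" and Lv: "L ((s m)\<^sup>2) \<le> 2 * (ln (cmod (bl ?v)) - ln P)"
      using norm_bl_imag(2)[OF abs1(1), of n] norm_bl_imag(2)[OF abs1(2), of n] by (simp_all add: L_def)
    have up: "ln (cmod (bl ?u)) + \<Lambda> (pk ?u) / (2 * pi) \<le> k * (s m)\<^sup>2 / (1 - (s m)\<^sup>2 - 2 * s m)\<^sup>2"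
      and vp: "ln (cmod (bl ?v)) + \<Lambda> (pk ?v) / (2 * pi) \<le> k * (s m)\<^sup>2 / (1 - (s m)\<^sup>2 - 2 * s m)\<^sup>2"
      using ln_norm_D_le[OF cw(1) lt(1) norm_bl_imag(1)[OF abs1(1)]] ln_norm_D_le[OF cw(2) lt(2) norm_bl_imag(1)[OF abs1(2)]] s(1)[of m]
      unfolding n by (simp_all add: norm_mult)
    have "\<Lambda> (pk ?u) + \<Lambda> (pk ?v) = 2 * \<Lambda> (\<lambda>_. 1) + (s m)\<^sup>2 * \<Lambda> (\<phi> m)"
    proof -
      have "\<Lambda> (pk ?u) + \<Lambda> (pk ?v) = \<Lambda> (\<lambda>t. pk ?u t + pk ?v t)"
        by (rule \<Lambda>_add[symmetric]) (rule continuous_pk[OF cw(1)], rule continuous_pk[OF cw(2)])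
      also have "(\<lambda>t. pk ?u t + pk ?v t) = (\<lambda>t. 2 * 1 + (s m)\<^sup>2 * \<phi> m t)"
        using s(1)[of m] by (simp add: \<phi>_def fun_eq_iff)
      also have "\<Lambda> \<dots> = \<Lambda> (\<lambda>t. 2 * 1) + (s m)\<^sup>2 * \<Lambda> (\<phi> m)"
        by (subst \<Lambda>_add) (auto intro!: continuous_intros \<phi>c simp: \<Lambda>_cmult[OF \<phi>c])
      also have "\<Lambda> (\<lambda>t. 2 * 1) = 2 * \<Lambda> (\<lambda>_. 1)" by (rule \<Lambda>_cmult) (intro continuous_intros)
      finally show ?thesis .
    qed
    then have mid: "\<Lambda> (pk ?u) / (2 * pi) + \<Lambda> (pk ?v) / (2 * pi) = - 2 * ln P + (s m)\<^sup>2 * (\<Lambda> (\<phi> m) / (2 * pi))"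
      unfolding \<Lambda>_1 add_divide_distrib[symmetric] by (simp only: add_divide_distrib) simp
    have "L ((s m)\<^sup>2) \<le> 2 * (k * (s m)\<^sup>2 / (1 - (s m)\<^sup>2 - 2 * s m)\<^sup>2) - (s m)\<^sup>2 * (\<Lambda> (\<phi> m) / (2 * pi))"
    proof -
      have "l \<le> 2 * X - y"
        if "l \<le> 2 * (a - q)" and "l \<le> 2 * (b - q)" and "a + u \<le> X" and "b + v \<le> X" and "u + v = - 2 * q + y"
        for l :: real and a :: real and b :: real and q :: real and u :: real and v :: real and y :: real and X :: real
        using that by argo
      from this[OF Lu Lv up vp mid] show ?thesis .
    qed
    also have "\<dots> = (2 * k / (1 - (s m)\<^sup>2 - 2 * s m)\<^sup>2 - \<Lambda> (\<phi> m) / (2 * pi)) * (s m)\<^sup>2"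
    proof -
      have "2 * (k * y / c) - y * q = (2 * k / c - q) * y" for y c q :: real by (simp add: left_diff_distrib)
      then show ?thesis .
    qed
    finally show ?thesis using s(1)[of m] by (simp add: pos_divide_le_eq)
  qed
  moreover have "(\<lambda>m. L ((s m)\<^sup>2) / (s m)\<^sup>2) \<longlonglongrightarrow> (\<Sum>j<n. 1 / (x j)\<^sup>2 - (x j)\<^sup>2)"
  proof -
    have "(L has_real_derivative (\<Sum>j<n. 1 / (x j)\<^sup>2 - (x j)\<^sup>2)) (at 0)"
      unfolding L_def
    proof (rule DERIV_sum)
      have d: "((\<lambda>\<tau>. ln (1 + \<tau> / a) - ln (1 + a * \<tau>)) has_real_derivative 1 / a - a) (at 0)" if "a \<noteq> 0" for a :: real
        using that by (auto intro!: derivative_eq_intros)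
      show "((\<lambda>\<tau>. ln (1 + \<tau> / (x j)\<^sup>2) - ln (1 + (x j)\<^sup>2 * \<tau>)) has_real_derivative 1 / (x j)\<^sup>2 - (x j)\<^sup>2) (at 0)" for j
        using x(1)[of j] by (intro d) auto
    qed
    moreover have "L 0 = 0" by (simp add: L_def)
    ultimately have "((\<lambda>h. L h / h) \<longlongrightarrow> (\<Sum>j<n. 1 / (x j)\<^sup>2 - (x j)\<^sup>2)) (at 0)"
      unfolding DERIV_def by simp
    moreover have "filterlim (\<lambda>m. (s m)\<^sup>2) (at 0) sequentially"
      unfolding filterlim_at using tendsto_power[OF s0, of 2] s(1) by (auto simp: less_imp_neq[symmetric])
    ultimately show ?thesis by (rule filterlim_compose)
  qed
  moreover have "(\<lambda>m. 2 * k / (1 - (s m)\<^sup>2 - 2 * s m)\<^sup>2 - \<Lambda> (\<phi> m) / (2 * pi))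
      \<longlonglongrightarrow> 2 * k / (1 - 0\<^sup>2 - 2 * 0)\<^sup>2 - \<Lambda> (\<lambda>t. - 4 * cos (real 2 * t)) / (2 * pi)"
    by (intro tendsto_intros \<phi>lim s0) auto
  ultimately have "(\<Sum>j<n. 1 / (x j)\<^sup>2 - (x j)\<^sup>2) \<le> 2 * k / (1 - 0\<^sup>2 - 2 * 0)\<^sup>2 - \<Lambda> (\<lambda>t. - 4 * cos (real 2 * t)) / (2 * pi)"
    by (intro LIMSEQ_le) auto
  also have "\<Lambda> (\<lambda>t. - 4 * cos (real 2 * t)) = - 4 * \<Lambda> (\<lambda>t. cos (real 2 * t))"
    by (rule \<Lambda>_cmult) (intro continuous_intros)
  also have "2 * k / (1 - 0\<^sup>2 - 2 * 0)\<^sup>2 - (- 4 * \<Lambda> (\<lambda>t. cos (real 2 * t))) / (2 * pi) = 2 * k + 2 * \<Lambda> (\<lambda>t. cos (real 2 * t)) / pi"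
    by simp
  also have "\<dots> \<le> 2 * k + 2 * (2 * pi * M) / pi"
    using \<Lambda>_cos_le[of 2 1] by (intro add_left_mono divide_right_mono mult_left_mono) auto
  finally show ?thesis by simp
qed

end

section \<open>From zeros to eigenvalues, and the three inequalities\<close>

lemma varkappa_joukowski:
  fixes x :: real
  assumes x: "0 < \<bar>x\<bar>" "\<bar>x\<bar> \<le> 1"
  shows "varkappa d (eigenvalue_of_zero d (of_real x)) = real d / 2 * (1 / x - x)"
    and "varkappa d (eigenvalue_of_zero d (of_real x)) * eigenvalue_of_zero d (of_real x)
      = (real d)\<^sup>2 / 4 * (1 / x\<^sup>2 - x\<^sup>2)"
proof -
  define y where "y = 1 / x"
  have xy: "x * y = 1" using x by (simp add: y_def)
  have lam: "eigenvalue_of_zero d (of_real x) = real d / 2 * (x + y)"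
  proof -
    have "joukowski d (of_real x) = of_real (real d / 2 * (x + y))" by (simp add: joukowski_def y_def)
    then show ?thesis by (simp only: eigenvalue_of_zero_def Re_complex_of_real)
  qed
  \<comment> \<open>Because x y = 1, \<lambda>^2 - d^2 is a perfect square; its root d/2 (y - x) is
    0 or has the sign of x, which is the sign of \<lambda>.\<close>
  have "(real d / 2 * (x + y))\<^sup>2 - (real d)\<^sup>2 = (real d / 2 * (y - x))\<^sup>2"
  proof -
    have "(c / 2 * (x + y))\<^sup>2 - c\<^sup>2 = (c / 2 * (y - x))\<^sup>2 + c\<^sup>2 * (x * y - 1)" for c :: real
      by (simp add: power2_eq_square field_simps)
    then show ?thesis using xy by simp
  qed
  then have "varkappa d (real d / 2 * (x + y)) = \<bar>real d / 2 * (y - x)\<bar> * sgn (real d / 2 * (x + y))"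
    by (simp add: varkappa_def)
  also have "\<dots> = real d / 2 * (y - x)"
  proof -
    have d: "\<bar>real d / 2 * (y - x)\<bar> = real d / 2 * \<bar>y - x\<bar>" by (simp add: abs_mult)
    have sq: "x * x \<le> 1" using x(2) by (simp add: abs_square_le_1[symmetric] flip: power2_eq_square)
    consider "x > 0" "y > 0" | "x < 0" "y < 0" using x by (cases "x > 0") (auto simp: y_def)
    then show ?thesis
    proof cases
      case 1
      have "x \<le> y" using sq 1 by (simp add: y_def pos_le_divide_eq)
      then show ?thesis unfolding d using 1 by (cases "d = 0") (simp_all add: sgn_mult)
    next
      case 2
      have "y \<le> x" using sq 2 by (simp add: y_def neg_divide_le_eq)
      then show ?thesis unfolding d using 2 by (cases "d = 0") (simp_all add: sgn_mult right_diff_distrib)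
    qed
  qed
  finally have kap: "varkappa d (eigenvalue_of_zero d (of_real x)) = real d / 2 * (y - x)" unfolding lam .
  then show "varkappa d (eigenvalue_of_zero d (of_real x)) = real d / 2 * (1 / x - x)" by (simp add: y_def)
  show "varkappa d (eigenvalue_of_zero d (of_real x)) * eigenvalue_of_zero d (of_real x)
      = (real d)\<^sup>2 / 4 * (1 / x\<^sup>2 - x\<^sup>2)"
    unfolding kap unfolding lam by (simp add: y_def power2_eq_square algebra_simps)
qed

text \<open>The defining predicate of \<open>prodinf\<close> is then false everywhere, so all
  divergent products share one value, whatever it is.\<close>

lemma prodinf_not_convergent:
  fixes f :: "nat \<Rightarrow> complex"
  shows "\<not> convergent_prod f \<Longrightarrow> prodinf f = (THE p. False)"
proof -
  assume "\<not> convergent_prod f"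
  then have "(has_prod) f = (\<lambda>p. False)" by (simp add: fun_eq_iff has_prod_iff)
  then show ?thesis by (simp add: prodinf_def)
qed

text \<open>The points with sin t = 0 are the ones where \<open>norm_boundary_value_le\<close> gives
  no bound.\<close>

lemma ae_sin_nonzero: "AE t in lborel. t \<in> {-pi..pi} \<longrightarrow> sin t \<noteq> 0"
proof -
  have "sin t \<noteq> 0" if "t \<in> {-pi..pi}" "t \<notin> {-pi, 0, pi}" for t
  proof (cases "t > 0")
    case True
    then show ?thesis using that sin_gt_zero[of t] by auto
  next
    case False
    then show ?thesis using that sin_gt_zero[of "- t"] by auto
  qed
  then have *: "t \<in> {-pi..pi} \<longrightarrow> sin t \<noteq> 0" if "t \<notin> {-pi, 0, pi}" for t using that by blast
  have "AE t in lborel. t \<notin> {-pi, 0, pi}"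
    by (rule AE_not_in) (rule finite_imp_null_set_lborel, simp)
  then show ?thesis by (rule eventually_mono) (rule *)
qed

theorem corollary1p6:
  fixes V :: "int ^ ('n::finite) \<Rightarrow> real" and d :: nat and p :: real
    and N :: enat and z :: "nat \<Rightarrow> complex" and \<sigma> :: "real measure"
    and B0 :: real and lam kap :: "nat \<Rightarrow> real"
  assumes "d = CARD('n)" and "d \<ge> 3"
    and "1 \<le> p" and "d = 3 \<Longrightarrow> p < 6 / 5" and "d \<ge> 4 \<Longrightarrow> p < 4 / 3"
    and "V \<in> lp p"
    and "enumerates_disc_zeros (pert_det V) N z"
    and "canonical_singular_measure (pert_det V) N z \<sigma>"
    and "B0 = ln (Re (blaschke N z 0))"
    and "\<And>j. lam j = eigenvalue_of_zero d (z j)"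
    and "\<And>j. kap j = varkappa d (lam j)"
  shows
    "convergent_prod (\<lambda>j. if enat j < N then cmod (z j) else 1) \<and>
     B0 = ln (prodinf (\<lambda>j. if enat j < N then cmod (z j) else 1)) \<and> B0 \<le> 0 \<and>
     measure \<sigma> (space \<sigma>) / (2 * pi) - B0 \<le> (C_star p d)\<^sup>2 / 2 * (lp_norm p V)\<^sup>2 \<and>
     kap summable_on {j. enat j < N} \<and>
     \<bar>\<Sum>\<^sub>\<infinity>j\<in>{j. enat j < N}. kap j\<bar> \<le> real d * (C_star p d)\<^sup>2 * (lp_norm p V)\<^sup>2 \<and>
     (\<lambda>j. kap j * lam j) summable_on {j. enat j < N} \<and>
     (\<Sum>\<^sub>\<infinity>j\<in>{j. enat j < N}. kap j * lam j)
       \<le> 1 / 2 * Re (op_trace (mult_op V \<circ> mult_op V))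
         + (real d)\<^sup>2 / (4 * pi) * (C_star p d)\<^sup>2 * (lp_norm p V)\<^sup>2"
proof -
  have adm: "admissible p CARD('n)" using assms(1-5) by (simp add: admissible_def)
  interpret potential V p by unfold_locales (rule adm, rule assms(6))
  note d = assms(1) and canon = assms(8)[unfolded canonical_singular_measure_def]
  have zj: "cmod (z j) < 1" "D (z j) = 0" if "enat j < N" for j
    using assms(7)[unfolded enumerates_disc_zeros_def, THEN conjunct1] that by blast+
  \<comment> \<open>the padding value \<open>1\<close> has Blaschke factor \<open>1\<close> and contributes \<open>0\<close> to both eigenvalue sums\<close>
  define x where "x = (\<lambda>j. if enat j < N then Re (z j) else 1)"
  have zx: "z j = of_real (x j)" if "enat j < N" for j
    using D_zero_real[OF zj[OF that]] that by (simp add: x_def complex_eq_iff)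
  have x: "0 < \<bar>x j\<bar>" "\<bar>x j\<bar> \<le> 1" for j
  proof -
    have "x j \<noteq> 0 \<and> \<bar>x j\<bar> \<le> 1"
    proof (cases "enat j < N")
      case True
      have "z j \<noteq> 0"
      proof
        assume "z j = 0"
        with zj(2)[OF True] show False by (simp only: D_0 one_neq_zero)
      qed
      moreover have "cmod (complex_of_real (x j)) < 1" using zj(1)[OF True] by (simp only: zx[OF True])
      ultimately show ?thesis by (simp add: zx[OF True])
    next
      case False
      then show ?thesis by (simp add: x_def)
    qed
    then show "0 < \<bar>x j\<bar>" "\<bar>x j\<bar> \<le> 1" by simp_all
  qed
  have blaschke: "blaschke N z w = prodinf (\<lambda>j. bfactor (x j) w)" if "cmod w < 1" for w
    unfolding blaschke_def
  proof (rule prodinf_cong)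
    fix j
    show "(if enat j < N then of_real (cmod (z j)) / z j * ((z j - w) / (1 - cnj (z j) * w)) else 1) = bfactor (x j) w"
    proof (cases "enat j < N")
      case True
      have "complex_of_real (cmod (z j)) / z j = of_real (sgn (x j))"
        unfolding zx[OF True] using x(1)[of j] by (simp add: sgn_if)
      then show ?thesis using True by (simp add: bfactor_def zx)
    next
      case False
      then show ?thesis using bfactor_1[OF that] by (simp add: x_def)
    qed
  qed
  define E where "E = (\<lambda>w. exp (- (1 / (2 * of_real pi)) * (LINT t|\<sigma>. (cis t + w) / (cis t - w)))
          * exp (1 / (2 * of_real pi) *
              (LBINT t:{-pi..pi}. (cis t + w) / (cis t - w)
                  * of_real (ln (cmod (boundary_value D (cis t)))))))"
  have E: "E w \<noteq> 0" for w by (simp add: E_def)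
  have factor: "D w = blaschke N z w * E w" if "cmod w < 1" for w
    using canon[THEN conjunct2, THEN conjunct2, THEN conjunct2, THEN conjunct2, rule_format, OF that]
    unfolding E_def mult.assoc .
  text \<open>A product that does not converge has one fixed junk value. If the Blaschke product diverged at
    \<open>0\<close>, then this value would be nonzero, since \<open>D 0 = 1\<close>; so the product converges at each zero of \<open>D\<close>.\<close>
  have "summable (\<lambda>j. 1 - \<bar>x j\<bar>)"
  proof (cases "convergent_prod (\<lambda>j. bfactor (x j) 0)")
    case True
    from convergent_prod_norm_le_1_imp_summable[OF this] norm_bfactor_le_1[OF x, of 0]
    show ?thesis by (simp add: bfactor_0)
  next
    case False
    have "\<exists>j. enat j < N"
    proof (rule ccontr)
      assume "\<nexists>j. enat j < N"
      then have "(\<lambda>j. bfactor (x j) 0) = (\<lambda>_. 1)" by (simp add: x_def bfactor_1)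
      then show False using False by simp
    qed
    then obtain i where i: "enat i < N" by blast
    have 1: "blaschke N z (z i) = 0"
      using factor[OF zj(1)[OF i]] E[of "z i"] unfolding zj(2)[OF i] by simp
    have 2: "blaschke N z 0 \<noteq> 0"
    proof
      assume "blaschke N z 0 = 0"
      then have "D 0 = 0" using factor[of 0] by simp
      then show False unfolding D_0 by simp
    qed
    have "convergent_prod (\<lambda>j. bfactor (x j) (z i))"
    proof (rule ccontr)
      assume "\<not> convergent_prod (\<lambda>j. bfactor (x j) (z i))"
      from prodinf_not_convergent[OF this] prodinf_not_convergent[OF False]
      have "blaschke N z (z i) = blaschke N z 0" by (simp only: blaschke[OF zj(1)[OF i]] blaschke[of 0] norm_zero zero_less_one)
      then show False using 1 2 by simp
    qed
    then have "summable (\<lambda>j. 1 - cmod (bfactor (x j) (z i)))"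
      by (rule convergent_prod_norm_le_1_imp_summable) (rule norm_bfactor_le_1[OF x zj(1)[OF i]])
    then have "summable (\<lambda>j. 8 / (1 - (cmod (z i))\<^sup>2) * (1 - cmod (bfactor (x j) (z i))))" by (rule summable_mult)
    then show ?thesis
      by (rule summable_comparison_test'[of _ 0]) (use one_minus_abs_le_bfactor[OF x zj(1)[OF i]] x in auto)
  qed
  then interpret blaschke_zeros x using x by unfold_locales auto
  have M0: "M \<ge> 0" using hs_const_bounds(1)[OF adm] by (simp add: M_def)
  define Lb where "Lb = (\<lambda>t. ln (cmod (boundary_value D (cis t))))"
  interpret boundary_data \<sigma> Lb M
  proof (rule boundary_data.intro)
    show "finite_measure \<sigma>" "sets \<sigma> = sets (restrict_space borel {-pi..pi})" "set_integrable lborel {-pi..pi} Lb"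
      using canon by (simp_all add: Lb_def)
    show "AE t in lborel. t \<in> {-pi..pi} \<longrightarrow> Lb t \<le> M"
      using ae_sin_nonzero
    proof eventually_elim
      case (elim t)
      show ?case
      proof
        assume "t \<in> {-pi..pi}"
        then have le: "cmod (boundary_value D (cis t)) \<le> exp M" using elim by (intro norm_boundary_value_le) auto
        show "Lb t \<le> M"
        \<comment> \<open>\<open>ln 0\<close> is 0, so a vanishing boundary value is covered by M
          \<ge> 0 rather than by monotonicity of the logarithm.\<close>
        proof (cases "boundary_value D (cis t) = 0")
          case False
          then have "ln (cmod (boundary_value D (cis t))) \<le> ln (exp M)" using le by (intro ln_mono) auto
          then show ?thesis by (simp add: Lb_def)
        qed (use M0 in \<open>simp add: Lb_def\<close>)
      qed
    qed
  qed
  \<comment> \<open>The squared l2 norm of Green's function is at most (2 |w| / (d c))^2 with c = |1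
    + w^2| - |2 w|; half of \<open>Q\<close> times this is k |w|^2 / c^2.\<close>
  define k where "k = 2 * Q / (real d)\<^sup>2"
  interpret trace_data x \<sigma> Lb M D k
  proof (intro trace_data.intro trace_data_axioms.intro)
    show "blaschke_zeros x" "boundary_data \<sigma> Lb M" by (rule blaschke_zeros_axioms boundary_data_axioms)+
    show "cmod (D w) = cmod (bl w) * exp (\<Lambda> (pk w) / (2 * pi))" if "cmod w < 1" for w
      using norm_factor[OF that] factor[OF that] blaschke[OF that] by (simp add: E_def Lb_def bl_def norm_mult)
    show "D 0 = 1" by (rule D_0)
    show "cmod (D w) \<le> exp (k * (cmod w)\<^sup>2 / (cmod (1 + w\<^sup>2) - cmod (2 * w))\<^sup>2)"
      if w: "cmod w < 1" "cmod (2 * w) < cmod (1 + w\<^sup>2)" for w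
    proof -
      define c where "c = cmod (1 + w\<^sup>2) - cmod (2 * w)"
      have "Q * sq_norm (disc_green w :: 'n seq) / 2 \<le> Q * (cmod (2 * w) / (real CARD('n) * c))\<^sup>2 / 2"
        using sq_norm_disc_green_le[OF w, where 'n = 'n] Q_nonneg
        by (intro divide_right_mono mult_left_mono) (auto simp: c_def)
      also have "\<dots> = k * (cmod w)\<^sup>2 / c\<^sup>2"
        by (simp add: k_def d norm_mult power_divide power_mult_distrib mult_ac)
      finally show ?thesis using norm_D_le_near_0[OF w(1)] unfolding c_def by (meson exp_le_cancel_iff order.trans)
    qed
  qed
  have absx: "(\<lambda>j. if enat j < N then cmod (z j) else 1) = (\<lambda>j. \<bar>x j\<bar>)"
    by (auto simp: fun_eq_iff zx) (simp add: x_def)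
  have B0: "B0 = ln P" using assms(9) blaschke[of 0] bl_0 by (simp add: bl_def)
  have kap: "kap j = real d / 2 * (1 / x j - x j)" "kap j * lam j = (real d)\<^sup>2 / 4 * (1 / (x j)\<^sup>2 - (x j)\<^sup>2)"
    if "enat j < N" for j
    using varkappa_joukowski[OF x, of d j] by (simp_all add: assms(10,11) zx[OF that])
  have hs_le: "hs_const p CARD('n) \<le> (C_star p d)\<^sup>2"
  proof -
    have "(C_star p d)\<^sup>2 / (2 * pi) \<le> (C_star p d)\<^sup>2 / 1" using pi_ge_two by (intro divide_left_mono) auto
    then show ?thesis by (simp add: hs_const_def d[symmetric] add_increasing2 diff_le_eq)
  qed
  have M_le: "M \<le> (C_star p d)\<^sup>2 / 2 * nv\<^sup>2"
    using mult_right_mono[OF hs_le, of "nv\<^sup>2 / 2"] by (simp add: M_def)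
  have s1: "(\<lambda>j. 1 / x j - x j) summable_on UNIV"
    by (rule norm_summable_imp_summable_on) (use summable_inverse_minus in simp)
  have s2: "(\<lambda>j. 1 / (x j)\<^sup>2 - (x j)\<^sup>2) summable_on UNIV"
    and s2': "(\<Sum>\<^sub>\<infinity>j. 1 / (x j)\<^sup>2 - (x j)\<^sup>2) \<le> 2 * k + 4 * M"
  proof -
    have nn: "1 / (x j)\<^sup>2 - (x j)\<^sup>2 \<ge> 0" for j
    proof -
      have "(x j)\<^sup>2 \<le> 1" "(x j)\<^sup>2 > 0" using x[of j] by (auto simp: abs_square_le_1)
      then have "1 \<le> 1 / (x j)\<^sup>2" by (simp add: le_divide_eq)
      then show ?thesis using \<open>(x j)\<^sup>2 \<le> 1\<close> by simp
    qed
    have F: "(\<Sum>j\<in>F. 1 / (x j)\<^sup>2 - (x j)\<^sup>2) \<le> 2 * k + 4 * M" if F: "finite F" for F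
    proof -
      obtain n where "F \<subseteq> {..<n}" using F unfolding finite_nat_iff_bounded by blast
      then have "(\<Sum>j\<in>F. 1 / (x j)\<^sup>2 - (x j)\<^sup>2) \<le> (\<Sum>j<n. 1 / (x j)\<^sup>2 - (x j)\<^sup>2)" using nn by (intro sum_mono2) auto
      then show ?thesis using sum_quadratic_le[of n] by simp
    qed
    show *: "(\<lambda>j. 1 / (x j)\<^sup>2 - (x j)\<^sup>2) summable_on UNIV"
      by (rule nonneg_bdd_above_summable_on) (use nn F in \<open>auto simp: bdd_above_def\<close>)
    show "(\<Sum>\<^sub>\<infinity>j. 1 / (x j)\<^sup>2 - (x j)\<^sup>2) \<le> 2 * k + 4 * M" by (rule infsum_le_finite_sums[OF *]) (rule F)
  qed
  have r1: "kap summable_on {j. enat j < N} \<longleftrightarrow> (\<lambda>j. real d / 2 * (1 / x j - x j)) summable_on UNIV"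
    and r1': "(\<Sum>\<^sub>\<infinity>j\<in>{j. enat j < N}. kap j) = (\<Sum>\<^sub>\<infinity>j. real d / 2 * (1 / x j - x j))"
    by (rule summable_on_cong_neutral infsum_cong_neutral; use kap in \<open>simp add: x_def\<close>)+
  have r2: "(\<lambda>j. kap j * lam j) summable_on {j. enat j < N} \<longleftrightarrow> (\<lambda>j. (real d)\<^sup>2 / 4 * (1 / (x j)\<^sup>2 - (x j)\<^sup>2)) summable_on UNIV"
    and r2': "(\<Sum>\<^sub>\<infinity>j\<in>{j. enat j < N}. kap j * lam j) = (\<Sum>\<^sub>\<infinity>j. (real d)\<^sup>2 / 4 * (1 / (x j)\<^sup>2 - (x j)\<^sup>2))"
    by (rule summable_on_cong_neutral infsum_cong_neutral; use kap in \<open>simp add: x_def\<close>)+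
  have sum1: "(\<Sum>\<^sub>\<infinity>j. 1 / x j - x j) = - (\<Sum>j. x j - 1 / x j)"
  proof -
    have "(\<lambda>j. 1 / x j - x j) sums (\<Sum>\<^sub>\<infinity>j. 1 / x j - x j)" using s1 by (intro has_sum_imp_sums) simp
    from sums_minus[OF this] show ?thesis by (simp add: sums_iff)
  qed
  have v: "nv = lp_norm p V" by (rule nv_def)
  show ?thesis
  proof (intro conjI)
    show "convergent_prod (\<lambda>j. if enat j < N then cmod (z j) else 1)" unfolding absx by (rule conv_P)
    show "B0 = ln (prodinf (\<lambda>j. if enat j < N then cmod (z j) else 1))" unfolding absx B0 P_def ..
    show "B0 \<le> 0" unfolding B0 by (rule ln_P_le)
    show "measure \<sigma> (space \<sigma>) / (2 * pi) - B0 \<le> (C_star p d)\<^sup>2 / 2 * (lp_norm p V)\<^sup>2"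
      using mass_le M_le unfolding B0 v by linarith
    show "kap summable_on {j. enat j < N}" unfolding r1 by (rule summable_on_cmult_right[OF s1])
    show "(\<lambda>j. kap j * lam j) summable_on {j. enat j < N}" unfolding r2 by (rule summable_on_cmult_right[OF s2])
    have "\<bar>\<Sum>\<^sub>\<infinity>j\<in>{j. enat j < N}. kap j\<bar> = real d / 2 * \<bar>\<Sum>j. x j - 1 / x j\<bar>"
      unfolding r1' infsum_cmult_right' sum1 by (simp add: abs_mult)
    also have "\<dots> \<le> real d / 2 * (2 * M)" by (intro mult_left_mono abs_sum_linear_le) simp
    also have "\<dots> \<le> real d * ((C_star p d)\<^sup>2 * nv\<^sup>2)"
    proof -
      have "M \<le> (C_star p d)\<^sup>2 * nv\<^sup>2" using M_le M0 by simp
      then show ?thesis by (simp add: mult_left_mono)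
    qed
    finally show "\<bar>\<Sum>\<^sub>\<infinity>j\<in>{j. enat j < N}. kap j\<bar> \<le> real d * (C_star p d)\<^sup>2 * (lp_norm p V)\<^sup>2"
      by (simp add: v mult.assoc)
    have tr: "Re (op_trace (mult_op V \<circ> mult_op V)) = Q"
    proof -
      have "op_trace (mult_op V \<circ> mult_op V) = (\<Sum>\<^sub>\<infinity>n. of_real ((V n)\<^sup>2))"
        by (simp add: op_trace_def mult_op_def unit_seq_def power2_eq_square)
      also have "\<dots> = of_real Q" unfolding Q_def
        by (rule infsumI) (use V_sq_summable in \<open>simp only: has_sum_of_real_iff has_sum_infsum\<close>)
      finally show ?thesis by simp
    qed
    have "(\<Sum>\<^sub>\<infinity>j\<in>{j. enat j < N}. kap j * lam j) \<le> (real d)\<^sup>2 / 4 * (2 * k + 4 * M)"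
      unfolding r2' infsum_cmult_right' by (intro mult_left_mono s2') simp
    also have "\<dots> = Q + (real d)\<^sup>2 * M" using assms(2) by (simp add: k_def distrib_left)
    \<comment> \<open>The term - 1 / d^2 in \<open>hs_const\<close> becomes - nv^2 / 2 here, and
      \<open>Q_le\<close> lets it absorb half of \<open>Q\<close>.\<close>
    also have "(real d)\<^sup>2 * M = (real d)\<^sup>2 / (4 * pi) * (C_star p d)\<^sup>2 * nv\<^sup>2 - nv\<^sup>2 / 2"
    proof -
      have "c\<^sup>2 * ((a / (2 * pi) - 1 / c\<^sup>2) * b / 2) = c\<^sup>2 / (4 * pi) * a * b - b / 2" if "c \<noteq> 0" for a b c :: real
        using that by (simp add: left_diff_distrib right_diff_distrib)
      then show ?thesis using assms(2) by (simp only: M_def hs_const_def d[symmetric])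
    qed
    finally show "(\<Sum>\<^sub>\<infinity>j\<in>{j. enat j < N}. kap j * lam j)
       \<le> 1 / 2 * Re (op_trace (mult_op V \<circ> mult_op V))
         + (real d)\<^sup>2 / (4 * pi) * (C_star p d)\<^sup>2 * (lp_norm p V)\<^sup>2"
      using Q_le unfolding tr v by linarith
  qed
qed

end
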